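(* Let $\chi\in Y'\setminus\{0\}$ and $z\in\rho(|\chi|^{-2}\mathcal{A}_\chi)\cap\rho(|\chi|^{-2}\mathcal{A}^{\rm hom}_\chi)$. There exists $C>0$, independent of $\chi$ and $z$, such that $$\Big\|\big(\tfrac{1}{|\chi|^2}\mathcal{A}_\chi-zI\big)^{-1}-\big(\tfrac{1}{|\chi|^2}\mathcal{A}^{\rm hom}_\chi-zI_{\mathbb{C}^3}\big)^{-1}S\Big\|_{L^2(Y;\mathbb{C}^3)\to H^1(Y;\mathbb{C}^3)}\le C\max\Big\{1,\tfrac{|z+1|}{D(z)}\Big\}\Big[\tfrac{\max\{1,|z|^2\}}{D_{\rm hom}(z)}+\max\{1,|z|\}\Big]|\chi|,$$ $$\Big\|\big(\tfrac{1}{|\chi|^2}\mathcal{A}_\chi-zI\big)^{-1}-\big(\tfrac{1}{|\chi|^2}\mathcal{A}^{\rm hom}_\chi-zI_{\mathbb{C}^3}\big)^{-1}S-\mathcal{R}_{{\rm corr},1,\chi}(z)-\mathcal{R}_{{\rm corr},2,\chi}(z)\Big\|_{L^2(Y;\mathbb{C}^3)\to H^1(Y;\mathbb{C}^3)}$$ $$\le C\max\Big\{1,\tfrac{|z+1|}{D(z)}\Big\}\Big[\tfrac{\max\{1,|z|^3\}}{D_{\rm hom}(z)^2}+\tfrac{\max\{1,|z|^2\}}{D_{\rm hom}(z)}+\max\{1,|z|\}\Big]|\chi|^2.$$ Moreover, $\mathcal{A}^{\rm hom}_\chi$ is quadratic in $\chi$: $\mathcal{A}^{\rm hom}_\chi=(iX_\chi)^*\mathbb{A}^{\rm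 hom}(iX_\chi)$, where $\mathbb{A}^{\rm hom}\in\mathbb{R}^{3\times3\times3\times3}$ is a constant tensor with the same symmetries as $\mathbb{A}$.
   Context: $Y=[0,1)^3$, $Y'=[-\pi,\pi)^3$. The tensor $\mathbb{A}$ is $\mathbb{Z}^3$-periodic, real, with entries in $L^\infty(Y)$, satisfies $\mathbb{A}^{ik}_{jl}=\mathbb{A}^{jk}_{il}=\mathbb{A}^{ki}_{lj}$ and $\nu|\xi|^2\le\mathbb{A}(y)\xi:\xi\le\nu^{-1}|\xi|^2$ for real symmetric $\xi$ ($(\mathbb{A}B)^i_j=\sum_{k,l}\mathbb{A}^{ik}_{jl}B^k_l$, $A:\bar B=\sum A^i_j\overline{B^i_j}$). $H^1_\#=H^1_\#(Y;\mathbb{C}^3)$ is periodic $H^1$; $\mathbb{C}^3$ is identified with constant functions; $S f=\int_Yf$. $X_\chi u=\operatorname{sym}(u\chi^\top)$. $\mathcal{A}_\chi$ is the operator on $L^2(Y;\mathbb{C}^3)$ associated with the form $\int_Y\mathbb{A}(\operatorname{sym}\nabla+iX_\chi)u:\overline{(\operatorname{sym}\nabla+iX_\chi)v}$ on $H^1_\#$. $\mathcal{A}^{\rm hom}_\chi\in\mathbb{C}^{3\times3}$ is defined by $\langle\mathcal{A}^{\rm hom}_\chi c,d\rangle=\int_Y\mathbb{A}(\operatorname{sym}\nabla u_c+iX_\chi c):\overline{iX_\chi d}$, where $u_c\in H^1_\#$ is the mean-zero solution of $\int_Y\mathbb{A}(\operatorname{sym}\nabla u_c+iX_\chi c):\overline{\operatorname{sym}\nabla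 v}=0$ for all $v\in H^1_\#$. $D_{\rm hom}(z)=\operatorname{dist}(z,\sigma(|\chi|^{-2}\mathcal{A}^{\rm hom}_\chi))$, $D(z)=\operatorname{dist}(z,\sigma(|\chi|^{-2}\mathcal{A}_\chi))$. Correctors: for $f\in L^2(Y;\mathbb{C}^3)$ let $u_0=(|\chi|^{-2}\mathcal{A}^{\rm hom}_\chi-z)^{-1}Sf\in\mathbb{C}^3$; $u_1\in H^1_\#$ mean-zero with $\int_Y\mathbb{A}\operatorname{sym}\nabla u_1:\overline{\operatorname{sym}\nabla v}=-\int_Y\mathbb{A}iX_\chi u_0:\overline{\operatorname{sym}\nabla v}$ for all $v\in H^1_\#$; $u_2\in H^1_\#$ mean-zero with $\int_Y\mathbb{A}\operatorname{sym}\nabla u_2:\overline{\operatorname{sym}\nabla v}=-\int_Y\mathbb{A}iX_\chi u_1:\overline{\operatorname{sym}\nabla v}-\int_Y\mathbb{A}\operatorname{sym}\nabla u_1:\overline{iX_\chi v}-\int_Y\mathbb{A}iX_\chi u_0:\overline{iX_\chi v}+z|\chi|^2\int_Yu_0\cdot\bar v+|\chi|^2\int_Yf\cdot\bar v$ for all $v\in H^1_\#$; $u_0^{(1)}\in\mathbb{C}^3$ solving $\langle\mathcal{A}^{\rm hom}_\chi u_0^{(1)},v_0\rangle-z|\chi|^2u_0^{(1)}\cdot\bar v_0=-\int_Y\mathbb{A}(\operatorname{sym}\nabla u_2+iX_\chi u_1):\overline{iX_\chi v_0}$ for all $v_0\in\mathbb{C}^3$. Then $\mathcal{R}_{{\rm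 corr},1,\chi}(z)f:=u_1$ and $\mathcal{R}_{{\rm corr},2,\chi}(z)f:=u_0^{(1)}$. *)

theory Defs
  imports "HOL-Analysis.Analysis"
begin

text \<open>Conventions. Points of R^3: real^3. Vectors of C^3: complex^3.
 3x3 matrices: ('a)^3^3 with M$i$j the (i,j) entry.
 A fourth order tensor field is a function Aten :: real^3 => 3 => 3 => 3 => 3 => real,
 where Aten y i k j l is the entry A^{ik}_{jl}(y).\<close>

type_synonym tensor_field = "real^3 \<Rightarrow> 3 \<Rightarrow> 3 \<Rightarrow> 3 \<Rightarrow> 3 \<Rightarrow> real"
type_synonym const_tensor = "3 \<Rightarrow> 3 \<Rightarrow> 3 \<Rightarrow> 3 \<Rightarrow> real"

definition Ycell :: "(real^3) set" where
  "Ycell = {y. \<forall>i. 0 \<le> y$i \<and> y$i < 1}"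

definition Ydual :: "(real^3) set" where
  "Ydual = {x. \<forall>i. - pi \<le> x$i \<and> x$i < pi}"

definition int_vec :: "real^3 \<Rightarrow> bool" where
  "int_vec k \<longleftrightarrow> (\<forall>i. k$i \<in> \<int>)"

definition intY :: "(real^3 \<Rightarrow> 'b::{banach,second_countable_topology}) \<Rightarrow> 'b" where
  "intY f = integral\<^sup>L (lebesgue_on Ycell) f"

definition meanY :: "(real^3 \<Rightarrow> complex^3) \<Rightarrow> complex^3" where
  "meanY f = intY f"

definition L2 :: "(real^3 \<Rightarrow> 'b::euclidean_space) \<Rightarrow> bool" where
  "L2 u \<longleftrightarrow> u \<in> borel_measurable (lebesgue_on Ycell)
     \<and> integrable (lebesgue_on Ycell) (\<lambda>y. (norm (u y))^2)"

definition L2norm :: "(real^3 \<Rightarrow> 'b::euclidean_space) \<Rightarrow> real" where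
  "L2norm u = sqrt (intY (\<lambda>y. (norm (u y))^2))"

definition cinner :: "complex^3 \<Rightarrow> complex^3 \<Rightarrow> complex" where
  "cinner c d = (\<Sum>i\<in>UNIV. c$i * cnj (d$i))"

definition l2inner :: "(real^3 \<Rightarrow> complex^3) \<Rightarrow> (real^3 \<Rightarrow> complex^3) \<Rightarrow> complex" where
  "l2inner f v = intY (\<lambda>y. cinner (f y) (v y))"

text \<open>Periodic C^1 test functions and weak gradients (periodic H^1 = H^1 of the torus).\<close>
definition pderiv :: "(real^3 \<Rightarrow> complex) \<Rightarrow> 3 \<Rightarrow> real^3 \<Rightarrow> complex" where
  "pderiv \<phi> j y = frechet_derivative \<phi> (at y) (axis j 1)"

definition testfn :: "(real^3 \<Rightarrow> complex) \<Rightarrow> bool" where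
  "testfn \<phi> \<longleftrightarrow> (\<forall>y k. int_vec k \<longrightarrow> \<phi> (y + k) = \<phi> y)
     \<and> (\<forall>y. \<phi> differentiable (at y))
     \<and> (\<forall>j. continuous_on UNIV (pderiv \<phi> j))"

definition weak_grad :: "(real^3 \<Rightarrow> complex^3) \<Rightarrow> (real^3 \<Rightarrow> complex^3^3) \<Rightarrow> bool" where
  "weak_grad u G \<longleftrightarrow> (\<forall>\<phi>. testfn \<phi> \<longrightarrow> (\<forall>i j.
      intY (\<lambda>y. u y $ i * pderiv \<phi> j y) = - intY (\<lambda>y. G y $ i $ j * \<phi> y)))"

definition H1per :: "(real^3 \<Rightarrow> complex^3) \<Rightarrow> bool" where
  "H1per u \<longleftrightarrow> L2 u \<and> (\<exists>G. L2 G \<and> weak_grad u G)"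

definition grad :: "(real^3 \<Rightarrow> complex^3) \<Rightarrow> real^3 \<Rightarrow> complex^3^3" where
  "grad u = (SOME G. L2 G \<and> weak_grad u G)"

definition H1norm :: "(real^3 \<Rightarrow> complex^3) \<Rightarrow> real" where
  "H1norm u = sqrt ((L2norm u)^2 + (L2norm (grad u))^2)"

definition symm :: "complex^3^3 \<Rightarrow> complex^3^3" where
  "symm M = (\<chi> i j. (M$i$j + M$j$i) / 2)"

definition cmul :: "complex \<Rightarrow> complex^3^3 \<Rightarrow> complex^3^3" where
  "cmul c M = (\<chi> i j. c * M$i$j)"

definition frob :: "complex^3^3 \<Rightarrow> complex^3^3 \<Rightarrow> complex" where
  "frob M N = (\<Sum>i\<in>UNIV. \<Sum>j\<in>UNIV. M$i$j * cnj (N$i$j))"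

definition Xchi :: "real^3 \<Rightarrow> complex^3 \<Rightarrow> complex^3^3" where
  "Xchi \<chi>\<^sub>0 c = symm (\<chi> i j. c$i * complex_of_real (\<chi>\<^sub>0$j))"

definition iX :: "real^3 \<Rightarrow> complex^3 \<Rightarrow> complex^3^3" where
  "iX \<chi>\<^sub>0 c = cmul \<i> (Xchi \<chi>\<^sub>0 c)"

definition tappc :: "const_tensor \<Rightarrow> complex^3^3 \<Rightarrow> complex^3^3" where
  "tappc T M = (\<chi> i j. \<Sum>k\<in>UNIV. \<Sum>l\<in>UNIV. complex_of_real (T i k j l) * M$k$l)"

definition tapp :: "tensor_field \<Rightarrow> real^3 \<Rightarrow> complex^3^3 \<Rightarrow> complex^3^3" where
  "tapp A y M = tappc (A y) M"

definition tensor_symmetric :: "const_tensor \<Rightarrow> bool" where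
  "tensor_symmetric T \<longleftrightarrow> (\<forall>i k j l. T i k j l = T j k i l \<and> T i k j l = T k i l j)"

definition aform :: "tensor_field \<Rightarrow> real^3 \<Rightarrow> (real^3 \<Rightarrow> complex^3) \<Rightarrow> (real^3 \<Rightarrow> complex^3) \<Rightarrow> complex" where
  "aform A \<chi>\<^sub>0 u v = intY (\<lambda>y. frob (tapp A y (symm (grad u y) + iX \<chi>\<^sub>0 (u y)))
                                     (symm (grad v y) + iX \<chi>\<^sub>0 (v y)))"

text \<open>u solves (|chi|^{-2} A_chi - z) u = f, where A_chi is the operator associated with
  aform: u in dom(A_chi) iff u in H^1_# and a_chi(u,v) = <g,v> for all v, with A_chi u = g.
  Here g = |chi|^2 (f + z u).\<close>
definition res_sol :: "tensor_field \<Rightarrow> real^3 \<Rightarrow> complex \<Rightarrow> (real^3 \<Rightarrow> complex^3) \<Rightarrow> (real^3 \<Rightarrow> complex^3) \<Rightarrow> bool" where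
  "res_sol A \<chi>\<^sub>0 z f u \<longleftrightarrow> H1per u \<and>
     (\<forall>v. H1per v \<longrightarrow> aform A \<chi>\<^sub>0 u v - z * complex_of_real ((norm \<chi>\<^sub>0)^2) * l2inner u v
                         = complex_of_real ((norm \<chi>\<^sub>0)^2) * l2inner f v)"

text \<open>Resolvent set of |chi|^{-2} A_chi: the operator minus z is a bijection of its domain onto
  L^2 (elements of L^2 being a.e.-classes) with bounded inverse.\<close>
definition rho_op :: "tensor_field \<Rightarrow> real^3 \<Rightarrow> complex set" where
  "rho_op A \<chi>\<^sub>0 = {z. (\<forall>f. L2 f \<longrightarrow> (\<exists>u. res_sol A \<chi>\<^sub>0 z f u))
     \<and> (\<forall>f u w. L2 f \<and> res_sol A \<chi>\<^sub>0 z f u \<and> res_sol A \<chi>\<^sub>0 z f w \<longrightarrow>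
                 (AE y in lebesgue_on Ycell. u y = w y))
     \<and> (\<exists>M. \<forall>f u. L2 f \<and> res_sol A \<chi>\<^sub>0 z f u \<longrightarrow> L2norm u \<le> M * L2norm f)}"

definition D_op :: "tensor_field \<Rightarrow> real^3 \<Rightarrow> complex \<Rightarrow> real" where
  "D_op A \<chi>\<^sub>0 z = infdist z (- rho_op A \<chi>\<^sub>0)"

definition cell_corr :: "tensor_field \<Rightarrow> real^3 \<Rightarrow> complex^3 \<Rightarrow> (real^3 \<Rightarrow> complex^3) \<Rightarrow> bool" where
  "cell_corr A \<chi>\<^sub>0 c u \<longleftrightarrow> H1per u \<and> meanY u = 0 \<and>
     (\<forall>v. H1per v \<longrightarrow> intY (\<lambda>y. frob (tapp A y (symm (grad u y) + iX \<chi>\<^sub>0 c)) (symm (grad v y))) = 0)"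

definition homform :: "tensor_field \<Rightarrow> real^3 \<Rightarrow> complex^3 \<Rightarrow> complex^3 \<Rightarrow> complex" where
  "homform A \<chi>\<^sub>0 c d = (let uc = (SOME u. cell_corr A \<chi>\<^sub>0 c u) in
      intY (\<lambda>y. frob (tapp A y (symm (grad uc y) + iX \<chi>\<^sub>0 c)) (iX \<chi>\<^sub>0 d)))"

text \<open>Ahom A chi is the matrix with <Ahom c, d> = homform A chi c d.\<close>
definition Ahom :: "tensor_field \<Rightarrow> real^3 \<Rightarrow> complex^3^3" where
  "Ahom A \<chi>\<^sub>0 = (\<chi> i j. homform A \<chi>\<^sub>0 (axis j 1) (axis i 1))"

definition Ahom_sc :: "tensor_field \<Rightarrow> real^3 \<Rightarrow> complex^3^3" where
  "Ahom_sc A \<chi>\<^sub>0 = (\<chi> i j. Ahom A \<chi>\<^sub>0 $ i $ j / complex_of_real ((norm \<chi>\<^sub>0)^2))"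

definition mat_spectrum :: "complex^3^3 \<Rightarrow> complex set" where
  "mat_spectrum M = {e. \<exists>v. v \<noteq> 0 \<and> M *v v = e *s v}"

definition D_hom :: "tensor_field \<Rightarrow> real^3 \<Rightarrow> complex \<Rightarrow> real" where
  "D_hom A \<chi>\<^sub>0 z = infdist z (mat_spectrum (Ahom_sc A \<chi>\<^sub>0))"

definition u0vec :: "tensor_field \<Rightarrow> real^3 \<Rightarrow> complex \<Rightarrow> (real^3 \<Rightarrow> complex^3) \<Rightarrow> complex^3" where
  "u0vec A \<chi>\<^sub>0 z f = matrix_inv (Ahom_sc A \<chi>\<^sub>0 - mat z) *v meanY f"

definition corr1 :: "tensor_field \<Rightarrow> real^3 \<Rightarrow> complex^3 \<Rightarrow> (real^3 \<Rightarrow> complex^3) \<Rightarrow> bool" where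
  "corr1 A \<chi>\<^sub>0 u0 u1 \<longleftrightarrow> H1per u1 \<and> meanY u1 = 0 \<and>
     (\<forall>v. H1per v \<longrightarrow>
        intY (\<lambda>y. frob (tapp A y (symm (grad u1 y))) (symm (grad v y)))
        = - intY (\<lambda>y. frob (tapp A y (iX \<chi>\<^sub>0 u0)) (symm (grad v y))))"

definition corr2 :: "tensor_field \<Rightarrow> real^3 \<Rightarrow> complex \<Rightarrow> (real^3 \<Rightarrow> complex^3) \<Rightarrow> complex^3
    \<Rightarrow> (real^3 \<Rightarrow> complex^3) \<Rightarrow> (real^3 \<Rightarrow> complex^3) \<Rightarrow> bool" where
  "corr2 A \<chi>\<^sub>0 z f u0 u1 u2 \<longleftrightarrow> H1per u2 \<and> meanY u2 = 0 \<and>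
     (\<forall>v. H1per v \<longrightarrow>
        intY (\<lambda>y. frob (tapp A y (symm (grad u2 y))) (symm (grad v y)))
        = - intY (\<lambda>y. frob (tapp A y (iX \<chi>\<^sub>0 (u1 y))) (symm (grad v y)))
          - intY (\<lambda>y. frob (tapp A y (symm (grad u1 y))) (iX \<chi>\<^sub>0 (v y)))
          - intY (\<lambda>y. frob (tapp A y (iX \<chi>\<^sub>0 u0)) (iX \<chi>\<^sub>0 (v y)))
          + z * complex_of_real ((norm \<chi>\<^sub>0)^2) * intY (\<lambda>y. cinner u0 (v y))
          + complex_of_real ((norm \<chi>\<^sub>0)^2) * intY (\<lambda>y. cinner (f y) (v y)))"

definition corr3 :: "tensor_field \<Rightarrow> real^3 \<Rightarrow> complex \<Rightarrow> (real^3 \<Rightarrow> complex^3)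
    \<Rightarrow> (real^3 \<Rightarrow> complex^3) \<Rightarrow> complex^3 \<Rightarrow> bool" where
  "corr3 A \<chi>\<^sub>0 z u1 u2 u01 \<longleftrightarrow>
     (\<forall>v0. cinner (Ahom A \<chi>\<^sub>0 *v u01) v0 - z * complex_of_real ((norm \<chi>\<^sub>0)^2) * cinner u01 v0
        = - intY (\<lambda>y. frob (tapp A y (symm (grad u2 y) + iX \<chi>\<^sub>0 (u1 y))) (iX \<chi>\<^sub>0 v0)))"

text \<open>Standing assumptions on the tensor field (L^infinity entries, represented by a
  bounded measurable representative).\<close>
definition admissible_tensor :: "tensor_field \<Rightarrow> real \<Rightarrow> bool" where
  "admissible_tensor A \<nu> \<longleftrightarrow>
     (\<forall>y k. int_vec k \<longrightarrow> A (y + k) = A y)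
     \<and> (\<forall>i k j l. (\<lambda>y. A y i k j l) \<in> borel_measurable lebesgue)
     \<and> (\<exists>M. \<forall>y i k j l. \<bar>A y i k j l\<bar> \<le> M)
     \<and> (\<forall>y. tensor_symmetric (A y))
     \<and> 0 < \<nu>
     \<and> (\<forall>y (\<xi>::real^3^3). transpose \<xi> = \<xi> \<longrightarrow>
          \<nu> * (norm \<xi>)^2 \<le> (\<Sum>i\<in>UNIV. \<Sum>j\<in>UNIV. \<Sum>k\<in>UNIV. \<Sum>l\<in>UNIV. A y i k j l * \<xi>$k$l * \<xi>$i$j)
          \<and> (\<Sum>i\<in>UNIV. \<Sum>j\<in>UNIV. \<Sum>k\<in>UNIV. \<Sum>l\<in>UNIV. A y i k j l * \<xi>$k$l * \<xi>$i$j) \<le> (norm \<xi>)^2 / \<nu>)"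

end

theory Submission
  imports Defs "HOL-Library.Function_Algebras"
begin

text \<open>Write \<open>T\<close> for \<open>|\<chi>|\<^sup>-\<^sup>2 \<A>\<^sub>\<chi>\<close> and measure everything in the form norm of \<open>T + 1\<close>. On the Fourier
  side \<open>sym\<nabla> + iX\<^sub>\<chi>\<close> multiplies by the symmetrised product with \<open>\<xi> = 2\<pi>k + \<chi>\<close>, and \<open>|\<xi>\<^sub>j| \<ge> max(|\<chi>\<^sub>j|, \<pi>|k\<^sub>j|)\<close> on
  the dual cell; Parseval thus gives a Korn inequality that controls \<open>|\<chi>| \<parallel>u\<parallel>\<close>, \<open>\<parallel>\<nabla>u\<parallel>\<close> and the oscillation of
  \<open>u\<close> uniformly in \<open>\<chi>\<close>. The difference of \<open>u\<close> and the truncated two-scale expansion solves the resolvent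
  equation with a right-hand side that vanishes on constants, hence is \<open>O(|\<chi>|\<^sup>2)\<close> resp. \<open>O(|\<chi>|\<^sup>3)\<close> when tested
  against \<open>(sym\<nabla> + iX\<^sub>\<chi>) v\<close>. Splitting \<open>(T - z)\<^sup>-\<^sup>1 = (T + 1)\<^sup>-\<^sup>1 + (z + 1)(T - z)\<^sup>-\<^sup>1(T + 1)\<^sup>-\<^sup>1\<close> turns
  this into the estimates, once \<open>\<parallel>(T - z)\<^sup>-\<^sup>1\<parallel> \<le> 1 / dist(z, \<sigma>(T))\<close> is known. That bound needs no spectral theorem:
  for real \<open>a\<close> and \<open>c\<close> the optimal constant in \<open>c\<parallel>u\<parallel> \<le> \<parallel>(T - a) u\<parallel>\<close>, one of \<open>a \<plusminus> c\<close> is in the spectrum.\<close>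

section \<open>Semi-inner products and the Riesz theorem\<close>

text \<open>Functions are not identified almost everywhere and \<open>grad\<close> is a choice,
  linear only up to null sets. Hence the abstract part works on sets of functions with seminorms, an
  explicit scalar multiplication and non-unique limits. The form norm is forced by the data: the
  residual of an expansion is only known as a functional bounded by
  \<open>L2norm (Lam \<chi>\<^sub>0 v)\<close>. Dividing the equation by
  \<open>\<bar>\<chi>\<bar>\<^sup>2\<close> costs two powers of \<bar>\<chi>\<bar>, and the strain
  is smaller than the form norm by one power, so one power is lost in total. The residual must
  therefore be one order better than the claim. This is why terms absent from the claim are added
  and dropped again: \<open>u1\<close> in the first estimate, \<open>u2\<close> and the corrector of
  \<open>u01\<close> in the second. The spectral bound is proved for an abstract form because it
  serves twice: for the fibre operator, and for the homogenised 3x3 matrix, where it yields the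
  powers of \<open>1 / D_hom\<close>.\<close>

locale semi_inner =
  fixes V :: "'v::ab_group_add set" and sc :: "complex \<Rightarrow> 'v \<Rightarrow> 'v" and ip :: "'v \<Rightarrow> 'v \<Rightarrow> complex"
  assumes zero_mem: "0 \<in> V"
    and add_mem: "x \<in> V \<Longrightarrow> y \<in> V \<Longrightarrow> x + y \<in> V"
    and sc_mem: "x \<in> V \<Longrightarrow> sc c x \<in> V"
    and sc_minus_one: "sc (-1) x = - x"
    and ip_add: "x \<in> V \<Longrightarrow> y \<in> V \<Longrightarrow> z \<in> V \<Longrightarrow> ip (x + y) z = ip x z + ip y z"
    and ip_sc: "x \<in> V \<Longrightarrow> z \<in> V \<Longrightarrow> ip (sc c x) z = c * ip x z"
    and ip_cnj: "x \<in> V \<Longrightarrow> y \<in> V \<Longrightarrow> ip y x = cnj (ip x y)"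
    and ip_pos: "x \<in> V \<Longrightarrow> 0 \<le> Re (ip x x)"
begin

definition nrm :: "'v \<Rightarrow> real" where "nrm x = sqrt (Re (ip x x))"

lemma uminus_mem: "x \<in> V \<Longrightarrow> - x \<in> V"
  using sc_mem[of x "-1"] sc_minus_one by simp

lemma diff_mem: "x \<in> V \<Longrightarrow> y \<in> V \<Longrightarrow> x - y \<in> V"
  using add_mem[of x "-y"] uminus_mem by simp

lemma ip_minus: "x \<in> V \<Longrightarrow> z \<in> V \<Longrightarrow> ip (- x) z = - ip x z"
  using ip_sc[of x z "-1"] sc_minus_one by simp

lemma ip_diff: "x \<in> V \<Longrightarrow> y \<in> V \<Longrightarrow> z \<in> V \<Longrightarrow> ip (x - y) z = ip x z - ip y z"
  using ip_add[of x "-y" z] uminus_mem ip_minus by simp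

lemma ip_add_right: "x \<in> V \<Longrightarrow> y \<in> V \<Longrightarrow> z \<in> V \<Longrightarrow> ip z (x + y) = ip z x + ip z y"
  using ip_cnj[of "x + y" z] ip_cnj[of x z] ip_cnj[of y z] ip_add add_mem by simp

lemma ip_sc_right: "x \<in> V \<Longrightarrow> z \<in> V \<Longrightarrow> ip z (sc c x) = cnj c * ip z x"
  using ip_cnj[of "sc c x" z] ip_cnj[of x z] ip_sc sc_mem by simp

lemma ip_minus_right: "x \<in> V \<Longrightarrow> z \<in> V \<Longrightarrow> ip z (- x) = - ip z x"
  using ip_sc_right[of x z "-1"] sc_minus_one by simp

lemma ip_diff_right: "x \<in> V \<Longrightarrow> y \<in> V \<Longrightarrow> z \<in> V \<Longrightarrow> ip z (x - y) = ip z x - ip z y"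
  using ip_add_right[of x "-y" z] uminus_mem ip_minus_right by simp

lemma ip_zero: "z \<in> V \<Longrightarrow> ip 0 z = 0"
  using ip_add[of 0 0 z] zero_mem by simp

lemma Im_ip_self: "x \<in> V \<Longrightarrow> Im (ip x x) = 0"
  using ip_cnj[of x x] by (metis complex_cnj complex.sel(2) neg_equal_zero complex_surj)

lemma nrm_nonneg: "x \<in> V \<Longrightarrow> 0 \<le> nrm x"
  by (simp add: nrm_def ip_pos)

lemma nrm_sq: "x \<in> V \<Longrightarrow> (nrm x)\<^sup>2 = Re (ip x x)"
  by (simp add: nrm_def ip_pos)

lemma ip_self: "x \<in> V \<Longrightarrow> ip x x = complex_of_real ((nrm x)\<^sup>2)"
  by (simp add: complex_eq_iff nrm_sq Im_ip_self del: of_real_power)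

lemma nrm_zero: "nrm 0 = 0"
  using ip_zero[OF zero_mem] by (simp add: nrm_def)

lemma nrm_add_sq:
  assumes "x \<in> V" "y \<in> V"
  shows "(nrm (x + y))\<^sup>2 = (nrm x)\<^sup>2 + (nrm y)\<^sup>2 + 2 * Re (ip x y)"
  using assms ip_cnj[of x y] by (simp add: nrm_sq add_mem ip_add ip_add_right)

lemma nrm_sc: "x \<in> V \<Longrightarrow> nrm (sc c x) = cmod c * nrm x"
proof -
  assume x: "x \<in> V"
  have "ip (sc c x) (sc c x) = (c * cnj c) * ip x x"
    using x by (simp add: ip_sc ip_sc_right sc_mem mult_ac)
  also have "\<dots> = complex_of_real ((cmod c * nrm x)\<^sup>2)"
    using x by (simp add: ip_self complex_norm_square[symmetric] power_mult_distrib)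
  finally show ?thesis
    using x nrm_nonneg[OF x] by (simp add: nrm_def del: of_real_power of_real_mult)
qed

lemma nrm_minus: "x \<in> V \<Longrightarrow> nrm (- x) = nrm x"
  using nrm_sc[of x "-1"] sc_minus_one by simp

lemma nrm_minus_commute: "x \<in> V \<Longrightarrow> y \<in> V \<Longrightarrow> nrm (x - y) = nrm (y - x)"
  using nrm_minus[of "x - y"] diff_mem by simp

text \<open>Only a seminorm is available, so \<open>nrm y = 0\<close> may hold for nonzero
  \<open>y\<close>. The quadratic polynomial in \<open>s\<close> is then affine, and nonnegativity
  for all \<open>s\<close> forces \<open>ip x y = 0\<close>.\<close>

lemma Cauchy_Schwarz:
  assumes x: "x \<in> V" and y: "y \<in> V"
  shows "cmod (ip x y) \<le> nrm x * nrm y"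
proof -
  let ?c = "ip x y" let ?X = "(nrm x)\<^sup>2" let ?Y = "(nrm y)\<^sup>2" let ?q = "(cmod (ip x y))\<^sup>2"
  \<comment> \<open>Expands the squared seminorm of \<open>x - s <x,y> y\<close> for real
    \<open>s\<close>; the factor \<open><x,y>\<close> makes the cross term real.\<close>
  have key: "0 \<le> ?X - 2 * s * ?q + s\<^sup>2 * ?q * ?Y" for s :: real
  proof -
    let ?a = "- (complex_of_real s * ?c)"
    have "(nrm (x + sc ?a y))\<^sup>2 = ?X + (cmod ?a * nrm y)\<^sup>2 + 2 * Re (cnj ?a * ?c)"
      using x y by (simp add: nrm_add_sq sc_mem nrm_sc ip_sc_right)
    also have "cnj ?a * ?c = - complex_of_real (s * ?q)"
      by (simp add: complex_norm_square mult_ac del: of_real_power)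
    finally have "(nrm (x + sc ?a y))\<^sup>2 = ?X + (s\<^sup>2 * ?q * ?Y) - 2 * s * ?q"
      by (simp add: norm_mult power_mult_distrib)
    then show ?thesis by (smt (verit) zero_le_power2)
  qed
  have "?q \<le> ?X * ?Y"
  proof (cases "?Y = 0")
    case True
    have "?q = 0"
    proof (rule ccontr)
      assume "?q \<noteq> 0"
      then have q: "0 < ?q" by simp
      have "0 \<le> ?X - 2 * ((?X + 1) / ?q) * ?q" using key[of "(?X + 1) / ?q"] True by simp
      also have "\<dots> = - ?X - 2" using q by simp
      finally show False by (smt (verit) zero_le_power2)
    qed
    then show ?thesis by simp
  next
    case False
    then have Y: "0 < ?Y" by simp
    have "0 \<le> ?X - 2 * (1/?Y) * ?q + (1/?Y)\<^sup>2 * ?q * ?Y" by (rule key)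
    also have "\<dots> = ?X - ?q / ?Y" using Y by (simp add: field_simps power2_eq_square)
    finally have "?q / ?Y \<le> ?X" by simp
    then show ?thesis using Y by (simp add: pos_divide_le_eq)
  qed
  then have "(cmod ?c)\<^sup>2 \<le> (nrm x * nrm y)\<^sup>2" by (simp add: power_mult_distrib)
  then show ?thesis using nrm_nonneg x y by (meson mult_nonneg_nonneg power2_le_imp_le)
qed

lemma nrm_triangle:
  assumes x: "x \<in> V" and y: "y \<in> V"
  shows "nrm (x + y) \<le> nrm x + nrm y"
proof -
  have "Re (ip x y) \<le> nrm x * nrm y"
    using Cauchy_Schwarz[OF x y] complex_Re_le_cmod order_trans by blast
  then have "(nrm (x + y))\<^sup>2 \<le> (nrm x + nrm y)\<^sup>2"
    using nrm_add_sq[OF x y] by (simp add: power2_sum)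
  then show ?thesis using nrm_nonneg x y by (meson add_nonneg_nonneg power2_le_imp_le)
qed

lemma nrm_triangle3:
  assumes "x \<in> V" "y \<in> V" "z \<in> V"
  shows "nrm (x - z) \<le> nrm (x - y) + nrm (y - z)"
  using nrm_triangle[of "x - y" "y - z"] assms diff_mem by simp

text \<open>Limits are unique only up to vectors of seminorm 0, so existence of a limit is asserted
  and none is named.\<close>

definition complete_nrm :: bool where
  "complete_nrm \<longleftrightarrow> (\<forall>x. (\<forall>n::nat. x n \<in> V) \<and> (\<forall>\<epsilon>>0. \<exists>N. \<forall>m\<ge>N. \<forall>n\<ge>N. nrm (x m - x n) < \<epsilon>)
     \<longrightarrow> (\<exists>u\<in>V. (\<lambda>n. nrm (x n - u)) \<longlonglongrightarrow> 0))"

lemma ip_tendsto: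
  assumes "\<And>n. x n \<in> V" "u \<in> V" "v \<in> V" "(\<lambda>n. nrm (x n - u)) \<longlonglongrightarrow> 0"
  shows "(\<lambda>n. ip (x n) v) \<longlonglongrightarrow> ip u v"
proof -
  have "(\<lambda>n. ip (x n) v - ip u v) \<longlonglongrightarrow> 0"
  proof (rule Lim_null_comparison)
    show "\<forall>\<^sub>F n in sequentially. norm (ip (x n) v - ip u v) \<le> nrm (x n - u) * nrm v"
      using assms Cauchy_Schwarz[of "x _ - u" v] by (simp add: ip_diff diff_mem)
    show "(\<lambda>n. nrm (x n - u) * nrm v) \<longlonglongrightarrow> 0"
      using tendsto_mult_left_zero[OF assms(4)] by simp
  qed
  then show ?thesis by (simp add: LIM_zero_iff)
qed

lemma nrm_tendsto:
  assumes "\<And>n. x n \<in> V" "u \<in> V" "(\<lambda>n. nrm (x n - u)) \<longlonglongrightarrow> 0"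
  shows "(\<lambda>n. nrm (x n)) \<longlonglongrightarrow> nrm u"
proof -
  have "(\<lambda>n. nrm (x n) - nrm u) \<longlonglongrightarrow> 0"
  proof (rule Lim_null_comparison)
    have "\<bar>nrm (x n) - nrm u\<bar> \<le> nrm (x n - u)" for n
      using nrm_triangle[of "x n - u" u] nrm_triangle[of "u - x n" "x n"] nrm_minus_commute[of u "x n"]
        assms(1,2) diff_mem by (smt (verit) diff_add_cancel)
    then show "\<forall>\<^sub>F n in sequentially. norm (nrm (x n) - nrm u) \<le> nrm (x n - u)" by simp
  qed (rule assms)
  then show ?thesis by (simp add: LIM_zero_iff)
qed

text \<open>The Riesz vector is the minimiser of \<open>\<parallel>v\<parallel>\<^sup>2 - 2 Re (F v)\<close>; the parallelogram law makes
  minimising sequences Cauchy.\<close>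

theorem Riesz:
  assumes complete: complete_nrm
    and F_add: "\<And>x y. x \<in> V \<Longrightarrow> y \<in> V \<Longrightarrow> F (x + y) = F x + F y"
    and F_sc: "\<And>c x. x \<in> V \<Longrightarrow> F (sc c x) = cnj c * F x"
    and F_bound: "\<And>x. x \<in> V \<Longrightarrow> cmod (F x) \<le> K * nrm x"
    and K: "0 \<le> K"
  obtains u where "u \<in> V" "\<And>v. v \<in> V \<Longrightarrow> ip u v = F v" "nrm u \<le> K"
proof -
  define J where "J v = (nrm v)\<^sup>2 - 2 * Re (F v)" for v
  have J_low: "- K\<^sup>2 \<le> J v" if "v \<in> V" for v
  proof -
    have "Re (F v) \<le> K * nrm v" using F_bound[OF that] complex_Re_le_cmod order_trans by blast
    moreover have "0 \<le> (nrm v - K)\<^sup>2" by simp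
    ultimately show ?thesis by (simp add: J_def power2_diff mult_ac)
  qed
  define d where "d = Inf (J ` V)"
  have bdd: "bdd_below (J ` V)" using J_low by (meson bdd_belowI2)
  have d_le: "d \<le> J v" if "v \<in> V" for v
    unfolding d_def using bdd that by (simp add: cInf_lower)
  have "\<exists>v\<in>V. J v < d + 1 / real (Suc n)" for n
  proof -
    have "Inf (J ` V) < d + 1 / real (Suc n)" by (simp add: d_def)
    then show ?thesis using cInf_less_iff[of "J ` V"] bdd zero_mem by auto
  qed
  then obtain x where xV: "\<And>n. x n \<in> V" and xJ: "\<And>n. J (x n) < d + 1 / real (Suc n)" by metis
  have F_m1: "F (- y) = - F y" if "y \<in> V" for y
    using F_sc[OF that, of "-1"] sc_minus_one by simp
  have par: "(nrm (a - b))\<^sup>2 \<le> 2 * (J a - d) + 2 * (J b - d)" if "a \<in> V" "b \<in> V" for a b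
  proof -
    let ?m = "sc (1/2) (a + b)"
    have "?m \<in> V" using that by (simp add: sc_mem add_mem)
    then have "d \<le> J ?m" by (rule d_le)
    also have "J ?m = (nrm (a + b))\<^sup>2 / 4 - Re (F a + F b)"
      using that by (simp add: J_def nrm_sc add_mem F_sc F_add power_divide field_simps)
    finally have 1: "4 * d \<le> (nrm (a + b))\<^sup>2 - 4 * Re (F a) - 4 * Re (F b)" by simp
    have 2: "(nrm (a - b))\<^sup>2 = (nrm a)\<^sup>2 + (nrm b)\<^sup>2 - 2 * Re (ip a b)"
      using that nrm_add_sq[of a "- b"] by (simp add: uminus_mem nrm_minus ip_minus_right)
    show ?thesis using 1 2 nrm_add_sq[OF that] by (simp add: J_def)
  qed
  have "\<exists>N. \<forall>m\<ge>N. \<forall>n\<ge>N. nrm (x m - x n) < \<epsilon>" if "\<epsilon> > 0" for \<epsilon>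
  proof -
    obtain N where N: "1 / real (Suc N) < \<epsilon>\<^sup>2 / 4"
      using nat_approx_posE[of "\<epsilon>\<^sup>2 / 4"] \<open>\<epsilon> > 0\<close> by (metis zero_less_power zero_less_divide_iff zero_less_numeral)
    have "nrm (x m - x n) < \<epsilon>" if "m \<ge> N" "n \<ge> N" for m n
    proof -
      have "1 / real (Suc m) \<le> 1 / real (Suc N)" "1 / real (Suc n) \<le> 1 / real (Suc N)"
        using that by (auto simp: field_simps)
      then have "J (x m) < d + \<epsilon>\<^sup>2 / 4" "J (x n) < d + \<epsilon>\<^sup>2 / 4"
        using xJ[of m] xJ[of n] N by (smt (verit))+
      then have "(nrm (x m - x n))\<^sup>2 < \<epsilon>\<^sup>2"
        using par[OF xV xV, of m n] by argo
      then show ?thesis using \<open>\<epsilon> > 0\<close> by (simp add: power2_less_imp_less)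
    qed
    then show ?thesis by blast
  qed
  then obtain u where u: "u \<in> V" and lim: "(\<lambda>n. nrm (x n - u)) \<longlonglongrightarrow> 0"
    using complete xV unfolding complete_nrm_def by blast
  have Flim: "(\<lambda>n. F (x n)) \<longlonglongrightarrow> F u"
  proof -
    have "(\<lambda>n. F (x n) - F u) \<longlonglongrightarrow> 0"
    proof (rule Lim_null_comparison)
      have "norm (F (x n) - F u) \<le> K * nrm (x n - u)" for n
        using F_bound[of "x n - u"] F_add[of "x n" "- u"] F_m1[OF u] xV u diff_mem uminus_mem by simp
      then show "\<forall>\<^sub>F n in sequentially. norm (F (x n) - F u) \<le> K * nrm (x n - u)" by simp
      show "(\<lambda>n. K * nrm (x n - u)) \<longlonglongrightarrow> 0" using tendsto_mult_right_zero[OF lim] by simp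
    qed
    then show ?thesis by (simp add: LIM_zero_iff)
  qed
  have "(\<lambda>n. J (x n)) \<longlonglongrightarrow> J u"
    unfolding J_def by (intro tendsto_intros nrm_tendsto[OF xV u lim] Flim)
  moreover have "(\<lambda>n. d + 1 / real (Suc n)) \<longlonglongrightarrow> d + 0"
    by (intro tendsto_intros LIMSEQ_Suc lim_1_over_n)
  ultimately have "J u \<le> d + 0"
    using xJ by (meson LIMSEQ_le less_imp_le)
  then have Ju: "J u \<le> J v" if "v \<in> V" for v using d_le[OF that] by simp
  \<comment> \<open>First variation: \<open>J (u + s v)\<close> is a quadratic polynomial in the
    real number \<open>s\<close> with its minimum at 0, so the linear coefficient vanishes.\<close>
  have re: "Re (ip u v) = Re (F v)" if v: "v \<in> V" for v
  proof -
    let ?D = "Re (ip u v) - Re (F v)"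
    have q: "0 \<le> s\<^sup>2 * (nrm v)\<^sup>2 + 2 * s * ?D" for s :: real
    proof -
      have "J (u + sc (of_real s) v) = J u + s\<^sup>2 * (nrm v)\<^sup>2 + 2 * s * ?D"
        using u v by (simp add: J_def nrm_add_sq sc_mem nrm_sc ip_sc_right F_add F_sc power_mult_distrib algebra_simps)
      then show ?thesis using Ju[of "u + sc (of_real s) v"] u v by (simp add: add_mem sc_mem)
    qed
    \<comment> \<open>The added 1 keeps the trial value \<open>s = - ?D / ?Y\<close> meaningful when
      \<open>nrm v = 0\<close>.\<close>
    let ?Y = "(nrm v)\<^sup>2 + 1"
    have "0 \<le> (-(?D/?Y))\<^sup>2 * (nrm v)\<^sup>2 + 2 * (-(?D/?Y)) * ?D" by (rule q)
    moreover have "(-(?D/?Y))\<^sup>2 * (nrm v)\<^sup>2 \<le> (-(?D/?Y))\<^sup>2 * ?Y" by (intro mult_left_mono) auto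
    moreover have "(-(?D/?Y))\<^sup>2 * ?Y = ?D\<^sup>2 / ?Y" by (simp add: power2_eq_square)
    moreover have "2 * (-(?D/?Y)) * ?D = - 2 * (?D\<^sup>2 / ?Y)" by (simp add: power2_eq_square)
    ultimately have "?D\<^sup>2 / ?Y \<le> 0" by linarith
    moreover have "0 < ?Y" by (smt (verit) zero_le_power2)
    ultimately have "?D\<^sup>2 \<le> 0" by (simp add: divide_le_0_iff)
    then show ?thesis by simp
  qed
  have eq: "ip u v = F v" if v: "v \<in> V" for v
  proof (rule complex_eqI)
    show "Re (ip u v) = Re (F v)" by (rule re[OF v])
    \<comment> \<open>Both sides are antilinear in \<open>v\<close>, so the identity of real parts
      at \<open>\<i> v\<close> is the identity of imaginary parts at \<open>v\<close>.\<close>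
    show "Im (ip u v) = Im (F v)"
      using re[OF sc_mem[OF v, of \<i>]] u v by (simp add: ip_sc_right F_sc)
  qed
  have "nrm u \<le> K"
  proof (cases "nrm u = 0")
    case True
    then show ?thesis using K by simp
  next
    case False
    then have "0 < nrm u" using nrm_nonneg[OF u] by simp
    moreover have "nrm u * nrm u \<le> K * nrm u"
      using F_bound[OF u] by (simp flip: eq[OF u] add: ip_self[OF u] power2_eq_square norm_mult)
    ultimately show ?thesis by simp
  qed
  then show ?thesis using that u eq by blast
qed

end

section \<open>Resolvent bounds for forms\<close>

text \<open>\<open>V\<close> is the form domain of \<open>T\<close>, \<open>H\<close> the ambient
  space. \<open>h_le_e\<close> says that \<open>T\<close> is nonnegative. \<open>nontrivial\<close>
  excludes the degenerate case in which every \<open>z\<close> could be a resolvent point.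
  Completeness is asked of \<open>V\<close>, where the Riesz theorem and the Neumann series
  work.\<close>

locale form_pair = E: semi_inner V sc e + H: semi_inner H sc h
  for V H :: "'v::ab_group_add set" and sc e h +
  assumes V_sub_H: "V \<subseteq> H"
    and h_le_e: "x \<in> V \<Longrightarrow> H.nrm x \<le> E.nrm x"
    and complete: "E.complete_nrm"
    and nontrivial: "\<exists>x\<in>V. 0 < H.nrm x"
begin

text \<open>\<open>e\<close> is the form of \<open>T + 1\<close>, so that \<open>res z g u\<close> encodes \<open>(T - z) u = g\<close>.\<close>

definition res :: "complex \<Rightarrow> 'v \<Rightarrow> 'v \<Rightarrow> bool" where
  "res z g u \<longleftrightarrow> u \<in> V \<and> (\<forall>v\<in>V. e u v - (z + 1) * h u v = h g v)"

text \<open>Uniqueness is implicit: the bound, applied to the difference of two solutions, shows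
  that they agree up to \<open>H\<close>-seminorm 0.\<close>

definition rho :: "complex set" where
  "rho = {z. (\<forall>g\<in>H. \<exists>u. res z g u) \<and> (\<exists>M. \<forall>g\<in>H. \<forall>u. res z g u \<longrightarrow> H.nrm u \<le> M * H.nrm g)}"

text \<open>A lower bound for \<open>T - z\<close> in the form norm, phrased through solutions
  because the resolvent is not given as a function. The best \<open>c\<close> is the reciprocal of
  the resolvent norm on \<open>V\<close>.\<close>

definition lower :: "complex \<Rightarrow> real \<Rightarrow> bool" where
  "lower z c \<longleftrightarrow> (\<forall>g\<in>V. \<forall>u. res z g u \<longrightarrow> c * E.nrm u \<le> E.nrm g)"

lemma mem_H: "x \<in> V \<Longrightarrow> x \<in> H" using V_sub_H by blast

lemma res_mem: "res z g u \<Longrightarrow> u \<in> V" by (simp add: res_def)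

lemma res_eq: "res z g u \<Longrightarrow> v \<in> V \<Longrightarrow> e u v = (z + 1) * h u v + h g v"
  by (auto simp: res_def algebra_simps)

lemma resI: "u \<in> V \<Longrightarrow> (\<And>v. v \<in> V \<Longrightarrow> e u v = (z + 1) * h u v + h g v) \<Longrightarrow> res z g u"
  by (auto simp: res_def)

lemma res_diff: "res z g u \<Longrightarrow> res z g' u' \<Longrightarrow> g \<in> H \<Longrightarrow> g' \<in> H \<Longrightarrow> res z (g - g') (u - u')"
  by (rule resI)
    (auto simp: res_eq E.diff_mem res_mem E.ip_diff H.ip_diff mem_H algebra_simps)

text \<open>The resolvent identity in terms of solutions: a change of the spectral parameter is paid
  for by a multiple of \<open>u\<close> in the data.\<close>

lemma res_shift: "res z g u \<Longrightarrow> g \<in> H \<Longrightarrow> res s (g + sc (z - s) u) u"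
  by (rule resI)
    (auto simp: res_eq res_mem E.sc_mem H.ip_add H.ip_sc H.sc_mem mem_H algebra_simps)

text \<open>Testing the equation with \<open>u\<close> itself produces the square of the form norm,
  and the \<open>H\<close>-bound on \<open>u\<close> controls the other side by \<open>g\<close>. So
  resolvent bounds pass from \<open>H\<close> to the form norm.\<close>

lemma rho_imp_lower:
  assumes "z \<in> rho"
  shows "\<exists>c>0. lower z c"
proof -
  obtain M0 where M0: "\<And>g u. g \<in> H \<Longrightarrow> res z g u \<Longrightarrow> H.nrm u \<le> M0 * H.nrm g"
    using assms by (auto simp: rho_def)
  \<comment> \<open>The constant supplied by \<open>rho\<close> carries no sign; truncation at 0
    keeps the monotonicity steps valid.\<close>
  define M where "M = max M0 0"
  have M: "H.nrm u \<le> M * H.nrm g" if "g \<in> H" "res z g u" for g u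
    using M0[OF that] H.nrm_nonneg[OF that(1)] mult_right_mono[of M0 M "H.nrm g"] by (simp add: M_def)
  define K where "K = cmod (z + 1) * M\<^sup>2 + M + 1"
  have "M \<ge> 0" by (simp add: M_def)
  then have "K \<ge> 1" by (simp add: K_def)
  have "1 / sqrt K * E.nrm u \<le> E.nrm g" if g: "g \<in> V" and u: "res z g u" for g u
  proof -
    let ?u = "H.nrm u" and ?g = "H.nrm g"
    have uV: "u \<in> V" using res_mem u by blast
    have gu: "?u \<le> M * ?g" using M[OF mem_H[OF g] u] .
    have nn: "0 \<le> ?u" "0 \<le> ?g" using H.nrm_nonneg mem_H g uV by auto
    have "(E.nrm u)\<^sup>2 = Re ((z + 1) * h u u + h g u)"
      using uV res_eq[OF u uV] by (simp add: E.nrm_sq)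
    also have "\<dots> \<le> cmod ((z + 1) * h u u + h g u)" by (rule complex_Re_le_cmod)
    also have "\<dots> \<le> cmod (z + 1) * cmod (h u u) + cmod (h g u)"
      by (metis norm_mult norm_triangle_ineq)
    also have "\<dots> \<le> cmod (z + 1) * (?u * ?u) + ?g * ?u"
      using H.Cauchy_Schwarz mem_H g uV by (intro add_mono mult_left_mono) auto
    also have "\<dots> \<le> cmod (z + 1) * ((M * ?g) * (M * ?g)) + ?g * (M * ?g)"
      using gu nn \<open>M \<ge> 0\<close> by (intro add_mono mult_left_mono mult_mono) auto
    also have "\<dots> \<le> K * ?g\<^sup>2" by (simp add: K_def algebra_simps power2_eq_square)
    also have "\<dots> \<le> K * (E.nrm g)\<^sup>2"
      using h_le_e[OF g] nn \<open>K \<ge> 1\<close> by (intro mult_left_mono power_mono) auto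
    finally have "(E.nrm u)\<^sup>2 \<le> (sqrt K * E.nrm g)\<^sup>2" using \<open>K \<ge> 1\<close> by (simp add: power_mult_distrib)
    then have "E.nrm u \<le> sqrt K * E.nrm g"
      using E.nrm_nonneg[OF g] \<open>K \<ge> 1\<close> by (intro power2_le_imp_le[of "E.nrm u"]) auto
    then show ?thesis using \<open>K \<ge> 1\<close> by (simp add: divide_le_eq mult.commute)
  qed
  then show ?thesis using \<open>K \<ge> 1\<close> by (intro exI[of _ "1 / sqrt K"]) (auto simp: lower_def)
qed

text \<open>Neumann series for the resolvent in the form norm.\<close>

lemma rho_open:
  assumes z: "z \<in> rho"
  shows "\<exists>\<delta>>0. \<forall>s. cmod (s - z) < \<delta> \<longrightarrow> s \<in> rho"
proof -
  obtain c where c: "c > 0" "lower z c" using rho_imp_lower[OF z] by blast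
  obtain M0 where M0: "\<And>g u. g \<in> H \<Longrightarrow> res z g u \<Longrightarrow> H.nrm u \<le> M0 * H.nrm g"
    using z by (auto simp: rho_def)
  define M where "M = max M0 0"
  have M: "H.nrm u \<le> M * H.nrm g" if "g \<in> H" "res z g u" for g u
    using M0[OF that] H.nrm_nonneg[OF that(1)] mult_right_mono[of M0 M "H.nrm g"] by (simp add: M_def)
  have "M \<ge> 0" by (simp add: M_def)
  obtain R where R: "\<And>g. g \<in> H \<Longrightarrow> res z g (R g)" using z by (auto simp: rho_def) metis
  \<comment> \<open>The radius \<open>c\<close> makes the iteration a contraction in the form norm;
    the radius \<open>1 / (M + 1)\<close> lets the \<open>H\<close>-estimate absorb the
    perturbation.\<close>
  have "s \<in> rho" if s: "cmod (s - z) < min c (1 / (M + 1))" for s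
  proof -
    let ?d = "s - z"
    define q where "q = cmod ?d / c"
    have q: "0 \<le> q" "q < 1" using s c by (auto simp: q_def)
    have bound: "H.nrm u \<le> 2 * (M + 1) * (M + 1) * H.nrm g" if g: "g \<in> H" and u: "res s g u" for g u
    proof -
      have uH: "u \<in> H" using res_mem[OF u] mem_H by blast
      have "res z (g + sc ?d u) u" using res_shift[OF u g, of z] .
      then have "H.nrm u \<le> M * H.nrm (g + sc ?d u)" by (rule M[rotated]) (simp add: H.add_mem g H.sc_mem uH)
      also have "\<dots> \<le> M * (H.nrm g + cmod ?d * H.nrm u)"
        using H.nrm_triangle[OF g H.sc_mem[OF uH], of ?d] \<open>M \<ge> 0\<close>
        by (intro mult_left_mono) (auto simp: H.nrm_sc uH)
      finally have 1: "H.nrm u \<le> M * H.nrm g + (M * cmod ?d) * H.nrm u" by (simp add: algebra_simps)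
      have "M * cmod ?d \<le> M * (1 / (M + 1))" using s \<open>M \<ge> 0\<close> by (intro mult_left_mono) auto
      then have "(M * cmod ?d) * H.nrm u \<le> (M / (M + 1)) * H.nrm u"
        using H.nrm_nonneg[OF uH] by (intro mult_right_mono) auto
      with 1 have "H.nrm u \<le> M * H.nrm g + (M / (M + 1)) * H.nrm u" by linarith
      moreover have "H.nrm u - (M / (M + 1)) * H.nrm u = H.nrm u / (M + 1)"
        using \<open>M \<ge> 0\<close> by (simp add: field_simps)
      ultimately have "H.nrm u / (M + 1) \<le> M * H.nrm g" by linarith
      then have "H.nrm u \<le> M * (M + 1) * H.nrm g" using \<open>M \<ge> 0\<close> by (simp add: divide_le_eq mult_ac)
      also have "\<dots> \<le> 2 * (M + 1) * (M + 1) * H.nrm g"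
        using \<open>M \<ge> 0\<close> H.nrm_nonneg[OF g] by (intro mult_right_mono) auto
      finally show ?thesis .
    qed
    have "\<exists>u. res s g u" if g: "g \<in> H" for g
    proof -
      \<comment> \<open>Iterates of \<open>u \<mapsto> R (g + (s - z) u)\<close>, the partial sums
        of the Neumann series. \<open>R\<close> merely selects solutions and is not known to be
        linear, so consecutive iterates are compared through \<open>res_diff\<close>.\<close>
      define x where "x = rec_nat (R g) (\<lambda>_ y. R (g + sc ?d y))"
      have x0: "x 0 = R g" and xS: "x (Suc n) = R (g + sc ?d (x n))" for n by (auto simp: x_def)
      have xV: "x n \<in> V" for n
      proof (induction n)
        case (Suc n)
        then have "g + sc ?d (x n) \<in> H" using g mem_H H.add_mem H.sc_mem by blast
        then show ?case unfolding xS by (rule res_mem[OF R])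
      qed (simp add: x0 res_mem[OF R[OF g]])
      have step: "E.nrm (x (Suc (Suc n)) - x (Suc n)) \<le> q * E.nrm (x (Suc n) - x n)" for n
      proof -
        let ?w = "x (Suc (Suc n)) - x (Suc n)" and ?y = "x (Suc n) - x n"
        have inH: "g + sc ?d (x k) \<in> H" for k by (simp add: H.add_mem g H.sc_mem mem_H xV)
        have "res z ((g + sc ?d (x (Suc n))) - (g + sc ?d (x n))) ?w"
          using res_diff[OF R[OF inH[of "Suc n"]] R[OF inH[of n]] inH inH] by (simp only: xS)
        then have "res z (sc ?d ?y) ?w"
          unfolding res_def using xV g H.sc_mem mem_H inH
          by (simp add: H.ip_diff H.ip_add H.ip_sc E.diff_mem algebra_simps)
        then have "c * E.nrm ?w \<le> E.nrm (sc ?d ?y)"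
          using c(2) xV by (auto simp: lower_def E.sc_mem E.diff_mem)
        also have "\<dots> = cmod ?d * E.nrm ?y" using xV by (simp add: E.nrm_sc E.diff_mem)
        finally show ?thesis using c by (simp add: q_def field_simps)
      qed
      define a where "a = E.nrm (x (Suc 0) - x 0)"
      have a: "a \<ge> 0" using xV by (simp add: a_def E.nrm_nonneg E.diff_mem)
      have step': "E.nrm (x (Suc n) - x n) \<le> q ^ n * a" for n
      proof (induction n)
        case (Suc n)
        have "E.nrm (x (Suc (Suc n)) - x (Suc n)) \<le> q * E.nrm (x (Suc n) - x n)" by (rule step)
        also have "\<dots> \<le> q * (q ^ n * a)" using Suc q by (intro mult_left_mono) auto
        finally show ?case by (simp add: mult_ac)
      qed (simp add: a_def)
      have tele: "E.nrm (x (n + k) - x n) \<le> q ^ n * a / (1 - q)" for n k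
      proof -
        have "E.nrm (x (n + k) - x n) \<le> (\<Sum>i<k. q ^ (n + i) * a)"
        proof (induction k)
          case 0 then show ?case by (simp add: E.nrm_zero)
        next
          case (Suc k)
          have "E.nrm (x (n + Suc k) - x n) \<le> E.nrm (x (Suc (n + k)) - x (n + k)) + E.nrm (x (n + k) - x n)"
            using E.nrm_triangle3[OF xV xV xV, of "Suc (n + k)" n "n + k"] by simp
          then show ?case using Suc step'[of "n + k"] by simp
        qed
        also have "\<dots> = q ^ n * a * (\<Sum>i<k. q ^ i)"
          by (simp add: power_add sum_distrib_left mult_ac)
        also have "\<dots> \<le> q ^ n * a * (1 / (1 - q))"
        proof (intro mult_left_mono)
          show "(\<Sum>i<k. q ^ i) \<le> 1 / (1 - q)"
            using q by (simp add: sum_gp_strict divide_right_mono)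
        qed (use q a in auto)
        finally show ?thesis by simp
      qed
      have "(\<lambda>n. q ^ n * (a / (1 - q))) \<longlonglongrightarrow> 0"
        using q by (intro tendsto_mult_left_zero LIMSEQ_power_zero) auto
      then have small: "\<exists>N. \<forall>n\<ge>N. q ^ n * a / (1 - q) < \<epsilon>" if "\<epsilon> > 0" for \<epsilon>
        using order_tendstoD(2)[of "\<lambda>n. q ^ n * (a / (1 - q))" 0 sequentially \<epsilon>] that
        by (simp add: eventually_sequentially)
      have "\<exists>N. \<forall>m\<ge>N. \<forall>n\<ge>N. E.nrm (x m - x n) < \<epsilon>" if "\<epsilon> > 0" for \<epsilon>
      proof -
        obtain N where N: "\<And>n. n \<ge> N \<Longrightarrow> q ^ n * a / (1 - q) < \<epsilon>" using small[OF \<open>\<epsilon> > 0\<close>] by blast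
        have "E.nrm (x m - x n) < \<epsilon>" if "m \<ge> N" "n \<ge> N" for m n
        proof (cases "n \<le> m")
          case True
          then show ?thesis using tele[of n "m - n"] N[OF that(2)] by simp
        next
          case False
          then show ?thesis using tele[of m "n - m"] N[OF that(1)] E.nrm_minus_commute[OF xV xV, of m n] by simp
        qed
        then show ?thesis by blast
      qed
      then obtain u where u: "u \<in> V" and lim: "(\<lambda>n. E.nrm (x n - u)) \<longlonglongrightarrow> 0"
        using complete xV unfolding E.complete_nrm_def by blast
      have limS: "(\<lambda>n. E.nrm (x (Suc n) - u)) \<longlonglongrightarrow> 0" using LIMSEQ_Suc[OF lim] .
      have toH: "(\<lambda>n. H.nrm (y n - u)) \<longlonglongrightarrow> 0" if "(\<lambda>n. E.nrm (y n - u)) \<longlonglongrightarrow> 0" "\<And>n. y n \<in> V" for y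
        by (rule Lim_null_comparison[OF _ that(1)])
          (use that u in \<open>auto simp: h_le_e E.diff_mem H.nrm_nonneg mem_H\<close>)
      have "res s g u"
      proof (rule resI[OF u])
        fix v assume v: "v \<in> V"
        have l1: "(\<lambda>n. e (x (Suc n)) v) \<longlonglongrightarrow> e u v"
          by (rule E.ip_tendsto[OF xV u v limS])
        have l2: "(\<lambda>n. h (x (Suc n)) v) \<longlonglongrightarrow> h u v"
          by (rule H.ip_tendsto[OF _ _ _ toH[OF limS]]) (use xV u v mem_H in auto)
        have l3: "(\<lambda>n. h (x n) v) \<longlonglongrightarrow> h u v"
          by (rule H.ip_tendsto[OF _ _ _ toH[OF lim]]) (use xV u v mem_H in auto)
        have "e (x (Suc n)) v = (z + 1) * h (x (Suc n)) v + (h g v + ?d * h (x n) v)" for n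
        proof -
          have inH: "g + sc ?d (x n) \<in> H" by (simp add: H.add_mem g H.sc_mem mem_H xV)
          show ?thesis using res_eq[OF R[OF inH] v] g v xV
            by (simp add: xS H.ip_add H.ip_sc H.sc_mem mem_H)
        qed
        moreover have "(\<lambda>n. (z + 1) * h (x (Suc n)) v + (h g v + ?d * h (x n) v))
            \<longlonglongrightarrow> (z + 1) * h u v + (h g v + ?d * h u v)"
          by (intro tendsto_intros l2 l3)
        ultimately have "e u v = (z + 1) * h u v + (h g v + ?d * h u v)"
          using l1 LIMSEQ_unique by simp
        then show "e u v = (s + 1) * h u v + h g v" by (simp add: algebra_simps)
      qed
      then show ?thesis by blast
    qed
    then show ?thesis using bound unfolding rho_def by blast
  qed
  moreover have "min c (1 / (M + 1)) > 0" using c \<open>M \<ge> 0\<close> by simp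
  ultimately show ?thesis by blast
qed

text \<open>With \<open>R = (T - a)\<^sup>-\<^sup>1\<close>, both points in the resolvent set make \<open>R\<^sup>2 - c\<^sup>-\<^sup>2\<close> boundedly invertible,
  so that \<open>\<parallel>R\<parallel>\<close> is strictly below \<open>c\<^sup>-\<^sup>1\<close>.\<close>

lemma lower_shift_pos:
  assumes "a \<in> rho" "lower a c" "0 < c" "complex_of_real r = a"
    and p: "a + of_real c \<in> rho" and m: "a - of_real c \<in> rho"
  shows "\<exists>c'>c. lower a c'"
proof -
  obtain cp cm where cp: "cp > 0" "lower (a + of_real c) cp" and cm: "cm > 0" "lower (a - of_real c) cm"
    using rho_imp_lower[OF p] rho_imp_lower[OF m] by blast
  define \<kappa> where "\<kappa> = cp * cm"
  have \<kappa>: "\<kappa> > 0" using cp cm by (simp add: \<kappa>_def)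
  \<comment> \<open>The two entries belong to the final case split: \<open>2 * c\<close> if
    \<open>g\<close> is large against \<open>u\<close>, otherwise the root, in which
    \<open>\<kappa>\<close> improves on \<open>c\<close>.\<close>
  define c' where "c' = min (2 * c) (sqrt (c\<^sup>2 + \<kappa>\<^sup>2 / (4 * c\<^sup>2)))"
  have "c < c'"
    unfolding c'_def using \<open>0 < c\<close> \<kappa> by (auto intro!: real_less_rsqrt)
  moreover have "c' * E.nrm u \<le> E.nrm g" if g: "g \<in> V" and u: "res a g u" for g u
  proof -
    have uV: "u \<in> V" using res_mem[OF u] .
    obtain w where w: "res a u w" using assms(1) mem_H[OF uV] by (auto simp: rho_def)
    have wV: "w \<in> V" using res_mem[OF w] .
    let ?c = "complex_of_real c"
    let ?N = "E.nrm g" and ?U = "E.nrm u" and ?W = "E.nrm w"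
    have nn: "0 \<le> ?N" "0 \<le> ?U" "0 \<le> ?W" using E.nrm_nonneg g uV wV by auto
    \<comment> \<open>With \<open>R\<close> the resolvent at \<open>a\<close>,
      \<open>u = R g\<close> and \<open>w = R u\<close>. Since \<open>a\<close> is real,
      \<open>R\<close> is symmetric for \<open>e\<close>, and so
      \<open>e (R (R g)) g = e (R g) (R g)\<close>.\<close>
    have wg: "e w g = complex_of_real (?U\<^sup>2)"
    proof -
      have 1: "e u w = (a + 1) * h u w + h g w" using res_eq[OF u wV] .
      have 2: "e w u = (a + 1) * h w u + h u u" using res_eq[OF w uV] .
      have "cnj a = a" using assms(4) by auto
      then have "e w u = (a + 1) * h w u + h w g"
        using 1 E.ip_cnj[OF uV wV] H.ip_cnj[OF mem_H[OF uV] mem_H[OF wV]] H.ip_cnj[OF mem_H[OF g] mem_H[OF wV]]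
        by simp
      with 2 have "h w g = h u u" by simp
      then have "e w g = (a + 1) * h u u + h u g"
        using res_eq[OF w g] by simp
      moreover have "h u g + (a + 1) * h u u = e u u"
        using res_eq[OF u uV] E.ip_cnj[OF uV uV] \<open>cnj a = a\<close>
          H.ip_cnj[OF mem_H[OF uV] mem_H[OF uV]] H.ip_cnj[OF mem_H[OF g] mem_H[OF uV]]
        by (metis add.commute complex_cnj_add complex_cnj_mult complex_cnj_one)
      ultimately show ?thesis using E.ip_self[OF uV] by (simp add: add.commute)
    qed
    \<comment> \<open>The factorisation
      \<open>g - c\<^sup>2 w = (T - a + c) ((T - a - c) w)\<close>. Inverting one factor after the
      other bounds \<open>\<kappa> \<parallel>w\<parallel>\<close> by the norm of the left
      side.\<close>
    have r1: "res (a + ?c) (u - sc ?c w) w"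
      using res_shift[OF w mem_H[OF uV], of "a + ?c"] uV wV
      by (simp add: res_def H.ip_add H.ip_diff H.sc_mem mem_H H.ip_sc H.diff_mem)
    have r2: "res (a - ?c) (g - sc (?c * ?c) w) (u - sc ?c w)"
    proof (rule resI)
      show "u - sc ?c w \<in> V" using uV wV by (simp add: E.diff_mem E.sc_mem)
      fix v assume v: "v \<in> V"
      show "e (u - sc ?c w) v = (a - ?c + 1) * h (u - sc ?c w) v + h (g - sc (?c * ?c) w) v"
        using uV wV v g mem_H by (simp add: E.ip_diff E.ip_sc E.sc_mem res_eq[OF u v] res_eq[OF w v]
            H.ip_diff H.ip_sc H.sc_mem algebra_simps)
    qed
    let ?y = "g - sc (?c * ?c) w"
    have yV: "?y \<in> V" and xV: "u - sc ?c w \<in> V" using uV wV g by (auto simp: E.diff_mem E.sc_mem)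
    have "cm * E.nrm (u - sc ?c w) \<le> E.nrm ?y" using cm(2) r2 yV by (auto simp: lower_def)
    moreover have "cp * ?W \<le> E.nrm (u - sc ?c w)" using cp(2) r1 xV by (auto simp: lower_def)
    ultimately have "\<kappa> * ?W \<le> E.nrm ?y"
      using cm(1) unfolding \<kappa>_def by (smt (verit) mult.assoc mult.commute mult_left_mono)
    then have "(\<kappa> * ?W)\<^sup>2 \<le> (E.nrm ?y)\<^sup>2" using \<kappa> nn by (intro power_mono) auto
    also have "(E.nrm ?y)\<^sup>2 = ?N\<^sup>2 - 2 * c\<^sup>2 * ?U\<^sup>2 + c^4 * ?W\<^sup>2"
    proof -
      have "e g w = complex_of_real (?U\<^sup>2)" using wg E.ip_cnj[OF wV g] by simp
      then show ?thesis
        using E.nrm_add_sq[OF g E.uminus_mem[OF E.sc_mem[OF wV, of "?c * ?c"]]] g wV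
        by (simp add: E.nrm_minus E.sc_mem E.nrm_sc norm_mult E.ip_minus_right E.ip_sc_right
            power_mult_distrib power2_eq_square power4_eq_xxxx)
    qed
    finally have i1: "\<kappa>\<^sup>2 * ?W\<^sup>2 \<le> ?N\<^sup>2 - 2 * c\<^sup>2 * ?U\<^sup>2 + c^4 * ?W\<^sup>2" by (simp add: power_mult_distrib)
    \<comment> \<open>The constant \<open>c\<close> applied to \<open>w\<close> trades the quartic
      term for one in \<open>u\<close> and leaves \<open>\<kappa>\<^sup>2 * ?W\<^sup>2\<close> as a
      gain.\<close>
    have "c * ?W \<le> ?U" using assms(2) w uV by (auto simp: lower_def)
    then have "(c * (c * ?W))\<^sup>2 \<le> (c * ?U)\<^sup>2" using \<open>0 < c\<close> nn by (intro power_mono mult_left_mono) auto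
    then have "c^4 * ?W\<^sup>2 \<le> c\<^sup>2 * ?U\<^sup>2" by (simp add: power_mult_distrib power2_eq_square power4_eq_xxxx mult_ac)
    with i1 have i2: "c\<^sup>2 * ?U\<^sup>2 + \<kappa>\<^sup>2 * ?W\<^sup>2 \<le> ?N\<^sup>2" by linarith
    show ?thesis
    proof (cases "2 * c * ?U \<le> ?N")
      case True
      have "c' * ?U \<le> 2 * c * ?U" using nn by (intro mult_right_mono) (auto simp: c'_def)
      then show ?thesis using True by simp
    next
      case False
      \<comment> \<open>In this case \<open>?W\<close> turns out to be at least
        \<open>?U / (2 * c)\<close>, so the gain is a fixed multiple of
        \<open>?U\<^sup>2\<close>.\<close>
      have "?U\<^sup>2 \<le> ?W * ?N" using E.Cauchy_Schwarz[OF wV g] wg by (simp add: norm_power)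
      also have "\<dots> \<le> ?W * (2 * c * ?U)" using False nn by (intro mult_left_mono) auto
      finally have "?U * ?U \<le> (2 * c * ?W) * ?U" by (simp add: power2_eq_square mult_ac)
      moreover have "?U > 0" using False nn \<open>0 < c\<close> by (smt (verit) mult_nonneg_nonneg mult_eq_0_iff)
      ultimately have "?U \<le> 2 * c * ?W" by simp
      then have "?U\<^sup>2 \<le> (2 * c * ?W)\<^sup>2" using nn by (intro power_mono) auto
      then have "?U\<^sup>2 / (4 * c\<^sup>2) \<le> ?W\<^sup>2" using \<open>0 < c\<close> by (simp add: field_simps power_mult_distrib)
      then have "\<kappa>\<^sup>2 * (?U\<^sup>2 / (4 * c\<^sup>2)) \<le> \<kappa>\<^sup>2 * ?W\<^sup>2" by (intro mult_left_mono) auto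
      with i2 have "(c\<^sup>2 + \<kappa>\<^sup>2 / (4 * c\<^sup>2)) * ?U\<^sup>2 \<le> ?N\<^sup>2" by (simp add: algebra_simps)
      then have "(sqrt (c\<^sup>2 + \<kappa>\<^sup>2 / (4 * c\<^sup>2)) * ?U)\<^sup>2 \<le> ?N\<^sup>2" by (simp add: power_mult_distrib)
      then have "sqrt (c\<^sup>2 + \<kappa>\<^sup>2 / (4 * c\<^sup>2)) * ?U \<le> ?N" using nn by (meson power2_le_imp_le)
      moreover have "c' * ?U \<le> sqrt (c\<^sup>2 + \<kappa>\<^sup>2 / (4 * c\<^sup>2)) * ?U"
        using nn by (intro mult_right_mono) (auto simp: c'_def)
      ultimately show ?thesis by linarith
    qed
  qed
  ultimately show ?thesis by (auto simp: lower_def)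
qed

text \<open>An optimal constant has to exist: the admissible constants are bounded above because
  some right-hand side has a solution of positive form norm, and their supremum is admissible
  because each defining inequality is closed.\<close>

lemma real_rho_spectrum:
  assumes a: "complex_of_real r \<in> rho"
  shows "\<exists>s::real. complex_of_real s \<notin> rho \<and> lower (of_real r) \<bar>s - r\<bar>"
proof -
  let ?S = "{c. lower (of_real r) c}"
  obtain c0 where c0: "c0 > 0" "lower (of_real r) c0" using rho_imp_lower[OF a] by blast
  have bdd: "bdd_above ?S"
  proof -
    obtain g where g: "g \<in> V" "0 < H.nrm g" using nontrivial by blast
    obtain u where u: "res (of_real r) g u" using a mem_H[OF g(1)] by (auto simp: rho_def)
    have uV: "u \<in> V" using res_mem[OF u] .
    \<comment> \<open>A solution of form norm 0 pairs to 0 with everything, so its right-hand side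
      would have seminorm 0.\<close>
    have "E.nrm u \<noteq> 0"
    proof
      assume 0: "E.nrm u = 0"
      then have hu0: "H.nrm u = 0" using h_le_e[OF uV] H.nrm_nonneg[OF mem_H[OF uV]] by simp
      have z: "e u v = 0" "h u v = 0" if "v \<in> V" for v
        using E.Cauchy_Schwarz[OF uV that] H.Cauchy_Schwarz[OF mem_H[OF uV] mem_H[OF that]] 0 hu0 by auto
      have "h g g = 0" using res_eq[OF u g(1)] z[OF g(1)] by simp
      then show False using g(2) by (simp add: H.nrm_def)
    qed
    then have "0 < E.nrm u" using E.nrm_nonneg[OF uV] by simp
    then have "c \<le> E.nrm g / E.nrm u" if "c \<in> ?S" for c
      using that g(1) u by (auto simp: lower_def field_simps)
    then show ?thesis by (meson bdd_aboveI)
  qed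
  define c where "c = Sup ?S"
  have "c0 \<le> c" unfolding c_def using bdd c0 by (intro cSup_upper) auto
  then have "0 < c" using c0 by simp
  have low: "lower (of_real r) c"
    unfolding lower_def
  proof (intro ballI allI impI)
    fix g u assume g: "g \<in> V" and u: "res (of_real r) g u"
    show "c * E.nrm u \<le> E.nrm g"
    proof (cases "E.nrm u = 0")
      case False
      then have "0 < E.nrm u" using E.nrm_nonneg[OF res_mem[OF u]] by simp
      moreover have "c \<le> E.nrm g / E.nrm u"
        unfolding c_def using c0 \<open>0 < E.nrm u\<close> g u
        by (intro cSup_least) (auto simp: lower_def field_simps)
      ultimately show ?thesis by (simp add: field_simps)
    qed (use E.nrm_nonneg[OF g] in simp)
  qed
  have "of_real (r + c) \<notin> rho \<or> of_real (r - c) \<notin> rho"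
  proof (rule ccontr)
    assume "\<not> ?thesis"
    then obtain c' where "c' > c" "lower (of_real r) c'"
      using lower_shift_pos[OF a low \<open>0 < c\<close>, of r] by auto
    then show False using bdd cSup_upper[of c' ?S] by (simp add: c_def)
  qed
  then show ?thesis
    using low \<open>0 < c\<close> by (elim disjE) (auto intro: exI[of _ "r + c"] exI[of _ "r - c"])
qed

text \<open>Pitfall: the distance to the empty set is 0, so \<open>- rho \<noteq> {}\<close> has to be part of the argument.\<close>

lemma infdist_rho:
  assumes z: "z \<in> rho"
  shows "0 < infdist z (- rho)" "lower z (infdist z (- rho))"
proof -
  let ?D = "infdist z (- rho)"
  obtain \<delta> where \<delta>: "\<delta> > 0" "\<And>s. cmod (s - z) < \<delta> \<Longrightarrow> s \<in> rho" using rho_open[OF z] by blast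
  \<comment> \<open>Either 0 is a spectral point itself, or \<open>real_rho_spectrum\<close> at 0
    produces one.\<close>
  have "\<exists>s. s \<notin> rho" using real_rho_spectrum[of 0] by (metis of_real_0)
  then have ne: "- rho \<noteq> {}" by blast
  have "\<delta> \<le> ?D"
    unfolding infdist_notempty[OF ne]
    by (rule cINF_greatest[OF ne]) (use \<delta>(2) in \<open>force simp: dist_norm norm_minus_commute\<close>)
  then show "0 < ?D" using \<delta>(1) by simp
  define r b where "r = Re z" and "b = Im z"
  have z_eq: "z = of_real r + \<i> * of_real b" by (simp add: r_def b_def complex_eq)
  show "lower z ?D"
    unfolding lower_def
  proof (intro ballI allI impI)
    fix g u assume g: "g \<in> V" and u: "res z g u"
    have uV: "u \<in> V" using res_mem[OF u] .
    have nn: "0 \<le> E.nrm g" "0 \<le> E.nrm u" using E.nrm_nonneg g uV by auto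
    \<comment> \<open>Shift to the real part of \<open>z\<close>: \<open>?g\<close> is
      \<open>(T - r) u\<close>, and \<open>g\<close> differs from it by
      \<open>- \<i> b u\<close>.\<close>
    let ?g = "g + sc (\<i> * of_real b) u"
    have gV: "?g \<in> V" using g uV by (simp add: E.add_mem E.sc_mem)
    have rr: "res (of_real r) ?g u" using res_shift[OF u mem_H[OF g], of "of_real r"] by (simp add: z_eq)
    \<comment> \<open>By symmetry of \<open>T\<close> the number \<open>e u ((T - r) u)\<close> is
      real, so the cross term with \<open>\<i> b u\<close> vanishes and Pythagoras applies.\<close>
    have "Im (e u ?g) = 0"
    proof -
      have 1: "e u ?g = (of_real r + 1) * h u ?g + h ?g ?g" using res_eq[OF rr gV] .
      have 2: "e u u = (of_real r + 1) * h u u + h ?g u" using res_eq[OF rr uV] .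
      have "Im (h ?g u) = 0"
        using 2 E.Im_ip_self[OF uV] H.Im_ip_self[OF mem_H[OF uV]] by (simp add: complex_eq_iff)
      then have "Im (h u ?g) = 0" using H.ip_cnj[OF mem_H[OF gV] mem_H[OF uV]] by simp
      then show ?thesis using 1 H.Im_ip_self[OF mem_H[OF gV]] by simp
    qed
    then have "Im (e ?g u) = 0" using E.ip_cnj[OF uV gV] by simp
    moreover have "g = ?g + - sc (\<i> * of_real b) u" by simp
    ultimately have sq: "(E.nrm g)\<^sup>2 = (E.nrm ?g)\<^sup>2 + b\<^sup>2 * (E.nrm u)\<^sup>2"
      using E.nrm_add_sq[OF gV E.uminus_mem[OF E.sc_mem[OF uV, of "\<i> * of_real b"]]] uV gV
      by (simp add: E.nrm_minus E.sc_mem E.nrm_sc norm_mult E.ip_minus_right E.ip_sc_right power_mult_distrib)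
    \<comment> \<open>If \<open>r\<close> is itself spectral, \<open>s = r\<close> makes the
      inequality trivial.\<close>
    obtain s :: real where s: "of_real s \<notin> rho" "(s - r)\<^sup>2 * (E.nrm u)\<^sup>2 \<le> (E.nrm ?g)\<^sup>2"
    proof (cases "complex_of_real r \<in> rho")
      case True
      then obtain s where "complex_of_real s \<notin> rho" "lower (of_real r) \<bar>s - r\<bar>"
        using real_rho_spectrum by blast
      then show ?thesis using that[of s] rr gV nn power_mono[of "\<bar>s - r\<bar> * E.nrm u" "E.nrm ?g" 2]
        by (auto simp: lower_def power_mult_distrib)
    next
      case False
      then show ?thesis using that[of r] by simp
    qed
    have "?D \<le> dist z (of_real s)" using s by (intro infdist_le) auto
    then have "?D\<^sup>2 \<le> (dist z (of_real s))\<^sup>2" using \<open>0 < ?D\<close> by (intro power_mono) auto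
    also have "\<dots> = (s - r)\<^sup>2 + b\<^sup>2"
      by (simp add: dist_norm z_eq cmod_power2 power2_commute)
    finally have "?D\<^sup>2 * (E.nrm u)\<^sup>2 \<le> ((s - r)\<^sup>2 + b\<^sup>2) * (E.nrm u)\<^sup>2" by (intro mult_right_mono) auto
    also have "\<dots> \<le> (E.nrm g)\<^sup>2" using sq s by (simp add: algebra_simps)
    finally have "(?D * E.nrm u)\<^sup>2 \<le> (E.nrm g)\<^sup>2" by (simp add: power_mult_distrib)
    then show "?D * E.nrm u \<le> E.nrm g" using nn by (meson power2_le_imp_le)
  qed
qed

text \<open>Splitting off the solution \<open>w\<^sub>1\<close> of \<open>(T + 1) w\<^sub>1 = F\<close> leaves a resolvent problem with
  right-hand side \<open>(z + 1) w\<^sub>1\<close> in the form domain.\<close>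

theorem dual_resolvent_bound:
  assumes z: "z \<in> rho" and w: "w \<in> V"
    and eq: "\<And>v. v \<in> V \<Longrightarrow> e w v - (z + 1) * h w v = F v"
    and bound: "\<And>v. v \<in> V \<Longrightarrow> cmod (F v) \<le> K * E.nrm v" and K: "0 \<le> K"
  shows "E.nrm w \<le> 2 * max 1 (cmod (z + 1) / infdist z (- rho)) * K"
proof -
  let ?D = "infdist z (- rho)"
  \<comment> \<open>\<open>F\<close> inherits additivity and antilinearity from the left-hand side
    of \<open>eq\<close>; the Riesz theorem asks for both.\<close>
  have add: "F (x + y) = F x + F y" if "x \<in> V" "y \<in> V" for x y
    using eq[OF that(1)] eq[OF that(2)] eq[OF E.add_mem[OF that]] that w mem_H
    by (simp add: E.ip_add_right H.ip_add_right algebra_simps)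
  have sc: "F (sc c x) = cnj c * F x" if "x \<in> V" for c x
    using eq[OF that] eq[OF E.sc_mem[OF that, of c]] that w mem_H
    by (simp add: E.ip_sc_right H.ip_sc_right algebra_simps)
  obtain w1 where w1: "w1 \<in> V" "\<And>v. v \<in> V \<Longrightarrow> e w1 v = F v" "E.nrm w1 \<le> K"
    using E.Riesz[OF complete add sc bound K] by blast
  have "res z (sc (z + 1) w1) (w - w1)"
  proof (rule resI)
    show "w - w1 \<in> V" using w w1 by (simp add: E.diff_mem)
    fix v assume v: "v \<in> V"
    show "e (w - w1) v = (z + 1) * h (w - w1) v + h (sc (z + 1) w1) v"
      using v w w1 mem_H eq[OF v] w1(2)[OF v]
      by (simp add: E.ip_diff H.ip_diff H.ip_sc algebra_simps)
  qed
  then have "?D * E.nrm (w - w1) \<le> E.nrm (sc (z + 1) w1)"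
    using infdist_rho(2)[OF z] w1 by (auto simp: lower_def E.sc_mem)
  also have "\<dots> \<le> cmod (z + 1) * K" using w1 by (simp add: E.nrm_sc mult_left_mono)
  finally have "E.nrm (w - w1) \<le> cmod (z + 1) / ?D * K"
    using infdist_rho(1)[OF z] by (simp add: field_simps)
  also have "\<dots> \<le> max 1 (cmod (z + 1) / ?D) * K" using K by (intro mult_right_mono) auto
  finally have "E.nrm (w - w1) \<le> max 1 (cmod (z + 1) / ?D) * K" .
  moreover have "E.nrm w \<le> E.nrm (w - w1) + E.nrm w1"
    using E.nrm_triangle[OF E.diff_mem[OF w w1(1)] w1(1)] by simp
  moreover have "1 * K \<le> max 1 (cmod (z + 1) / ?D) * K" using K by (intro mult_right_mono) auto
  \<comment> \<open>Both pieces of \<open>w\<close> are at most the maximum times \<open>K\<close>;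
    this is the origin of the factor 2.\<close>
  moreover have "c \<le> 2 * m * K" if "a \<le> m * K" "c \<le> a + b" "1 * K \<le> m * K" "b \<le> K" for a b c m :: real
    using that by simp
  ultimately show ?thesis using w1(3) by blast
qed

end

section \<open>Square-integrable functions on the cell\<close>

abbreviation MY :: "(real^3) measure" where "MY \<equiv> lebesgue_on Ycell"

lemma Ycell_borel: "Ycell \<in> sets borel"
  unfolding Ycell_def by measurable

lemma Ycell_lebesgue: "Ycell \<in> sets lebesgue"
  using Ycell_borel by simp

lemma box_subset_Ycell: "box 0 1 \<subseteq> Ycell"
  by (auto simp: Ycell_def mem_box_cart less_imp_le)

lemma Ycell_subset_cbox: "Ycell \<subseteq> cbox 0 1"
  by (auto simp: Ycell_def mem_box_cart less_imp_le)

text \<open>The half-open cell lies between the open and the closed unit box, which have equal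
  measure.\<close>

lemma emeasure_Ycell: "emeasure lebesgue Ycell = 1"
proof -
  have "emeasure lebesgue (box 0 (1::real^3)) \<le> emeasure lebesgue Ycell"
    by (rule emeasure_mono[OF box_subset_Ycell Ycell_lebesgue])
  moreover have "emeasure lebesgue Ycell \<le> emeasure lebesgue (cbox 0 (1::real^3))"
    by (rule emeasure_mono[OF Ycell_subset_cbox]) simp
  moreover have "(\<Prod>b\<in>Basis. (1::real^3) \<bullet> b) = 1"
    by (rule prod.neutral) (auto simp: Basis_vec_def inner_axis)
  moreover have "\<And>b. b \<in> Basis \<Longrightarrow> 0 \<le> (1::real^3) \<bullet> b"
    by (auto simp: Basis_vec_def inner_axis)
  ultimately show ?thesis by (auto simp: emeasure_lborel_box emeasure_lborel_cbox intro: antisym)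
qed

lemma emeasure_space_MY: "emeasure MY (space MY) = 1"
  using emeasure_Ycell Ycell_lebesgue by (simp add: emeasure_restrict_space space_restrict_space)

lemma finite_measure_MY: "finite_measure MY"
  by (rule finite_measureI, subst emeasure_space_MY, simp)

interpretation MY: finite_measure MY by (rule finite_measure_MY)

lemma space_MY: "space MY = Ycell" by (simp add: space_restrict_space)

lemma measure_space_MY: "measure MY Ycell = 1"
  using emeasure_space_MY by (simp add: measure_def space_MY)

lemma intY_const: "intY (\<lambda>y. c) = c"
  by (simp add: intY_def measure_space_MY space_MY)

lemma intY_cong_AE:
  "f \<in> borel_measurable MY \<Longrightarrow> g \<in> borel_measurable MY \<Longrightarrow> (AE y in MY. f y = g y) \<Longrightarrow> intY f = intY g"
  unfolding intY_def by (rule integral_cong_AE)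

lemma L2_measurable: "L2 u \<Longrightarrow> u \<in> borel_measurable MY"
  by (simp add: L2_def)

lemma L2_sq: "L2 u \<Longrightarrow> integrable MY (\<lambda>y. (norm (u y))\<^sup>2)"
  by (simp add: L2_def)

lemma L2_bound:
  assumes "g \<in> borel_measurable MY" "L2 f" "AE y in MY. norm (g y) \<le> C * norm (f y)"
  shows "L2 g"
proof -
  have "integrable MY (\<lambda>y. C\<^sup>2 * (norm (f y))\<^sup>2)" using L2_sq[OF assms(2)] by simp
  moreover have "AE y in MY. norm ((norm (g y))\<^sup>2) \<le> norm (C\<^sup>2 * (norm (f y))\<^sup>2)"
    using assms(3)
  proof eventually_elim
    case (elim y)
    then have "(norm (g y))\<^sup>2 \<le> (C * norm (f y))\<^sup>2" by (intro power_mono) auto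
    then show ?case by (simp add: power_mult_distrib)
  qed
  moreover have "(\<lambda>y. (norm (g y))\<^sup>2) \<in> borel_measurable MY" using assms(1) by measurable
  ultimately show ?thesis
    using assms(1) Bochner_Integration.integrable_bound unfolding L2_def by blast
qed

lemma L2_bounded_linear: "bounded_linear T \<Longrightarrow> L2 u \<Longrightarrow> L2 (\<lambda>y. T (u y))"
proof -
  assume T: "bounded_linear T" and u: "L2 u"
  obtain C where C: "\<And>x. norm (T x) \<le> norm x * C"
    using bounded_linear.bounded[OF T] by blast
  have "T \<in> borel_measurable borel"
    by (intro borel_measurable_continuous_onI linear_continuous_on T)
  then have "(\<lambda>y. T (u y)) \<in> borel_measurable MY"
    using L2_measurable[OF u] by (rule measurable_compose[rotated])
  then show ?thesis by (rule L2_bound[OF _ u, of _ C]) (simp add: C mult.commute[of C])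
qed

lemma L2_add: "L2 u \<Longrightarrow> L2 v \<Longrightarrow> L2 (\<lambda>y. u y + v y)"
proof -
  assume u: "L2 u" and v: "L2 v"
  have [measurable]: "u \<in> borel_measurable MY" "v \<in> borel_measurable MY"
    using u v by (auto simp: L2_measurable)
  have "integrable MY (\<lambda>y. 2 * (norm (u y))\<^sup>2 + 2 * (norm (v y))\<^sup>2)"
    using u v by (intro Bochner_Integration.integrable_add integrable_mult_right L2_sq)
  moreover have "norm ((norm (u y + v y))\<^sup>2) \<le> norm (2 * (norm (u y))\<^sup>2 + 2 * (norm (v y))\<^sup>2)" for y
  proof -
    have "(norm (u y + v y))\<^sup>2 \<le> (norm (u y) + norm (v y))\<^sup>2"
      by (intro power_mono norm_triangle_ineq) auto
    also have "\<dots> \<le> 2 * (norm (u y))\<^sup>2 + 2 * (norm (v y))\<^sup>2" using sum_squares_bound[of "norm (u y)" "norm (v y)"] by (simp add: power2_sum)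
    finally show ?thesis by simp
  qed
  ultimately have "integrable MY (\<lambda>y. (norm (u y + v y))\<^sup>2)"
    by - (rule Bochner_Integration.integrable_bound[OF _ _ AE_I2], auto)
  then show ?thesis unfolding L2_def by simp
qed

lemma L2_const: "L2 (\<lambda>y. c)"
  by (simp add: L2_def)

lemma L2_diff: "L2 u \<Longrightarrow> L2 v \<Longrightarrow> L2 (\<lambda>y. u y - v y)"
  using L2_add[of u "\<lambda>y. - v y"] L2_bounded_linear[OF bounded_linear_minus[OF bounded_linear_ident], of v] by simp

lemma L2_cong_AE: "L2 u \<Longrightarrow> v \<in> borel_measurable MY \<Longrightarrow> (AE y in MY. u y = v y) \<Longrightarrow> L2 v"
  by (rule L2_bound[of _ u 1]) auto

lemma L2_sum: "finite I \<Longrightarrow> (\<And>i. i \<in> I \<Longrightarrow> L2 (f i)) \<Longrightarrow> L2 (\<lambda>y. \<Sum>i\<in>I. f i y)"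
  by (induction rule: finite_induct) (auto simp: L2_add L2_const)

lemma L2_bounded_measurable:
  assumes "u \<in> borel_measurable MY" "AE y in MY. norm (u y) \<le> B"
  shows "L2 u"
  by (rule L2_bound[OF assms(1) L2_const[of "1::real"], of B]) (use assms(2) in simp)

lemma L2norm_nonneg [simp]: "0 \<le> L2norm u"
  by (simp add: L2norm_def intY_def integral_nonneg)

lemma L2norm_sq: "(L2norm u)\<^sup>2 = intY (\<lambda>y. (norm (u y))\<^sup>2)"
  by (simp add: L2norm_def intY_def integral_nonneg)

lemma L2norm_cong_AE:
  "u \<in> borel_measurable MY \<Longrightarrow> v \<in> borel_measurable MY \<Longrightarrow> (AE y in MY. u y = v y) \<Longrightarrow> L2norm u = L2norm v"
  unfolding L2norm_def by (auto intro!: arg_cong[where f=sqrt] intY_cong_AE)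

lemma L2norm_mono:
  assumes "L2 f" "g \<in> borel_measurable MY" "AE y in MY. norm (g y) \<le> C * norm (f y)" "0 \<le> C"
  shows "L2norm g \<le> C * L2norm f"
proof -
  have g: "L2 g" by (rule L2_bound) (use assms in auto)
  have "intY (\<lambda>y. (norm (g y))\<^sup>2) \<le> intY (\<lambda>y. C\<^sup>2 * (norm (f y))\<^sup>2)"
    unfolding intY_def
  proof (rule integral_mono_AE)
    show "AE y in MY. (norm (g y))\<^sup>2 \<le> C\<^sup>2 * (norm (f y))\<^sup>2"
      using assms(3) by eventually_elim (metis norm_ge_zero power_mono power_mult_distrib)
  qed (use L2_sq g assms in auto)
  then have "(L2norm g)\<^sup>2 \<le> (C * L2norm f)\<^sup>2"
    by (simp add: L2norm_sq power_mult_distrib intY_def)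
  then show ?thesis using L2norm_nonneg assms(4) by (meson mult_nonneg_nonneg power2_le_imp_le)
qed

lemma L2norm_const: "L2norm (\<lambda>y. c) = norm c"
  by (simp add: L2norm_def intY_const)

lemma L2norm_eq_0_iff: "L2 u \<Longrightarrow> L2norm u = 0 \<longleftrightarrow> (AE y in MY. u y = 0)"
  using integral_nonneg_eq_0_iff_AE[OF L2_sq, of u] by (simp add: L2norm_def intY_def)

lemma L2_integrable_norm_mult:
  assumes "L2 u" "L2 v"
  shows "integrable MY (\<lambda>y. norm (u y) * norm (v y))"
proof -
  have [measurable]: "u \<in> borel_measurable MY" "v \<in> borel_measurable MY"
    using assms by (auto simp: L2_measurable)
  have "integrable MY (\<lambda>y. (norm (u y))\<^sup>2 + (norm (v y))\<^sup>2)"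
    using assms by (intro Bochner_Integration.integrable_add L2_sq)
  moreover have "norm (norm (u y) * norm (v y)) \<le> norm ((norm (u y))\<^sup>2 + (norm (v y))\<^sup>2)" for y
  proof -
    have "2 * norm (u y) * norm (v y) \<le> (norm (u y))\<^sup>2 + (norm (v y))\<^sup>2" by (rule sum_squares_bound)
    moreover have "0 \<le> norm (u y) * norm (v y)" by simp
    ultimately have "norm (u y) * norm (v y) \<le> (norm (u y))\<^sup>2 + (norm (v y))\<^sup>2" by linarith
    then show ?thesis by (simp add: abs_mult)
  qed
  ultimately show ?thesis by - (rule Bochner_Integration.integrable_bound[OF _ _ AE_I2], auto)
qed

lemma L2_integrable_bilinear:
  fixes B :: "'b::euclidean_space \<Rightarrow> 'c::euclidean_space \<Rightarrow> 'd::{banach,second_countable_topology}"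
  assumes B: "bounded_bilinear B" and "L2 u" "L2 v"
  shows "integrable MY (\<lambda>y. B (u y) (v y))"
proof -
  obtain K where K: "\<And>a b. norm (B a b) \<le> norm a * norm b * K"
    using bounded_bilinear.bounded[OF B] by blast
  have i: "integrable MY (\<lambda>y. K * (norm (u y) * norm (v y)))" using assms by (intro integrable_mult_right L2_integrable_norm_mult)
  have m: "(\<lambda>y. B (u y) (v y)) \<in> borel_measurable MY"
  proof -
    have "continuous_on UNIV (\<lambda>x. B (fst x) (snd x))"
      by (intro bounded_bilinear.continuous_on[OF B] continuous_intros)
    then show ?thesis
      by (rule borel_measurable_continuous_Pair[OF L2_measurable[OF assms(2)] L2_measurable[OF assms(3)], of B, simplified])
  qed
  have n: "norm (B (u y) (v y)) \<le> norm (K * (norm (u y) * norm (v y)))" for y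
  proof -
    have "norm (B (u y) (v y)) \<le> K * (norm (u y) * norm (v y))" using K[of "u y" "v y"] by (simp add: mult_ac)
    then show ?thesis by (metis abs_ge_self order_trans real_norm_def)
  qed
  show ?thesis by (rule Bochner_Integration.integrable_bound[OF i m AE_I2[OF n]])
qed

lemma L2_integrable: "L2 u \<Longrightarrow> integrable MY u"
  using L2_integrable_bilinear[OF bounded_bilinear_scaleR L2_const[of "1::real"], of u] by simp

text \<open>Lifts a pointwise Hermitian product to \<open>L2\<close>. It is instantiated for
  scalars, vectors and matrices, so Cauchy-Schwarz and the triangle inequality are proved
  once.\<close>

locale pointwise_inner =
  fixes sc0 :: "complex \<Rightarrow> 'b::euclidean_space \<Rightarrow> 'b" and ip0 :: "'b \<Rightarrow> 'b \<Rightarrow> complex"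
  assumes bilin: "bounded_bilinear ip0"
    and lin_sc0: "bounded_linear (sc0 c)"
    and sc0_m1: "sc0 (-1) x = - x"
    and ip0_sc: "ip0 (sc0 c x) y = c * ip0 x y"
    and ip0_cnj: "ip0 y x = cnj (ip0 x y)"
    and ip0_self: "ip0 x x = complex_of_real ((norm x)\<^sup>2)"
begin

definition scf :: "complex \<Rightarrow> (real^3 \<Rightarrow> 'b) \<Rightarrow> real^3 \<Rightarrow> 'b" where "scf c u = (\<lambda>y. sc0 c (u y))"
definition ipf :: "(real^3 \<Rightarrow> 'b) \<Rightarrow> (real^3 \<Rightarrow> 'b) \<Rightarrow> complex" where "ipf u v = intY (\<lambda>y. ip0 (u y) (v y))"

lemma ip0_integrable: "L2 u \<Longrightarrow> L2 v \<Longrightarrow> integrable MY (\<lambda>y. ip0 (u y) (v y))"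
  by (rule L2_integrable_bilinear[OF bilin])

lemma semi_inner_L2: "semi_inner {u. L2 u} scf ipf"
proof
  show "0 \<in> {u::real^3 \<Rightarrow> 'b. L2 u}" by (simp add: zero_fun_def L2_const)
next
  fix x y :: "real^3 \<Rightarrow> 'b" assume "x \<in> {u. L2 u}" "y \<in> {u. L2 u}"
  then show "x + y \<in> {u. L2 u}" by (simp add: plus_fun_def L2_add)
next
  fix x :: "real^3 \<Rightarrow> 'b" and c assume "x \<in> {u. L2 u}"
  then show "scf c x \<in> {u. L2 u}" by (simp add: scf_def L2_bounded_linear lin_sc0)
next
  fix x show "scf (-1) x = - x" by (simp add: scf_def sc0_m1 fun_eq_iff)
next
  fix x y z :: "real^3 \<Rightarrow> 'b" assume "x \<in> {u. L2 u}" "y \<in> {u. L2 u}" "z \<in> {u. L2 u}"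
  then show "ipf (x + y) z = ipf x z + ipf y z"
    by (simp add: ipf_def intY_def bounded_bilinear.add_left[OF bilin] ip0_integrable)
next
  fix x z :: "real^3 \<Rightarrow> 'b" and c assume "x \<in> {u. L2 u}" "z \<in> {u. L2 u}"
  then show "ipf (scf c x) z = c * ipf x z"
    by (simp add: ipf_def scf_def intY_def ip0_sc)
next
  fix x y :: "real^3 \<Rightarrow> 'b" assume "x \<in> {u. L2 u}" "y \<in> {u. L2 u}"
  have eq: "(\<lambda>w. ip0 (y w) (x w)) = (\<lambda>w. cnj (ip0 (x w) (y w)))" by (rule ext) (rule ip0_cnj)
  show "ipf y x = cnj (ipf x y)"
    by (simp add: ipf_def intY_def eq)
next
  fix x :: "real^3 \<Rightarrow> 'b" assume "x \<in> {u. L2 u}"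
  then show "0 \<le> Re (ipf x x)"
    using integral_complex_of_real[of MY "\<lambda>w. (norm (x w))\<^sup>2"]
    by (simp add: ipf_def intY_def ip0_self integral_nonneg del: of_real_power)
qed

sublocale L2: semi_inner "{u. L2 u}" scf ipf
  by (rule semi_inner_L2)

lemma nrm_eq: "L2.nrm u = L2norm u"
  using integral_complex_of_real[of MY "\<lambda>w. (norm (u w))\<^sup>2"]
  by (simp add: L2.nrm_def L2norm_def ipf_def intY_def ip0_self del: of_real_power)

end

interpretation CX: pointwise_inner "(*)" "\<lambda>x y. x * cnj y"
proof (rule pointwise_inner.intro, goal_cases)
  case 1
  show ?case by (rule bounded_bilinear.comp[OF bounded_bilinear_mult bounded_linear_ident bounded_linear_cnj])
next
  case (2 c)
  show ?case by (rule bounded_linear_mult_right)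
qed (simp_all add: complex_norm_square del: of_real_power)

text \<open>Scalar Cauchy-Schwarz for the pointwise norms, regarded as complex functions. It thereby
  serves values in any Euclidean space, where no complex product is given.\<close>

lemma L2norm_Cauchy_Schwarz_norm:
  assumes "L2 u" "L2 v"
  shows "intY (\<lambda>y. norm (u y) * norm (v y)) \<le> L2norm u * L2norm v"
proof -
  let ?u = "\<lambda>y. complex_of_real (norm (u y))" and ?v = "\<lambda>y. complex_of_real (norm (v y))"
  have L: "L2 ?u" "L2 ?v"
    using assms by (auto simp: L2_def)
  have "CX.ipf ?u ?v = complex_of_real (intY (\<lambda>y. norm (u y) * norm (v y)))"
    by (simp add: CX.ipf_def intY_def flip: of_real_mult)
  moreover have "cmod (CX.ipf ?u ?v) \<le> L2norm ?u * L2norm ?v"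
    using CX.L2.Cauchy_Schwarz[of ?u ?v] L by (simp add: CX.nrm_eq)
  moreover have "L2norm ?u = L2norm u" "L2norm ?v = L2norm v" by (simp_all add: L2norm_def)
  ultimately show ?thesis by simp
qed

lemma L2_bilinear_bound:
  assumes "L2 u" "L2 v" "AE y in MY. norm (w y) \<le> K * (norm (u y) * norm (v y))" "0 \<le> K"
    "w \<in> borel_measurable MY"
  shows "norm (intY w) \<le> K * (L2norm u * L2norm v)"
proof -
  have i: "integrable MY (\<lambda>y. K * (norm (u y) * norm (v y)))" using assms by (intro integrable_mult_right L2_integrable_norm_mult)
  have "norm (intY w) \<le> intY (\<lambda>y. K * (norm (u y) * norm (v y)))"
    unfolding intY_def
  proof (rule order_trans[OF integral_norm_bound integral_mono_AE])
    have "AE y in MY. norm (w y) \<le> norm (K * (norm (u y) * norm (v y)))" using assms(3) by eventually_elim auto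
    then show "integrable MY (\<lambda>y. norm (w y))"
      using Bochner_Integration.integrable_bound[OF i assms(5)] by simp
  qed (use assms i in auto)
  also have "\<dots> = K * intY (\<lambda>y. norm (u y) * norm (v y))" by (simp add: intY_def)
  also have "\<dots> \<le> K * (L2norm u * L2norm v)"
    using L2norm_Cauchy_Schwarz_norm assms by (intro mult_left_mono) auto
  finally show ?thesis .
qed

text \<open>Riesz-Fischer: on a space of finite measure an \<open>L2\<close> Cauchy sequence is
  Cauchy in the mean, so a subsequence converges almost everywhere, and Fatou's lemma turns the
  pointwise limit into an \<open>L2\<close> limit.\<close>

lemma L2_complete:
  fixes x :: "nat \<Rightarrow> real^3 \<Rightarrow> 'b::euclidean_space"
  assumes L2x: "\<And>n. L2 (x n)"
    and cauchy: "\<And>\<epsilon>. \<epsilon> > 0 \<Longrightarrow> \<exists>N. \<forall>m\<ge>N. \<forall>n\<ge>N. L2norm (\<lambda>y. x m y - x n y) < \<epsilon>"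
  shows "\<exists>u. L2 u \<and> (\<lambda>n. L2norm (\<lambda>y. x n y - u y)) \<longlonglongrightarrow> 0"
proof -
  have [measurable]: "\<And>n. x n \<in> borel_measurable MY" using L2x L2_measurable by blast
  have L1: "(LINT y|MY. norm (f y)) \<le> L2norm f" if "L2 f" for f :: "real^3 \<Rightarrow> 'b"
    using L2norm_Cauchy_Schwarz_norm[OF that L2_const[of "1::real"]] by (simp add: intY_def L2norm_const)
  have "\<exists>N. \<forall>i\<ge>N. \<forall>j\<ge>N. (LINT y|MY. norm (x i y - x j y)) < e" if e: "e > 0" for e
  proof -
    obtain N where N: "\<forall>m\<ge>N. \<forall>n\<ge>N. L2norm (\<lambda>y. x m y - x n y) < e" using cauchy[OF e] by blast
    have "(LINT y|MY. norm (x i y - x j y)) < e" if "i \<ge> N" "j \<ge> N" for i j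
      using N that L1[OF L2_diff[OF L2x[of i] L2x[of j]]] le_less_trans by blast
    then show ?thesis by blast
  qed
  then obtain r where r: "strict_mono r" "AE y in MY. Cauchy (\<lambda>i. x (r i) y)"
    by (rule cauchy_L1_AE_cauchy_subseq[where M=MY and s=x, OF L2_integrable[OF L2x]]) blast+
  define u where "u y = lim (\<lambda>i. x (r i) y)" for y
  have [measurable]: "u \<in> borel_measurable MY" unfolding u_def by measurable
  have conv: "AE y in MY. (\<lambda>i. x (r i) y) \<longlonglongrightarrow> u y"
    using r(2) unfolding u_def by eventually_elim (simp add: Cauchy_convergent_iff convergent_LIMSEQ_iff)
  \<comment> \<open>Fatou for fixed \<open>n\<close>: the distance to the limit is at most the
    liminf of the distances to the subsequence.\<close>
  have key: "L2 (\<lambda>y. x n y - u y) \<and> L2norm (\<lambda>y. x n y - u y) \<le> \<epsilon>"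
    if N: "\<forall>m\<ge>N. \<forall>n\<ge>N. L2norm (\<lambda>y. x m y - x n y) < \<epsilon>" and n: "n \<ge> N" and e: "\<epsilon> > 0" for N n \<epsilon>
  proof -
    have "(\<integral>\<^sup>+ y. ennreal ((norm (x n y - u y))\<^sup>2) \<partial>MY)
        = (\<integral>\<^sup>+ y. liminf (\<lambda>i. ennreal ((norm (x n y - x (r i) y))\<^sup>2)) \<partial>MY)"
    proof (rule nn_integral_cong_AE)
      show "AE y in MY. ennreal ((norm (x n y - u y))\<^sup>2) = liminf (\<lambda>i. ennreal ((norm (x n y - x (r i) y))\<^sup>2))"
        using conv
      proof eventually_elim
        case (elim y)
        then have "(\<lambda>i. ennreal ((norm (x n y - x (r i) y))\<^sup>2)) \<longlonglongrightarrow> ennreal ((norm (x n y - u y))\<^sup>2)"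
          by (intro tendsto_ennrealI tendsto_intros)
        then show ?case using lim_imp_Liminf[of sequentially] by (metis trivial_limit_sequentially)
      qed
    qed
    also have "\<dots> \<le> liminf (\<lambda>i. \<integral>\<^sup>+ y. ennreal ((norm (x n y - x (r i) y))\<^sup>2) \<partial>MY)"
      by (rule nn_integral_liminf) simp
    also have "\<dots> \<le> ennreal (\<epsilon>\<^sup>2)"
    proof -
      have "(\<integral>\<^sup>+ y. ennreal ((norm (x n y - x (r i) y))\<^sup>2) \<partial>MY) \<le> ennreal (\<epsilon>\<^sup>2)" if "i \<ge> N" for i
      proof -
        have "r i \<ge> N" using that seq_suble[OF r(1), of i] by simp
        then have "L2norm (\<lambda>y. x n y - x (r i) y) \<le> \<epsilon>" using N n less_imp_le by blast
        then have "(L2norm (\<lambda>y. x n y - x (r i) y))\<^sup>2 \<le> \<epsilon>\<^sup>2" by (intro power_mono L2norm_nonneg)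
        then show ?thesis
          using nn_integral_eq_integral[OF L2_sq[OF L2_diff[OF L2x L2x, of n "r i"]]]
          by (simp add: L2norm_sq intY_def ennreal_leI)
      qed
      then show ?thesis
        by (intro Liminf_le) (auto simp: eventually_sequentially)
    qed
    finally have nn: "(\<integral>\<^sup>+ y. ennreal ((norm (x n y - u y))\<^sup>2) \<partial>MY) \<le> ennreal (\<epsilon>\<^sup>2)" .
    then have int: "integrable MY (\<lambda>y. (norm (x n y - u y))\<^sup>2)"
      by (intro integrableI_bounded) (auto intro: le_less_trans)
    then have L: "L2 (\<lambda>y. x n y - u y)" unfolding L2_def by simp
    have "(L2norm (\<lambda>y. x n y - u y))\<^sup>2 \<le> \<epsilon>\<^sup>2"
      using nn nn_integral_eq_integral[OF int] by (simp add: L2norm_sq intY_def)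
    then have "L2norm (\<lambda>y. x n y - u y) \<le> \<epsilon>" using e by (meson less_imp_le power2_le_imp_le)
    with L show ?thesis by blast
  qed
  obtain N1 where "\<forall>m\<ge>N1. \<forall>n\<ge>N1. L2norm (\<lambda>y. x m y - x n y) < 1" using cauchy[of 1] by auto
  then have L1u: "L2 (\<lambda>y. x N1 y - u y)" using key[of N1 1 N1] by auto
  have "L2 u" using L2_diff[OF L2x[of N1] L1u] by simp
  moreover have "(\<lambda>n. L2norm (\<lambda>y. x n y - u y)) \<longlonglongrightarrow> 0"
  proof (rule LIMSEQ_I)
    fix e :: real assume "e > 0"
    then obtain N where N: "\<forall>m\<ge>N. \<forall>n\<ge>N. L2norm (\<lambda>y. x m y - x n y) < e/2" using cauchy[of "e/2"] by auto
    have "norm (L2norm (\<lambda>y. x n y - u y) - 0) < e" if "n \<ge> N" for n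
      using key[OF N that] \<open>e > 0\<close> L2norm_nonneg[of "\<lambda>y. x n y - u y"] by simp
    then show "\<exists>N. \<forall>n\<ge>N. norm (L2norm (\<lambda>y. x n y - u y) - 0) < e" by blast
  qed
  ultimately show ?thesis by blast
qed

section \<open>Fourier series\<close>

lemma intY_eq_lborel:
  fixes f :: "real^3 \<Rightarrow> 'b::{banach,second_countable_topology}"
  assumes "f \<in> borel_measurable borel"
  shows "intY f = (\<integral>y. indicator Ycell y *\<^sub>R f y \<partial>lborel)"
proof -
  have "intY f = (\<integral>y. indicator Ycell y *\<^sub>R f y \<partial>lebesgue)"
    unfolding intY_def by (rule integral_restrict_space) (simp add: Ycell_lebesgue)
  also have "\<dots> = (\<integral>y. indicator Ycell y *\<^sub>R f y \<partial>lborel)"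
    by (rule integral_completion) (use assms Ycell_borel in measurable)
  finally show ?thesis .
qed

lemma lborel_integral_shift:
  fixes f :: "real^3 \<Rightarrow> 'b::{banach,second_countable_topology}"
  assumes [measurable]: "f \<in> borel_measurable borel"
  shows "(\<integral>y. f (y + h) \<partial>lborel) = (\<integral>y. f y \<partial>lborel)"
proof -
  have "(\<integral>y. f y \<partial>lborel) = (\<integral>y. f y \<partial>distr lborel borel ((+) h))"
    by (simp add: lborel_distr_plus)
  also have "\<dots> = (\<integral>y. f (h + y) \<partial>lborel)" by (rule integral_distr) auto
  finally show ?thesis by (simp add: add.commute)
qed

lemma indicator_Ycell_bounded_integrable:
  fixes f :: "real^3 \<Rightarrow> 'b::{banach,second_countable_topology}"
  assumes "A \<in> sets borel" "A \<subseteq> (\<lambda>y. y + a) ` Ycell" "f \<in> borel_measurable borel" "\<And>y. norm (f y) \<le> B"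
  shows "integrable lborel (\<lambda>y. indicator A y *\<^sub>R f y)"
proof (rule integrableI_bounded_set_indicator)
  have "A \<subseteq> cbox a (a + 1)"
    using assms(2) by (auto simp: Ycell_def mem_box_cart less_imp_le)
  then have "emeasure lborel A \<le> emeasure lborel (cbox a (a + 1))"
    by (intro emeasure_mono) auto
  then show "emeasure lborel A < \<infinity>" using emeasure_lborel_cbox_finite le_less_trans by blast
qed (use assms in auto)

lemma int_vec_axis: "int_vec (axis j 1)"
  by (simp add: int_vec_def axis_def)

text \<open>The translated cell is cut at the face \<open>x $ j = 1\<close>. Periodicity moves the
  overhang \<open>?Q\<close> back to the slab \<open>?Q'\<close> at the opposite face, and
  \<open>?P\<close> and \<open>?Q'\<close> partition the cell.\<close>

lemma intY_shift:
  fixes f :: "real^3 \<Rightarrow> 'b::{banach,second_countable_topology}"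
  assumes [measurable]: "f \<in> borel_measurable borel"
    and bd: "\<And>y. norm (f y) \<le> B" and per: "\<And>y k. int_vec k \<Longrightarrow> f (y + k) = f y"
    and t: "0 \<le> t" "t \<le> 1"
  shows "intY (\<lambda>y. f (y + t *\<^sub>R axis j 1)) = intY f"
proof -
  note Ycell_borel[measurable]
  define e :: "real^3" where "e = axis j 1"
  have e_nth: "e $ i = (if i = j then 1 else 0)" for i by (simp add: e_def axis_def)
  have [measurable]: "{x. x - t *\<^sub>R e \<in> Ycell \<and> x $ j < 1} \<in> sets borel"
    "{x. x - t *\<^sub>R e \<in> Ycell \<and> 1 \<le> x $ j} \<in> sets borel" "{x. x \<in> Ycell \<and> x $ j < t} \<in> sets borel"
    unfolding Ycell_def by measurable
  let ?P = "{x. x - t *\<^sub>R e \<in> Ycell \<and> x $ j < 1}" and ?Q = "{x. x - t *\<^sub>R e \<in> Ycell \<and> 1 \<le> x $ j}"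
  let ?Q' = "{x. x \<in> Ycell \<and> x $ j < t}"
  have sub: "?P \<subseteq> (\<lambda>y. y + t *\<^sub>R e) ` Ycell" "?Q \<subseteq> (\<lambda>y. y + t *\<^sub>R e) ` Ycell" "?Q' \<subseteq> (\<lambda>y. y + 0) ` Ycell"
    by (auto simp: image_iff intro!: bexI[of _ "_ - t *\<^sub>R e"])
  note int = indicator_Ycell_bounded_integrable[OF _ _ assms(1) bd]
  have iP: "integrable lborel (\<lambda>y. indicator ?P y *\<^sub>R f y)" by (rule int[OF _ sub(1)]) simp
  have iQ: "integrable lborel (\<lambda>y. indicator ?Q y *\<^sub>R f y)" by (rule int[OF _ sub(2)]) simp
  have iQ': "integrable lborel (\<lambda>y. indicator ?Q' y *\<^sub>R f y)" by (rule int[OF _ sub(3)]) simp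
  have "intY (\<lambda>y. f (y + t *\<^sub>R e)) = (\<integral>y. indicator Ycell y *\<^sub>R f (y + t *\<^sub>R e) \<partial>lborel)"
    by (rule intY_eq_lborel) measurable
  also have "\<dots> = (\<integral>y. indicator Ycell (y - t *\<^sub>R e) *\<^sub>R f y \<partial>lborel)"
    using lborel_integral_shift[of "\<lambda>y. indicator Ycell (y - t *\<^sub>R e) *\<^sub>R f y" "t *\<^sub>R e"] by simp
  also have "\<dots> = (\<integral>y. indicator ?P y *\<^sub>R f y + indicator ?Q y *\<^sub>R f y \<partial>lborel)"
    by (intro Bochner_Integration.integral_cong) (auto simp: indicator_def)
  also have "\<dots> = (\<integral>y. indicator ?P y *\<^sub>R f y \<partial>lborel) + (\<integral>y. indicator ?Q y *\<^sub>R f y \<partial>lborel)"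
    by (rule Bochner_Integration.integral_add[OF iP iQ])
  also have "(\<integral>y. indicator ?Q y *\<^sub>R f y \<partial>lborel) = (\<integral>y. indicator ?Q (y + e) *\<^sub>R f (y + e) \<partial>lborel)"
    using lborel_integral_shift[of "\<lambda>y. indicator ?Q y *\<^sub>R f y" e] by simp
  also have "\<dots> = (\<integral>y. indicator ?Q' y *\<^sub>R f y \<partial>lborel)"
  proof (rule Bochner_Integration.integral_cong[OF refl])
    fix y
    have "y + e \<in> ?Q \<longleftrightarrow> y \<in> ?Q'"
    proof -
      have "y + e \<in> ?Q \<longleftrightarrow> (\<forall>i. 0 \<le> y$i + (1 - t) * e$i \<and> y$i + (1 - t) * e$i < 1) \<and> 0 \<le> y$j"
        by (auto simp: Ycell_def e_nth algebra_simps)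
      also have "\<dots> \<longleftrightarrow> (\<forall>i. 0 \<le> y$i \<and> y$i < 1) \<and> y$j < t"
      proof safe
        fix i assume a: "\<forall>i. 0 \<le> y$i + (1 - t) * e$i \<and> y$i + (1 - t) * e$i < 1" "0 \<le> y$j"
        show "0 \<le> y$i" "y$i < 1" using a(1)[rule_format, of i] a(2) t by (auto simp: e_nth split: if_splits)
        show "y$j < t" using a(1)[rule_format, of j] by (auto simp: e_nth)
      next
        fix i assume a: "\<forall>i. 0 \<le> y$i \<and> y$i < 1" "y$j < t"
        show "0 \<le> y$i + (1 - t) * e$i" "y$i + (1 - t) * e$i < 1" using a(1)[rule_format, of i] a(2) t by (auto simp: e_nth)
        show "0 \<le> y$j" using a by auto
      qed
      also have "\<dots> \<longleftrightarrow> y \<in> ?Q'" by (auto simp: Ycell_def)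
      finally show ?thesis .
    qed
    moreover have "f (y + e) = f y" using per[OF int_vec_axis] by (simp add: e_def)
    ultimately show "indicator ?Q (y + e) *\<^sub>R f (y + e) = indicator ?Q' y *\<^sub>R f y"
      by (auto simp: indicator_def)
  qed
  also have "(\<integral>y. indicator ?P y *\<^sub>R f y \<partial>lborel) + (\<integral>y. indicator ?Q' y *\<^sub>R f y \<partial>lborel)
     = (\<integral>y. indicator ?P y *\<^sub>R f y + indicator ?Q' y *\<^sub>R f y \<partial>lborel)"
    by (rule Bochner_Integration.integral_add[OF iP iQ', symmetric])
  also have "\<dots> = (\<integral>y. indicator Ycell y *\<^sub>R f y \<partial>lborel)"
  proof (rule Bochner_Integration.integral_cong[OF refl])
    fix y
    have P: "y \<in> ?P \<longleftrightarrow> y \<in> Ycell \<and> t \<le> y$j"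
    proof -
      have "y \<in> ?P \<longleftrightarrow> (\<forall>i. 0 \<le> y$i - t * e$i \<and> y$i - t * e$i < 1) \<and> y$j < 1"
        by (auto simp: Ycell_def)
      also have "\<dots> \<longleftrightarrow> (\<forall>i. 0 \<le> y$i \<and> y$i < 1) \<and> t \<le> y$j"
      proof safe
        fix i assume a: "\<forall>i. 0 \<le> y$i - t * e$i \<and> y$i - t * e$i < 1" "y$j < 1"
        show "0 \<le> y$i" "y$i < 1" using a(1)[rule_format, of i] a(2) t by (auto simp: e_nth split: if_splits)
        show "t \<le> y$j" using a(1)[rule_format, of j] by (auto simp: e_nth)
      next
        fix i assume a: "\<forall>i. 0 \<le> y$i \<and> y$i < 1" "t \<le> y$j"
        show "0 \<le> y$i - t * e$i" "y$i - t * e$i < 1" using a(1)[rule_format, of i] a(2) t by (auto simp: e_nth)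
        show "y$j < 1" using a by auto
      qed
      finally show ?thesis by (auto simp: Ycell_def)
    qed
    show "indicator ?P y *\<^sub>R f y + indicator ?Q' y *\<^sub>R f y = indicator Ycell y *\<^sub>R f y"
      using P by (auto simp: indicator_def)
  qed
  also have "\<dots> = intY f" by (rule intY_eq_lborel[symmetric]) simp
  finally show ?thesis by (simp add: e_def)
qed

lemma int_vec_translate: obtains k where "int_vec k" "y + k \<in> cbox 0 (1::real^3)"
proof
  let ?k = "\<chi> i. - of_int \<lfloor>y $ i\<rfloor>"
  show "int_vec ?k" by (simp add: int_vec_def)
  show "y + ?k \<in> cbox 0 (1::real^3)" by (auto simp: mem_box_cart) linarith+
qed

lemma periodic_bounded:
  fixes f :: "real^3 \<Rightarrow> 'b::real_normed_vector"
  assumes "continuous_on UNIV f" "\<And>y k. int_vec k \<Longrightarrow> f (y + k) = f y"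
  obtains B where "\<And>y. norm (f y) \<le> B" "0 \<le> B"
proof -
  have "compact (f ` cbox 0 1)"
    by (intro compact_continuous_image continuous_on_subset[OF assms(1)]) auto
  then obtain B where B: "\<And>y. y \<in> cbox 0 1 \<Longrightarrow> norm (f y) \<le> B"
    by (meson compact_imp_bounded bounded_iff imageI)
  have "norm (f y) \<le> B" for y
    using int_vec_translate[of y] assms(2) B by metis
  moreover from this[of 0] have "0 \<le> B" by (meson norm_ge_zero order_trans)
  ultimately show ?thesis using that by blast
qed

lemma testfn_continuous: "testfn \<phi> \<Longrightarrow> continuous_on UNIV \<phi>"
  by (auto simp: testfn_def intro!: continuous_at_imp_continuous_on differentiable_imp_continuous_within)

lemma testfn_deriv:
  assumes "testfn \<phi>"
  shows "((\<lambda>s. \<phi> (y + s *\<^sub>R axis j 1)) has_vector_derivative pderiv \<phi> j (y + s *\<^sub>R axis j 1)) (at s within S)"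
proof -
  let ?e = "axis j 1 :: real^3"
  have "(\<phi> has_derivative frechet_derivative \<phi> (at (y + s *\<^sub>R ?e))) (at (y + s *\<^sub>R ?e))"
    using assms by (simp add: testfn_def flip: frechet_derivative_works)
  then have d: "(\<phi> has_derivative frechet_derivative \<phi> (at (y + s *\<^sub>R ?e))) (at (y + s *\<^sub>R ?e) within (\<lambda>s. y + s *\<^sub>R ?e) ` S)"
    by (rule has_derivative_at_withinI)
  have "((\<lambda>s. y + s *\<^sub>R ?e) has_derivative (\<lambda>h. h *\<^sub>R ?e)) (at s within S)"
    by (auto intro!: derivative_eq_intros)
  from diff_chain_within[OF this d]
  have "((\<lambda>s. \<phi> (y + s *\<^sub>R ?e)) has_derivative (\<lambda>h. frechet_derivative \<phi> (at (y + s *\<^sub>R ?e)) (h *\<^sub>R ?e))) (at s within S)"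
    by (simp add: o_def)
  moreover have "frechet_derivative \<phi> (at (y + s *\<^sub>R ?e)) (h *\<^sub>R ?e) = h *\<^sub>R pderiv \<phi> j (y + s *\<^sub>R ?e)" for h
    using linear_frechet_derivative[of \<phi> "at (y + s *\<^sub>R ?e)"] assms
    by (simp add: testfn_def linear_scale pderiv_def)
  ultimately show ?thesis by (simp add: has_vector_derivative_def)
qed

lemma testfn_pderiv_periodic:
  assumes "testfn \<phi>" "int_vec k"
  shows "pderiv \<phi> j (y + k) = pderiv \<phi> j y"
proof -
  let ?e = "axis j 1 :: real^3"
  have "((\<lambda>s. \<phi> (y + k + s *\<^sub>R ?e)) has_vector_derivative pderiv \<phi> j (y + k)) (at 0)"
    using testfn_deriv[OF assms(1), of "y + k" j 0 UNIV] by simp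
  moreover have "\<phi> (y + k + s *\<^sub>R ?e) = \<phi> (y + s *\<^sub>R ?e)" for s
    using assms by (metis (no_types) testfn_def add.assoc add.commute)
  ultimately have "((\<lambda>s. \<phi> (y + s *\<^sub>R ?e)) has_vector_derivative pderiv \<phi> j (y + k)) (at 0)" by simp
  moreover have "((\<lambda>s. \<phi> (y + s *\<^sub>R ?e)) has_vector_derivative pderiv \<phi> j y) (at 0)"
    using testfn_deriv[OF assms(1), of y j 0 UNIV] by simp
  ultimately show ?thesis by (rule vector_derivative_unique_at)
qed

text \<open>The difference quotients of \<open>\<phi>\<close> have integral 0 by translation invariance.\<close>

lemma intY_pderiv:
  assumes \<phi>: "testfn \<phi>"
  shows "intY (pderiv \<phi> j) = 0"
proof -
  let ?e = "axis j 1 :: real^3"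
  have cont: "continuous_on UNIV (pderiv \<phi> j)" using \<phi> by (simp add: testfn_def)
  obtain B where B: "\<And>y. norm (pderiv \<phi> j y) \<le> B" "0 \<le> B"
    using periodic_bounded[OF cont] testfn_pderiv_periodic[OF \<phi>] by metis
  have per: "\<And>y k. int_vec k \<Longrightarrow> \<phi> (y + k) = \<phi> y" using \<phi> by (simp add: testfn_def)
  obtain B0 where B0: "\<And>y. norm (\<phi> y) \<le> B0" "0 \<le> B0"
    using periodic_bounded[OF testfn_continuous[OF \<phi>] per] by metis
  have [measurable]: "\<phi> \<in> borel_measurable borel" "pderiv \<phi> j \<in> borel_measurable borel"
    using cont testfn_continuous[OF \<phi>] by (auto intro: borel_measurable_continuous_onI)
  define t where "t n = 1 / real (Suc n)" for n
  have t: "0 < t n" "t n \<le> 1" for n by (auto simp: t_def)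
  define s where "s n y = (\<phi> (y + t n *\<^sub>R ?e) - \<phi> y) /\<^sub>R t n" for n y
  have MYm: "f \<in> borel_measurable MY" if "f \<in> borel_measurable borel" for f :: "real^3 \<Rightarrow> complex"
    using that by (intro measurable_restrict_space1 measurable_completion) simp
  have "(\<lambda>n. intY (s n)) \<longlonglongrightarrow> intY (pderiv \<phi> j)"
    unfolding intY_def
  proof (rule integral_dominated_convergence[where w="\<lambda>_. B"])
    show "pderiv \<phi> j \<in> borel_measurable MY" by (rule MYm) simp
    show "s n \<in> borel_measurable MY" for n unfolding s_def by (rule MYm) measurable
    show "integrable MY (\<lambda>_. B)" by simp
    show "AE y in MY. (\<lambda>n. s n y) \<longlonglongrightarrow> pderiv \<phi> j y"
    proof (rule AE_I2)
      fix y
      have "((\<lambda>s. \<phi> (y + s *\<^sub>R ?e)) has_vector_derivative pderiv \<phi> j y) (at 0)"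
        using testfn_deriv[OF \<phi>, of y j 0 UNIV] by simp
      then have "((\<lambda>h. (\<phi> (y + h *\<^sub>R ?e) - \<phi> y) /\<^sub>R h) \<longlongrightarrow> pderiv \<phi> j y) (at 0)"
      proof -
        assume "((\<lambda>s. \<phi> (y + s *\<^sub>R ?e)) has_vector_derivative pderiv \<phi> j y) (at 0)"
        then have *: "(\<lambda>h. norm (\<phi> (y + h *\<^sub>R ?e) - \<phi> y - h *\<^sub>R pderiv \<phi> j y) / norm h) \<midarrow>0\<rightarrow> 0"
          by (simp add: has_vector_derivative_def has_derivative_at)
        have "\<forall>\<^sub>F h in at 0. norm (\<phi> (y + h *\<^sub>R ?e) - \<phi> y - h *\<^sub>R pderiv \<phi> j y) / norm h
            = norm ((\<phi> (y + h *\<^sub>R ?e) - \<phi> y) /\<^sub>R h - pderiv \<phi> j y)"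
        proof (rule eventually_at_filter[THEN iffD2, OF always_eventually], intro allI impI)
          fix h :: real assume "h \<noteq> 0"
          then have "(\<phi> (y + h *\<^sub>R ?e) - \<phi> y) /\<^sub>R h - pderiv \<phi> j y
              = (\<phi> (y + h *\<^sub>R ?e) - \<phi> y - h *\<^sub>R pderiv \<phi> j y) /\<^sub>R h"
            by (simp add: scaleR_right_diff_distrib)
          then show "norm (\<phi> (y + h *\<^sub>R ?e) - \<phi> y - h *\<^sub>R pderiv \<phi> j y) / norm h
            = norm ((\<phi> (y + h *\<^sub>R ?e) - \<phi> y) /\<^sub>R h - pderiv \<phi> j y)"
            by (simp add: divide_inverse_commute)
        qed
        with * have "((\<lambda>h. norm ((\<phi> (y + h *\<^sub>R ?e) - \<phi> y) /\<^sub>R h - pderiv \<phi> j y)) \<longlongrightarrow> 0) (at 0)"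
          by (rule Lim_transform_eventually)
        then have "((\<lambda>h. (\<phi> (y + h *\<^sub>R ?e) - \<phi> y) /\<^sub>R h - pderiv \<phi> j y) \<longlongrightarrow> 0) (at 0)"
          by (rule tendsto_norm_zero_cancel)
        then show ?thesis by (rule LIM_zero_cancel)
      qed
      moreover have "filterlim t (at 0) sequentially"
      proof -
        have "t \<longlonglongrightarrow> 0" unfolding t_def by (rule LIMSEQ_Suc[OF lim_1_over_n])
        then show ?thesis using t(1) by (auto simp: filterlim_at intro!: always_eventually less_imp_neq[symmetric])
      qed
      ultimately show "(\<lambda>n. s n y) \<longlonglongrightarrow> pderiv \<phi> j y"
        unfolding s_def by (rule filterlim_compose)
    qed
    \<comment> \<open>The mean value inequality dominates all difference quotients by the supremum
      of the derivative, which is finite by periodicity.\<close>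
    show "AE y in MY. norm (s n y) \<le> B" for n
    proof (rule AE_I2)
      fix y
      have "norm (\<phi> (y + t n *\<^sub>R ?e) - \<phi> (y + 0 *\<^sub>R ?e)) \<le> B * norm (t n - 0)"
      proof (rule differentiable_bound[of "{0..t n}" _ "\<lambda>s h. h *\<^sub>R pderiv \<phi> j (y + s *\<^sub>R ?e)"])
        show "((\<lambda>s. \<phi> (y + s *\<^sub>R ?e)) has_derivative (\<lambda>h. h *\<^sub>R pderiv \<phi> j (y + s *\<^sub>R ?e))) (at s within {0..t n})" for s
          using testfn_deriv[OF \<phi>] by (simp add: has_vector_derivative_def)
        show "onorm (\<lambda>h. h *\<^sub>R pderiv \<phi> j (y + s *\<^sub>R ?e)) \<le> B" for s
          by (rule onorm_bound) (use B in \<open>auto simp: mult.commute[of B] mult_left_mono\<close>)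
      qed (use t[of n] in auto)
      moreover have "norm (s n y) = norm (\<phi> (y + t n *\<^sub>R ?e) - \<phi> (y + 0 *\<^sub>R ?e)) / t n"
        using t[of n] by (simp add: s_def divide_inverse_commute del: scaleR_right_diff_distrib)
      ultimately show "norm (s n y) \<le> B" using t[of n] by (simp add: pos_divide_le_eq)
    qed
  qed
  moreover have "intY (s n) = 0" for n
  proof -
    have L: "integrable MY (\<lambda>y. \<phi> (y + h))" for h
      by (rule L2_integrable[OF L2_bounded_measurable[where B=B0]]) (auto intro!: MYm simp: B0)
    have "intY (s n) = (intY (\<lambda>y. \<phi> (y + t n *\<^sub>R ?e)) - intY \<phi>) /\<^sub>R t n"
      unfolding s_def intY_def using L[of "t n *\<^sub>R ?e"] L[of 0] by simp
    also have "\<dots> = 0" using intY_shift[of \<phi> B0 "t n" j] B0 per t[of n] by simp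
    finally show ?thesis .
  qed
  ultimately show ?thesis by (simp add: LIMSEQ_const_iff)
qed

section \<open>Characters and trigonometric polynomials\<close>

definition ek :: "real^3 \<Rightarrow> real^3 \<Rightarrow> complex" where
  "ek k y = cis (2 * pi * (k \<bullet> y))"

lemma norm_ek [simp]: "norm (ek k y) = 1" by (simp add: ek_def)

lemma ek_add: "ek (k + l) y = ek k y * ek l y"
  by (simp add: ek_def cis_mult inner_add_left distrib_left)

lemma cnj_ek: "cnj (ek k y) = ek (- k) y"
  by (simp add: ek_def cis_cnj)

lemma ek_0: "ek 0 y = 1" by (simp add: ek_def)

lemma int_vec_uminus: "int_vec k \<Longrightarrow> int_vec (- k)" by (simp add: int_vec_def)
lemma int_vec_add: "int_vec k \<Longrightarrow> int_vec l \<Longrightarrow> int_vec (k + l)" by (simp add: int_vec_def)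
lemma int_vec_diff: "int_vec k \<Longrightarrow> int_vec l \<Longrightarrow> int_vec (k - l)" by (simp add: int_vec_def)
lemma int_vec_0: "int_vec 0" by (simp add: int_vec_def)

lemma ek_has_derivative:
  "(ek k has_derivative (\<lambda>h. complex_of_real (2 * pi * (k \<bullet> h)) * \<i> * ek k y)) (at y)"
proof -
  have "((\<lambda>y. exp (\<i> * complex_of_real (2 * pi * (k \<bullet> y)))) has_derivative
      (\<lambda>h. exp (\<i> * complex_of_real (2 * pi * (k \<bullet> y))) * (\<i> * complex_of_real (2 * pi * (k \<bullet> h))))) (at y)"
  proof -
    have "bounded_linear (\<lambda>y. \<i> * complex_of_real (2 * pi * (k \<bullet> y)))"
      by (intro bounded_linear_compose[OF bounded_linear_mult_right] bounded_linear_compose[OF bounded_linear_of_real]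
          bounded_linear_inner_right)
    from has_derivative_compose[OF bounded_linear_imp_has_derivative[OF this]
        has_field_derivative_imp_has_derivative[OF DERIV_exp]]
    show ?thesis .
  qed
  then show ?thesis by (simp add: ek_def[abs_def] cis_conv_exp mult_ac)
qed

lemma pderiv_ek: "pderiv (ek k) j y = 2 * pi * \<i> * complex_of_real (k $ j) * ek k y"
  using frechet_derivative_at[OF ek_has_derivative, symmetric] by (simp add: pderiv_def inner_axis mult_ac)

lemma ek_continuous: "continuous_on S (ek k)"
  unfolding ek_def[abs_def] by (intro continuous_intros)

lemma ek_measurable: "ek k \<in> borel_measurable borel" "ek k \<in> borel_measurable MY"
  using borel_measurable_continuous_onI[OF ek_continuous]
  by (auto intro!: measurable_restrict_space1 measurable_completion)

lemma testfn_ek: "int_vec k \<Longrightarrow> testfn (ek k)"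
proof -
  assume k: "int_vec k"
  have "ek k (y + l) = ek k y" if l: "int_vec l" for y l
  proof -
    have "k \<bullet> l \<in> \<int>" unfolding inner_vec_def using k l by (auto simp: int_vec_def intro!: Ints_sum Ints_mult)
    then obtain n where "k \<bullet> l = of_int n" by (auto elim: Ints_cases)
    then have "cis (2 * pi * (k \<bullet> l)) = 1" by (metis cis_multiple_2pi mult.commute Ints_of_int)
    then show ?thesis by (simp add: ek_def inner_add_right distrib_left flip: cis_mult)
  qed
  moreover have "ek k differentiable (at y)" for y
    using ek_has_derivative differentiable_def by blast
  moreover have "continuous_on UNIV (pderiv (ek k) j)" for j
    unfolding pderiv_ek[abs_def] by (intro continuous_intros ek_continuous)
  ultimately show ?thesis by (auto simp: testfn_def)
qed

text \<open>Some \<open>k $ j\<close> is nonzero, so the character is a multiple of its own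
  \<open>j\<close>-th derivative, whose integral vanishes.\<close>

lemma intY_ek:
  assumes "int_vec k" "k \<noteq> 0"
  shows "intY (ek k) = 0"
proof -
  obtain j where j: "k $ j \<noteq> 0" using assms(2) by (metis vec_eq_iff zero_index)
  have "intY (pderiv (ek k) j) = 2 * pi * \<i> * complex_of_real (k $ j) * intY (ek k)"
    unfolding pderiv_ek[abs_def] intY_def by simp
  then show ?thesis using intY_pderiv[OF testfn_ek[OF assms(1)], of j] j by simp
qed

lemma L2_ek: "L2 (ek k)"
  by (rule L2_bounded_measurable[where B=1]) (auto simp: ek_measurable)

definition fc :: "(real^3 \<Rightarrow> complex) \<Rightarrow> real^3 \<Rightarrow> complex" where
  "fc f k = intY (\<lambda>y. f y * cnj (ek k y))"

lemma fc_ipf: "fc f k = CX.ipf f (ek k)"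
  by (simp add: fc_def CX.ipf_def)

lemma ipf_ek: "int_vec k \<Longrightarrow> int_vec l \<Longrightarrow> CX.ipf (ek k) (ek l) = (if k = l then 1 else 0)"
  using intY_ek[of "k - l"] int_vec_diff[of k l]
  by (auto simp: CX.ipf_def cnj_ek ek_0 intY_const simp flip: ek_add)

text \<open>Frequencies may repeat, which makes closure under products an easy induction;
  \<open>trigpoly_expand\<close> restores distinct frequencies.\<close>

inductive trigpoly :: "(real^3 \<Rightarrow> complex) \<Rightarrow> bool" where
  trigpoly_monom: "int_vec k \<Longrightarrow> trigpoly (\<lambda>y. c * ek k y)"
| trigpoly_add: "trigpoly p \<Longrightarrow> trigpoly q \<Longrightarrow> trigpoly (\<lambda>y. p y + q y)"

lemma trigpoly_const: "trigpoly (\<lambda>y. c)"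
  using trigpoly_monom[OF int_vec_0, of c] by (simp add: ek_0)

lemma trigpoly_mult_monom: "trigpoly p \<Longrightarrow> int_vec k \<Longrightarrow> trigpoly (\<lambda>y. p y * (c * ek k y))"
proof (induction rule: trigpoly.induct)
  case (trigpoly_monom l d)
  then have "trigpoly (\<lambda>y. (d * c) * ek (l + k) y)"
    by (intro trigpoly.trigpoly_monom int_vec_add)
  then show ?case by (simp add: ek_add mult_ac)
next
  case (trigpoly_add p q)
  then show ?case by (simp add: distrib_right trigpoly.trigpoly_add)
qed

lemma trigpoly_mult: "trigpoly q \<Longrightarrow> trigpoly p \<Longrightarrow> trigpoly (\<lambda>y. p y * q y)"
  by (induction rule: trigpoly.induct) (auto simp: trigpoly_mult_monom distrib_left intro: trigpoly_add)

lemma trigpoly_sum: "finite I \<Longrightarrow> (\<And>i. i \<in> I \<Longrightarrow> trigpoly (f i)) \<Longrightarrow> trigpoly (\<lambda>y. \<Sum>i\<in>I. f i y)"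
  by (induction rule: finite_induct) (auto simp: trigpoly_const intro: trigpoly_add)

lemma trigpoly_L2: "trigpoly p \<Longrightarrow> L2 p"
proof (induction rule: trigpoly.induct)
  case (trigpoly_monom k c)
  show ?case by (rule L2_bounded_linear[OF bounded_linear_mult_right L2_ek])
qed (rule L2_add)

lemma trigpoly_expand:
  "trigpoly p \<Longrightarrow> \<exists>F c. finite F \<and> F \<subseteq> {k. int_vec k} \<and> p = (\<lambda>y. \<Sum>k\<in>F. c k * ek k y)"
proof (induction rule: trigpoly.induct)
  case (trigpoly_monom k c)
  then show ?case by (intro exI[of _ "{k}"] exI[of _ "\<lambda>_. c"]) auto
next
  case (trigpoly_add p q)
  then obtain F c G d where F: "finite F" "F \<subseteq> {k. int_vec k}" "p = (\<lambda>y. \<Sum>k\<in>F. c k * ek k y)"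
    and G: "finite G" "G \<subseteq> {k. int_vec k}" "q = (\<lambda>y. \<Sum>k\<in>G. d k * ek k y)" by blast
  \<comment> \<open>Coefficients of a common frequency are added, since Bessel's identity runs over
    a set of frequencies.\<close>
  let ?c = "\<lambda>k. (if k \<in> F then c k else 0) + (if k \<in> G then d k else 0)"
  have "p y + q y = (\<Sum>k\<in>F \<union> G. ?c k * ek k y)" for y
  proof -
    have "(\<Sum>k\<in>F \<union> G. ?c k * ek k y)
        = (\<Sum>k\<in>F \<union> G. if k \<in> F then c k * ek k y else 0) + (\<Sum>k\<in>F \<union> G. if k \<in> G then d k * ek k y else 0)"
      by (auto simp: distrib_right simp flip: sum.distrib intro!: sum.cong)
    also have "(\<Sum>k\<in>F \<union> G. if k \<in> F then c k * ek k y else 0) = (\<Sum>k\<in>F. c k * ek k y)"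
      using F(1) G(1) by (simp add: sum.If_cases Int_absorb1)
    also have "(\<Sum>k\<in>F \<union> G. if k \<in> G then d k * ek k y else 0) = (\<Sum>k\<in>G. d k * ek k y)"
      using F(1) G(1) by (simp add: sum.If_cases Int_absorb1)
    finally show ?thesis by (simp add: F(3) G(3))
  qed
  then show ?case using F G by (intro exI[of _ "F \<union> G"] exI[of _ ?c]) auto
qed

section \<open>Density of trigonometric polynomials in L2\<close>

text \<open>The cell is identified with the torus \<open>|w\<^sub>j| = 1\<close> in \<open>\<complex>\<^sup>3\<close>; there polynomials
  become trigonometric polynomials.\<close>

definition torus :: "real^3 \<Rightarrow> complex^3" where
  "torus y = (\<chi> j. cis (2 * pi * y $ j))"

lemma torus_eq_ek: "torus y $ j = ek (axis j 1) y"
  by (simp add: torus_def ek_def inner_axis')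

lemma torus_measurable: "torus \<in> borel_measurable MY"
proof -
  have "continuous_on UNIV torus"
    unfolding torus_def[abs_def] by (intro continuous_intros)
  then show ?thesis
    by (intro measurable_restrict_space1 measurable_completion) (simp add: borel_measurable_continuous_onI)
qed

text \<open>A real-linear functional on \<open>complex^3\<close> combines real and imaginary parts
  of the coordinates. On the torus these are combinations of a character and its conjugate, which is
  the character of the opposite frequency.\<close>

lemma trigpoly_polynomial:
  assumes "real_polynomial_function q"
  shows "trigpoly (\<lambda>y. complex_of_real (q (torus y)))"
  using assms
proof (induction rule: real_polynomial_function.induct)
  case (linear f)
  have half: "trigpoly (\<lambda>y. c * cnj (ek k y))" "trigpoly (\<lambda>y. c * ek k y)" if "int_vec k" for c k
    using that by (auto simp: cnj_ek intro: trigpoly_monom int_vec_uminus)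
  have coord: "trigpoly (\<lambda>y. complex_of_real (Re (ek k y)))" "trigpoly (\<lambda>y. complex_of_real (Im (ek k y)))"
    if "int_vec k" for k
  proof -
    have re: "complex_of_real (Re z) = 1/2 * z + 1/2 * cnj z" for z by (simp add: complex_eq_iff)
    have im: "complex_of_real (Im z) = (-\<i>/2) * z + (\<i>/2) * cnj z" for z by (simp add: complex_eq_iff)
    show "trigpoly (\<lambda>y. complex_of_real (Re (ek k y)))" unfolding re by (intro trigpoly_add half that)
    show "trigpoly (\<lambda>y. complex_of_real (Im (ek k y)))" unfolding im by (intro trigpoly_add half that)
  qed
  have lin: "linear f" using linear by (simp add: bounded_linear.linear)
  have exp: "f w = (\<Sum>j\<in>UNIV. Re (w $ j) * f (axis j 1) + Im (w $ j) * f (axis j \<i>))" for w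
  proof -
    have "w = (\<Sum>j\<in>UNIV. Re (w $ j) *\<^sub>R axis j 1 + Im (w $ j) *\<^sub>R axis j \<i>)"
      by (simp add: vec_eq_iff axis_def complex_eq_iff if_distrib cong: if_cong)
    then have "f w = f (\<Sum>j\<in>UNIV. Re (w $ j) *\<^sub>R axis j 1 + Im (w $ j) *\<^sub>R axis j \<i>)" by simp
    also have "\<dots> = (\<Sum>j\<in>UNIV. Re (w $ j) * f (axis j 1) + Im (w $ j) * f (axis j \<i>))"
      by (simp add: linear_sum[OF lin] linear_add[OF lin] linear_scale[OF lin])
    finally show ?thesis .
  qed
  have "trigpoly (\<lambda>y. \<Sum>j\<in>UNIV. complex_of_real (Re (ek (axis j 1) y)) * complex_of_real (f (axis j 1))
       + complex_of_real (Im (ek (axis j 1) y)) * complex_of_real (f (axis j \<i>)))"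
    by (intro trigpoly_sum trigpoly_add trigpoly_mult trigpoly_const coord int_vec_axis) auto
  then show ?case by (subst exp) (simp add: torus_eq_ek)
next
  case (const c)
  show ?case by (rule trigpoly_const)
next
  case (add f g)
  then show ?case by (simp add: trigpoly_add)
next
  case (mult f g)
  then show ?case by (simp add: trigpoly_mult)
qed

text \<open>\<open>Arg2pi\<close> is continuous off the nonnegative half-line and 0 on it, so
  multiplication by the indicator of the complement changes nothing. It serves to invert
  \<open>torus\<close> measurably.\<close>

lemma Arg2pi_borel: "Arg2pi \<in> borel_measurable borel"
proof -
  have "closed (\<real>\<^sub>\<ge>\<^sub>0 :: complex set)" by simp
  moreover have "continuous_on (- \<real>\<^sub>\<ge>\<^sub>0) Arg2pi"
    by (intro continuous_at_imp_continuous_on ballI continuous_at_Arg2pi) auto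
  ultimately have "(\<lambda>x. indicator (- \<real>\<^sub>\<ge>\<^sub>0) x *\<^sub>R Arg2pi x) \<in> borel_measurable borel"
    by (intro borel_measurable_continuous_on_indicator) auto
  moreover have "(\<lambda>x. indicator (- \<real>\<^sub>\<ge>\<^sub>0) x *\<^sub>R Arg2pi x) = Arg2pi"
  proof
    fix x
    show "indicator (- \<real>\<^sub>\<ge>\<^sub>0) x *\<^sub>R Arg2pi x = Arg2pi x"
      using Arg2pi_eq_0[of x] by (auto simp: indicator_def complex_nonneg_Reals_iff complex_is_Real_iff)
  qed
  ultimately show ?thesis by (simp only:)
qed

text \<open>Membership in the \<open>L2\<close> closure of the trigonometric polynomials. The
  closure is shown to be a closed subspace that contains all indicators.\<close>

definition L2dense :: "(real^3 \<Rightarrow> complex) \<Rightarrow> bool" where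
  "L2dense f \<longleftrightarrow> L2 f \<and> (\<forall>\<epsilon>>0. \<exists>p. trigpoly p \<and> L2norm (\<lambda>y. f y - p y) < \<epsilon>)"

lemma L2norm_triangle:
  fixes f g :: "real^3 \<Rightarrow> complex"
  assumes "L2 f" "L2 g"
  shows "L2norm (\<lambda>y. f y + g y) \<le> L2norm f + L2norm g"
  using CX.L2.nrm_triangle[of f g] assms by (simp add: CX.nrm_eq plus_fun_def)

lemma L2dense_limit:
  assumes "L2 f" "\<And>\<epsilon>. \<epsilon> > 0 \<Longrightarrow> \<exists>g. L2dense g \<and> L2norm (\<lambda>y. f y - g y) < \<epsilon>"
  shows "L2dense f"
  unfolding L2dense_def
proof (intro conjI allI impI assms(1))
  fix \<epsilon> :: real assume e: "\<epsilon> > 0"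
  obtain g where g: "L2dense g" "L2norm (\<lambda>y. f y - g y) < \<epsilon> / 2" using assms(2)[of "\<epsilon> / 2"] e by auto
  then obtain p where p: "trigpoly p" "L2norm (\<lambda>y. g y - p y) < \<epsilon> / 2" using e unfolding L2dense_def by (metis half_gt_zero)
  have "L2 g" using g by (simp add: L2dense_def)
  then have "L2norm (\<lambda>y. f y - p y) \<le> L2norm (\<lambda>y. f y - g y) + L2norm (\<lambda>y. g y - p y)"
    using L2norm_triangle[OF L2_diff[OF assms(1)] L2_diff[OF _ trigpoly_L2[OF p(1)]], of g g] by simp
  then show "\<exists>p. trigpoly p \<and> L2norm (\<lambda>y. f y - p y) < \<epsilon>" using p g by (intro exI[of _ p]) auto
qed

lemma L2dense_add:
  assumes "L2dense f" "L2dense g"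
  shows "L2dense (\<lambda>y. f y + g y)"
  unfolding L2dense_def
proof (intro conjI allI impI)
  have f: "L2 f" and g: "L2 g" using assms by (auto simp: L2dense_def)
  then show "L2 (\<lambda>y. f y + g y)" by (rule L2_add)
  fix \<epsilon> :: real assume e: "\<epsilon> > 0"
  obtain p q where p: "trigpoly p" "L2norm (\<lambda>y. f y - p y) < \<epsilon> / 2" and q: "trigpoly q" "L2norm (\<lambda>y. g y - q y) < \<epsilon> / 2"
    using assms e unfolding L2dense_def by (metis half_gt_zero)
  have "L2norm (\<lambda>y. (f y + g y) - (p y + q y)) \<le> L2norm (\<lambda>y. f y - p y) + L2norm (\<lambda>y. g y - q y)"
    using L2norm_triangle[OF L2_diff[OF f trigpoly_L2[OF p(1)]] L2_diff[OF g trigpoly_L2[OF q(1)]]]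
    by (simp add: algebra_simps)
  then show "\<exists>p. trigpoly p \<and> L2norm (\<lambda>y. f y + g y - p y) < \<epsilon>"
    using p q by (intro exI[of _ "\<lambda>y. p y + q y"]) (auto intro: trigpoly_add)
qed

lemma L2dense_cmult:
  assumes "L2dense f"
  shows "L2dense (\<lambda>y. c * f y)"
  unfolding L2dense_def
proof (intro conjI allI impI)
  have f: "L2 f" using assms by (auto simp: L2dense_def)
  then show "L2 (\<lambda>y. c * f y)" by (rule L2_bounded_linear[OF bounded_linear_mult_right])
  fix \<epsilon> :: real assume e: "\<epsilon> > 0"
  have "\<epsilon> / (cmod c + 1) > 0" using e by (simp add: add_nonneg_pos)
  then obtain p where p: "trigpoly p" "L2norm (\<lambda>y. f y - p y) < \<epsilon> / (cmod c + 1)"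
    using assms unfolding L2dense_def by blast
  have L: "L2 (\<lambda>y. f y - p y)" by (intro L2_diff f trigpoly_L2 p)
  have "L2norm (\<lambda>y. c * f y - c * p y) = cmod c * L2norm (\<lambda>y. f y - p y)"
    using CX.L2.nrm_sc[of "\<lambda>y. f y - p y" c] L by (simp add: CX.nrm_eq CX.scf_def right_diff_distrib)
  also have "\<dots> \<le> (cmod c + 1) * L2norm (\<lambda>y. f y - p y)" using L2norm_nonneg by (intro mult_right_mono) auto
  also have "\<dots> < \<epsilon>" using p(2) by (simp add: pos_less_divide_eq add_nonneg_pos mult.commute)
  finally show "\<exists>q. trigpoly q \<and> L2norm (\<lambda>y. c * f y - q y) < \<epsilon>"
    using trigpoly_mult[OF p(1) trigpoly_const[of c]] by blast
qed

lemma L2dense_cong_AE: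
  assumes "L2dense f" "g \<in> borel_measurable MY" "AE y in MY. f y = g y"
  shows "L2dense g"
proof (rule L2dense_limit)
  have f: "L2 f" using assms by (auto simp: L2dense_def)
  then show "L2 g" by (rule L2_cong_AE[OF _ assms(2,3)])
  fix \<epsilon> :: real assume "\<epsilon> > 0"
  have "L2norm (\<lambda>y. g y - f y) = 0"
    using L2norm_eq_0_iff[OF L2_diff[OF \<open>L2 g\<close> f]] assms(3) by auto
  then show "\<exists>h. L2dense h \<and> L2norm (\<lambda>y. g y - h y) < \<epsilon>" using assms(1) \<open>\<epsilon> > 0\<close> by auto
qed

text \<open>Regularity and Urysohn's lemma are applied to the image measure on
  \<open>complex^3\<close> instead of the cell: a continuous function composed with
  \<open>torus\<close> is automatically periodic, and Stone-Weierstrass approximates it on the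
  compact torus. A continuous function chosen on the cell could disagree on opposite faces.\<close>

lemma L2dense_borel_indicator:
  assumes B: "B \<in> sets borel"
  shows "L2dense (indicator B :: real^3 \<Rightarrow> complex)"
proof -
  define N where "N = distr MY borel torus"
  \<comment> \<open>A Borel set whose preimage under \<open>torus\<close> is \<open>B\<close> inside
    the cell. \<open>Arg2pi\<close> takes values in \<open>[0, 2 \<pi>)\<close>, which matches the
    half-open cell.\<close>
  define C where "C = {w. (\<chi> j. Arg2pi (w $ j) / (2 * pi)) \<in> B}"
  have nth: "(\<lambda>w :: complex^3. w $ j) \<in> borel_measurable borel" for j
    by (intro borel_measurable_continuous_onI continuous_intros)
  have inv: "(\<lambda>w :: complex^3. \<chi> j. Arg2pi (w $ j) / (2 * pi)) \<in> borel_measurable borel"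
  proof (subst borel_measurable_euclidean_space, intro ballI)
    fix b :: "real^3" assume "b \<in> Basis"
    then obtain j where b: "b = axis j 1" by (auto simp: Basis_vec_def)
    show "(\<lambda>w :: complex^3. (\<chi> j. Arg2pi (w $ j) / (2 * pi)) \<bullet> b) \<in> borel_measurable borel"
      using measurable_compose[OF nth[of j] Arg2pi_borel] by (simp add: b inner_axis)
  qed
  have C: "C \<in> sets borel"
    unfolding C_def using measurable_sets[OF inv B] by (simp add: vimage_def)
  have torus_C: "torus y \<in> C \<longleftrightarrow> y \<in> B" if "y \<in> Ycell" for y
  proof -
    have "Arg2pi (torus y $ j) / (2 * pi) = y $ j" for j
    proof -
      have "Arg2pi (torus y $ j) = 2 * pi * y $ j"
        by (rule Arg2pi_unique[of 1]) (use that in \<open>auto simp: torus_def cis_conv_exp Ycell_def\<close>)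
      then show ?thesis by simp
    qed
    then show ?thesis by (simp add: C_def)
  qed
  have N_eq: "emeasure N D = emeasure MY (torus -` D \<inter> space MY)" if "D \<in> sets borel" for D
    unfolding N_def by (rule emeasure_distr[OF torus_measurable that])
  have setsN: "sets N = sets borel" by (simp add: N_def)
  interpret N: finite_measure N
    unfolding N_def by (rule MY.finite_measure_distr[OF torus_measurable])
  have Nfin: "emeasure N (space N) \<noteq> \<infinity>" by simp
  have Lind: "L2 (indicator B :: real^3 \<Rightarrow> complex)"
    by (rule L2_bounded_measurable[where B=1])
      (use B in \<open>auto intro!: measurable_restrict_space1 measurable_completion simp: indicator_def\<close>)
  show ?thesis
    unfolding L2dense_def
  proof (intro conjI allI impI Lind)
    fix \<epsilon> :: real assume e: "\<epsilon> > 0"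
    \<comment> \<open>\<open>U - K\<close> will have measure at most \<open>2 * \<delta>\<close>,
      whose square root has to stay below \<open>\<epsilon> / 2\<close>.\<close>
    define \<delta> where "\<delta> = \<epsilon>\<^sup>2 / 16"
    have d: "\<delta> > 0" using e by (simp add: \<delta>_def)
    have C_eq_K: "emeasure N C = (SUP K \<in> {K. K \<subseteq> C \<and> compact K}. emeasure N K)"
      by (rule inner_regular[OF setsN Nfin C])
    have "\<exists>K\<in>{K. K \<subseteq> C \<and> compact K}. emeasure N C < emeasure N K + ennreal \<delta>"
      by (rule SUP_approx_ennreal[OF d _ C_eq_K]) (auto intro: exI[of _ "{}"])
    then obtain K where K: "K \<subseteq> C" "compact K" "emeasure N C \<le> emeasure N K + ennreal \<delta>"
      by (auto intro: less_imp_le)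
    have C_eq_U: "emeasure N C = (INF U \<in> {U. C \<subseteq> U \<and> open U}. emeasure N U)"
      by (rule outer_regular[OF setsN Nfin C])
    have "\<exists>U\<in>{U. C \<subseteq> U \<and> open U}. emeasure N U < emeasure N C + ennreal \<delta>"
      by (rule INF_approx_ennreal[OF d C_eq_U]) simp
    then obtain U where U: "C \<subseteq> U" "open U" "emeasure N U \<le> emeasure N C + ennreal \<delta>"
      by (auto intro: less_imp_le)
    have mUK: "measure N (U - K) \<le> 2 * \<delta>"
    proof -
      have Ks: "K \<in> sets N" and Us: "U \<in> sets N"
        using K U C setsN by (auto intro: borel_compact)
      have "measure N C \<le> measure N K + \<delta>" "measure N U \<le> measure N C + \<delta>"
        using K(3) U(3) d by (simp_all add: N.emeasure_eq_measure flip: ennreal_plus)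
      moreover have "measure N (U - K) = measure N U - measure N K"
        using K U Ks Us by (intro N.finite_measure_Diff) auto
      ultimately show ?thesis by simp
    qed
    obtain g :: "complex^3 \<Rightarrow> real" where g: "continuous_on UNIV g" "\<And>x. g x \<in> closed_segment 0 1"
      "\<And>x. x \<in> - U \<Longrightarrow> g x = 0" "\<And>x. x \<in> K \<Longrightarrow> g x = 1"
      using Urysohn[of "- U" K 0 1] K U by (auto simp: compact_imp_closed)
    have g01: "0 \<le> g x" "g x \<le> 1" for x using g(2)[of x] by (auto simp: closed_segment_eq_real_ivl)
    define S :: "(complex^3) set" where "S = {w. \<forall>j. norm (w $ j) = 1}"
    have "compact S"
    proof -
      have "closed S" unfolding S_def by (intro closed_Collect_all closed_Collect_eq continuous_intros)
      moreover have "bounded S"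
        unfolding bounded_iff
      proof (intro exI ballI)
        fix w :: "complex^3" assume "w \<in> S"
        then show "norm w \<le> sqrt 3" by (simp add: norm_vec_def L2_set_def S_def)
      qed
      ultimately show ?thesis by (simp add: compact_eq_bounded_closed)
    qed
    moreover have "continuous_on S g" using g(1) continuous_on_subset by blast
    moreover have "\<epsilon> / 4 > 0" using e by simp
    ultimately obtain q where q: "real_polynomial_function q" "\<And>x. x \<in> S \<Longrightarrow> \<bar>g x - q x\<bar> < \<epsilon> / 4"
      using Stone_Weierstrass_real_polynomial_function[of S g "\<epsilon> / 4"] by metis
    have torusS: "torus y \<in> S" for y by (simp add: S_def torus_def)
    let ?g = "\<lambda>y. complex_of_real (g (torus y))" and ?q = "\<lambda>y. complex_of_real (q (torus y))"
    have mg: "?g \<in> borel_measurable MY"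
      using measurable_compose[OF torus_measurable borel_measurable_continuous_onI[OF g(1)]] by simp
    have Lg: "L2 ?g" by (rule L2_bounded_measurable[OF mg, of 1]) (use g01 in auto)
    have tq: "trigpoly ?q" using trigpoly_polynomial[OF q(1)] .
    have Lq: "L2 ?q" using trigpoly_L2[OF tq] .
    have "L2norm (\<lambda>y. ?g y - ?q y) \<le> \<epsilon> / 4 * L2norm (\<lambda>y. 1 :: real)"
    proof (rule L2norm_mono[OF L2_const])
      show "(\<lambda>y. ?g y - ?q y) \<in> borel_measurable MY" using L2_measurable[OF L2_diff[OF Lg Lq]] .
      show "AE y in MY. norm (?g y - ?q y) \<le> \<epsilon> / 4 * norm (1::real)"
        using q(2)[OF torusS] by (intro AE_I2) (simp add: less_imp_le flip: of_real_diff)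
    qed (use e in simp)
    then have 1: "L2norm (\<lambda>y. ?g y - ?q y) \<le> \<epsilon> / 4" by (simp add: L2norm_const)
    let ?D = "torus -` (U - K) \<inter> space MY"
    have Ds: "?D \<in> sets MY" by (rule measurable_sets[OF torus_measurable]) (use K U in \<open>auto intro: borel_compact\<close>)
    have "(L2norm (\<lambda>y. indicator B y - ?g y))\<^sup>2 \<le> 2 * \<delta>"
    proof -
      \<comment> \<open>Indicator and cutoff agree where \<open>torus y\<close> is outside
        \<open>U - K\<close>, and differ by at most 1 elsewhere.\<close>
      have "(L2norm (\<lambda>y. indicator B y - ?g y))\<^sup>2 \<le> intY (indicator ?D :: _ \<Rightarrow> real)"
        unfolding L2norm_sq intY_def
      proof (rule integral_mono)
        show "integrable MY (\<lambda>y. (norm (indicator B y - ?g y))\<^sup>2)" by (rule L2_sq[OF L2_diff[OF Lind Lg]])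
        show "integrable MY (indicator ?D :: _ \<Rightarrow> real)"
          by (rule MY.integrable_const_bound[of _ 1]) (use Ds in auto)
        fix y assume y: "y \<in> space MY"
        then have yc: "y \<in> Ycell" by (simp add: space_MY)
        have le1: "norm (indicator B y - ?g y) \<le> 1"
        proof -
          have "indicator B y - ?g y = complex_of_real (indicator B y - g (torus y))" by (simp add: indicator_def)
          then show ?thesis using g01[of "torus y"] by (simp only: norm_of_real) (auto simp: indicator_def)
        qed
        show "(norm (indicator B y - ?g y))\<^sup>2 \<le> indicator ?D y"
        proof (cases "y \<in> ?D")
          case True
          then show ?thesis using le1 by (simp add: power_le_one)
        next
          case False
          then have "torus y \<in> K \<or> torus y \<notin> U" using y by auto
          then have "indicator B y = ?g y"
            using g(3,4)[of "torus y"] torus_C[OF yc] K(1) U(1) by (auto simp: indicator_def)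
          then show ?thesis by simp
        qed
      qed
      also have "\<dots> = measure MY ?D" using Ds by (simp add: intY_def)
      also have "\<dots> = measure N (U - K)"
        using N_eq[of "U - K"] sets.Diff[OF borel_open[OF U(2)] borel_compact[OF K(2)]] by (simp add: measure_def)
      finally show ?thesis using mUK by simp
    qed
    also have "2 * \<delta> \<le> (\<epsilon> / 2)\<^sup>2" by (simp add: \<delta>_def power2_eq_square)
    finally have 2: "L2norm (\<lambda>y. indicator B y - ?g y) \<le> \<epsilon> / 2" using e by (elim power2_le_imp_le) simp
    have "L2norm (\<lambda>y. indicator B y - ?q y) \<le> L2norm (\<lambda>y. indicator B y - ?g y) + L2norm (\<lambda>y. ?g y - ?q y)"
      using L2norm_triangle[OF L2_diff[OF Lind Lg] L2_diff[OF Lg Lq]] by simp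
    then have "L2norm (\<lambda>y. indicator B y - ?q y) < \<epsilon>" using 1 2 e by linarith
    then show "\<exists>p. trigpoly p \<and> L2norm (\<lambda>y. indicator B y - p y) < \<epsilon>" using tq by blast
  qed
qed

text \<open>A Lebesgue set is a Borel set up to a null set, which the \<open>L2\<close> norm does
  not see.\<close>

lemma L2dense_indicator:
  assumes "B \<in> sets MY"
  shows "L2dense (indicator B :: real^3 \<Rightarrow> complex)"
proof -
  have "B \<in> sets lebesgue" using assms Ycell_lebesgue by (auto simp: sets_restrict_space)
  then obtain S N N' where SN: "B = S \<union> N" "N \<subseteq> N'" "N' \<in> null_sets lborel" "S \<in> sets lborel"
    by (auto elim: sets_completionE)
  have "AE y in lebesgue. y \<notin> N'" using SN(3) by (intro AE_completion AE_not_in)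
  then have "AE y in MY. y \<notin> N'" using Ycell_lebesgue by (subst AE_restrict_space_iff) (auto elim: eventually_mono)
  then have "AE y in MY. (indicator S y :: complex) = indicator B y"
    by eventually_elim (use SN in \<open>auto simp: indicator_def\<close>)
  then show ?thesis
    using L2dense_cong_AE[OF L2dense_borel_indicator] SN(4) assms by simp
qed

theorem trigpoly_dense:
  assumes f: "L2 f"
  shows "L2dense f"
proof -
  obtain F where F0: "\<forall>i. simple_function MY (F i)" "\<forall>y\<in>space MY. (\<lambda>i. F i y) \<longlonglongrightarrow> f y"
    "\<forall>i. \<forall>y\<in>space MY. dist (F i y) 0 \<le> 2 * dist (f y) 0"
    using borel_measurable_implies_sequence_metric[OF L2_measurable[OF f], of 0] by blast
  have F: "simple_function MY (F i)" "y \<in> space MY \<Longrightarrow> (\<lambda>i. F i y) \<longlonglongrightarrow> f y"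
    "y \<in> space MY \<Longrightarrow> norm (F i y) \<le> 2 * norm (f y)" for i y
    using F0 by (auto simp: dist_norm)
  have simple: "L2dense (F i)" for i
  proof -
    have fin: "finite (F i ` space MY)" using F(1) by (simp add: simple_function_def)
    have "L2dense (\<lambda>y. \<Sum>v\<in>F i ` space MY. v * indicator (F i -` {v} \<inter> space MY) y)"
    proof -
      have *: "L2dense (\<lambda>y. \<Sum>v\<in>I. v * indicator (F i -` {v} \<inter> space MY) y)"
        if "finite I" "I \<subseteq> F i ` space MY" for I
        using that
      proof (induction rule: finite_induct)
        case empty
        show ?case using L2_const[of "0::complex"] trigpoly_const[of 0]
          by (auto simp: L2dense_def L2norm_const intro!: exI[of _ "\<lambda>_. 0"])
      next
        case (insert v I)
        have "F i -` {v} \<inter> space MY \<in> sets MY" using F(1)[of i] insert by (auto simp: simple_function_def)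
        then have "L2dense (\<lambda>y. v * indicator (F i -` {v} \<inter> space MY) y)"
          by (intro L2dense_cmult L2dense_indicator)
        then show ?case unfolding sum.insert[OF insert(1,2)] using insert by (intro L2dense_add) auto
      qed
      show ?thesis by (rule *[OF fin order_refl])
    qed
    moreover have "(\<Sum>v\<in>F i ` space MY. v * indicator (F i -` {v} \<inter> space MY) y) = F i y" if "y \<in> space MY" for y
    proof -
      have "(\<Sum>v\<in>F i ` space MY. v * indicator (F i -` {v} \<inter> space MY) y)
          = (\<Sum>v\<in>F i ` space MY. if v = F i y then v else 0)"
        using that by (intro sum.cong) (auto simp: indicator_def)
      then show ?thesis using fin that by simp
    qed
    ultimately show ?thesis
      by (rule L2dense_cong_AE[OF _ borel_measurable_simple_function[OF F(1)] AE_I2])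
  qed
  have "(\<lambda>i. intY (\<lambda>y. (norm (f y - F i y))\<^sup>2)) \<longlonglongrightarrow> intY (\<lambda>y. 0 :: real)"
    unfolding intY_def
  \<comment> \<open>The simple functions are bounded by twice \<open>norm (f y)\<close>, so the
    difference is at most three times it; hence the 9.\<close>
  proof (rule integral_dominated_convergence[where w="\<lambda>y. 9 * (norm (f y))\<^sup>2"])
    have LF: "L2 (F i)" for i using simple by (simp add: L2dense_def)
    show "(\<lambda>y. (norm (f y - F i y))\<^sup>2) \<in> borel_measurable MY" for i
      using L2_sq[OF L2_diff[OF f LF]] by (rule borel_measurable_integrable)
    show "integrable MY (\<lambda>y. 9 * (norm (f y))\<^sup>2)" using L2_sq[OF f] by simp
    show "AE y in MY. (\<lambda>i. (norm (f y - F i y))\<^sup>2) \<longlonglongrightarrow> 0"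
    proof (rule AE_I2)
      fix y assume "y \<in> space MY"
      then have "(\<lambda>i. (norm (f y - F i y))\<^sup>2) \<longlonglongrightarrow> (norm (f y - f y))\<^sup>2" by (intro tendsto_intros F(2))
      then show "(\<lambda>i. (norm (f y - F i y))\<^sup>2) \<longlonglongrightarrow> 0" by simp
    qed
    show "AE y in MY. norm ((norm (f y - F i y))\<^sup>2) \<le> 9 * (norm (f y))\<^sup>2" for i
    proof (rule AE_I2)
      fix y assume "y \<in> space MY"
      then have "norm (f y - F i y) \<le> 3 * norm (f y)"
        using F(3)[of y i] norm_triangle_ineq4[of "f y" "F i y"] by linarith
      then have "(norm (f y - F i y))\<^sup>2 \<le> (3 * norm (f y))\<^sup>2" by (intro power_mono) auto
      then show "norm ((norm (f y - F i y))\<^sup>2) \<le> 9 * (norm (f y))\<^sup>2" by (simp add: power_mult_distrib)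
    qed
  qed simp
  then have lim: "(\<lambda>i. (L2norm (\<lambda>y. f y - F i y))\<^sup>2) \<longlonglongrightarrow> 0" by (simp add: L2norm_sq intY_const)
  show ?thesis
  proof (rule L2dense_limit[OF f])
    fix \<epsilon> :: real assume e: "\<epsilon> > 0"
    then have "\<forall>\<^sub>F i in sequentially. (L2norm (\<lambda>y. f y - F i y))\<^sup>2 < \<epsilon>\<^sup>2"
      using order_tendstoD(2)[OF lim] by simp
    then obtain i where "(L2norm (\<lambda>y. f y - F i y))\<^sup>2 < \<epsilon>\<^sup>2" by (auto simp: eventually_sequentially)
    then have "L2norm (\<lambda>y. f y - F i y) < \<epsilon>" using e by (simp add: power2_less_imp_less)
    then show "\<exists>g. L2dense g \<and> L2norm (\<lambda>y. f y - g y) < \<epsilon>" using simple by blast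
  qed
qed

section \<open>Bessel's identity and Parseval's equation\<close>

lemma Bessel_identity:
  assumes f: "L2 f" and F: "finite F" "F \<subseteq> {k. int_vec k}"
  shows "(L2norm (\<lambda>y. f y - (\<Sum>k\<in>F. c k * ek k y)))\<^sup>2
     = (L2norm f)\<^sup>2 - (\<Sum>k\<in>F. (cmod (fc f k))\<^sup>2) + (\<Sum>k\<in>F. (cmod (fc f k - c k))\<^sup>2)"
  using F
proof (induction rule: finite_induct)
  case empty
  then show ?case by simp
next
  case (insert l F)
  define g where "g = (\<lambda>y. f y - (\<Sum>k\<in>F. c k * ek k y))"
  have tp: "L2 (\<lambda>y. \<Sum>k\<in>F. c k * ek k y)"
    by (intro L2_sum insert L2_bounded_linear[OF bounded_linear_mult_right L2_ek])
  have g: "L2 g" unfolding g_def by (intro L2_diff f tp)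
  \<comment> \<open>\<open>ek l\<close> is orthogonal to the characters subtracted so far, so its
    coefficient in the remainder is still that of \<open>f\<close>.\<close>
  have IP: "CX.ipf g (ek l) = fc f l"
  proof -
    have "CX.ipf (\<lambda>y. \<Sum>k\<in>F. c k * ek k y) (ek l) = (\<Sum>k\<in>F. c k * CX.ipf (ek k) (ek l))"
      using CX.ip0_integrable[OF L2_ek L2_ek]
      by (simp add: CX.ipf_def intY_def sum_distrib_right mult.assoc)
    also have "\<dots> = 0" using insert by (intro sum.neutral) (auto simp: ipf_ek subset_iff)
    finally show ?thesis
      unfolding g_def fc_ipf using CX.L2.ip_diff[of f "\<lambda>y. \<Sum>k\<in>F. c k * ek k y" "ek l"] f tp L2_ek
      by (simp add: fun_diff_def)
  qed
  have "(\<lambda>y. f y - (\<Sum>k\<in>insert l F. c k * ek k y)) = g + - CX.scf (c l) (ek l)"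
    using insert by (auto simp: g_def CX.scf_def fun_eq_iff)
  then have "(L2norm (\<lambda>y. f y - (\<Sum>k\<in>insert l F. c k * ek k y)))\<^sup>2 = (CX.L2.nrm (g + - CX.scf (c l) (ek l)))\<^sup>2"
    by (simp add: CX.nrm_eq)
  also have "\<dots> = (L2norm g)\<^sup>2 + (cmod (c l))\<^sup>2 - 2 * Re (cnj (c l) * fc f l)"
  proof -
    have sc: "CX.scf (c l) (ek l) \<in> {u. L2 u}" using CX.L2.sc_mem[of "ek l" "c l"] L2_ek by simp
    have n1: "CX.L2.nrm (ek l) = 1"
      using ipf_ek[of l l] insert by (simp add: CX.L2.nrm_def)
    have nn: "CX.L2.nrm (- CX.scf (c l) (ek l)) = cmod (c l)"
      using CX.L2.nrm_minus[OF sc] CX.L2.nrm_sc[of "ek l" "c l"] n1 L2_ek by simp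
    show ?thesis
      using CX.L2.nrm_add_sq[of g "- CX.scf (c l) (ek l)"] g sc CX.L2.uminus_mem[OF sc] L2_ek n1 IP
      unfolding nn by (simp add: CX.L2.ip_minus_right CX.L2.ip_sc_right CX.nrm_eq)
  qed
  also have "\<dots> = (L2norm g)\<^sup>2 - (cmod (fc f l))\<^sup>2 + (cmod (fc f l - c l))\<^sup>2"
    by (simp add: cmod_power2 power2_diff algebra_simps)
  finally show ?case using insert by (simp add: g_def)
qed

text \<open>Bessel's identity admits arbitrary coefficients. With those of \<open>f\<close> it
  bounds every finite sum by the norm; with those of a nearby trigonometric polynomial it shows that
  finite sums come arbitrarily close.\<close>

theorem Parseval:
  assumes f: "L2 f"
  shows "((\<lambda>k. (cmod (fc f k))\<^sup>2) has_sum (L2norm f)\<^sup>2) {k. int_vec k}"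
proof -
  let ?Z = "{k::real^3. int_vec k}" and ?a = "\<lambda>k. (cmod (fc f k))\<^sup>2"
  have Bessel: "sum ?a F \<le> (L2norm f)\<^sup>2" if "finite F" "F \<subseteq> ?Z" for F
    using Bessel_identity[OF f that, of "fc f"] zero_le_power2[of "L2norm (\<lambda>y. f y - (\<Sum>k\<in>F. fc f k * ek k y))"]
    by simp
  then have bdd: "bdd_above (sum ?a ` {F. F \<subseteq> ?Z \<and> finite F})" by (auto simp: bdd_above_def)
  have sup: "(?a has_sum (SUP F\<in>{F. finite F \<and> F \<subseteq> ?Z}. sum ?a F)) ?Z"
    by (rule nonneg_bdd_above_has_sum[OF _ bdd]) simp
  have "(SUP F\<in>{F. finite F \<and> F \<subseteq> ?Z}. sum ?a F) = (L2norm f)\<^sup>2"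
  proof (rule antisym)
    show "(SUP F\<in>{F. finite F \<and> F \<subseteq> ?Z}. sum ?a F) \<le> (L2norm f)\<^sup>2"
      by (rule cSUP_least) (use Bessel in auto)
    show "(L2norm f)\<^sup>2 \<le> (SUP F\<in>{F. finite F \<and> F \<subseteq> ?Z}. sum ?a F)"
    proof (rule field_le_epsilon)
      fix e :: real assume e: "e > 0"
      obtain p where p: "trigpoly p" "L2norm (\<lambda>y. f y - p y) < sqrt e"
        using trigpoly_dense[OF f] e unfolding L2dense_def by (meson real_sqrt_gt_zero)
      obtain F c where F: "finite F" "F \<subseteq> ?Z" "p = (\<lambda>y. \<Sum>k\<in>F. c k * ek k y)"
        using trigpoly_expand[OF p(1)] by blast
      have "(L2norm (\<lambda>y. f y - p y))\<^sup>2 \<le> (sqrt e)\<^sup>2" using p(2) L2norm_nonneg by (intro power_mono) auto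
      then have "(L2norm f)\<^sup>2 - sum ?a F \<le> e"
        using Bessel_identity[OF f F(1,2), of c] e sum_nonneg[of F "\<lambda>k. (cmod (fc f k - c k))\<^sup>2"]
        by (simp add: F(3))
      moreover have "sum ?a F \<le> (SUP F\<in>{F. finite F \<and> F \<subseteq> ?Z}. sum ?a F)"
        by (rule cSUP_upper) (use F bdd in \<open>auto simp: conj_commute\<close>)
      ultimately show "(L2norm f)\<^sup>2 \<le> (SUP F\<in>{F. finite F \<and> F \<subseteq> ?Z}. sum ?a F) + e" by linarith
    qed
  qed
  with sup show ?thesis by simp
qed

section \<open>Periodic Sobolev functions and Korn's inequality\<close>

lemma norm_vec_sq: "(norm (x :: ('a::real_normed_vector)^'n::finite))\<^sup>2 = (\<Sum>i\<in>UNIV. (norm (x $ i))\<^sup>2)"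
  by (simp add: norm_vec_def L2_set_def sum_nonneg)

lemma norm_matrix_sq:
  "(norm (M :: complex^3^3))\<^sup>2 = (\<Sum>i\<in>UNIV. \<Sum>j\<in>UNIV. (norm (M $ i $ j))\<^sup>2)"
  by (simp add: norm_vec_sq)

lemma bilinear_cinner: "bounded_bilinear cinner"
proof -
  have "bilinear cinner"
    unfolding bilinear_def linear_iff cinner_def
    by (auto simp: distrib_right distrib_left sum.distrib scaleR_sum_right)
  then show ?thesis by (simp add: bilinear_conv_bounded_bilinear)
qed

lemma bilinear_frob: "bounded_bilinear frob"
proof -
  have "bilinear frob"
    unfolding bilinear_def linear_iff frob_def
    by (auto simp: distrib_right distrib_left sum.distrib scaleR_sum_right)
  then show ?thesis by (simp add: bilinear_conv_bounded_bilinear)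
qed

interpretation CV: pointwise_inner "(*s)" cinner
proof (rule pointwise_inner.intro, goal_cases)
  case 1
  show ?case by (rule bilinear_cinner)
next
  case (2 c)
  have "linear ((*s) c :: complex^3 \<Rightarrow> complex^3)"
    by (rule linearI) (auto simp: vec_eq_iff distrib_left)
  then show ?case by (rule linear_conv_bounded_linear[THEN iffD1])
next
  case (5 y x)
  show ?case by (simp add: cinner_def mult.commute)
next
  case (6 x)
  show ?case unfolding norm_vec_sq by (simp add: cinner_def complex_norm_square del: of_real_power)
qed (auto simp: cinner_def vec_eq_iff sum_distrib_left mult.assoc)

interpretation CM: pointwise_inner cmul frob
proof (rule pointwise_inner.intro, goal_cases)
  case 1
  show ?case by (rule bilinear_frob)
next
  case (2 c)
  have "linear (cmul c)"
    by (rule linearI) (auto simp: cmul_def vec_eq_iff distrib_left)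
  then show ?case by (rule linear_conv_bounded_linear[THEN iffD1])
next
  case (5 y x)
  show ?case by (simp add: frob_def mult.commute)
next
  case (6 x)
  show ?case unfolding norm_matrix_sq by (simp add: frob_def complex_norm_square del: of_real_power)
qed (auto simp: frob_def cmul_def vec_eq_iff sum_distrib_left mult.assoc)

lemma CV_ipf: "CV.ipf = l2inner"
  by (simp add: fun_eq_iff CV.ipf_def l2inner_def)

lemma L2_nth: "L2 u \<Longrightarrow> L2 (\<lambda>y. u y $ i)"
  by (rule L2_bounded_linear[OF bounded_linear_vec_nth])

lemma L2_nth2: "L2 G \<Longrightarrow> L2 (\<lambda>y. G y $ i $ j)"
  by (intro L2_nth)

lemma intY_nth: "integrable MY u \<Longrightarrow> intY u $ i = intY (\<lambda>y. u y $ i)"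
  unfolding intY_def by (rule integral_bounded_linear[OF bounded_linear_vec_nth, symmetric])

lemma has_sum_finite_sum:
  fixes f :: "'i \<Rightarrow> 'a \<Rightarrow> 'b::topological_comm_monoid_add"
  assumes "finite I" "\<And>i. i \<in> I \<Longrightarrow> (f i has_sum s i) A"
  shows "((\<lambda>k. \<Sum>i\<in>I. f i k) has_sum (\<Sum>i\<in>I. s i)) A"
  using assms by (induction rule: finite_induct) (auto intro: has_sum_add)

lemma Parseval_vec:
  fixes u :: "real^3 \<Rightarrow> complex^3"
  assumes "L2 u"
  shows "((\<lambda>k. \<Sum>i\<in>UNIV. (cmod (fc (\<lambda>y. u y $ i) k))\<^sup>2) has_sum (L2norm u)\<^sup>2) {k. int_vec k}"
proof -
  have "(L2norm u)\<^sup>2 = (\<Sum>i\<in>UNIV. (L2norm (\<lambda>y. u y $ i))\<^sup>2)"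
    unfolding L2norm_sq norm_vec_sq[of "u _"] intY_def
    by (rule Bochner_Integration.integral_sum) (rule L2_sq[OF L2_nth[OF assms]])
  moreover have "((\<lambda>k. \<Sum>i\<in>UNIV. (cmod (fc (\<lambda>y. u y $ i) k))\<^sup>2) has_sum (\<Sum>i\<in>UNIV. (L2norm (\<lambda>y. u y $ i))\<^sup>2)) {k. int_vec k}"
    by (intro has_sum_finite_sum finite) (rule Parseval[OF L2_nth[OF assms]])
  ultimately show ?thesis by simp
qed

lemma Parseval_matrix:
  fixes G :: "real^3 \<Rightarrow> complex^3^3"
  assumes "L2 G"
  shows "((\<lambda>k. \<Sum>i\<in>UNIV. \<Sum>j\<in>UNIV. (cmod (fc (\<lambda>y. G y $ i $ j) k))\<^sup>2) has_sum (L2norm G)\<^sup>2) {k. int_vec k}"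
proof -
  have "(L2norm G)\<^sup>2 = (\<Sum>i\<in>UNIV. (L2norm (\<lambda>y. G y $ i))\<^sup>2)"
    unfolding L2norm_sq norm_vec_sq[of "G _"] intY_def
    by (rule Bochner_Integration.integral_sum) (rule L2_sq[OF L2_nth[OF assms]])
  moreover have "((\<lambda>k. \<Sum>i\<in>UNIV. \<Sum>j\<in>UNIV. (cmod (fc (\<lambda>y. G y $ i $ j) k))\<^sup>2) has_sum (\<Sum>i\<in>UNIV. (L2norm (\<lambda>y. G y $ i))\<^sup>2)) {k. int_vec k}"
    by (intro has_sum_finite_sum finite) (rule Parseval_vec[OF L2_nth[OF assms]])
  ultimately show ?thesis by simp
qed

section \<open>Fourier coefficients and weak gradients\<close>

lemma fc_integrable: "L2 f \<Longrightarrow> integrable MY (\<lambda>y. f y * cnj (ek k y))"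
  using CX.ip0_integrable[OF _ L2_ek] by simp

lemma fc_add: "L2 f \<Longrightarrow> L2 g \<Longrightarrow> fc (\<lambda>y. f y + g y) k = fc f k + fc g k"
  by (simp add: fc_def intY_def distrib_right fc_integrable)

lemma fc_diff: "L2 f \<Longrightarrow> L2 g \<Longrightarrow> fc (\<lambda>y. f y - g y) k = fc f k - fc g k"
  by (simp add: fc_def intY_def left_diff_distrib fc_integrable)

lemma fc_cmult: "fc (\<lambda>y. c * f y) k = c * fc f k"
  by (simp add: fc_def intY_def mult.assoc)

lemma fc_const: "int_vec k \<Longrightarrow> fc (\<lambda>y. c) k = (if k = 0 then c else 0)"
  using intY_ek[of "- k"] int_vec_uminus[of k]
  by (simp add: fc_def cnj_ek ek_0 intY_const) (simp add: intY_def)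

lemma fc_0: "fc f 0 = intY f"
  by (simp add: fc_def ek_0)

text \<open>Testing with the character of frequency \<open>- k\<close> is the same as taking the
  coefficient at \<open>k\<close>.\<close>

lemma fc_weak_grad:
  assumes "weak_grad u G" "int_vec k"
  shows "fc (\<lambda>y. G y $ i $ j) k = 2 * pi * \<i> * complex_of_real (k $ j) * fc (\<lambda>y. u y $ i) k"
proof -
  have "intY (\<lambda>y. u y $ i * pderiv (ek (- k)) j y) = - intY (\<lambda>y. G y $ i $ j * ek (- k) y)"
    using assms testfn_ek[OF int_vec_uminus[OF assms(2)]] by (simp add: weak_grad_def)
  moreover have "(\<lambda>y. u y $ i * pderiv (ek (- k)) j y)
      = (\<lambda>y. (- (2 * pi * \<i> * complex_of_real (k $ j))) * (u y $ i * ek (- k) y))"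
    by (simp add: pderiv_ek fun_eq_iff)
  ultimately have "(- (2 * pi * \<i> * complex_of_real (k $ j))) * intY (\<lambda>y. u y $ i * ek (- k) y)
      = - intY (\<lambda>y. G y $ i $ j * ek (- k) y)"
    by (simp only: intY_def integral_mult_right_zero)
  then show ?thesis by (simp add: fc_def cnj_ek)
qed

text \<open>The function determines every Fourier coefficient of its gradient, and Parseval does the
  rest. This makes the choice in \<open>grad\<close> harmless up to null sets.\<close>

lemma weak_grad_unique:
  assumes "weak_grad u G" "weak_grad u G'" "L2 G" "L2 G'"
  shows "AE y in MY. G y = G' y"
proof -
  have L: "L2 (\<lambda>y. G y - G' y)" using assms by (intro L2_diff)
  have "fc (\<lambda>y. (G y - G' y) $ i $ j) k = 0" if "int_vec k" for i j k
    using fc_weak_grad[OF assms(1) that] fc_weak_grad[OF assms(2) that]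
    by (simp add: fc_diff L2_nth2 assms)
  then have "((\<lambda>k. 0) has_sum (L2norm (\<lambda>y. G y - G' y))\<^sup>2) {k. int_vec k}"
    using has_sum_cong[THEN iffD1, OF _ Parseval_matrix[OF L], of "\<lambda>k. 0"] by simp
  moreover have "((\<lambda>k::real^3. 0) has_sum (0::real)) {k. int_vec k}" by (rule has_sum_0) simp
  ultimately have "(L2norm (\<lambda>y. G y - G' y))\<^sup>2 = 0" by (rule has_sum_unique)
  then have "AE y in MY. G y - G' y = 0" using L2norm_eq_0_iff[OF L] by simp
  then show ?thesis by eventually_elim simp
qed

lemma H1per_L2: "H1per u \<Longrightarrow> L2 u" by (simp add: H1per_def)

lemma grad_props: "H1per u \<Longrightarrow> L2 (grad u) \<and> weak_grad u (grad u)"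
  unfolding grad_def using someI_ex[of "\<lambda>G. L2 G \<and> weak_grad u G"] by (simp add: H1per_def)

lemma L2_grad: "H1per u \<Longrightarrow> L2 (grad u)" and weak_grad_grad: "H1per u \<Longrightarrow> weak_grad u (grad u)"
  using grad_props by auto

lemma H1perI: "L2 u \<Longrightarrow> L2 G \<Longrightarrow> weak_grad u G \<Longrightarrow> H1per u"
  by (auto simp: H1per_def)

lemma grad_AE: "L2 u \<Longrightarrow> L2 G \<Longrightarrow> weak_grad u G \<Longrightarrow> AE y in MY. grad u y = G y"
  using weak_grad_unique[OF weak_grad_grad _ L2_grad] H1perI by blast

lemma testfn_L2:
  assumes "testfn \<phi>"
  shows "L2 \<phi>" "L2 (pderiv \<phi> j)"
proof -
  have c: "continuous_on UNIV \<phi>" "continuous_on UNIV (pderiv \<phi> j)"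
    using testfn_continuous[OF assms] assms by (auto simp: testfn_def)
  have m: "f \<in> borel_measurable MY" if "continuous_on UNIV f" for f :: "real^3 \<Rightarrow> complex"
    using that by (intro measurable_restrict_space1 measurable_completion) (simp add: borel_measurable_continuous_onI)
  obtain B where "\<And>y. norm (\<phi> y) \<le> B" using periodic_bounded[OF c(1)] assms unfolding testfn_def by metis
  then show "L2 \<phi>" by (intro L2_bounded_measurable[OF m[OF c(1)], of B]) auto
  obtain B where "\<And>y. norm (pderiv \<phi> j y) \<le> B" using periodic_bounded[OF c(2)] testfn_pderiv_periodic[OF assms] by metis
  then show "L2 (pderiv \<phi> j)" by (intro L2_bounded_measurable[OF m[OF c(2)], of B]) auto
qed

lemma L2_mult_integrable: "L2 f \<Longrightarrow> L2 g \<Longrightarrow> integrable MY (\<lambda>y. f y * g y :: complex)"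
  by (rule L2_integrable_bilinear[OF bounded_bilinear_mult])

lemma weak_grad_add:
  assumes "weak_grad u G" "weak_grad v K" "L2 u" "L2 v" "L2 G" "L2 K"
  shows "weak_grad (\<lambda>y. u y + v y) (\<lambda>y. G y + K y)"
  using assms
  by (auto simp: weak_grad_def intY_def distrib_right L2_mult_integrable L2_nth L2_nth2 testfn_L2)

lemma weak_grad_sc:
  assumes "weak_grad u G"
  shows "weak_grad (\<lambda>y. c *s u y) (\<lambda>y. cmul c (G y))"
  using assms by (auto simp: weak_grad_def intY_def cmul_def mult.assoc)

lemma weak_grad_const: "weak_grad (\<lambda>y. c) (\<lambda>y. 0)"
  using intY_pderiv by (auto simp: weak_grad_def) (simp add: intY_def)

lemma H1per_add:
  assumes "H1per u" "H1per v"
  shows "H1per (\<lambda>y. u y + v y)" "AE y in MY. grad (\<lambda>y. u y + v y) y = grad u y + grad v y"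
proof -
  have 1: "L2 (\<lambda>y. u y + v y)" "L2 (\<lambda>y. grad u y + grad v y)"
    using assms H1per_L2 L2_grad by (auto intro: L2_add)
  have 2: "weak_grad (\<lambda>y. u y + v y) (\<lambda>y. grad u y + grad v y)"
    using assms H1per_L2 L2_grad weak_grad_grad by (intro weak_grad_add) auto
  show "H1per (\<lambda>y. u y + v y)" by (rule H1perI[OF 1 2])
  show "AE y in MY. grad (\<lambda>y. u y + v y) y = grad u y + grad v y" by (rule grad_AE[OF 1 2])
qed

lemma L2_sc: "L2 u \<Longrightarrow> L2 (\<lambda>y. c *s u y)" for u :: "real^3 \<Rightarrow> complex^3"
  by (rule L2_bounded_linear[OF CV.lin_sc0])

lemma L2_cmul: "L2 u \<Longrightarrow> L2 (\<lambda>y. cmul c (u y))"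
  by (rule L2_bounded_linear[OF CM.lin_sc0])

lemma H1per_sc:
  assumes "H1per u"
  shows "H1per (\<lambda>y. c *s u y)" "AE y in MY. grad (\<lambda>y. c *s u y) y = cmul c (grad u y)"
proof -
  note * = L2_sc[OF H1per_L2[OF assms], of c] L2_cmul[OF L2_grad[OF assms], of c]
    weak_grad_sc[OF weak_grad_grad[OF assms], of c]
  show "H1per (\<lambda>y. c *s u y)" by (rule H1perI[OF *])
  show "AE y in MY. grad (\<lambda>y. c *s u y) y = cmul c (grad u y)" by (rule grad_AE[OF *])
qed

lemma H1per_const: "H1per (\<lambda>y. c)" "AE y in MY. grad (\<lambda>y. c) y = 0"
  by (rule H1perI[OF L2_const L2_const weak_grad_const]) (rule grad_AE[OF L2_const L2_const weak_grad_const])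

lemma cmul_m1: "cmul (-1) M = - M"
  by (simp add: cmul_def vec_eq_iff)

lemma H1per_diff:
  assumes "H1per u" "H1per v"
  shows "H1per (\<lambda>y. u y - v y)" "AE y in MY. grad (\<lambda>y. u y - v y) y = grad u y - grad v y"
proof -
  have m: "(-1) *s x = - x" for x :: "complex^3" by (simp add: vec_eq_iff)
  note sc = H1per_sc[OF assms(2), of "-1", unfolded m cmul_m1]
  note * = H1per_add[OF assms(1) sc(1)]
  show "H1per (\<lambda>y. u y - v y)" using *(1) by simp
  show "AE y in MY. grad (\<lambda>y. u y - v y) y = grad u y - grad v y"
    using *(2) sc(2) by eventually_elim simp
qed

lemma L2norm_triangle_vec: "L2 u \<Longrightarrow> L2 v \<Longrightarrow> L2norm (\<lambda>y. u y + v y) \<le> L2norm u + L2norm v"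
  for u v :: "real^3 \<Rightarrow> complex^3"
  using CV.L2.nrm_triangle[of u v] by (simp add: CV.nrm_eq plus_fun_def)

lemma L2norm_triangle_mat: "L2 u \<Longrightarrow> L2 v \<Longrightarrow> L2norm (\<lambda>y. u y + v y) \<le> L2norm u + L2norm v"
  for u v :: "real^3 \<Rightarrow> complex^3^3"
  using CM.L2.nrm_triangle[of u v] by (simp add: CM.nrm_eq plus_fun_def)

lemma H1norm_nonneg: "0 \<le> H1norm u" by (simp add: H1norm_def)

lemma L2norm_le_H1norm: "L2norm u \<le> H1norm u" "L2norm (grad u) \<le> H1norm u"
  using L2norm_nonneg by (auto simp: H1norm_def real_le_rsqrt)

lemma H1norm_le: "H1norm u \<le> L2norm u + L2norm (grad u)"
  unfolding H1norm_def using L2norm_nonneg by (intro sqrt_sum_squares_le_sum) auto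

lemma L2norm_grad_cong: "H1per u \<Longrightarrow> L2 G \<Longrightarrow> (AE y in MY. grad u y = G y) \<Longrightarrow> L2norm (grad u) = L2norm G"
  by (intro L2norm_cong_AE) (auto simp: L2_measurable L2_grad)

lemma H1norm_triangle:
  assumes u: "H1per u" and v: "H1per v"
  shows "H1norm (\<lambda>y. u y + v y) \<le> H1norm u + H1norm v"
proof -
  let ?a = "L2norm u" and ?b = "L2norm v" and ?c = "L2norm (grad u)" and ?d = "L2norm (grad v)"
  have 1: "L2norm (\<lambda>y. u y + v y) \<le> ?a + ?b"
    by (intro L2norm_triangle_vec H1per_L2 u v)
  have "L2norm (grad (\<lambda>y. u y + v y)) = L2norm (\<lambda>y. grad u y + grad v y)"
    using H1per_add[OF u v] by (intro L2norm_grad_cong L2_add L2_grad u v)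
  also have "\<dots> \<le> ?c + ?d" by (intro L2norm_triangle_mat L2_grad u v)
  finally have 2: "L2norm (grad (\<lambda>y. u y + v y)) \<le> ?c + ?d" .
  have "H1norm (\<lambda>y. u y + v y) \<le> sqrt ((?a + ?b)\<^sup>2 + (?c + ?d)\<^sup>2)"
    unfolding H1norm_def using 1 2 L2norm_nonneg by (intro real_sqrt_le_mono add_mono power_mono) auto
  also have "\<dots> \<le> H1norm u + H1norm v"
    unfolding H1norm_def by (rule real_sqrt_sum_squares_triangle_ineq)
  finally show ?thesis .
qed

text \<open>The weak gradient is a closed operator: functions and gradients converge separately in
  \<open>L2\<close>, and the defining identity passes to the limit against each fixed test
  function.\<close>

theorem H1_complete:
  fixes x :: "nat \<Rightarrow> real^3 \<Rightarrow> complex^3"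
  assumes x: "\<And>n. H1per (x n)"
    and cauchy: "\<And>\<epsilon>. \<epsilon> > 0 \<Longrightarrow> \<exists>N. \<forall>m\<ge>N. \<forall>n\<ge>N. H1norm (\<lambda>y. x m y - x n y) < \<epsilon>"
  shows "\<exists>u. H1per u \<and> (\<lambda>n. H1norm (\<lambda>y. x n y - u y)) \<longlonglongrightarrow> 0"
proof -
  have gd: "L2norm (grad (\<lambda>y. x m y - x n y)) = L2norm (\<lambda>y. grad (x m) y - grad (x n) y)" for m n
    using H1per_diff[OF x x, of m n] by (intro L2norm_grad_cong L2_diff L2_grad x)
  obtain u where u: "L2 u" "(\<lambda>n. L2norm (\<lambda>y. x n y - u y)) \<longlonglongrightarrow> 0"
  proof -
    have "\<exists>N. \<forall>m\<ge>N. \<forall>n\<ge>N. L2norm (\<lambda>y. x m y - x n y) < \<epsilon>" if "\<epsilon> > 0" for \<epsilon>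
      using cauchy[OF that] L2norm_le_H1norm(1) le_less_trans by blast
    from L2_complete[OF H1per_L2[OF x] this] show ?thesis using that by blast
  qed
  obtain G where G: "L2 G" "(\<lambda>n. L2norm (\<lambda>y. grad (x n) y - G y)) \<longlonglongrightarrow> 0"
  proof -
    have "\<exists>N. \<forall>m\<ge>N. \<forall>n\<ge>N. L2norm (\<lambda>y. grad (x m) y - grad (x n) y) < \<epsilon>" if "\<epsilon> > 0" for \<epsilon>
      using cauchy[OF that] L2norm_le_H1norm(2) le_less_trans unfolding gd[symmetric] by blast
    from L2_complete[OF L2_grad[OF x] this] show ?thesis using that by blast
  qed
  have lim: "(\<lambda>n. intY (\<lambda>y. f n y * \<phi> y)) \<longlonglongrightarrow> intY (\<lambda>y. g y * \<phi> y)"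
    if "\<And>n. L2 (f n)" "L2 g" "L2 \<phi>" "(\<lambda>n. L2norm (\<lambda>y. f n y - g y)) \<longlonglongrightarrow> 0" for f g and \<phi> :: "real^3 \<Rightarrow> complex"
  proof -
    have "(\<lambda>n. intY (\<lambda>y. f n y * \<phi> y) - intY (\<lambda>y. g y * \<phi> y)) \<longlonglongrightarrow> 0"
    proof (rule Lim_null_comparison)
      have "norm (intY (\<lambda>y. f n y * \<phi> y) - intY (\<lambda>y. g y * \<phi> y)) \<le> L2norm (\<lambda>y. f n y - g y) * L2norm \<phi>" for n
      proof -
        have "intY (\<lambda>y. f n y * \<phi> y) - intY (\<lambda>y. g y * \<phi> y) = intY (\<lambda>y. (f n y - g y) * \<phi> y)"
          using that by (simp add: intY_def left_diff_distrib L2_mult_integrable)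
        moreover have "norm (intY (\<lambda>y. (f n y - g y) * \<phi> y)) \<le> 1 * (L2norm (\<lambda>y. f n y - g y) * L2norm \<phi>)"
          by (rule L2_bilinear_bound)
            (use that in \<open>auto simp: norm_mult L2_diff intro!: borel_measurable_integrable L2_mult_integrable\<close>)
        ultimately show ?thesis by simp
      qed
      then show "\<forall>\<^sub>F n in sequentially. norm (intY (\<lambda>y. f n y * \<phi> y) - intY (\<lambda>y. g y * \<phi> y)) \<le> L2norm (\<lambda>y. f n y - g y) * L2norm \<phi>"
        by simp
      show "(\<lambda>n. L2norm (\<lambda>y. f n y - g y) * L2norm \<phi>) \<longlonglongrightarrow> 0"
        using tendsto_mult_left_zero[OF that(4)] by simp
    qed
    then show ?thesis by (simp add: LIM_zero_iff)
  qed
  have comp: "(\<lambda>n. L2norm (\<lambda>y. f n y $ i - g y $ i)) \<longlonglongrightarrow> 0"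
    if "\<And>n. L2 (f n)" "L2 g" "(\<lambda>n. L2norm (\<lambda>y. f n y - g y)) \<longlonglongrightarrow> 0"
    for f and g :: "real^3 \<Rightarrow> ('b::euclidean_space)^3" and i
  proof (rule Lim_null_comparison[OF _ that(3)])
    have "L2norm (\<lambda>y. (f n y - g y) $ i) \<le> 1 * L2norm (\<lambda>y. f n y - g y)" for n
    proof (rule L2norm_mono)
      show "(\<lambda>y. (f n y - g y) $ i) \<in> borel_measurable MY" by (intro L2_measurable L2_nth L2_diff that)
    qed (use that in \<open>auto simp: L2_diff Finite_Cartesian_Product.norm_nth_le simp del: vector_minus_component\<close>)
    then show "\<forall>\<^sub>F n in sequentially. norm (L2norm (\<lambda>y. f n y $ i - g y $ i)) \<le> L2norm (\<lambda>y. f n y - g y)"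
      using L2norm_nonneg by simp
  qed
  have wg: "weak_grad u G"
    unfolding weak_grad_def
  proof (intro allI impI)
    fix \<phi> i j assume \<phi>: "testfn \<phi>"
    have 1: "(\<lambda>n. intY (\<lambda>y. x n y $ i * pderiv \<phi> j y)) \<longlonglongrightarrow> intY (\<lambda>y. u y $ i * pderiv \<phi> j y)"
      by (rule lim[OF L2_nth[OF H1per_L2[OF x]] L2_nth[OF u(1)] testfn_L2(2)[OF \<phi>] comp[OF H1per_L2[OF x] u]])
    have "(\<lambda>n. L2norm (\<lambda>y. grad (x n) y $ i - G y $ i)) \<longlonglongrightarrow> 0"
      by (rule comp[OF L2_grad[OF x] G])
    note 3 = comp[OF L2_nth[OF L2_grad[OF x]] L2_nth[OF G(1)] this]
    have 2: "(\<lambda>n. intY (\<lambda>y. grad (x n) y $ i $ j * \<phi> y)) \<longlonglongrightarrow> intY (\<lambda>y. G y $ i $ j * \<phi> y)"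
      by (rule lim[OF L2_nth2[OF L2_grad[OF x]] L2_nth2[OF G(1)] testfn_L2(1)[OF \<phi>] 3])
    have eq: "intY (\<lambda>y. x n y $ i * pderiv \<phi> j y) = - intY (\<lambda>y. grad (x n) y $ i $ j * \<phi> y)" for n
      using weak_grad_grad[OF x] \<phi> by (simp add: weak_grad_def)
    show "intY (\<lambda>y. u y $ i * pderiv \<phi> j y) = - intY (\<lambda>y. G y $ i $ j * \<phi> y)"
      by (rule LIMSEQ_unique[OF 1[unfolded eq] tendsto_minus[OF 2]])
  qed
  have H: "H1per u" by (rule H1perI[OF u(1) G(1) wg])
  have "L2norm (grad (\<lambda>y. x n y - u y)) = L2norm (\<lambda>y. grad (x n) y - G y)" for n
  proof (rule L2norm_grad_cong)
    show "H1per (\<lambda>y. x n y - u y)" by (rule H1per_diff(1)[OF x H])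
    show "L2 (\<lambda>y. grad (x n) y - G y)" by (intro L2_diff L2_grad x G)
    show "AE y in MY. grad (\<lambda>y. x n y - u y) y = grad (x n) y - G y"
      using H1per_diff(2)[OF x H, of n] grad_AE[OF u(1) G(1) wg] by eventually_elim simp
  qed
  then have "norm (H1norm (\<lambda>y. x n y - u y)) \<le> L2norm (\<lambda>y. x n y - u y) + L2norm (\<lambda>y. grad (x n) y - G y)" for n
    using H1norm_le[of "\<lambda>y. x n y - u y"] H1norm_nonneg by simp
  then have b: "\<forall>\<^sub>F n in sequentially. norm (H1norm (\<lambda>y. x n y - u y))
      \<le> L2norm (\<lambda>y. x n y - u y) + L2norm (\<lambda>y. grad (x n) y - G y)" by simp
  have "(\<lambda>n. H1norm (\<lambda>y. x n y - u y)) \<longlonglongrightarrow> 0"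
    by (rule Lim_null_comparison[OF b]) (use tendsto_add[OF u(2) G(2)] in simp)
  with H show ?thesis by blast
qed

text \<open>The strain twisted by the quasimomentum. At \<open>\<chi>\<^sub>0 = 0\<close> it is the
  plain symmetric gradient, so cell problems and fibre form share their lemmas.\<close>

definition Lam :: "real^3 \<Rightarrow> (real^3 \<Rightarrow> complex^3) \<Rightarrow> real^3 \<Rightarrow> complex^3^3" where
  "Lam \<chi>\<^sub>0 u y = symm (grad u y) + iX \<chi>\<^sub>0 (u y)"

lemma bounded_linear_symm: "bounded_linear symm"
  by (rule linear_conv_bounded_linear[THEN iffD1], rule linearI)
    (auto simp: symm_def vec_eq_iff complex_eq_iff field_simps)

lemma bounded_linear_iX: "bounded_linear (iX \<chi>\<^sub>0)"
  by (rule linear_conv_bounded_linear[THEN iffD1], rule linearI)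
    (auto simp: iX_def cmul_def Xchi_def symm_def vec_eq_iff complex_eq_iff field_simps)

lemma L2_symm_grad: "H1per u \<Longrightarrow> L2 (\<lambda>y. symm (grad u y))"
  by (intro L2_bounded_linear[OF bounded_linear_symm] L2_grad)

lemma L2_iX: "L2 u \<Longrightarrow> L2 (\<lambda>y. iX \<chi>\<^sub>0 (u y))"
  by (rule L2_bounded_linear[OF bounded_linear_iX])

lemma L2_Lam: "H1per u \<Longrightarrow> L2 (Lam \<chi>\<^sub>0 u)"
  unfolding Lam_def[abs_def] by (intro L2_add L2_symm_grad L2_iX H1per_L2)

lemma fc_Lam:
  assumes u: "H1per u" and k: "int_vec k"
  shows "fc (\<lambda>y. Lam \<chi>\<^sub>0 u y $ i $ j) k
     = \<i> / 2 * (complex_of_real ((2 * pi *\<^sub>R k + \<chi>\<^sub>0) $ j) * fc (\<lambda>y. u y $ i) k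
              + complex_of_real ((2 * pi *\<^sub>R k + \<chi>\<^sub>0) $ i) * fc (\<lambda>y. u y $ j) k)"
proof -
  let ?G = "grad u"
  note L = L2_nth2[OF L2_grad[OF u]] L2_nth[OF H1per_L2[OF u]]
  have c: "L2 (\<lambda>y. c * f y)" if "L2 f" for c and f :: "real^3 \<Rightarrow> complex"
    using that by (rule L2_bounded_linear[OF bounded_linear_mult_right])
  have eq: "Lam \<chi>\<^sub>0 u y $ i $ j = (1/2 * ?G y $ i $ j + 1/2 * ?G y $ j $ i)
      + (\<i>/2 * complex_of_real (\<chi>\<^sub>0 $ j) * u y $ i + \<i>/2 * complex_of_real (\<chi>\<^sub>0 $ i) * u y $ j)" for y
    by (simp add: Lam_def symm_def iX_def cmul_def Xchi_def field_simps)
  show ?thesis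
    unfolding eq
    by (simp only: fc_add fc_cmult L c L2_add fc_weak_grad[OF weak_grad_grad[OF u] k])
      (simp add: field_simps)
qed

section \<open>Korn's inequality in Fourier variables\<close>

lemma int_vec_component: "int_vec k \<Longrightarrow> k $ j = 0 \<or> 1 \<le> \<bar>k $ j\<bar>"
  unfolding int_vec_def by (metis Ints_nonzero_abs_ge1)

text \<open>For a nonzero integer \<open>k $ j\<close>, the modulus of \<open>2 * pi * k $ j\<close>
  exceeds \<open>pi * \<bar>k $ j\<bar>\<close> by at least \<open>pi\<close>, and
  \<open>\<chi>\<^sub>0 $ j\<close> takes away at most that. So no shifted frequency is closer to 0
  than \<open>\<chi>\<^sub>0\<close>.\<close>

lemma xi_component:
  assumes "int_vec k" "\<chi>\<^sub>0 \<in> Ydual"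
  shows "\<bar>\<chi>\<^sub>0 $ j\<bar> \<le> \<bar>(2 * pi *\<^sub>R k + \<chi>\<^sub>0) $ j\<bar>" "pi * \<bar>k $ j\<bar> \<le> \<bar>(2 * pi *\<^sub>R k + \<chi>\<^sub>0) $ j\<bar>"
proof -
  have c: "\<bar>\<chi>\<^sub>0 $ j\<bar> \<le> pi" 
  proof -
    have "- pi \<le> \<chi>\<^sub>0 $ j" "\<chi>\<^sub>0 $ j < pi" using assms(2) by (auto simp: Ydual_def)
    then show ?thesis by linarith
  qed
  have "\<bar>2 * pi * k $ j\<bar> \<le> \<bar>(2 * pi *\<^sub>R k + \<chi>\<^sub>0) $ j\<bar> + \<bar>\<chi>\<^sub>0 $ j\<bar>" by simp
  then have t: "2 * (pi * \<bar>k $ j\<bar>) \<le> \<bar>(2 * pi *\<^sub>R k + \<chi>\<^sub>0) $ j\<bar> + \<bar>\<chi>\<^sub>0 $ j\<bar>" by (simp add: abs_mult)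
  show "\<bar>\<chi>\<^sub>0 $ j\<bar> \<le> \<bar>(2 * pi *\<^sub>R k + \<chi>\<^sub>0) $ j\<bar>" and "pi * \<bar>k $ j\<bar> \<le> \<bar>(2 * pi *\<^sub>R k + \<chi>\<^sub>0) $ j\<bar>"
  proof -
    consider "k $ j = 0" | "pi * 1 \<le> pi * \<bar>k $ j\<bar>"
      using int_vec_component[OF assms(1), of j] mult_left_mono[of 1 "\<bar>k $ j\<bar>" pi] by auto
    then have "\<bar>\<chi>\<^sub>0 $ j\<bar> \<le> \<bar>(2 * pi *\<^sub>R k + \<chi>\<^sub>0) $ j\<bar> \<and> pi * \<bar>k $ j\<bar> \<le> \<bar>(2 * pi *\<^sub>R k + \<chi>\<^sub>0) $ j\<bar>"
    proof cases
      case 1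
      then show ?thesis by simp
    next
      case 2
      then show ?thesis using t c by linarith
    qed
    then show "\<bar>\<chi>\<^sub>0 $ j\<bar> \<le> \<bar>(2 * pi *\<^sub>R k + \<chi>\<^sub>0) $ j\<bar>" "pi * \<bar>k $ j\<bar> \<le> \<bar>(2 * pi *\<^sub>R k + \<chi>\<^sub>0) $ j\<bar>" by auto
  qed
qed

text \<open>For real \<open>\<xi>\<close> the right side equals \<open>\<bar>\<xi>\<bar>\<^sup>2
  \<bar>a\<bar>\<^sup>2 / 2 + \<bar>\<xi> \<cdot> a\<bar>\<^sup>2 / 2\<close>. The second summand,
  written through real and imaginary parts of \<open>a\<close>, is dropped.\<close>

lemma Korn_algebra:
  fixes a :: "complex^3" and \<xi> :: "real^3"
  shows "(norm \<xi>)\<^sup>2 * (norm a)\<^sup>2 / 2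
     \<le> (\<Sum>i\<in>UNIV. \<Sum>j\<in>UNIV. (cmod (\<i> / 2 * (complex_of_real (\<xi> $ j) * a $ i + complex_of_real (\<xi> $ i) * a $ j)))\<^sup>2)"
proof -
  have sq: "(cmod (\<i> / 2 * z))\<^sup>2 = ((Re z)\<^sup>2 + (Im z)\<^sup>2) / 4" for z
    by (simp add: norm_mult power_mult_distrib power_divide cmod_power2)
  let ?r = "\<lambda>i. Re (a $ i)" and ?s = "\<lambda>i. Im (a $ i)"
  have "(norm \<xi>)\<^sup>2 * (norm a)\<^sup>2 / 2 + (\<Sum>i\<in>UNIV. \<xi> $ i * ?r i)\<^sup>2 / 2 + (\<Sum>i\<in>UNIV. \<xi> $ i * ?s i)\<^sup>2 / 2
     = (\<Sum>i\<in>UNIV. \<Sum>j\<in>UNIV. (cmod (\<i> / 2 * (complex_of_real (\<xi> $ j) * a $ i + complex_of_real (\<xi> $ i) * a $ j)))\<^sup>2)"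
    unfolding sq norm_vec_sq sum_3 cmod_power2 by (simp add: power2_eq_square field_simps)
  then show ?thesis by (smt (verit) divide_nonneg_nonneg zero_le_power2)
qed

lemma Korn_coeff:
  assumes u: "H1per u" and k: "int_vec k"
  shows "(norm (2 * pi *\<^sub>R k + \<chi>\<^sub>0))\<^sup>2 * (\<Sum>i\<in>UNIV. (cmod (fc (\<lambda>y. u y $ i) k))\<^sup>2)
     \<le> 2 * (\<Sum>i\<in>UNIV. \<Sum>j\<in>UNIV. (cmod (fc (\<lambda>y. Lam \<chi>\<^sub>0 u y $ i $ j) k))\<^sup>2)"
  using Korn_algebra[of "2 * pi *\<^sub>R k + \<chi>\<^sub>0" "\<chi> i. fc (\<lambda>y. u y $ i) k"]
  unfolding fc_Lam[OF u k] by (simp add: norm_vec_sq[of "\<chi> i. fc (\<lambda>y. u y $ i) k"])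

text \<open>All three bounds are summed from \<open>Korn_coeff\<close> by Parseval; the squared
  constants 2, 8 and 2 are rounded up to the squares of 2, 3 and 2.\<close>

theorem Korn:
  assumes u: "H1per u" and \<chi>\<^sub>0: "\<chi>\<^sub>0 \<in> Ydual"
  shows "norm \<chi>\<^sub>0 * L2norm u \<le> 2 * L2norm (Lam \<chi>\<^sub>0 u)"
    and "L2norm (grad u) \<le> 3 * L2norm (Lam \<chi>\<^sub>0 u)"
    and "L2norm (\<lambda>y. u y - meanY u) \<le> 2 * L2norm (Lam \<chi>\<^sub>0 u)"
proof -
  let ?Z = "{k::real^3. int_vec k}"
  let ?u = "\<lambda>k. \<Sum>i\<in>UNIV. (cmod (fc (\<lambda>y. u y $ i) k))\<^sup>2"
  let ?L = "\<lambda>k. \<Sum>i\<in>UNIV. \<Sum>j\<in>UNIV. (cmod (fc (\<lambda>y. Lam \<chi>\<^sub>0 u y $ i $ j) k))\<^sup>2"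
  have PL: "((\<lambda>k. c * ?L k) has_sum (c * (L2norm (Lam \<chi>\<^sub>0 u))\<^sup>2)) ?Z" for c
    by (intro has_sum_cmult_right Parseval_matrix L2_Lam u)
  have u0: "0 \<le> ?u k" for k by (intro sum_nonneg) auto
  have xi: "c * ?u k \<le> 2 * d * ?L k" if "c \<le> d * (norm (2 * pi *\<^sub>R k + \<chi>\<^sub>0))\<^sup>2" "int_vec k" "0 \<le> d" for c d k
  proof -
    have "c * ?u k \<le> d * (norm (2 * pi *\<^sub>R k + \<chi>\<^sub>0))\<^sup>2 * ?u k" using that u0 by (intro mult_right_mono) auto
    also have "\<dots> \<le> d * (2 * ?L k)"
      using mult_left_mono[OF Korn_coeff[OF u that(2), of \<chi>\<^sub>0] that(3)] by (simp add: mult.assoc)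
    finally show ?thesis by simp
  qed
  have comp_le: "(norm x)\<^sup>2 \<le> (norm w)\<^sup>2" if "\<And>j. \<bar>x $ j\<bar> \<le> \<bar>w $ j\<bar>" for x w :: "real^3"
    unfolding norm_vec_sq using that by (intro sum_mono) (simp add: abs_le_square_iff)
  have "(norm \<chi>\<^sub>0)\<^sup>2 * (L2norm u)\<^sup>2 \<le> 2 * (L2norm (Lam \<chi>\<^sub>0 u))\<^sup>2"
  proof (rule has_sum_mono[OF has_sum_cmult_right[OF Parseval_vec[OF H1per_L2[OF u]]] PL])
    fix k assume "k \<in> ?Z"
    then show "(norm \<chi>\<^sub>0)\<^sup>2 * ?u k \<le> 2 * ?L k"
      using xi[of "(norm \<chi>\<^sub>0)\<^sup>2" 1 k] comp_le[of \<chi>\<^sub>0] xi_component(1)[OF _ \<chi>\<^sub>0] by simp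
  qed
  also have "\<dots> \<le> (2 * L2norm (Lam \<chi>\<^sub>0 u))\<^sup>2" by (simp add: power_mult_distrib)
  finally have "(norm \<chi>\<^sub>0 * L2norm u)\<^sup>2 \<le> (2 * L2norm (Lam \<chi>\<^sub>0 u))\<^sup>2" by (simp only: power_mult_distrib)
  then show "norm \<chi>\<^sub>0 * L2norm u \<le> 2 * L2norm (Lam \<chi>\<^sub>0 u)" by (rule power2_le_imp_le) simp
  have "(L2norm (grad u))\<^sup>2 \<le> 8 * (L2norm (Lam \<chi>\<^sub>0 u))\<^sup>2"
  proof (rule has_sum_mono[OF Parseval_matrix[OF L2_grad[OF u]] PL])
    fix k assume k: "k \<in> ?Z"
    have "(\<Sum>i\<in>UNIV. \<Sum>j\<in>UNIV. (cmod (fc (\<lambda>y. grad u y $ i $ j) k))\<^sup>2) = (norm (2 * pi *\<^sub>R k))\<^sup>2 * ?u k"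
    proof -
      have "(cmod (fc (\<lambda>y. grad u y $ i $ j) k))\<^sup>2 = (norm ((2 * pi *\<^sub>R k) $ j))\<^sup>2 * (cmod (fc (\<lambda>y. u y $ i) k))\<^sup>2" for i j
        using fc_weak_grad[OF weak_grad_grad[OF u], of k i j] k by (simp add: norm_mult power_mult_distrib)
      then show ?thesis
        unfolding norm_vec_sq[of "2 * pi *\<^sub>R k"] sum_product by (subst sum.swap) simp
    qed
    \<comment> \<open>Componentwise the frequency is at most twice the shifted frequency; the
      resulting 4 times the 2 of \<open>Korn_coeff\<close> is the 8.\<close>
    moreover have "(norm (2 * pi *\<^sub>R k))\<^sup>2 \<le> (norm (2 *\<^sub>R (2 * pi *\<^sub>R k + \<chi>\<^sub>0)))\<^sup>2"
    proof (rule comp_le)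
      fix j
      have "\<bar>(2 *\<^sub>R (2 * pi *\<^sub>R k + \<chi>\<^sub>0)) $ j\<bar> = 2 * \<bar>(2 * pi *\<^sub>R k + \<chi>\<^sub>0) $ j\<bar>"
        by (simp only: vector_scaleR_component real_scaleR_def abs_mult abs_numeral)
      moreover have "\<bar>(2 * pi *\<^sub>R k) $ j\<bar> = 2 * (pi * \<bar>k $ j\<bar>)" by (simp add: abs_mult)
      ultimately show "\<bar>(2 * pi *\<^sub>R k) $ j\<bar> \<le> \<bar>(2 *\<^sub>R (2 * pi *\<^sub>R k + \<chi>\<^sub>0)) $ j\<bar>"
        using xi_component(2)[OF _ \<chi>\<^sub>0, of k j] k by simp
    qed
    ultimately show "(\<Sum>i\<in>UNIV. \<Sum>j\<in>UNIV. (cmod (fc (\<lambda>y. grad u y $ i $ j) k))\<^sup>2) \<le> 8 * ?L k"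
      using xi[of "(norm (2 * pi *\<^sub>R k))\<^sup>2" 4 k] k by (simp add: power_mult_distrib)
  qed
  also have "\<dots> \<le> (3 * L2norm (Lam \<chi>\<^sub>0 u))\<^sup>2" by (simp add: power_mult_distrib)
  finally show "L2norm (grad u) \<le> 3 * L2norm (Lam \<chi>\<^sub>0 u)"
    by (rule power2_le_imp_le) simp
  let ?m = "meanY u"
  have Lm: "L2 (\<lambda>y. u y - ?m)" by (intro L2_diff H1per_L2 u L2_const)
  have "(L2norm (\<lambda>y. u y - ?m))\<^sup>2 \<le> 2 * (L2norm (Lam \<chi>\<^sub>0 u))\<^sup>2"
  proof (rule has_sum_mono[OF Parseval_vec[OF Lm] PL])
    fix k assume k: "k \<in> ?Z"
    \<comment> \<open>Subtracting the mean removes exactly the frequency 0, the only one whose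
      shifted frequency can be small.\<close>
    have fcm: "fc (\<lambda>y. (u y - ?m) $ i) k = (if k = 0 then 0 else fc (\<lambda>y. u y $ i) k)" for i
    proof -
      have "fc (\<lambda>y. (u y - ?m) $ i) k = fc (\<lambda>y. u y $ i) k - fc (\<lambda>y. ?m $ i) k"
        using fc_diff[OF L2_nth[OF H1per_L2[OF u], of i] L2_const[of "?m $ i"], of k] by simp
      then show ?thesis
        using k intY_nth[OF L2_integrable[OF H1per_L2[OF u]]] by (auto simp: fc_const fc_0 meanY_def)
    qed
    show "(\<Sum>i\<in>UNIV. (cmod (fc (\<lambda>y. (u y - ?m) $ i) k))\<^sup>2) \<le> 2 * ?L k"
    proof (cases "k = 0")
      case True
      then show ?thesis unfolding fcm by (simp add: sum_nonneg)
    next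
      case False
      then obtain j where "k $ j \<noteq> 0" by (metis vec_eq_iff zero_index)
      then have "1 \<le> \<bar>k $ j\<bar>" using int_vec_component k by blast
      then have "1 * 1 \<le> pi * \<bar>k $ j\<bar>" using pi_gt3 by (intro mult_mono) auto
      also have "\<dots> \<le> \<bar>(2 * pi *\<^sub>R k + \<chi>\<^sub>0) $ j\<bar>" using xi_component(2)[OF _ \<chi>\<^sub>0] k by simp
      also have "\<dots> \<le> norm (2 * pi *\<^sub>R k + \<chi>\<^sub>0)" using component_le_norm_cart by blast
      finally have "1 \<le> (norm (2 * pi *\<^sub>R k + \<chi>\<^sub>0))\<^sup>2" by simp
      then show ?thesis using xi[of 1 1 k] k False unfolding fcm by simp
    qed
  qed
  also have "\<dots> \<le> (2 * L2norm (Lam \<chi>\<^sub>0 u))\<^sup>2" by (simp add: power_mult_distrib)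
  finally show "L2norm (\<lambda>y. u y - ?m) \<le> 2 * L2norm (Lam \<chi>\<^sub>0 u)"
    by (rule power2_le_imp_le) simp
qed

section \<open>The elasticity form\<close>

lemma norm_matrix_le_sum: "norm (M :: complex^3^3) \<le> (\<Sum>i\<in>UNIV. \<Sum>j\<in>UNIV. cmod (M $ i $ j))"
proof -
  have 1: "norm x \<le> (\<Sum>i\<in>UNIV. norm (x $ i))" for x :: "('b::real_normed_vector)^3"
    unfolding norm_vec_def by (rule L2_set_le_sum) simp
  have "norm M \<le> (\<Sum>i\<in>UNIV. norm (M $ i))" by (rule 1)
  also have "\<dots> \<le> (\<Sum>i\<in>UNIV. \<Sum>j\<in>UNIV. cmod (M $ i $ j))" by (intro sum_mono 1)
  finally show ?thesis .
qed

lemma entry_le_norm: "cmod (M $ k $ l) \<le> norm (M :: complex^3^3)"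
  by (rule order_trans[OF Finite_Cartesian_Product.norm_nth_le Finite_Cartesian_Product.norm_nth_le])

text \<open>A crude count: nine entries, each a sum of nine products.\<close>

lemma tappc_bound:
  assumes "\<And>i k j l. \<bar>T i k j l\<bar> \<le> B"
  shows "norm (tappc T M) \<le> 81 * B * norm M"
proof -
  have B: "0 \<le> B" using assms[of 0 0 0 0] by linarith
  have "cmod (tappc T M $ i $ j) \<le> 9 * B * norm M" for i j
  proof -
    have "cmod (tappc T M $ i $ j) \<le> (\<Sum>k\<in>UNIV. cmod (\<Sum>l\<in>UNIV. complex_of_real (T i k j l) * M $ k $ l))"
      by (simp only: tappc_def vec_lambda_beta norm_sum)
    also have "\<dots> \<le> (\<Sum>k\<in>UNIV. \<Sum>l\<in>UNIV. cmod (complex_of_real (T i k j l) * M $ k $ l))"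
      by (intro sum_mono norm_sum)
    also have "\<dots> \<le> (\<Sum>k\<in>(UNIV::3 set). \<Sum>l\<in>(UNIV::3 set). B * norm M)"
      using assms entry_le_norm B by (intro sum_mono) (auto simp: norm_mult intro!: mult_mono)
    finally show ?thesis by simp
  qed
  then have "(\<Sum>i\<in>UNIV. \<Sum>j\<in>UNIV. cmod (tappc T M $ i $ j)) \<le> (\<Sum>i\<in>(UNIV::3 set). \<Sum>j\<in>(UNIV::3 set). 9 * B * norm M)"
    by (intro sum_mono)
  then show ?thesis using norm_matrix_le_sum[of "tappc T M"] by simp
qed

lemma linear_tappc: "linear (tappc T)"
  by (rule linearI) (auto simp: tappc_def vec_eq_iff distrib_left sum.distrib scaleR_sum_right)

lemma tappc_cmul: "tappc T (cmul c M) = cmul c (tappc T M)"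
  by (simp add: tappc_def cmul_def vec_eq_iff sum_distrib_left mult_ac)

lemma frob_tappc: "frob (tappc T M) N = (\<Sum>i\<in>UNIV. \<Sum>j\<in>UNIV. \<Sum>k\<in>UNIV. \<Sum>l\<in>UNIV. complex_of_real (T i k j l) * M$k$l * cnj (N$i$j))"
  by (simp add: frob_def tappc_def sum_distrib_right)

text \<open>The major symmetry exchanges the index pairs \<open>(i, j)\<close> and
  \<open>(k, l)\<close>; the steps reorder the four sums accordingly.\<close>

lemma frob_tappc_hermitian:
  assumes "tensor_symmetric T"
  shows "frob (tappc T N) M = cnj (frob (tappc T M) N)"
proof -
  have T: "T i k j l = T k i l j" for i k j l using assms unfolding tensor_symmetric_def by blast
  have "frob (tappc T N) M = (\<Sum>i\<in>UNIV. \<Sum>j\<in>UNIV. \<Sum>k\<in>UNIV. \<Sum>l\<in>UNIV. complex_of_real (T i k j l) * N$k$l * cnj (M$i$j))"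
    by (rule frob_tappc)
  also have "\<dots> = (\<Sum>i\<in>UNIV. \<Sum>k\<in>UNIV. \<Sum>j\<in>UNIV. \<Sum>l\<in>UNIV. complex_of_real (T i k j l) * N$k$l * cnj (M$i$j))"
    by (intro sum.cong refl sum.swap)
  also have "\<dots> = (\<Sum>k\<in>UNIV. \<Sum>i\<in>UNIV. \<Sum>j\<in>UNIV. \<Sum>l\<in>UNIV. complex_of_real (T i k j l) * N$k$l * cnj (M$i$j))"
    by (rule sum.swap)
  also have "\<dots> = (\<Sum>k\<in>UNIV. \<Sum>i\<in>UNIV. \<Sum>l\<in>UNIV. \<Sum>j\<in>UNIV. complex_of_real (T i k j l) * N$k$l * cnj (M$i$j))"
    by (intro sum.cong refl sum.swap)
  also have "\<dots> = (\<Sum>k\<in>UNIV. \<Sum>l\<in>UNIV. \<Sum>i\<in>UNIV. \<Sum>j\<in>UNIV. complex_of_real (T i k j l) * N$k$l * cnj (M$i$j))"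
    by (intro sum.cong refl sum.swap)
  also have "\<dots> = (\<Sum>i\<in>UNIV. \<Sum>j\<in>UNIV. \<Sum>k\<in>UNIV. \<Sum>l\<in>UNIV. complex_of_real (T i k j l) * N$i$j * cnj (M$k$l))"
    by (intro sum.cong refl) (subst T, rule refl)
  also have "\<dots> = cnj (frob (tappc T M) N)"
    by (simp add: frob_tappc mult_ac)
  finally show ?thesis .
qed

lemma symm_sym: "symm M $ i $ j = symm M $ j $ i"
  by (simp add: symm_def add.commute)

lemma iX_sym: "iX \<chi>\<^sub>0 c $ i $ j = iX \<chi>\<^sub>0 c $ j $ i"
  by (simp add: iX_def cmul_def Xchi_def symm_def add.commute)

lemma Lam_sym: "Lam \<chi>\<^sub>0 u y $ i $ j = Lam \<chi>\<^sub>0 u y $ j $ i"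
  by (simp add: Lam_def symm_sym[of _ i j] iX_sym[of _ _ i j])

lemma symm_id: "(\<And>i j. M $ i $ j = M $ j $ i) \<Longrightarrow> symm M = M"
  by (simp add: symm_def vec_eq_iff)

lemma iX_0: "iX 0 c = 0"
  by (simp add: iX_def cmul_def Xchi_def symm_def vec_eq_iff)

lemma Lam_0: "Lam 0 u y = symm (grad u y)"
  by (simp add: Lam_def iX_0)

lemma Lam_split: "Lam \<chi>\<^sub>0 u y = Lam 0 u y + iX \<chi>\<^sub>0 (u y)"
  by (simp add: Lam_def iX_0)

text \<open>Each entry is the mean of two entries of \<open>M\<close>, and the square is
  convex.\<close>

lemma symm_norm: "norm (symm M) \<le> norm M"
proof -
  have "(cmod ((a + b) / 2))\<^sup>2 \<le> ((cmod a)\<^sup>2 + (cmod b)\<^sup>2) / 2" for a b :: complex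
  proof -
    have "(cmod (a + b))\<^sup>2 \<le> (cmod a + cmod b)\<^sup>2" by (intro power_mono norm_triangle_ineq) auto
    also have "\<dots> \<le> 2 * ((cmod a)\<^sup>2 + (cmod b)\<^sup>2)" using sum_squares_bound[of "cmod a" "cmod b"] by (simp add: power2_sum)
    finally show ?thesis by (simp add: norm_divide power_divide)
  qed
  then have "(norm (symm M))\<^sup>2 \<le> (\<Sum>i\<in>UNIV. \<Sum>j\<in>UNIV. ((cmod (M$i$j))\<^sup>2 + (cmod (M$j$i))\<^sup>2) / 2)"
    unfolding norm_matrix_sq symm_def by (intro sum_mono) simp
  also have "\<dots> = (\<Sum>i\<in>UNIV. \<Sum>j\<in>UNIV. (cmod (M$i$j))\<^sup>2 / 2) + (\<Sum>i\<in>UNIV. \<Sum>j\<in>UNIV. (cmod (M$j$i))\<^sup>2 / 2)"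
    by (simp add: add_divide_distrib sum.distrib)
  also have "(\<Sum>i\<in>UNIV. \<Sum>j\<in>UNIV. (cmod (M$j$i))\<^sup>2 / 2) = (\<Sum>i\<in>UNIV. \<Sum>j\<in>UNIV. (cmod (M$i$j))\<^sup>2 / 2)"
    by (rule sum.swap)
  also have "(\<Sum>i\<in>UNIV. \<Sum>j\<in>UNIV. (cmod (M$i$j))\<^sup>2 / 2) + (\<Sum>i\<in>UNIV. \<Sum>j\<in>UNIV. (cmod (M$i$j))\<^sup>2 / 2) = (norm M)\<^sup>2"
    unfolding norm_matrix_sq by (simp flip: sum_divide_distrib)
  finally show ?thesis by (rule power2_le_imp_le) simp
qed

lemma iX_norm: "norm (iX \<chi>\<^sub>0 c) \<le> norm \<chi>\<^sub>0 * norm c"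
proof -
  let ?M = "(\<chi> i j. c$i * complex_of_real (\<chi>\<^sub>0$j)) :: complex^3^3"
  have "(norm (iX \<chi>\<^sub>0 c))\<^sup>2 = (norm (symm ?M))\<^sup>2"
    unfolding norm_matrix_sq by (simp add: iX_def cmul_def Xchi_def norm_mult)
  then have "norm (iX \<chi>\<^sub>0 c) = norm (symm ?M)" by (simp add: power2_eq_iff_nonneg)
  also have "\<dots> \<le> norm ?M" by (rule symm_norm)
  also have "norm ?M = norm \<chi>\<^sub>0 * norm c"
  proof -
    have "(norm ?M)\<^sup>2 = (norm c)\<^sup>2 * (norm \<chi>\<^sub>0)\<^sup>2"
      unfolding norm_matrix_sq norm_vec_sq[of c] norm_vec_sq[of \<chi>\<^sub>0] sum_product
      by (simp add: norm_mult power_mult_distrib)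
    then have "(norm ?M)\<^sup>2 = (norm \<chi>\<^sub>0 * norm c)\<^sup>2" by (simp add: power_mult_distrib)
    then show ?thesis by (simp add: power2_eq_iff_nonneg)
  qed
  finally show ?thesis .
qed

lemma L2norm_iX:
  assumes "L2 u"
  shows "L2norm (\<lambda>y. iX \<chi>\<^sub>0 (u y)) \<le> norm \<chi>\<^sub>0 * L2norm u"
  by (rule L2norm_mono[OF assms L2_measurable[OF L2_iX[OF assms]]]) (auto simp: iX_norm)

lemma iX_add: "iX \<chi>\<^sub>0 (c + d) = iX \<chi>\<^sub>0 c + iX \<chi>\<^sub>0 d"
  and iX_diff: "iX \<chi>\<^sub>0 (c - d) = iX \<chi>\<^sub>0 c - iX \<chi>\<^sub>0 d"
  using bounded_linear_iX[THEN bounded_linear.linear] by (auto simp: linear_add linear_diff)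

lemma iX_sc: "iX \<chi>\<^sub>0 (a *s c) = cmul a (iX \<chi>\<^sub>0 c)"
  by (simp add: iX_def cmul_def Xchi_def symm_def vec_eq_iff field_simps)

lemma symm_add: "symm (M + N) = symm M + symm N" and symm_diff: "symm (M - N) = symm M - symm N"
  using bounded_linear_symm[THEN bounded_linear.linear] by (auto simp: linear_add linear_diff)

lemma symm_cmul: "symm (cmul c M) = cmul c (symm M)"
  by (simp add: cmul_def symm_def vec_eq_iff field_simps)

lemma cmul_add: "cmul c (M + N) = cmul c M + cmul c N"
  by (simp add: cmul_def vec_eq_iff distrib_left)

lemma Lam_add:
  assumes "H1per u" "H1per v"
  shows "AE y in MY. Lam \<chi>\<^sub>0 (\<lambda>y. u y + v y) y = Lam \<chi>\<^sub>0 u y + Lam \<chi>\<^sub>0 v y"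
  using H1per_add(2)[OF assms] by eventually_elim (simp add: Lam_def symm_add iX_add)

lemma Lam_diff:
  assumes "H1per u" "H1per v"
  shows "AE y in MY. Lam \<chi>\<^sub>0 (\<lambda>y. u y - v y) y = Lam \<chi>\<^sub>0 u y - Lam \<chi>\<^sub>0 v y"
  using H1per_diff(2)[OF assms] by eventually_elim (simp add: Lam_def symm_diff iX_diff)

lemma Lam_sc:
  assumes "H1per u"
  shows "AE y in MY. Lam \<chi>\<^sub>0 (\<lambda>y. c *s u y) y = cmul c (Lam \<chi>\<^sub>0 u y)"
  using H1per_sc(2)[OF assms, of c] by eventually_elim (simp add: Lam_def symm_cmul iX_sc cmul_add)

lemma Lam_const: "AE y in MY. Lam \<chi>\<^sub>0 (\<lambda>y. c) y = iX \<chi>\<^sub>0 c"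
  using H1per_const(2)[of c] by eventually_elim (simp add: Lam_def symm_def vec_eq_iff)

lemma Lam_H1norm:
  assumes "H1per u"
  shows "L2norm (Lam \<chi>\<^sub>0 u) \<le> (1 + norm \<chi>\<^sub>0) * H1norm u"
proof -
  have "L2norm (Lam \<chi>\<^sub>0 u) \<le> L2norm (\<lambda>y. symm (grad u y)) + L2norm (\<lambda>y. iX \<chi>\<^sub>0 (u y))"
    unfolding Lam_def[abs_def] by (intro L2norm_triangle_mat L2_symm_grad L2_iX H1per_L2 assms)
  also have "L2norm (\<lambda>y. symm (grad u y)) \<le> 1 * L2norm (grad u)"
    by (rule L2norm_mono[OF L2_grad[OF assms] L2_measurable[OF L2_symm_grad[OF assms]]]) (auto simp: symm_norm)
  also have "\<dots> \<le> H1norm u" using L2norm_le_H1norm by simp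
  also have "L2norm (\<lambda>y. iX \<chi>\<^sub>0 (u y)) \<le> norm \<chi>\<^sub>0 * L2norm u" by (intro L2norm_iX H1per_L2 assms)
  also have "\<dots> \<le> norm \<chi>\<^sub>0 * H1norm u" using L2norm_le_H1norm by (intro mult_left_mono) auto
  finally show ?thesis by (simp add: algebra_simps)
qed

section \<open>The energy form of a fixed admissible tensor\<close>

locale elasticity =
  fixes A :: tensor_field and \<nu> :: real
  assumes adm: "admissible_tensor A \<nu>"
begin

lemma \<nu>_pos: "0 < \<nu>" using adm by (simp add: admissible_tensor_def)

lemma A_sym: "tensor_symmetric (A y)" using adm by (simp add: admissible_tensor_def)

text \<open>An operator bound for \<open>tapp A y\<close>, uniform in \<open>y\<close>. All further
  constants are built from it and \<open>\<nu>\<close>, which is why the final constant is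
  independent of \<open>\<chi>\<^sub>0\<close> and \<open>z\<close>.\<close>

definition KA :: real where
  "KA = 81 * (SOME B. 0 \<le> B \<and> (\<forall>y i k j l. \<bar>A y i k j l\<bar> \<le> B))"

lemma KA: "0 \<le> KA" "norm (tapp A y M) \<le> KA * norm M"
proof -
  obtain B where B: "\<bar>A y i k j l\<bar> \<le> B" for y i k j l using adm by (auto simp: admissible_tensor_def)
  have "0 \<le> B" using B[of 0 0 0 0 0] by linarith
  then have "\<exists>B. 0 \<le> B \<and> (\<forall>y i k j l. \<bar>A y i k j l\<bar> \<le> B)" using B by blast
  from someI_ex[OF this] show "0 \<le> KA" "norm (tapp A y M) \<le> KA * norm M"
    using tappc_bound[of "A y" _ M] by (auto simp: KA_def tapp_def)
qed

lemma tapp_L2: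
  assumes "L2 P"
  shows "L2 (\<lambda>y. tapp A y (P y))"
proof (rule L2_bound[OF _ assms])
  have mA: "(\<lambda>y. complex_of_real (A y i k j l)) \<in> borel_measurable MY" for i k j l
  proof -
    have "(\<lambda>y. A y i k j l) \<in> borel_measurable lebesgue" using adm by (simp add: admissible_tensor_def)
    note [measurable] = measurable_restrict_space1[OF this, of Ycell]
    show ?thesis by measurable
  qed
  have mP: "(\<lambda>y. P y $ k $ l) \<in> borel_measurable MY" for k l by (intro L2_measurable L2_nth2 assms)
  have "(\<lambda>y. tapp A y (P y) $ i $ j) \<in> borel_measurable MY" for i j
    unfolding tapp_def tappc_def by (simp, intro borel_measurable_sum borel_measurable_times mA mP)
  then have comp: "(\<lambda>y. tapp A y (P y) $ i $ j \<bullet> b) \<in> borel_measurable MY" for i j b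
    by (intro borel_measurable_inner) auto
  show "(\<lambda>y. tapp A y (P y)) \<in> borel_measurable MY"
  proof (subst borel_measurable_euclidean_space, intro ballI)
    fix b :: "complex^3^3" assume "b \<in> Basis"
    then obtain i j c where "b = axis i (axis j c)" by (auto simp: Basis_vec_def)
    then show "(\<lambda>y. tapp A y (P y) \<bullet> b) \<in> borel_measurable MY"
      using comp[of i j c] by (simp add: inner_axis)
  qed
  show "AE y in MY. norm (tapp A y (P y)) \<le> KA * norm (P y)" by (intro AE_I2 KA)
qed

text \<open>The energy is defined on matrix fields rather than on displacements, because residuals
  contain fields such as \<open>iX\<close> of a corrector, which are not strains.\<close>

definition aA :: "(real^3 \<Rightarrow> complex^3^3) \<Rightarrow> (real^3 \<Rightarrow> complex^3^3) \<Rightarrow> complex" where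
  "aA P Q = intY (\<lambda>y. frob (tapp A y (P y)) (Q y))"

lemma aA_ipf: "aA P Q = CM.ipf (\<lambda>y. tapp A y (P y)) Q"
  by (simp add: aA_def CM.ipf_def)

lemma tapp_add: "tapp A y (M + N) = tapp A y M + tapp A y N"
  using linear_tappc[of "A y"] by (simp add: tapp_def linear_add)

lemma tapp_cmul: "tapp A y (cmul c M) = cmul c (tapp A y M)"
  by (simp add: tapp_def tappc_cmul)

lemma aA_bound: "L2 P \<Longrightarrow> L2 Q \<Longrightarrow> cmod (aA P Q) \<le> KA * (L2norm P * L2norm Q)"
proof -
  assume P: "L2 P" and Q: "L2 Q"
  have "cmod (aA P Q) \<le> L2norm (\<lambda>y. tapp A y (P y)) * L2norm Q"
    unfolding aA_ipf using CM.L2.Cauchy_Schwarz[of "\<lambda>y. tapp A y (P y)" Q] tapp_L2[OF P] Q by (simp add: CM.nrm_eq)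
  also have "L2norm (\<lambda>y. tapp A y (P y)) \<le> KA * L2norm P"
    by (rule L2norm_mono[OF P L2_measurable[OF tapp_L2[OF P]]]) (auto simp: KA)
  finally show ?thesis by (simp add: mult_right_mono mult.assoc)
qed

lemma aA_cong:
  assumes "L2 P" "L2 P'" "L2 Q" "L2 Q'" "AE y in MY. P y = P' y" "AE y in MY. Q y = Q' y"
  shows "aA P Q = aA P' Q'"
  unfolding aA_def
proof (rule intY_cong_AE)
  show "(\<lambda>y. frob (tapp A y (P y)) (Q y)) \<in> borel_measurable MY" "(\<lambda>y. frob (tapp A y (P' y)) (Q' y)) \<in> borel_measurable MY"
    using assms by (intro borel_measurable_integrable CM.ip0_integrable tapp_L2; simp)+
  show "AE y in MY. frob (tapp A y (P y)) (Q y) = frob (tapp A y (P' y)) (Q' y)"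
    using assms(5,6) by eventually_elim simp
qed

lemma aA_add_left: "L2 P \<Longrightarrow> L2 P' \<Longrightarrow> L2 Q \<Longrightarrow> aA (\<lambda>y. P y + P' y) Q = aA P Q + aA P' Q"
  unfolding aA_ipf tapp_add
  using CM.L2.ip_add[of "\<lambda>y. tapp A y (P y)" "\<lambda>y. tapp A y (P' y)" Q] by (simp add: tapp_L2 plus_fun_def)

lemma aA_cmul_left: "L2 P \<Longrightarrow> L2 Q \<Longrightarrow> aA (\<lambda>y. cmul c (P y)) Q = c * aA P Q"
  unfolding aA_ipf tapp_cmul
  using CM.L2.ip_sc[of "\<lambda>y. tapp A y (P y)" Q c] by (simp add: tapp_L2 CM.scf_def)

lemma aA_hermitian: "L2 P \<Longrightarrow> L2 Q \<Longrightarrow> aA Q P = cnj (aA P Q)"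
  unfolding aA_def tapp_def
  by (subst frob_tappc_hermitian[OF A_sym]) (simp add: intY_def)

lemma aA_add_right: "L2 P \<Longrightarrow> L2 Q \<Longrightarrow> L2 Q' \<Longrightarrow> aA P (\<lambda>y. Q y + Q' y) = aA P Q + aA P Q'"
  using aA_hermitian[of "\<lambda>y. Q y + Q' y" P] aA_add_left[of Q Q' P] aA_hermitian[of Q P] aA_hermitian[of Q' P] L2_add[of Q Q']
  by simp

lemma aA_cmul_right: "L2 P \<Longrightarrow> L2 Q \<Longrightarrow> aA P (\<lambda>y. cmul c (Q y)) = cnj c * aA P Q"
  using aA_hermitian[of "\<lambda>y. cmul c (Q y)" P] aA_cmul_left[of Q P] aA_hermitian[of Q P] L2_cmul[of Q]
  by simp

lemma aA_minus_left: "L2 P \<Longrightarrow> L2 Q \<Longrightarrow> aA (\<lambda>y. - P y) Q = - aA P Q"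
  using aA_cmul_left[of P Q "-1"] by (simp add: cmul_m1)

lemma L2_uminus: "L2 P \<Longrightarrow> L2 (\<lambda>y. - P y :: 'b::euclidean_space)"
  by (rule L2_bounded_linear[OF bounded_linear_minus[OF bounded_linear_ident]])

lemma aA_diff_left: "L2 P \<Longrightarrow> L2 P' \<Longrightarrow> L2 Q \<Longrightarrow> aA (\<lambda>y. P y - P' y) Q = aA P Q - aA P' Q"
  using aA_add_left[of P "\<lambda>y. - P' y" Q] aA_minus_left[of P' Q] L2_uminus[of P'] by simp

text \<open>\<open>A\<close> is real, so the real part of the Hermitian form at \<open>M\<close> is
  the sum of the real quadratic forms at the real and imaginary parts of \<open>M\<close>, and
  ellipticity applies to each.\<close>

lemma tapp_coercive:
  assumes "\<And>i j. M $ i $ j = M $ j $ i"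
  shows "\<nu> * (norm M)\<^sup>2 \<le> Re (frob (tapp A y M) M)"
proof -
  let ?q = "\<lambda>X :: real^3^3. \<Sum>i\<in>UNIV. \<Sum>j\<in>UNIV. \<Sum>k\<in>UNIV. \<Sum>l\<in>UNIV. A y i k j l * X$k$l * X$i$j"
  let ?R = "\<chi> i j. Re (M $ i $ j)" and ?I = "\<chi> i j. Im (M $ i $ j)"
  have co: "\<nu> * (norm X)\<^sup>2 \<le> ?q X" if "Finite_Cartesian_Product.transpose X = X" for X
    by (rule adm[unfolded admissible_tensor_def, THEN conjunct2, THEN conjunct2, THEN conjunct2, THEN conjunct2,
        THEN conjunct2, THEN spec, THEN spec, THEN mp, OF that, THEN conjunct1])
  have "Finite_Cartesian_Product.transpose ?R = ?R"
    by (simp add: transpose_def vec_eq_iff) (intro allI arg_cong[where f=Re] assms)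
  moreover have "Finite_Cartesian_Product.transpose ?I = ?I"
    by (simp add: transpose_def vec_eq_iff) (intro allI arg_cong[where f=Im] assms)
  ultimately have tr: "Finite_Cartesian_Product.transpose ?R = ?R" "Finite_Cartesian_Product.transpose ?I = ?I"
    by blast+
  note co[OF tr(1)] co[OF tr(2)]
  moreover have "Re (frob (tapp A y M) M) = ?q ?R + ?q ?I"
  proof -
    have "Re (frob (tapp A y M) M) = (\<Sum>i\<in>UNIV. \<Sum>j\<in>UNIV. \<Sum>k\<in>UNIV. \<Sum>l\<in>UNIV.
        A y i k j l * Re (M$k$l) * Re (M$i$j) + A y i k j l * Im (M$k$l) * Im (M$i$j))"
      unfolding tapp_def frob_tappc Re_sum by (intro sum.cong refl) (simp add: algebra_simps)
    then show ?thesis by (simp add: sum.distrib)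
  qed
  moreover have "(norm M)\<^sup>2 = (norm ?R)\<^sup>2 + (norm ?I)\<^sup>2"
    unfolding norm_matrix_sq norm_vec_sq[of ?R] norm_vec_sq[of ?I] norm_vec_sq[of "?R $ _"] norm_vec_sq[of "?I $ _"]
    by (simp add: cmod_power2 sum.distrib)
  ultimately show ?thesis by (simp add: distrib_left)
qed

lemma aA_coercive:
  assumes "L2 P" "\<And>y i j. P y $ i $ j = P y $ j $ i"
  shows "\<nu> * (L2norm P)\<^sup>2 \<le> Re (aA P P)"
proof -
  have int: "integrable MY (\<lambda>y. frob (tapp A y (P y)) (P y))"
    by (intro CM.ip0_integrable tapp_L2 assms)
  have "\<nu> * (L2norm P)\<^sup>2 = intY (\<lambda>y. \<nu> * (norm (P y))\<^sup>2)" by (simp add: L2norm_sq intY_def)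
  also have "\<dots> \<le> intY (\<lambda>y. Re (frob (tapp A y (P y)) (P y)))"
    unfolding intY_def
  proof (rule integral_mono)
    show "integrable MY (\<lambda>y. \<nu> * (norm (P y))\<^sup>2)" by (intro integrable_mult_right L2_sq assms)
    show "integrable MY (\<lambda>y. Re (frob (tapp A y (P y)) (P y)))" using int by (rule integrable_Re)
  qed (rule tapp_coercive[OF assms(2)])
  also have "\<dots> = Re (aA P P)"
    unfolding aA_def intY_def using int by (simp add: integral_Re)
  finally show ?thesis .
qed

lemma aform_eq: "aform A \<chi>\<^sub>0 u v = aA (Lam \<chi>\<^sub>0 u) (Lam \<chi>\<^sub>0 v)"
  by (simp add: aform_def aA_def Lam_def)

end

section \<open>Cell problems\<close>

lemma zero_Ydual: "0 \<in> Ydual"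
  by (simp add: Ydual_def)

lemma meanY_add: "L2 u \<Longrightarrow> L2 v \<Longrightarrow> meanY (\<lambda>y. u y + v y) = meanY u + meanY v"
  by (simp add: meanY_def intY_def L2_integrable)

lemma meanY_diff: "L2 u \<Longrightarrow> L2 v \<Longrightarrow> meanY (\<lambda>y. u y - v y) = meanY u - meanY v"
  by (simp add: meanY_def intY_def L2_integrable)

lemma meanY_sc: "L2 u \<Longrightarrow> meanY (\<lambda>y. c *s u y) = c *s meanY u"
  unfolding meanY_def intY_def
  by (rule integral_bounded_linear[OF CV.lin_sc0]) (rule L2_integrable)

lemma meanY_const: "meanY (\<lambda>y. c) = c"
  by (simp add: meanY_def intY_const)

lemma l2inner_const_left: "L2 v \<Longrightarrow> l2inner (\<lambda>y. c) v = cinner c (meanY v)"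
  unfolding l2inner_def meanY_def intY_def
  by (rule integral_bounded_linear[OF bounded_bilinear.bounded_linear_right[OF bilinear_cinner]]) (rule L2_integrable)

lemma l2inner_const_right: "L2 v \<Longrightarrow> l2inner v (\<lambda>y. c) = cinner (meanY v) c"
  unfolding l2inner_def meanY_def intY_def
  by (rule integral_bounded_linear[OF bounded_bilinear.bounded_linear_left[OF bilinear_cinner]]) (rule L2_integrable)

lemma l2inner_bound: "L2 u \<Longrightarrow> L2 v \<Longrightarrow> cmod (l2inner u v) \<le> L2norm u * L2norm v"
  using CV.L2.Cauchy_Schwarz[of u v] by (simp add: CV_ipf CV.nrm_eq[unfolded CV_ipf])

lemma meanY_bound: "L2 u \<Longrightarrow> norm (meanY u) \<le> L2norm u"
  using L2_bilinear_bound[of "\<lambda>_. 1::real" u u 1] L2_const[of "1::real"] L2_measurable[of u]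
  by (simp add: meanY_def L2norm_const)

lemma l2inner_add_left: "L2 u \<Longrightarrow> L2 v \<Longrightarrow> L2 w \<Longrightarrow> l2inner (\<lambda>y. u y + v y) w = l2inner u w + l2inner v w"
  using CV.L2.ip_add[of u v w] by (simp add: CV_ipf plus_fun_def)

lemma l2inner_diff_left: "L2 u \<Longrightarrow> L2 v \<Longrightarrow> L2 w \<Longrightarrow> l2inner (\<lambda>y. u y - v y) w = l2inner u w - l2inner v w"
  using CV.L2.ip_diff[of u v w] by (simp add: CV_ipf fun_diff_def)

lemma l2inner_diff_right: "L2 u \<Longrightarrow> L2 v \<Longrightarrow> L2 w \<Longrightarrow> l2inner w (\<lambda>y. u y - v y) = l2inner w u - l2inner w v"
  using CV.L2.ip_diff_right[of u v w] by (simp add: CV_ipf fun_diff_def)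

lemma scf_eq: "CV.scf c u = (\<lambda>y. c *s u y)" by (simp add: CV.scf_def)

definition W0 :: "(real^3 \<Rightarrow> complex^3) set" where
  "W0 = {u. H1per u \<and> meanY u = 0}"

lemma W0_H1per: "u \<in> W0 \<Longrightarrow> H1per u" by (simp add: W0_def)
lemma W0_mean: "u \<in> W0 \<Longrightarrow> meanY u = 0" by (simp add: W0_def)

lemma W0_add: "u \<in> W0 \<Longrightarrow> v \<in> W0 \<Longrightarrow> (\<lambda>y. u y + v y) \<in> W0"
  by (simp add: W0_def H1per_add(1) meanY_add H1per_L2)

lemma W0_sc: "u \<in> W0 \<Longrightarrow> (\<lambda>y. c *s u y) \<in> W0"
  by (simp add: W0_def H1per_sc(1) meanY_sc H1per_L2)

lemma W0_diff: "u \<in> W0 \<Longrightarrow> v \<in> W0 \<Longrightarrow> (\<lambda>y. u y - v y) \<in> W0"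
  by (simp add: W0_def H1per_diff(1) meanY_diff H1per_L2)

lemma W0_sub_mean: "H1per v \<Longrightarrow> (\<lambda>y. v y - meanY v) \<in> W0"
  by (simp add: W0_def H1per_diff(1) H1per_const(1) meanY_diff H1per_L2 L2_const meanY_const)

lemma Lam0_sub_mean:
  assumes "H1per v"
  shows "AE y in MY. Lam 0 (\<lambda>y. v y - c) y = Lam 0 v y"
  using Lam_diff[OF assms H1per_const(1)[of c], of 0] Lam_const[of 0 c]
  by eventually_elim (simp add: iX_0)

text \<open>Korn's inequality at \<open>\<chi>\<^sub>0 = 0\<close>: 3 from the gradient and 2 from
  the field itself, whose mean is 0.\<close>

lemma W0_bound: "u \<in> W0 \<Longrightarrow> H1norm u \<le> 5 * L2norm (Lam 0 u)"
  using Korn(2)[OF W0_H1per zero_Ydual, of u] Korn(3)[OF W0_H1per zero_Ydual, of u] H1norm_le[of u]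
  by (simp add: W0_mean)

text \<open>Completeness passes from \<open>H1norm\<close> to any equivalent seminorm on a closed
  subspace. It is applied to mean-zero fields and to all periodic fields, with different
  products.\<close>

lemma complete_H1:
  assumes si: "semi_inner W CV.scf ip" and W: "\<And>u. u \<in> W \<Longrightarrow> H1per u"
    and low: "\<And>u. u \<in> W \<Longrightarrow> H1norm u \<le> C * semi_inner.nrm ip u" and C: "0 < C"
    and up: "\<And>u. u \<in> W \<Longrightarrow> semi_inner.nrm ip u \<le> C' * H1norm u"
    and clos: "\<And>x u. (\<And>n::nat. x n \<in> W) \<Longrightarrow> H1per u \<Longrightarrow> (\<lambda>n. H1norm (\<lambda>y. x n y - u y)) \<longlonglongrightarrow> 0 \<Longrightarrow> u \<in> W"
  shows "semi_inner.complete_nrm W ip"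
proof -
  interpret semi_inner W CV.scf ip by (rule si)
  have d: "u - v = (\<lambda>y. u y - v y)" for u v :: "real^3 \<Rightarrow> complex^3" by (simp add: fun_diff_def)
  show ?thesis
    unfolding complete_nrm_def
  proof (intro allI impI, elim conjE)
    fix x :: "nat \<Rightarrow> real^3 \<Rightarrow> complex^3"
    assume x: "\<forall>n. x n \<in> W" and c: "\<forall>\<epsilon>>0. \<exists>N. \<forall>m\<ge>N. \<forall>n\<ge>N. nrm (x m - x n) < \<epsilon>"
    have "\<exists>N. \<forall>m\<ge>N. \<forall>n\<ge>N. H1norm (\<lambda>y. x m y - x n y) < \<epsilon>" if e: "\<epsilon> > 0" for \<epsilon>
    proof -
      obtain N where N: "\<forall>m\<ge>N. \<forall>n\<ge>N. nrm (x m - x n) < \<epsilon> / C" using c e C by (meson divide_pos_pos)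
      have "H1norm (\<lambda>y. x m y - x n y) < \<epsilon>" if "m \<ge> N" "n \<ge> N" for m n
      proof -
        have "H1norm (x m - x n) \<le> C * nrm (x m - x n)" using low diff_mem x by blast
        also have "\<dots> < \<epsilon>" using N that C by (simp add: pos_less_divide_eq mult.commute)
        finally show ?thesis by (simp add: d)
      qed
      then show ?thesis by blast
    qed
    from H1_complete[OF _ this] obtain u where u: "H1per u" "(\<lambda>n. H1norm (\<lambda>y. x n y - u y)) \<longlonglongrightarrow> 0"
      using x W by blast
    have uW: "u \<in> W" by (rule clos[OF _ u]) (use x in blast)
    have "\<forall>\<^sub>F n in sequentially. norm (nrm (x n - u)) \<le> C' * H1norm (\<lambda>y. x n y - u y)"
    proof (rule always_eventually, rule allI)
      fix n
      have "x n - u \<in> W" using x uW diff_mem by blast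
      then show "norm (nrm (x n - u)) \<le> C' * H1norm (\<lambda>y. x n y - u y)"
        using up nrm_nonneg by (simp add: d)
    qed
    then have "(\<lambda>n. nrm (x n - u)) \<longlonglongrightarrow> 0"
      by (rule Lim_null_comparison) (use tendsto_mult_right_zero[OF u(2)] in simp)
    then show "\<exists>u\<in>W. (\<lambda>n. nrm (x n - u)) \<longlonglongrightarrow> 0" using uW by blast
  qed
qed

lemma W0_closed:
  assumes "\<And>n::nat. x n \<in> W0" "H1per u" "(\<lambda>n. H1norm (\<lambda>y. x n y - u y)) \<longlonglongrightarrow> 0"
  shows "u \<in> W0"
proof -
  have "norm (meanY u) \<le> H1norm (\<lambda>y. x n y - u y)" for n
  proof -
    have "norm (meanY u) = norm (meanY (\<lambda>y. x n y - u y))"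
      using assms by (simp add: meanY_diff H1per_L2 W0_H1per W0_mean)
    also have "\<dots> \<le> L2norm (\<lambda>y. x n y - u y)"
      by (intro meanY_bound L2_diff H1per_L2 W0_H1per assms)
    also have "\<dots> \<le> H1norm (\<lambda>y. x n y - u y)" by (rule L2norm_le_H1norm)
    finally show ?thesis .
  qed
  then have "norm (meanY u) \<le> 0" by (intro LIMSEQ_le_const[OF assms(3)]) auto
  then show ?thesis using assms(2) by (simp add: W0_def)
qed

section \<open>Energy products on periodic fields\<close>

context elasticity
begin

lemma aA_cong_left: "L2 P \<Longrightarrow> L2 P' \<Longrightarrow> L2 Q \<Longrightarrow> (AE y in MY. P y = P' y) \<Longrightarrow> aA P Q = aA P' Q"
  by (rule aA_cong) auto

lemma aA_cong_right: "L2 P \<Longrightarrow> L2 Q \<Longrightarrow> L2 Q' \<Longrightarrow> (AE y in MY. Q y = Q' y) \<Longrightarrow> aA P Q = aA P Q'"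
  by (rule aA_cong) auto

lemma aA_Lam_add_left:
  assumes "H1per u" "H1per v" "L2 Q"
  shows "aA (Lam \<chi>\<^sub>0 (\<lambda>y. u y + v y)) Q = aA (Lam \<chi>\<^sub>0 u) Q + aA (Lam \<chi>\<^sub>0 v) Q"
  using aA_cong_left[OF L2_Lam[OF H1per_add(1)[OF assms(1,2)]] L2_add[OF L2_Lam L2_Lam] assms(3) Lam_add[OF assms(1,2)]]
    aA_add_left[OF L2_Lam L2_Lam assms(3)] assms by simp

lemma aA_Lam_diff_left:
  assumes "H1per u" "H1per v" "L2 Q"
  shows "aA (Lam \<chi>\<^sub>0 (\<lambda>y. u y - v y)) Q = aA (Lam \<chi>\<^sub>0 u) Q - aA (Lam \<chi>\<^sub>0 v) Q"
  using aA_cong_left[OF L2_Lam[OF H1per_diff(1)[OF assms(1,2)]] L2_diff[OF L2_Lam L2_Lam] assms(3) Lam_diff[OF assms(1,2)]]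
    aA_diff_left[OF L2_Lam L2_Lam assms(3)] assms by simp

lemma aA_Lam_sc_left:
  assumes "H1per u" "L2 Q"
  shows "aA (Lam \<chi>\<^sub>0 (\<lambda>y. c *s u y)) Q = c * aA (Lam \<chi>\<^sub>0 u) Q"
  using aA_cong_left[OF L2_Lam[OF H1per_sc(1)[OF assms(1)]] L2_cmul[OF L2_Lam] assms(2) Lam_sc[OF assms(1)]]
    aA_cmul_left[OF L2_Lam assms(2)] assms by simp

lemma aA_Lam_add_right:
  assumes "H1per u" "H1per v" "L2 Q"
  shows "aA Q (Lam \<chi>\<^sub>0 (\<lambda>y. u y + v y)) = aA Q (Lam \<chi>\<^sub>0 u) + aA Q (Lam \<chi>\<^sub>0 v)"
  using aA_cong_right[OF assms(3) L2_Lam[OF H1per_add(1)[OF assms(1,2)]] L2_add[OF L2_Lam L2_Lam] Lam_add[OF assms(1,2)]]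
    aA_add_right[OF assms(3) L2_Lam L2_Lam] assms by simp

lemma aA_Lam_sc_right:
  assumes "H1per u" "L2 Q"
  shows "aA Q (Lam \<chi>\<^sub>0 (\<lambda>y. c *s u y)) = cnj c * aA Q (Lam \<chi>\<^sub>0 u)"
  using aA_cong_right[OF assms(2) L2_Lam[OF H1per_sc(1)[OF assms(1)]] L2_cmul[OF L2_Lam] Lam_sc[OF assms(1)]]
    aA_cmul_right[OF assms(2) L2_Lam] assms by simp

text \<open>Two instances matter: \<open>\<alpha> = 1\<close>, \<open>\<beta> = 0\<close> at
  \<open>\<chi>\<^sub>0 = 0\<close> for the cell problems, and
  \<open>\<alpha> = 1 / \<bar>\<chi>\<bar>\<^sup>2\<close>, \<open>\<beta> = 1\<close> for the form
  of \<open>T + 1\<close>.\<close>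

definition ipE :: "real \<Rightarrow> real \<Rightarrow> real^3 \<Rightarrow> (real^3 \<Rightarrow> complex^3) \<Rightarrow> (real^3 \<Rightarrow> complex^3) \<Rightarrow> complex" where
  "ipE \<alpha> \<beta> \<chi>\<^sub>0 u v = of_real \<alpha> * aA (Lam \<chi>\<^sub>0 u) (Lam \<chi>\<^sub>0 v) + of_real \<beta> * l2inner u v"

lemma aA_Lam_pos: "H1per u \<Longrightarrow> \<nu> * (L2norm (Lam \<chi>\<^sub>0 u))\<^sup>2 \<le> Re (aA (Lam \<chi>\<^sub>0 u) (Lam \<chi>\<^sub>0 u))"
  by (intro aA_coercive L2_Lam Lam_sym)

lemma ipE_semi_inner:
  assumes W: "\<And>u. u \<in> W \<Longrightarrow> H1per u" and z: "(\<lambda>y. 0) \<in> W"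
    and add: "\<And>u v. u \<in> W \<Longrightarrow> v \<in> W \<Longrightarrow> (\<lambda>y. u y + v y) \<in> W"
    and sc: "\<And>u c. u \<in> W \<Longrightarrow> (\<lambda>y. c *s u y) \<in> W" and ab: "0 \<le> \<alpha>" "0 \<le> \<beta>"
  shows "semi_inner W CV.scf (ipE \<alpha> \<beta> \<chi>\<^sub>0)"
proof
  show "0 \<in> W" using z by (simp add: zero_fun_def)
  show "x + y \<in> W" if "x \<in> W" "y \<in> W" for x y using add[OF that] by (simp add: plus_fun_def)
  show "CV.scf c x \<in> W" if "x \<in> W" for x c using sc[OF that] by (simp add: scf_eq)
  show "CV.scf (-1) x = - x" for x by (rule CV.L2.sc_minus_one)
  show "ipE \<alpha> \<beta> \<chi>\<^sub>0 (x + y) z = ipE \<alpha> \<beta> \<chi>\<^sub>0 x z + ipE \<alpha> \<beta> \<chi>\<^sub>0 y z" if "x \<in> W" "y \<in> W" "z \<in> W" for x y z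
    using aA_Lam_add_left[OF W[OF that(1)] W[OF that(2)] L2_Lam[OF W[OF that(3)]]]
      l2inner_add_left[of x y z] H1per_L2[OF W] that
    by (simp add: ipE_def plus_fun_def algebra_simps)
  show "ipE \<alpha> \<beta> \<chi>\<^sub>0 (CV.scf c x) z = c * ipE \<alpha> \<beta> \<chi>\<^sub>0 x z" if "x \<in> W" "z \<in> W" for x z c
    using aA_Lam_sc_left[OF W[OF that(1)] L2_Lam[OF W[OF that(2)]]] CV.L2.ip_sc[of x z c] H1per_L2[OF W] that
    by (simp add: ipE_def scf_eq CV_ipf algebra_simps)
  show "ipE \<alpha> \<beta> \<chi>\<^sub>0 y x = cnj (ipE \<alpha> \<beta> \<chi>\<^sub>0 x y)" if "x \<in> W" "y \<in> W" for x y
    using aA_hermitian[OF L2_Lam[OF W[OF that(1)]] L2_Lam[OF W[OF that(2)]]] CV.L2.ip_cnj[of x y] H1per_L2[OF W] that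
    by (simp add: ipE_def CV_ipf)
  show "0 \<le> Re (ipE \<alpha> \<beta> \<chi>\<^sub>0 x x)" if "x \<in> W" for x
  proof -
    have "0 \<le> Re (aA (Lam \<chi>\<^sub>0 x) (Lam \<chi>\<^sub>0 x))"
      using aA_Lam_pos[OF W[OF that]] \<nu>_pos by (meson mult_nonneg_nonneg less_imp_le order_trans zero_le_power2)
    moreover have "0 \<le> Re (l2inner x x)" using CV.L2.ip_pos[of x] H1per_L2[OF W[OF that]] by (simp add: CV_ipf)
    ultimately show ?thesis using ab by (simp add: ipE_def)
  qed
qed

lemma ipE_nrm_sq:
  assumes "semi_inner W CV.scf (ipE \<alpha> \<beta> \<chi>\<^sub>0)" "u \<in> W" "H1per u"
  shows "(semi_inner.nrm (ipE \<alpha> \<beta> \<chi>\<^sub>0) u)\<^sup>2 = \<alpha> * Re (aA (Lam \<chi>\<^sub>0 u) (Lam \<chi>\<^sub>0 u)) + \<beta> * (L2norm u)\<^sup>2"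
proof -
  interpret semi_inner W CV.scf "ipE \<alpha> \<beta> \<chi>\<^sub>0" by (rule assms)
  have "Re (l2inner u u) = (L2norm u)\<^sup>2" using CV.L2.nrm_sq[of u] H1per_L2[OF assms(3)]
    by (simp add: CV_ipf CV.nrm_eq[unfolded CV_ipf])
  then show ?thesis using nrm_sq[OF assms(2)] by (simp add: ipE_def)
qed

lemma aA_Lam_up:
  assumes "H1per u"
  shows "Re (aA (Lam \<chi>\<^sub>0 u) (Lam \<chi>\<^sub>0 u)) \<le> KA * (L2norm (Lam \<chi>\<^sub>0 u))\<^sup>2"
proof -
  have "Re (aA (Lam \<chi>\<^sub>0 u) (Lam \<chi>\<^sub>0 u)) \<le> cmod (aA (Lam \<chi>\<^sub>0 u) (Lam \<chi>\<^sub>0 u))" by (rule complex_Re_le_cmod)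
  also have "\<dots> \<le> KA * (L2norm (Lam \<chi>\<^sub>0 u) * L2norm (Lam \<chi>\<^sub>0 u))" by (intro aA_bound L2_Lam assms)
  finally show ?thesis by (simp add: power2_eq_square)
qed

lemma ipE_nrm_up:
  assumes "semi_inner W CV.scf (ipE \<alpha> \<beta> \<chi>\<^sub>0)" "u \<in> W" "H1per u" "0 \<le> \<alpha>" "0 \<le> \<beta>"
  shows "semi_inner.nrm (ipE \<alpha> \<beta> \<chi>\<^sub>0) u \<le> sqrt (\<alpha> * KA * (1 + norm \<chi>\<^sub>0)\<^sup>2 + \<beta>) * H1norm u"
proof -
  have "(L2norm (Lam \<chi>\<^sub>0 u))\<^sup>2 \<le> ((1 + norm \<chi>\<^sub>0) * H1norm u)\<^sup>2"
    by (intro power_mono Lam_H1norm assms) simp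
  then have "\<alpha> * (KA * (L2norm (Lam \<chi>\<^sub>0 u))\<^sup>2) \<le> \<alpha> * (KA * ((1 + norm \<chi>\<^sub>0)\<^sup>2 * (H1norm u)\<^sup>2))"
    unfolding power_mult_distrib using assms KA by (intro mult_left_mono) auto
  moreover have "\<alpha> * Re (aA (Lam \<chi>\<^sub>0 u) (Lam \<chi>\<^sub>0 u)) \<le> \<alpha> * (KA * (L2norm (Lam \<chi>\<^sub>0 u))\<^sup>2)"
    by (intro mult_left_mono aA_Lam_up assms)
  moreover have "\<beta> * (L2norm u)\<^sup>2 \<le> \<beta> * (H1norm u)\<^sup>2"
    by (intro mult_left_mono power_mono L2norm_le_H1norm assms) simp
  ultimately have "(semi_inner.nrm (ipE \<alpha> \<beta> \<chi>\<^sub>0) u)\<^sup>2 \<le> (\<alpha> * KA * (1 + norm \<chi>\<^sub>0)\<^sup>2 + \<beta>) * (H1norm u)\<^sup>2"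
    unfolding ipE_nrm_sq[OF assms(1-3)] distrib_right mult.assoc by linarith
  also have "\<dots> = (sqrt (\<alpha> * KA * (1 + norm \<chi>\<^sub>0)\<^sup>2 + \<beta>) * H1norm u)\<^sup>2"
    using assms KA by (simp add: power_mult_distrib)
  finally show ?thesis by (rule power2_le_imp_le) (use assms KA H1norm_nonneg in auto)
qed

section \<open>Cell problems for constant strains\<close>

lemma W0_zero: "(\<lambda>y. 0) \<in> W0" by (simp add: W0_def H1per_const(1) meanY_const)

lemma W0_semi_inner: "semi_inner W0 CV.scf (ipE 1 0 0)"
  by (rule ipE_semi_inner) (auto intro: W0_H1per W0_add W0_sc W0_zero)

lemma W0_complete: "semi_inner.complete_nrm W0 (ipE 1 0 0)"
proof (rule complete_H1[OF W0_semi_inner W0_H1per _ _ _ W0_closed])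
  interpret semi_inner W0 CV.scf "ipE 1 0 0" by (rule W0_semi_inner)
  show "0 < 5 / sqrt \<nu>" using \<nu>_pos by simp
  fix u assume u: "u \<in> W0"
  have "(sqrt \<nu> * L2norm (Lam 0 u))\<^sup>2 \<le> (nrm u)\<^sup>2"
    unfolding ipE_nrm_sq[OF W0_semi_inner u W0_H1per[OF u]]
    using aA_Lam_pos[OF W0_H1per[OF u], of 0] \<nu>_pos by (simp add: power_mult_distrib)
  then have "sqrt \<nu> * L2norm (Lam 0 u) \<le> nrm u" by (rule power2_le_imp_le) (rule nrm_nonneg[OF u])
  then have "L2norm (Lam 0 u) \<le> nrm u / sqrt \<nu>" using \<nu>_pos by (simp add: pos_le_divide_eq mult.commute)
  then show "H1norm u \<le> 5 / sqrt \<nu> * nrm u" using W0_bound[OF u] by simp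
  show "nrm u \<le> sqrt (1 * KA * (1 + norm (0::real^3))\<^sup>2 + 0) * H1norm u"
    by (rule ipE_nrm_up[OF W0_semi_inner u W0_H1per[OF u]]) auto
qed

text \<open>The prescribed strain is an arbitrary matrix, not only
  \<open>iX \<chi>\<^sub>0 c\<close>: the homogenised tensor must not depend on
  \<open>\<chi>\<^sub>0\<close> and is read off from problems of this kind.\<close>

definition cellM :: "complex^3^3 \<Rightarrow> (real^3 \<Rightarrow> complex^3) \<Rightarrow> bool" where
  "cellM M u \<longleftrightarrow> u \<in> W0 \<and> (\<forall>v. H1per v \<longrightarrow> aA (\<lambda>y. Lam 0 u y + M) (Lam 0 v) = 0)"

text \<open>Riesz representation on mean-zero fields, where Korn's inequality makes the energy
  equivalent to \<open>H1norm\<close>.\<close>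

lemma cellM_ex: "\<exists>u. cellM M u"
proof -
  interpret semi_inner W0 CV.scf "ipE 1 0 0" by (rule W0_semi_inner)
  let ?F = "\<lambda>v. - aA (\<lambda>y. M) (Lam 0 v)"
  have LM: "L2 (\<lambda>y. M)" by (rule L2_const)
  have b: "cmod (?F v) \<le> (KA * norm M / sqrt \<nu>) * nrm v" if v: "v \<in> W0" for v
  proof -
    have "(sqrt \<nu> * L2norm (Lam 0 v))\<^sup>2 \<le> (nrm v)\<^sup>2"
      unfolding ipE_nrm_sq[OF W0_semi_inner v W0_H1per[OF v]]
      using aA_Lam_pos[OF W0_H1per[OF v], of 0] \<nu>_pos by (simp add: power_mult_distrib)
    then have "sqrt \<nu> * L2norm (Lam 0 v) \<le> nrm v" by (rule power2_le_imp_le) (rule nrm_nonneg[OF v])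
    then have le: "L2norm (Lam 0 v) \<le> nrm v / sqrt \<nu>" using \<nu>_pos by (simp add: pos_le_divide_eq mult.commute)
    have "cmod (?F v) \<le> KA * (norm M * L2norm (Lam 0 v))"
      using aA_bound[OF LM L2_Lam[OF W0_H1per[OF v]]] by (simp add: L2norm_const)
    also have "\<dots> \<le> KA * (norm M * (nrm v / sqrt \<nu>))" using le KA by (intro mult_left_mono) auto
    finally show ?thesis by simp
  qed
  obtain u where u: "u \<in> W0" "\<And>v. v \<in> W0 \<Longrightarrow> ipE 1 0 0 u v = ?F v"
  proof (rule Riesz[OF W0_complete, of ?F "KA * norm M / sqrt \<nu>"])
    show "- aA (\<lambda>y. M) (Lam 0 (x + y)) = - aA (\<lambda>y. M) (Lam 0 x) + - aA (\<lambda>y. M) (Lam 0 y)" if "x \<in> W0" "y \<in> W0" for x y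
      using aA_Lam_add_right[OF W0_H1per[OF that(1)] W0_H1per[OF that(2)] LM, of 0] by (simp add: plus_fun_def)
    show "- aA (\<lambda>y. M) (Lam 0 (CV.scf c x)) = cnj c * - aA (\<lambda>y. M) (Lam 0 x)" if "x \<in> W0" for c x
      using aA_Lam_sc_right[OF W0_H1per[OF that] LM, of 0 c] by (simp add: scf_eq)
    show "0 \<le> KA * norm M / sqrt \<nu>" using KA \<nu>_pos by simp
  qed (use b in blast)+
  have "aA (\<lambda>y. Lam 0 u y + M) (Lam 0 v) = 0" if v: "H1per v" for v
  proof -
    let ?v = "\<lambda>y. v y - meanY v"
    have Lv: "L2 (Lam 0 v)" "L2 (Lam 0 ?v)" using v W0_sub_mean[OF v] by (auto intro: L2_Lam W0_H1per)
    have Lu: "L2 (\<lambda>y. Lam 0 u y + M)" by (intro L2_add L2_Lam W0_H1per u LM)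
    have "aA (\<lambda>y. Lam 0 u y + M) (Lam 0 v) = aA (\<lambda>y. Lam 0 u y + M) (Lam 0 ?v)"
      using Lam0_sub_mean[OF v, of "meanY v"] by (intro aA_cong_right Lu Lv) (auto elim: eventually_mono)
    also have "\<dots> = aA (Lam 0 u) (Lam 0 ?v) + aA (\<lambda>y. M) (Lam 0 ?v)"
      by (intro aA_add_left Lv LM L2_Lam W0_H1per u)
    also have "\<dots> = 0" using u(2)[OF W0_sub_mean[OF v]] by (simp add: ipE_def)
    finally show ?thesis .
  qed
  then show ?thesis using u(1) by (auto simp: cellM_def)
qed

lemma cellM_H1per: "cellM M u \<Longrightarrow> H1per u" and cellM_W0: "cellM M u \<Longrightarrow> u \<in> W0"
  by (auto simp: cellM_def W0_def)

lemma cellM_L2: "cellM M u \<Longrightarrow> L2 (\<lambda>y. Lam 0 u y + M)"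
  by (intro L2_add L2_Lam cellM_H1per L2_const)

lemma cellM_orth: "cellM M u \<Longrightarrow> H1per v \<Longrightarrow> aA (\<lambda>y. Lam 0 u y + M) (Lam 0 v) = 0"
  by (simp add: cellM_def)

lemma cellM_diff:
  assumes "cellM M u" "cellM N v"
  shows "cellM (M - N) (\<lambda>y. u y - v y)"
  unfolding cellM_def
proof (intro conjI allI impI)
  show "(\<lambda>y. u y - v y) \<in> W0" by (intro W0_diff cellM_W0[OF assms(1)] cellM_W0[OF assms(2)])
  fix w assume w: "H1per w"
  note H = cellM_H1per[OF assms(1)] cellM_H1per[OF assms(2)]
  have "aA (\<lambda>y. Lam 0 (\<lambda>y. u y - v y) y + (M - N)) (Lam 0 w)
      = aA (\<lambda>y. (Lam 0 u y + M) - (Lam 0 v y + N)) (Lam 0 w)"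
    using Lam_diff[OF H, of 0]
    by (intro aA_cong_left L2_add L2_diff L2_Lam H1per_diff(1) H L2_const w) (auto elim: eventually_mono)
  also have "\<dots> = 0"
    using aA_diff_left[OF cellM_L2[OF assms(1)] cellM_L2[OF assms(2)] L2_Lam[OF w]] cellM_orth[OF assms(1) w] cellM_orth[OF assms(2) w]
    by simp
  finally show "aA (\<lambda>y. Lam 0 (\<lambda>y. u y - v y) y + (M - N)) (Lam 0 w) = 0" .
qed

lemma cellM_sc:
  assumes "cellM M u"
  shows "cellM (cmul c M) (\<lambda>y. c *s u y)"
  unfolding cellM_def
proof (intro conjI allI impI)
  show "(\<lambda>y. c *s u y) \<in> W0" by (intro W0_sc cellM_W0[OF assms(1)])
  fix w assume w: "H1per w"
  note H = cellM_H1per[OF assms(1)]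
  have "aA (\<lambda>y. Lam 0 (\<lambda>y. c *s u y) y + cmul c M) (Lam 0 w) = aA (\<lambda>y. cmul c (Lam 0 u y + M)) (Lam 0 w)"
    using Lam_sc[OF H, of 0 c]
    by (intro aA_cong_left L2_add L2_cmul L2_Lam H1per_sc(1) H L2_const w) (auto elim: eventually_mono simp: cmul_add)
  also have "\<dots> = 0"
    using aA_cmul_left[OF cellM_L2[OF assms(1)] L2_Lam[OF w]] cellM_orth[OF assms(1) w] by simp
  finally show "aA (\<lambda>y. Lam 0 (\<lambda>y. c *s u y) y + cmul c M) (Lam 0 w) = 0" .
qed

text \<open>Test the problem with its own solution; the 5 is that of
  \<open>W0_bound\<close>.\<close>

lemma cellM_bound:
  assumes "cellM M u"
  shows "L2norm (Lam 0 u) \<le> KA / \<nu> * norm M" "H1norm u \<le> 5 * KA / \<nu> * norm M"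
proof -
  note H = cellM_H1per[OF assms]
  let ?n = "L2norm (Lam 0 u)"
  have "aA (Lam 0 u) (Lam 0 u) = - aA (\<lambda>y. M) (Lam 0 u)"
    using cellM_orth[OF assms H] aA_add_left[OF L2_Lam[OF H] L2_const L2_Lam[OF H], of 0 M 0] by (simp add: add_eq_0_iff)
  then have "\<nu> * ?n\<^sup>2 \<le> Re (- aA (\<lambda>y. M) (Lam 0 u))" using aA_Lam_pos[OF H, of 0] by simp
  also have "\<dots> \<le> cmod (aA (\<lambda>y. M) (Lam 0 u))" using complex_Re_le_cmod[of "- aA (\<lambda>y. M) (Lam 0 u)"] by simp
  also have "\<dots> \<le> KA * (norm M * ?n)" using aA_bound[OF L2_const L2_Lam[OF H], of M 0] by (simp add: L2norm_const)
  finally have "(\<nu> * ?n) * ?n \<le> (KA * norm M) * ?n" by (simp add: power2_eq_square mult.assoc)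
  then have "\<nu> * ?n \<le> KA * norm M"
    using L2norm_nonneg[of "Lam 0 u"] KA by (cases "?n = 0") auto
  then show 1: "?n \<le> KA / \<nu> * norm M" using \<nu>_pos by (simp add: field_simps)
  show "H1norm u \<le> 5 * KA / \<nu> * norm M" using W0_bound[OF cellM_W0[OF assms]] 1 by simp
qed

text \<open>The difference solves the problem for the zero strain and is annihilated by
  \<open>cellM_bound\<close>.\<close>

lemma cellM_unique:
  assumes "cellM M u" "cellM M v"
  shows "AE y in MY. Lam 0 u y = Lam 0 v y"
proof -
  have c: "cellM 0 (\<lambda>y. u y - v y)" using cellM_diff[OF assms] by simp
  have "L2norm (Lam 0 (\<lambda>y. u y - v y)) = 0"
    using cellM_bound(1)[OF c] by (simp add: antisym)
  then have "AE y in MY. Lam 0 (\<lambda>y. u y - v y) y = 0"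
    using L2norm_eq_0_iff[OF L2_Lam[OF cellM_H1per[OF c]]] by blast
  then show ?thesis using Lam_diff[OF cellM_H1per[OF assms(1)] cellM_H1per[OF assms(2)], of 0]
    by eventually_elim simp
qed

text \<open>The effective energy of two constant strains. Only the strain of the chosen corrector
  enters, and that is unique almost everywhere.\<close>

definition Qh :: "complex^3^3 \<Rightarrow> complex^3^3 \<Rightarrow> complex" where
  "Qh M N = aA (\<lambda>y. Lam 0 (SOME u. cellM M u) y + M) (\<lambda>y. N)"

lemma Qh_eq:
  assumes "cellM M u"
  shows "Qh M N = aA (\<lambda>y. Lam 0 u y + M) (\<lambda>y. N)"
proof -
  have c: "cellM M (SOME u. cellM M u)" by (rule someI_ex[OF cellM_ex])
  show ?thesis
    unfolding Qh_def using cellM_unique[OF c assms]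
    by (intro aA_cong_left cellM_L2[OF c] cellM_L2[OF assms] L2_const) (auto elim: eventually_mono)
qed

text \<open>The flux of a corrected strain is orthogonal to the strains of periodic fields, so the
  second argument may be corrected too. In this symmetric form Hermitian symmetry and nonnegativity
  can be read off.\<close>

lemma Qh_full:
  assumes "cellM M u" "cellM N v"
  shows "Qh M N = aA (\<lambda>y. Lam 0 u y + M) (\<lambda>y. Lam 0 v y + N)"
  using aA_add_right[OF cellM_L2[OF assms(1)] L2_Lam[OF cellM_H1per[OF assms(2)]] L2_const, of 0 N]
    cellM_orth[OF assms(1) cellM_H1per[OF assms(2)]] Qh_eq[OF assms(1), of N] by simp

lemma Qh_hermitian: "Qh N M = cnj (Qh M N)"
proof -
  obtain u v where c: "cellM M u" "cellM N v" using cellM_ex by blast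
  show ?thesis
    unfolding Qh_full[OF c] Qh_full[OF c(2,1)] by (rule aA_hermitian[OF cellM_L2[OF c(1)] cellM_L2[OF c(2)]])
qed

lemma Qh_diff_left: "Qh (M - M') N = Qh M N - Qh M' N"
proof -
  obtain u v where c: "cellM M u" "cellM M' v" using cellM_ex by blast
  have "Qh (M - M') N = aA (\<lambda>y. Lam 0 (\<lambda>y. u y - v y) y + (M - M')) (\<lambda>y. N)"
    by (rule Qh_eq[OF cellM_diff[OF c]])
  also have "\<dots> = aA (\<lambda>y. (Lam 0 u y + M) - (Lam 0 v y + M')) (\<lambda>y. N)"
    using Lam_diff[OF cellM_H1per[OF c(1)] cellM_H1per[OF c(2)], of 0]
    by (intro aA_cong_left cellM_L2[OF cellM_diff[OF c]] L2_diff cellM_L2[OF c(1)] cellM_L2[OF c(2)] L2_const)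
      (auto elim: eventually_mono)
  also have "\<dots> = Qh M N - Qh M' N"
    unfolding Qh_eq[OF c(1)] Qh_eq[OF c(2)] by (rule aA_diff_left[OF cellM_L2[OF c(1)] cellM_L2[OF c(2)] L2_const])
  finally show ?thesis .
qed

lemma Qh_cmul_left: "Qh (cmul a M) N = a * Qh M N"
proof -
  obtain u where c: "cellM M u" using cellM_ex by blast
  have "Qh (cmul a M) N = aA (\<lambda>y. Lam 0 (\<lambda>y. a *s u y) y + cmul a M) (\<lambda>y. N)"
    by (rule Qh_eq[OF cellM_sc[OF c]])
  also have "\<dots> = aA (\<lambda>y. cmul a (Lam 0 u y + M)) (\<lambda>y. N)"
    using Lam_sc[OF cellM_H1per[OF c], of 0 a]
    by (intro aA_cong_left cellM_L2[OF cellM_sc[OF c]] L2_cmul cellM_L2[OF c] L2_const)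
      (auto elim: eventually_mono simp: cmul_add)
  also have "\<dots> = a * Qh M N"
    unfolding Qh_eq[OF c] by (rule aA_cmul_left[OF cellM_L2[OF c] L2_const])
  finally show ?thesis .
qed

lemma Qh_add_left: "Qh (M + M') N = Qh M N + Qh M' N"
  using Qh_diff_left[of M "cmul (-1) M'" N] Qh_cmul_left[of "-1" M' N] by (simp add: cmul_m1)

lemma Qh_zero_left: "Qh 0 N = 0"
  using Qh_diff_left[of 0 0 N] by simp

lemma Qh_sum_left: "finite I \<Longrightarrow> Qh (\<Sum>i\<in>I. f i) N = (\<Sum>i\<in>I. Qh (f i) N)"
  by (induction rule: finite_induct) (auto simp: Qh_zero_left Qh_add_left)

lemma Qh_cmul_right: "Qh M (cmul a N) = cnj a * Qh M N"
  by (subst Qh_hermitian) (simp add: Qh_cmul_left Qh_hermitian[of M N])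

lemma Qh_sum_right: "finite I \<Longrightarrow> Qh N (\<Sum>i\<in>I. f i) = (\<Sum>i\<in>I. Qh N (f i))"
  by (subst Qh_hermitian) (simp add: Qh_sum_left Qh_hermitian[of N "f _"])

lemma cell_corr_iff: "cell_corr A \<chi>\<^sub>0 c u \<longleftrightarrow> cellM (iX \<chi>\<^sub>0 c) u"
  by (auto simp: cell_corr_def cellM_def W0_def aA_def Lam_0)

text \<open>\<open>cell_corr\<close> and \<open>cellM\<close> are equal as predicates, so both sides
  choose literally the same corrector.\<close>

lemma homform_eq: "homform A \<chi>\<^sub>0 c d = Qh (iX \<chi>\<^sub>0 c) (iX \<chi>\<^sub>0 d)"
  by (simp add: homform_def Qh_def aA_def Lam_0 cell_corr_iff[abs_def] Let_def)

lemma vec_expand: "c = (\<Sum>j\<in>UNIV. (c $ j) *s axis j (1::complex))"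
  by (simp add: vec_eq_iff axis_def if_distrib cong: if_cong)

lemma iX_expand: "iX \<chi>\<^sub>0 c = (\<Sum>j\<in>UNIV. cmul (c $ j) (iX \<chi>\<^sub>0 (axis j 1)))"
proof -
  have "iX \<chi>\<^sub>0 c = iX \<chi>\<^sub>0 (\<Sum>j\<in>UNIV. (c $ j) *s axis j 1)" by (subst vec_expand[of c]) simp
  also have "\<dots> = (\<Sum>j\<in>UNIV. iX \<chi>\<^sub>0 ((c $ j) *s axis j 1))"
    by (rule linear_sum[OF bounded_linear.linear[OF bounded_linear_iX]])
  finally show ?thesis by (simp add: iX_sc)
qed

lemma Ahom_cinner: "cinner (Ahom A \<chi>\<^sub>0 *v c) d = Qh (iX \<chi>\<^sub>0 c) (iX \<chi>\<^sub>0 d)"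
proof -
  have "Qh (iX \<chi>\<^sub>0 c) (iX \<chi>\<^sub>0 d) = (\<Sum>i\<in>UNIV. \<Sum>j\<in>UNIV. cnj (d $ i) * (c $ j * Qh (iX \<chi>\<^sub>0 (axis j 1)) (iX \<chi>\<^sub>0 (axis i 1))))"
    by (subst iX_expand[of _ d], subst iX_expand[of _ c])
      (simp add: Qh_sum_left Qh_sum_right Qh_cmul_left Qh_cmul_right sum_distrib_left)
  then show ?thesis
    by (simp add: cinner_def Ahom_def matrix_vector_mult_def homform_eq sum_distrib_left sum_distrib_right mult_ac)
qed

end

section \<open>The homogenised matrix and tensor\<close>

definition cnjv :: "complex^3 \<Rightarrow> complex^3" where "cnjv c = (\<chi> i. cnj (c $ i))"
definition cnjm :: "complex^3^3 \<Rightarrow> complex^3^3" where "cnjm M = (\<chi> i j. cnj (M $ i $ j))"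

lemma bounded_linear_cnjv: "bounded_linear cnjv"
  by (rule linear_conv_bounded_linear[THEN iffD1], rule linearI) (auto simp: cnjv_def vec_eq_iff)

lemma bounded_linear_cnjm: "bounded_linear cnjm"
  by (rule linear_conv_bounded_linear[THEN iffD1], rule linearI) (auto simp: cnjm_def vec_eq_iff)

lemma cnjm_cnjm: "cnjm (cnjm M) = M" by (simp add: cnjm_def vec_eq_iff)

lemma intY_cnj: "intY (\<lambda>y. cnj (f y)) = cnj (intY f)"
  by (simp add: intY_def)

lemma testfn_cnj:
  assumes "testfn \<phi>"
  shows "testfn (\<lambda>y. cnj (\<phi> y))" "pderiv (\<lambda>y. cnj (\<phi> y)) j y = cnj (pderiv \<phi> j y)"
proof -
  have d: "((\<lambda>y. cnj (\<phi> y)) has_derivative (\<lambda>h. cnj (frechet_derivative \<phi> (at y) h))) (at y)" for y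
    using assms by (intro bounded_linear.has_derivative[OF bounded_linear_cnj])
      (simp add: testfn_def flip: frechet_derivative_works)
  have p: "pderiv (\<lambda>y. cnj (\<phi> y)) j y = cnj (pderiv \<phi> j y)" for j y
    using frechet_derivative_at[OF d, symmetric] by (simp add: pderiv_def)
  then show "pderiv (\<lambda>y. cnj (\<phi> y)) j y = cnj (pderiv \<phi> j y)" .
  have "(\<lambda>y. cnj (\<phi> y)) differentiable (at y)" for y using d differentiable_def by blast
  moreover have "continuous_on UNIV (pderiv (\<lambda>y. cnj (\<phi> y)) j)" for j
    unfolding p[abs_def] using assms by (intro continuous_on_cnj) (simp add: testfn_def)
  ultimately show "testfn (\<lambda>y. cnj (\<phi> y))" using assms by (simp add: testfn_def)
qed

lemma weak_grad_cnj:
  assumes "weak_grad u G"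
  shows "weak_grad (\<lambda>y. cnjv (u y)) (\<lambda>y. cnjm (G y))"
  unfolding weak_grad_def
proof (intro allI impI)
  fix \<phi> i j assume \<phi>: "testfn \<phi>"
  have "intY (\<lambda>y. u y $ i * cnj (pderiv \<phi> j y)) = - intY (\<lambda>y. G y $ i $ j * cnj (\<phi> y))"
    using assms[unfolded weak_grad_def, rule_format, OF testfn_cnj(1)[OF \<phi>], of i j]
    by (simp only: testfn_cnj(2)[OF \<phi>])
  then have "cnj (intY (\<lambda>y. u y $ i * cnj (pderiv \<phi> j y))) = - cnj (intY (\<lambda>y. G y $ i $ j * cnj (\<phi> y)))"
    by simp
  then show "intY (\<lambda>y. cnjv (u y) $ i * pderiv \<phi> j y) = - intY (\<lambda>y. cnjm (G y) $ i $ j * \<phi> y)"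
    unfolding intY_cnj[symmetric] by (simp add: cnjv_def cnjm_def)
qed

lemma H1per_cnj:
  assumes "H1per u"
  shows "H1per (\<lambda>y. cnjv (u y))" "AE y in MY. Lam 0 (\<lambda>y. cnjv (u y)) y = cnjm (Lam 0 u y)"
proof -
  note * = L2_bounded_linear[OF bounded_linear_cnjv H1per_L2[OF assms]]
    L2_bounded_linear[OF bounded_linear_cnjm L2_grad[OF assms]] weak_grad_cnj[OF weak_grad_grad[OF assms]]
  show "H1per (\<lambda>y. cnjv (u y))" by (rule H1perI[OF *])
  show "AE y in MY. Lam 0 (\<lambda>y. cnjv (u y)) y = cnjm (Lam 0 u y)"
    using grad_AE[OF *] by eventually_elim (simp add: Lam_0 symm_def cnjm_def vec_eq_iff)
qed

lemma L2_cnjm: "L2 P \<Longrightarrow> L2 (\<lambda>y. cnjm (P y))"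
  by (rule L2_bounded_linear[OF bounded_linear_cnjm])

definition unit_sym :: "3 \<Rightarrow> 3 \<Rightarrow> complex^3^3" where
  "unit_sym k l = symm (\<chi> a b. if a = k \<and> b = l then 1 else 0)"

lemma unit_sym_commute: "unit_sym k l = unit_sym l k"
proof -
  have "unit_sym k l $ a $ b = unit_sym l k $ a $ b" for a b
    unfolding unit_sym_def symm_def by (cases "a = k"; cases "b = l"; cases "a = l"; cases "b = k"; simp)
  then show ?thesis by (simp only: vec_eq_iff simp_thms)
qed

lemma cnjm_unit_sym: "cnjm (unit_sym k l) = unit_sym k l"
proof -
  have "cnjm (unit_sym k l) $ a $ b = unit_sym k l $ a $ b" for a b
    unfolding cnjm_def unit_sym_def symm_def by (cases "a = k"; cases "b = l"; cases "a = l"; cases "b = k"; simp)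
  then show ?thesis by (simp only: vec_eq_iff simp_thms)
qed

text \<open>An off-diagonal pair occurs twice in the double sum, each time with weight one half, so
  diagonal and off-diagonal entries need no separate treatment.\<close>

lemma unit_sym_expand:
  assumes "\<And>i j. M $ i $ j = M $ j $ i"
  shows "M = (\<Sum>k\<in>UNIV. \<Sum>l\<in>UNIV. cmul (M $ k $ l) (unit_sym k l))"
proof -
  have "M = symm M" using symm_id[OF assms] by simp
  have e: "M = (\<Sum>k\<in>UNIV. \<Sum>l\<in>UNIV. cmul (M $ k $ l) (\<chi> a b. if a = k \<and> b = l then 1 else 0))"
  proof -
    have "(\<Sum>k\<in>UNIV. \<Sum>l\<in>UNIV. cmul (M $ k $ l) (\<chi> a b. if a = k \<and> b = l then 1 else 0)) $ a $ b = M $ a $ b" for a b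
    proof -
      have "(\<Sum>k\<in>UNIV. \<Sum>l\<in>UNIV. cmul (M $ k $ l) (\<chi> a b. if a = k \<and> b = l then 1 else 0)) $ a $ b
        = (\<Sum>k\<in>UNIV. \<Sum>l\<in>UNIV. if k = a then (if l = b then M $ k $ l else 0) else 0)"
        by (simp add: cmul_def) (intro sum.cong refl, auto)
      also have "\<dots> = (\<Sum>k\<in>UNIV. if k = a then M $ a $ b else 0)"
        by (intro sum.cong refl) (simp cong: if_cong)
      also have "\<dots> = M $ a $ b" by simp
      finally show ?thesis .
    qed
    then show ?thesis by (simp add: vec_eq_iff)
  qed
  have "M = symm (\<Sum>k\<in>UNIV. \<Sum>l\<in>UNIV. cmul (M $ k $ l) (\<chi> a b. if a = k \<and> b = l then 1 else 0))"
    by (rule trans[OF \<open>M = symm M\<close> arg_cong[where f=symm, OF e]])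
  then show ?thesis
    by (simp only: linear_sum[OF bounded_linear.linear[OF bounded_linear_symm]] symm_cmul unit_sym_def)
qed

lemma invertible_matrix_inv:
  fixes B :: "'a::semiring_1^'n^'m"
  assumes "invertible B"
  shows "B ** matrix_inv B = mat 1" "matrix_inv B ** B = mat 1"
  using someI_ex[OF assms[unfolded invertible_def]] by (auto simp: matrix_inv_def)

context elasticity
begin

lemma tapp_cnj: "tapp A y (cnjm M) = cnjm (tapp A y M)"
  by (simp add: tapp_def tappc_def cnjm_def vec_eq_iff)

lemma aA_cnj: "aA (\<lambda>y. cnjm (P y)) (\<lambda>y. cnjm (Q y)) = cnj (aA P Q)"
proof -
  have "frob (cnjm M) (cnjm N) = cnj (frob M N)" for M N by (simp add: frob_def cnjm_def)
  then show ?thesis by (simp add: aA_def tapp_cnj intY_cnj)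
qed

text \<open>\<open>A\<close> is real, so conjugating all fields preserves the cell problem. This is
  what makes the entries of the homogenised tensor real.\<close>

lemma cellM_cnj:
  assumes "cellM M u"
  shows "cellM (cnjm M) (\<lambda>y. cnjv (u y))"
  unfolding cellM_def
proof (intro conjI allI impI)
  note H = cellM_H1per[OF assms]
  have "meanY (\<lambda>y. cnjv (u y)) = cnjv (meanY u)"
    unfolding meanY_def intY_def
    by (rule integral_bounded_linear[OF bounded_linear_cnjv]) (rule L2_integrable[OF H1per_L2[OF H]])
  then show "(\<lambda>y. cnjv (u y)) \<in> W0"
    using H1per_cnj(1)[OF H] W0_mean[OF cellM_W0[OF assms]] by (simp add: W0_def cnjv_def vec_eq_iff)
  fix v assume v: "H1per v"
  have "aA (\<lambda>y. Lam 0 (\<lambda>y. cnjv (u y)) y + cnjm M) (Lam 0 v)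
      = aA (\<lambda>y. cnjm (Lam 0 u y + M)) (\<lambda>y. cnjm (Lam 0 (\<lambda>y. cnjv (v y)) y))"
  proof (rule aA_cong)
    show "AE y in MY. Lam 0 (\<lambda>y. cnjv (u y)) y + cnjm M = cnjm (Lam 0 u y + M)"
      using H1per_cnj(2)[OF H] by eventually_elim (simp add: cnjm_def vec_eq_iff)
    show "AE y in MY. Lam 0 v y = cnjm (Lam 0 (\<lambda>y. cnjv (v y)) y)"
      using H1per_cnj(2)[OF v] by eventually_elim (simp add: cnjm_cnjm)
  qed (intro L2_add L2_cnjm L2_Lam H1per_cnj(1) H v L2_const cellM_L2[OF assms])+
  also have "\<dots> = 0"
    using cellM_orth[OF assms H1per_cnj(1)[OF v]] by (simp add: aA_cnj)
  finally show "aA (\<lambda>y. Lam 0 (\<lambda>y. cnjv (u y)) y + cnjm M) (Lam 0 v) = 0" .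
qed

lemma Qh_cnj: "Qh (cnjm M) (cnjm N) = cnj (Qh M N)"
proof -
  obtain u where c: "cellM M u" using cellM_ex by blast
  have "Qh (cnjm M) (cnjm N) = aA (\<lambda>y. Lam 0 (\<lambda>y. cnjv (u y)) y + cnjm M) (\<lambda>y. cnjm N)"
    by (rule Qh_eq[OF cellM_cnj[OF c]])
  also have "\<dots> = aA (\<lambda>y. cnjm (Lam 0 u y + M)) (\<lambda>y. cnjm N)"
  proof (rule aA_cong_left)
    show "AE y in MY. Lam 0 (\<lambda>y. cnjv (u y)) y + cnjm M = cnjm (Lam 0 u y + M)"
      using H1per_cnj(2)[OF cellM_H1per[OF c]] by eventually_elim (simp add: cnjm_def vec_eq_iff)
  qed (intro cellM_L2[OF cellM_cnj[OF c]] L2_cnjm cellM_L2[OF c] L2_const)+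
  also have "\<dots> = cnj (Qh M N)" unfolding Qh_eq[OF c] by (rule aA_cnj)
  finally show ?thesis .
qed

text \<open>The entries are effective energies of symmetrised matrix units. Hermitian symmetry gives
  the major symmetry, the symmetry of the units the minor one, and sesquilinearity recovers
  \<open>Qh\<close> on all symmetric matrices, among them every
  \<open>iX \<chi>\<^sub>0 c\<close>.\<close>

theorem homogenised_tensor:
  "\<exists>T. tensor_symmetric T \<and>
     (\<forall>\<chi>\<^sub>0 c d. cinner (Ahom A \<chi>\<^sub>0 *v c) d = frob (tappc T (iX \<chi>\<^sub>0 c)) (iX \<chi>\<^sub>0 d))"
proof -
  \<comment> \<open>The order follows \<open>tappc\<close>: the pair \<open>(k, l)\<close> is
    contracted with the argument, the pair \<open>(i, j)\<close> indexes the result.\<close>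
  define T :: const_tensor where "T i k j l = Re (Qh (unit_sym k l) (unit_sym i j))" for i k j l
  have real: "complex_of_real (T i k j l) = Qh (unit_sym k l) (unit_sym i j)" for i k j l
  proof -
    have "Qh (unit_sym k l) (unit_sym i j) = cnj (Qh (unit_sym k l) (unit_sym i j))"
      using Qh_cnj[of "unit_sym k l" "unit_sym i j"] by (simp add: cnjm_unit_sym)
    then show ?thesis by (simp add: T_def complex_eq_iff)
  qed
  have "T i k j l = T k i l j" for i k j l
    using Qh_hermitian[of "unit_sym k l" "unit_sym i j"] by (simp add: T_def)
  moreover have "T i k j l = T j k i l" for i k j l
    by (simp add: T_def unit_sym_commute[of i j])
  ultimately have sym: "tensor_symmetric T" unfolding tensor_symmetric_def by blast
  have key: "Qh M N = frob (tappc T M) N"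
    if M: "\<And>i j. M $ i $ j = M $ j $ i" and N: "\<And>i j. N $ i $ j = N $ j $ i" for M N
  proof -
    have "Qh M N = Qh M (\<Sum>i\<in>UNIV. \<Sum>j\<in>UNIV. cmul (N $ i $ j) (unit_sym i j))"
      by (rule arg_cong[OF unit_sym_expand[OF N]])
    also have "\<dots> = (\<Sum>i\<in>UNIV. \<Sum>j\<in>UNIV. cnj (N $ i $ j) * Qh M (unit_sym i j))"
      by (simp add: Qh_sum_right Qh_cmul_right)
    also have "\<dots> = (\<Sum>i\<in>UNIV. \<Sum>j\<in>UNIV. cnj (N $ i $ j) * (\<Sum>k\<in>UNIV. \<Sum>l\<in>UNIV. M $ k $ l * complex_of_real (T i k j l)))"
    proof -
      have "Qh M (unit_sym i j) = (\<Sum>k\<in>UNIV. \<Sum>l\<in>UNIV. M $ k $ l * complex_of_real (T i k j l))" for i j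
      proof -
        have "Qh M (unit_sym i j) = Qh (\<Sum>k\<in>UNIV. \<Sum>l\<in>UNIV. cmul (M $ k $ l) (unit_sym k l)) (unit_sym i j)"
          by (rule arg_cong[where f="\<lambda>M. Qh M (unit_sym i j)", OF unit_sym_expand[OF M]])
        then show ?thesis by (simp add: Qh_sum_left Qh_cmul_left real)
      qed
      then show ?thesis by simp
    qed
    also have "\<dots> = frob (tappc T M) N"
      by (simp add: frob_tappc sum_distrib_left mult_ac)
    finally show ?thesis .
  qed
  show ?thesis
  proof (intro exI[of _ T] conjI allI sym)
    show "cinner (Ahom A \<chi>\<^sub>0 *v c) d = frob (tappc T (iX \<chi>\<^sub>0 c)) (iX \<chi>\<^sub>0 d)" for \<chi>\<^sub>0 c d
      unfolding Ahom_cinner by (rule key[OF iX_sym iX_sym])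
  qed
qed

section \<open>Resolvent of the homogenised matrix\<close>

lemma Qh_self:
  assumes M: "\<And>i j. M $ i $ j = M $ j $ i"
  shows "0 \<le> Re (Qh M M)" "Re (Qh M M) \<le> KA * (KA / \<nu> + 1) * (norm M)\<^sup>2"
proof -
  obtain u where c: "cellM M u" using cellM_ex by blast
  let ?P = "\<lambda>y. Lam 0 u y + M"
  have "\<nu> * (L2norm ?P)\<^sup>2 \<le> Re (aA ?P ?P)"
  proof (rule aA_coercive[OF cellM_L2[OF c]])
    show "(Lam 0 u y + M) $ i $ j = (Lam 0 u y + M) $ j $ i" for y i j
      using M[of i j] Lam_sym[of 0 u y i j] by simp
  qed
  then show "0 \<le> Re (Qh M M)"
    unfolding Qh_full[OF c c] using \<nu>_pos by (meson mult_nonneg_nonneg less_imp_le order_trans zero_le_power2)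
  have P: "L2norm ?P \<le> (KA / \<nu> + 1) * norm M"
  proof -
    have "L2norm ?P \<le> L2norm (Lam 0 u) + L2norm (\<lambda>y. M)"
      by (intro L2norm_triangle_mat L2_Lam cellM_H1per[OF c] L2_const)
    then show ?thesis using cellM_bound(1)[OF c] by (simp add: L2norm_const distrib_right)
  qed
  have "Re (Qh M M) \<le> cmod (Qh M M)" by (rule complex_Re_le_cmod)
  also have "\<dots> \<le> KA * (L2norm ?P * norm M)"
    unfolding Qh_eq[OF c] using aA_bound[OF cellM_L2[OF c] L2_const, of M] by (simp add: L2norm_const)
  also have "\<dots> \<le> KA * ((KA / \<nu> + 1) * norm M * norm M)"
    using P KA by (intro mult_left_mono mult_right_mono) auto
  finally show "Re (Qh M M) \<le> KA * (KA / \<nu> + 1) * (norm M)\<^sup>2" by (simp add: power2_eq_square mult_ac)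
qed

text \<open>The form of the scaled matrix plus the identity. With it \<open>form_pair\<close>
  applies to \<open>complex^3\<close>, and the resolvent bound by \<open>1 / D_hom\<close> becomes
  an instance of \<open>infdist_rho\<close>.\<close>

definition ehom :: "real^3 \<Rightarrow> complex^3 \<Rightarrow> complex^3 \<Rightarrow> complex" where
  "ehom \<chi>\<^sub>0 p q = cinner (Ahom_sc A \<chi>\<^sub>0 *v p) q + cinner p q"

lemma Ahom_sc_vec: "Ahom_sc A \<chi>\<^sub>0 *v p = (1 / complex_of_real ((norm \<chi>\<^sub>0)\<^sup>2)) *s (Ahom A \<chi>\<^sub>0 *v p)"
  by (simp add: vec_eq_iff matrix_vector_mult_def Ahom_sc_def sum_distrib_left)

lemma ehom_eq: "ehom \<chi>\<^sub>0 p q = Qh (iX \<chi>\<^sub>0 p) (iX \<chi>\<^sub>0 q) / complex_of_real ((norm \<chi>\<^sub>0)\<^sup>2) + cinner p q"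
  by (simp add: ehom_def Ahom_sc_vec CV.ip0_sc Ahom_cinner)

text \<open>Compares the form norm with the Euclidean norm. It is free of
  \<open>\<chi>\<^sub>0\<close> because \<open>iX\<close> is linear in \<open>\<chi>\<^sub>0\<close>
  and the form is divided by the squared norm of \<open>\<chi>\<^sub>0\<close>.\<close>

definition CH :: real where "CH = sqrt (KA * (KA / \<nu> + 1) + 1)"

lemma CH_pos: "1 \<le> CH" using KA \<nu>_pos by (simp add: CH_def)

lemma cinner_add_left: "cinner (x + y) z = cinner x z + cinner y z"
  by (rule bounded_bilinear.add_left[OF bilinear_cinner])

lemma ehom_self:
  "0 \<le> Re (ehom \<chi>\<^sub>0 p p)" "(norm p)\<^sup>2 \<le> Re (ehom \<chi>\<^sub>0 p p)" "Re (ehom \<chi>\<^sub>0 p p) \<le> (CH * norm p)\<^sup>2"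
proof -
  let ?t = "norm \<chi>\<^sub>0" and ?q = "Re (Qh (iX \<chi>\<^sub>0 p) (iX \<chi>\<^sub>0 p))"
  have eq: "Re (ehom \<chi>\<^sub>0 p p) = ?q / ?t\<^sup>2 + (norm p)\<^sup>2"
    unfolding ehom_eq by (simp add: CV.ip0_self Re_divide_of_real del: of_real_power)
  have q: "0 \<le> ?q" "?q \<le> KA * (KA / \<nu> + 1) * (norm (iX \<chi>\<^sub>0 p))\<^sup>2"
    by (rule Qh_self; rule iX_sym)+
  then show 1: "(norm p)\<^sup>2 \<le> Re (ehom \<chi>\<^sub>0 p p)" unfolding eq by simp
  then show "0 \<le> Re (ehom \<chi>\<^sub>0 p p)" by (meson order_trans zero_le_power2)
  have "(norm (iX \<chi>\<^sub>0 p))\<^sup>2 \<le> (?t * norm p)\<^sup>2" by (intro power_mono iX_norm) simp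
  then have "KA * (KA / \<nu> + 1) * (norm (iX \<chi>\<^sub>0 p))\<^sup>2 \<le> KA * (KA / \<nu> + 1) * (?t * norm p)\<^sup>2"
    using KA \<nu>_pos by (intro mult_left_mono) auto
  with q(2) have "?q \<le> (KA * (KA / \<nu> + 1) * (norm p)\<^sup>2) * ?t\<^sup>2" by (simp add: power_mult_distrib mult_ac)
  \<comment> \<open>At \<open>\<chi>\<^sub>0 = 0\<close> the quotient is 0 by the convention on
    division, so this case is covered as well.\<close>
  then have "?q / ?t\<^sup>2 \<le> KA * (KA / \<nu> + 1) * (norm p)\<^sup>2"
    using KA \<nu>_pos by (cases "?t = 0") (auto simp: pos_divide_le_eq)
  moreover have "(CH * norm p)\<^sup>2 = KA * (KA / \<nu> + 1) * (norm p)\<^sup>2 + (norm p)\<^sup>2"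
    using KA \<nu>_pos by (simp add: CH_def power_mult_distrib distrib_right)
  ultimately show "Re (ehom \<chi>\<^sub>0 p p) \<le> (CH * norm p)\<^sup>2" unfolding eq by simp
qed

lemma cinner_semi_inner: "semi_inner (UNIV :: (complex^3) set) (*s) cinner"
proof
  show "cinner y x = cnj (cinner x y)" for x y by (rule CV.ip0_cnj)
  show "0 \<le> Re (cinner x x)" for x by (simp add: CV.ip0_self del: of_real_power)
qed (auto simp: cinner_add_left CV.ip0_sc CV.sc0_m1)

lemma cinner_nrm: "semi_inner.nrm cinner p = norm p"
proof -
  interpret semi_inner "UNIV :: (complex^3) set" "(*s)" cinner by (rule cinner_semi_inner)
  show ?thesis by (simp add: nrm_def CV.ip0_self del: of_real_power)
qed

lemma ehom_semi_inner: "semi_inner (UNIV :: (complex^3) set) (*s) (ehom \<chi>\<^sub>0)"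
proof
  show "ehom \<chi>\<^sub>0 y x = cnj (ehom \<chi>\<^sub>0 x y)" for x y
    unfolding ehom_eq using Qh_hermitian[of "iX \<chi>\<^sub>0 y" "iX \<chi>\<^sub>0 x"] CV.ip0_cnj[of y x] by simp
  show "0 \<le> Re (ehom \<chi>\<^sub>0 x x)" for x by (rule ehom_self)
  show "ehom \<chi>\<^sub>0 (x + y) z = ehom \<chi>\<^sub>0 x z + ehom \<chi>\<^sub>0 y z" for x y z
    unfolding ehom_eq by (simp add: iX_add Qh_add_left cinner_add_left add_divide_distrib)
  show "ehom \<chi>\<^sub>0 (c *s x) z = c * ehom \<chi>\<^sub>0 x z" for c x z
    unfolding ehom_eq by (simp add: iX_sc Qh_cmul_left CV.ip0_sc distrib_left)
qed (auto simp: CV.sc0_m1)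

lemma ehom_nrm: "norm p \<le> semi_inner.nrm (ehom \<chi>\<^sub>0) p" "semi_inner.nrm (ehom \<chi>\<^sub>0) p \<le> CH * norm p"
proof -
  interpret semi_inner "UNIV :: (complex^3) set" "(*s)" "ehom \<chi>\<^sub>0" by (rule ehom_semi_inner)
  show "norm p \<le> nrm p" unfolding nrm_def by (rule real_le_rsqrt) (rule ehom_self)
  show "nrm p \<le> CH * norm p" unfolding nrm_def by (rule real_le_lsqrt) (use ehom_self CH_pos in auto)
qed

lemma ehom_form_pair: "form_pair UNIV UNIV (*s) (ehom \<chi>\<^sub>0) cinner"
proof -
  interpret E: semi_inner "UNIV :: (complex^3) set" "(*s)" "ehom \<chi>\<^sub>0" by (rule ehom_semi_inner)
  interpret H: semi_inner "UNIV :: (complex^3) set" "(*s)" cinner by (rule cinner_semi_inner)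
  show ?thesis
  proof
    show "H.nrm x \<le> E.nrm x" for x by (simp add: cinner_nrm ehom_nrm)
    show "\<exists>x\<in>UNIV. 0 < H.nrm x" by (rule bexI[of _ "axis 1 1"]) (auto simp: cinner_nrm axis_eq_0_iff)
    show E.complete_nrm
      unfolding E.complete_nrm_def
    proof (intro allI impI, elim conjE)
      fix x :: "nat \<Rightarrow> complex^3"
      assume c: "\<forall>\<epsilon>>0. \<exists>N. \<forall>m\<ge>N. \<forall>n\<ge>N. E.nrm (x m - x n) < \<epsilon>"
      have "Cauchy x"
        unfolding Cauchy_def dist_norm
      proof (intro allI impI)
        fix \<epsilon> :: real assume "\<epsilon> > 0"
        then obtain N where N: "\<forall>m\<ge>N. \<forall>n\<ge>N. E.nrm (x m - x n) < \<epsilon>" using c by blast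
        have "norm (x m - x n) < \<epsilon>" if "m \<ge> N" "n \<ge> N" for m n
          using N that le_less_trans[OF ehom_nrm(1)] by blast
        then show "\<exists>N. \<forall>m\<ge>N. \<forall>n\<ge>N. norm (x m - x n) < \<epsilon>" by blast
      qed
      from Cauchy_convergent[OF this] obtain u where "x \<longlonglongrightarrow> u" unfolding convergent_def by blast
      then have "(\<lambda>n. norm (x n - u)) \<longlonglongrightarrow> 0" by (intro tendsto_norm_zero LIM_zero)
      then have l: "(\<lambda>n. CH * norm (x n - u)) \<longlonglongrightarrow> 0" by (rule tendsto_mult_right_zero)
      have "\<forall>\<^sub>F n in sequentially. norm (E.nrm (x n - u)) \<le> CH * norm (x n - u)"
        using ehom_nrm(2) E.nrm_nonneg by simp
      then have "(\<lambda>n. E.nrm (x n - u)) \<longlonglongrightarrow> 0" by (rule Lim_null_comparison[OF _ l])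
      then show "\<exists>u\<in>UNIV. (\<lambda>n. E.nrm (x n - u)) \<longlonglongrightarrow> 0" by blast
    qed
  qed auto
qed

lemma cinner_eqI: "(\<And>d. cinner p d = cinner q d) \<Longrightarrow> p = q"
proof -
  assume "\<And>d. cinner p d = cinner q d"
  moreover have "cinner c (axis i 1) = c $ i" for c i
    by (simp add: cinner_def axis_def if_distrib cong: if_cong)
  ultimately show ?thesis by (metis vec_eq_iff)
qed

lemma ehom_res:
  "form_pair.res UNIV (ehom \<chi>\<^sub>0) cinner z g u \<longleftrightarrow> Ahom_sc A \<chi>\<^sub>0 *v u - z *s u = g"
proof -
  interpret P: form_pair UNIV UNIV "(*s)" "ehom \<chi>\<^sub>0" cinner by (rule ehom_form_pair)
  have eq: "ehom \<chi>\<^sub>0 u v - (z + 1) * cinner u v = cinner (Ahom_sc A \<chi>\<^sub>0 *v u - z *s u) v" for v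
    using P.H.ip_diff[of "Ahom_sc A \<chi>\<^sub>0 *v u" "z *s u" v]
    by (simp add: ehom_def CV.ip0_sc algebra_simps)
  show ?thesis
    unfolding P.res_def eq using cinner_eqI by auto
qed

lemma mat_shift: "(Ahom_sc A \<chi>\<^sub>0 - mat z) *v v = Ahom_sc A \<chi>\<^sub>0 *v v - z *s v"
proof -
  have "(mat z :: complex^3^3) *v v = z *s v"
    by (simp add: vec_eq_iff matrix_vector_mult_def mat_def if_distrib if_distribR cong: if_cong)
  then show ?thesis by (simp add: matrix_vector_mult_diff_rdistrib)
qed

lemma hom_invertible:
  assumes "z \<notin> mat_spectrum (Ahom_sc A \<chi>\<^sub>0)"
  shows "invertible (Ahom_sc A \<chi>\<^sub>0 - mat z)"
proof -
  have "v = 0" if "(Ahom_sc A \<chi>\<^sub>0 - mat z) *v v = 0" for v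
    using assms that unfolding mat_shift mat_spectrum_def by auto
  then have "\<exists>B. B ** (Ahom_sc A \<chi>\<^sub>0 - mat z) = mat 1"
    unfolding matrix_left_invertible_ker by blast
  then show ?thesis by (simp add: invertible_left_inverse)
qed

text \<open>An eigenvector solves the equation with data 0 and violates the bound; off the spectrum
  the inverse matrix supplies solution and bound.\<close>

lemma ehom_rho: "form_pair.rho UNIV UNIV (ehom \<chi>\<^sub>0) cinner = - mat_spectrum (Ahom_sc A \<chi>\<^sub>0)"
proof -
  interpret P: form_pair UNIV UNIV "(*s)" "ehom \<chi>\<^sub>0" cinner by (rule ehom_form_pair)
  show ?thesis
  proof (intro set_eqI iffI)
    fix z assume z: "z \<in> P.rho"
    show "z \<in> - mat_spectrum (Ahom_sc A \<chi>\<^sub>0)"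
    proof
      assume "z \<in> mat_spectrum (Ahom_sc A \<chi>\<^sub>0)"
      then obtain v where v: "v \<noteq> 0" "Ahom_sc A \<chi>\<^sub>0 *v v = z *s v" by (auto simp: mat_spectrum_def)
      then have "P.res z 0 v" by (simp add: ehom_res)
      moreover obtain B where "\<And>g u. P.res z g u \<Longrightarrow> P.H.nrm u \<le> B * P.H.nrm g" using z by (auto simp: P.rho_def)
      ultimately have "norm v \<le> B * norm (0::complex^3)" by (metis cinner_nrm)
      then show False using v by simp
    qed
  next
    fix z assume "z \<in> - mat_spectrum (Ahom_sc A \<chi>\<^sub>0)"
    then have inv: "invertible (Ahom_sc A \<chi>\<^sub>0 - mat z)" by (intro hom_invertible) simp
    let ?B = "Ahom_sc A \<chi>\<^sub>0 - mat z"
    have l: "matrix_inv ?B ** ?B = mat 1" and r: "?B ** matrix_inv ?B = mat 1"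
      using invertible_matrix_inv[OF inv] by auto
    have sol: "P.res z g (matrix_inv ?B *v g)" for g
      unfolding ehom_res mat_shift[symmetric] by (simp add: matrix_vector_mul_assoc r)
    have uniq: "u = matrix_inv ?B *v g" if "P.res z g u" for g u
      using that unfolding ehom_res mat_shift[symmetric] by (metis l matrix_vector_mul_assoc matrix_vector_mul_lid)
    have "linear ((*v) (matrix_inv ?B) :: complex^3 \<Rightarrow> complex^3)"
      by (rule linearI) (auto simp: vec_eq_iff matrix_vector_mult_def distrib_left sum.distrib scaleR_sum_right)
    then obtain K where K: "\<And>g. norm (matrix_inv ?B *v g) \<le> norm g * K"
      using bounded_linear.bounded linear_conv_bounded_linear by blast
    then have "P.H.nrm u \<le> K * P.H.nrm g" if "P.res z g u" for g u
      using uniq[OF that] by (simp add: cinner_nrm mult.commute)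
    then show "z \<in> P.rho" unfolding P.rho_def using sol by blast
  qed
qed

text \<open>The second part takes the equation multiplied by
  \<open>\<bar>\<chi>\<bar>\<^sup>2\<close>, the shape it has for \<open>u0vec\<close> and in
  \<open>corr3\<close>. Passing to the form norm and back costs \<open>CH\<close>.\<close>

lemma hom_resolvent:
  assumes z: "z \<notin> mat_spectrum (Ahom_sc A \<chi>\<^sub>0)" and x0: "\<chi>\<^sub>0 \<noteq> 0"
  shows "0 < D_hom A \<chi>\<^sub>0 z"
    and "(\<And>d. cinner (Ahom A \<chi>\<^sub>0 *v p) d - z * complex_of_real ((norm \<chi>\<^sub>0)\<^sup>2) * cinner p d = cinner g d)
      \<Longrightarrow> norm p \<le> CH / D_hom A \<chi>\<^sub>0 z * (norm g / (norm \<chi>\<^sub>0)\<^sup>2)"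
proof -
  interpret P: form_pair UNIV UNIV "(*s)" "ehom \<chi>\<^sub>0" cinner by (rule ehom_form_pair)
  have D: "D_hom A \<chi>\<^sub>0 z = infdist z (- P.rho)" by (simp add: D_hom_def ehom_rho)
  have zr: "z \<in> P.rho" using z by (simp add: ehom_rho)
  show pos: "0 < D_hom A \<chi>\<^sub>0 z" unfolding D by (rule P.infdist_rho(1)[OF zr])
  assume eq: "\<And>d. cinner (Ahom A \<chi>\<^sub>0 *v p) d - z * complex_of_real ((norm \<chi>\<^sub>0)\<^sup>2) * cinner p d = cinner g d"
  let ?t2 = "(norm \<chi>\<^sub>0)\<^sup>2"
  have t2: "0 < ?t2" using x0 by simp
  let ?g = "(1 / complex_of_real ?t2) *s g"
  have "Ahom_sc A \<chi>\<^sub>0 *v p - z *s p = ?g"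
  proof (rule cinner_eqI)
    fix d
    have "cinner (Ahom_sc A \<chi>\<^sub>0 *v p - z *s p) d = cinner (Ahom A \<chi>\<^sub>0 *v p) d / complex_of_real ?t2 - z * cinner p d"
      using P.H.ip_diff[of "Ahom_sc A \<chi>\<^sub>0 *v p" "z *s p" d] by (simp add: Ahom_sc_vec CV.ip0_sc)
    also have "\<dots> = cinner ?g d" using eq[of d] t2 by (simp add: CV.ip0_sc field_simps)
    finally show "cinner (Ahom_sc A \<chi>\<^sub>0 *v p - z *s p) d = cinner ?g d" .
  qed
  then have "P.res z ?g p" by (simp add: ehom_res)
  then have "D_hom A \<chi>\<^sub>0 z * P.E.nrm p \<le> P.E.nrm ?g"
    using P.infdist_rho(2)[OF zr] unfolding D P.lower_def by blast
  also have "\<dots> \<le> CH * norm ?g" by (rule ehom_nrm)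
  also have "norm ?g = norm g / ?t2"
    using P.H.nrm_sc[of g "1 / complex_of_real ?t2"] by (simp add: cinner_nrm norm_divide del: of_real_power)
  finally have "D_hom A \<chi>\<^sub>0 z * P.E.nrm p \<le> CH * (norm g / ?t2)" .
  moreover have "D_hom A \<chi>\<^sub>0 z * norm p \<le> D_hom A \<chi>\<^sub>0 z * P.E.nrm p"
    using ehom_nrm(1) pos by (intro mult_left_mono) auto
  ultimately have "D_hom A \<chi>\<^sub>0 z * norm p \<le> CH * (norm g / ?t2)" by linarith
  then have "norm p \<le> (CH * (norm g / ?t2)) / D_hom A \<chi>\<^sub>0 z"
    by (subst pos_le_divide_eq[OF pos]) (simp only: mult.commute)
  then show "norm p \<le> CH / D_hom A \<chi>\<^sub>0 z * (norm g / ?t2)" by (simp add: mult_ac)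
qed

lemma u0vec_eq:
  assumes "z \<notin> mat_spectrum (Ahom_sc A \<chi>\<^sub>0)" and x0: "\<chi>\<^sub>0 \<noteq> 0"
  shows "cinner (Ahom A \<chi>\<^sub>0 *v u0vec A \<chi>\<^sub>0 z f) d - z * complex_of_real ((norm \<chi>\<^sub>0)\<^sup>2) * cinner (u0vec A \<chi>\<^sub>0 z f) d
    = complex_of_real ((norm \<chi>\<^sub>0)\<^sup>2) * cinner (meanY f) d"
proof -
  interpret P: form_pair UNIV UNIV "(*s)" "ehom \<chi>\<^sub>0" cinner by (rule ehom_form_pair)
  let ?B = "Ahom_sc A \<chi>\<^sub>0 - mat z" and ?u = "u0vec A \<chi>\<^sub>0 z f"
  have "?B *v ?u = meanY f"
    using invertible_matrix_inv[OF hom_invertible[OF assms(1)]] by (simp add: u0vec_def matrix_vector_mul_assoc)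
  then have "cinner (Ahom_sc A \<chi>\<^sub>0 *v ?u - z *s ?u) d = cinner (meanY f) d" by (simp add: mat_shift)
  moreover have "cinner (Ahom_sc A \<chi>\<^sub>0 *v ?u - z *s ?u) d
      = cinner (Ahom A \<chi>\<^sub>0 *v ?u) d / complex_of_real ((norm \<chi>\<^sub>0)\<^sup>2) - z * cinner ?u d"
    using P.H.ip_diff[of "Ahom_sc A \<chi>\<^sub>0 *v ?u" "z *s ?u" d] by (simp add: Ahom_sc_vec CV.ip0_sc)
  ultimately show ?thesis using x0 by (simp add: field_simps)
qed

end

section \<open>Residual estimates\<close>

text \<open>Three components of modulus at most 4. The bound trades surplus powers of
  \<bar>\<chi>\<bar> for constants.\<close>

lemma norm_Ydual: "\<chi>\<^sub>0 \<in> Ydual \<Longrightarrow> norm \<chi>\<^sub>0 \<le> 12"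
proof -
  assume x: "\<chi>\<^sub>0 \<in> Ydual"
  have "norm \<chi>\<^sub>0 \<le> (\<Sum>i\<in>UNIV. \<bar>\<chi>\<^sub>0 $ i\<bar>)" by (rule norm_le_l1_cart)
  also have "\<dots> \<le> (\<Sum>i\<in>(UNIV::3 set). 4)"
  proof (rule sum_mono)
    fix i
    have "- pi \<le> \<chi>\<^sub>0 $ i" "\<chi>\<^sub>0 $ i < pi" using x by (auto simp: Ydual_def)
    then show "\<bar>\<chi>\<^sub>0 $ i\<bar> \<le> 4" using pi_less_4 by linarith
  qed
  finally show ?thesis by simp
qed

lemma nrm_l2inner: "semi_inner.nrm l2inner u = L2norm u"
  by (rule CV.nrm_eq[unfolded CV_ipf])

lemma l2inner_semi_inner: "semi_inner {u. L2 u} CV.scf l2inner"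
  by (rule CV.semi_inner_L2[unfolded CV_ipf])

section \<open>The fibre operator in its form norm\<close>

context elasticity
begin

abbreviation eM :: "real^3 \<Rightarrow> (real^3 \<Rightarrow> complex^3) \<Rightarrow> (real^3 \<Rightarrow> complex^3) \<Rightarrow> complex" where
  "eM \<chi>\<^sub>0 \<equiv> ipE (1 / (norm \<chi>\<^sub>0)\<^sup>2) 1 \<chi>\<^sub>0"

lemma eM_semi_inner: "semi_inner {u. H1per u} CV.scf (eM \<chi>\<^sub>0)"
  by (rule ipE_semi_inner) (auto intro: H1per_add H1per_sc H1per_const)

text \<open>Each bound drops one of the two nonnegative parts of the form norm. The factor
  \<open>norm \<chi>\<^sub>0\<close> in the second is the power regained in
  \<open>main_dual\<close>.\<close>

lemma eM_low:
  assumes "H1per u" "\<chi>\<^sub>0 \<noteq> 0"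
  shows "L2norm u \<le> semi_inner.nrm (eM \<chi>\<^sub>0) u"
    and "L2norm (Lam \<chi>\<^sub>0 u) \<le> norm \<chi>\<^sub>0 / sqrt \<nu> * semi_inner.nrm (eM \<chi>\<^sub>0) u"
proof -
  interpret semi_inner "{u. H1per u}" CV.scf "eM \<chi>\<^sub>0" by (rule eM_semi_inner)
  let ?t = "norm \<chi>\<^sub>0"
  have t: "0 < ?t" using assms by simp
  have sq: "(nrm u)\<^sup>2 = 1 / ?t\<^sup>2 * Re (aA (Lam \<chi>\<^sub>0 u) (Lam \<chi>\<^sub>0 u)) + 1 * (L2norm u)\<^sup>2"
    by (rule ipE_nrm_sq[OF eM_semi_inner]) (use assms in auto)
  have nn: "0 \<le> nrm u" using nrm_nonneg assms by simp
  have p: "\<nu> * (L2norm (Lam \<chi>\<^sub>0 u))\<^sup>2 \<le> Re (aA (Lam \<chi>\<^sub>0 u) (Lam \<chi>\<^sub>0 u))" by (rule aA_Lam_pos[OF assms(1)])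
  have "0 \<le> \<nu> * (L2norm (Lam \<chi>\<^sub>0 u))\<^sup>2" using \<nu>_pos by simp
  then have "(L2norm u)\<^sup>2 \<le> (nrm u)\<^sup>2" unfolding sq using p by simp
  then show "L2norm u \<le> nrm u" using nn by (rule power2_le_imp_le)
  have "(sqrt \<nu> / ?t * L2norm (Lam \<chi>\<^sub>0 u))\<^sup>2 = 1 / ?t\<^sup>2 * (\<nu> * (L2norm (Lam \<chi>\<^sub>0 u))\<^sup>2)"
    using \<nu>_pos by (simp add: power_mult_distrib power_divide)
  also have "\<dots> \<le> 1 / ?t\<^sup>2 * Re (aA (Lam \<chi>\<^sub>0 u) (Lam \<chi>\<^sub>0 u))" by (intro mult_left_mono p) simp
  also have "\<dots> \<le> (nrm u)\<^sup>2" unfolding sq by simp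
  finally have "sqrt \<nu> / ?t * L2norm (Lam \<chi>\<^sub>0 u) \<le> nrm u" using nn by (rule power2_le_imp_le)
  then show "L2norm (Lam \<chi>\<^sub>0 u) \<le> ?t / sqrt \<nu> * nrm u" using t \<nu>_pos by (simp add: field_simps)
qed

text \<open>The 36 is the 3 of Korn's inequality times the bound 12 on
  \<open>norm \<chi>\<^sub>0\<close>.\<close>

lemma eM_H1:
  assumes "H1per u" "\<chi>\<^sub>0 \<in> Ydual - {0}"
  shows "H1norm u \<le> (1 + 36 / sqrt \<nu>) * semi_inner.nrm (eM \<chi>\<^sub>0) u"
proof -
  let ?N = "semi_inner.nrm (eM \<chi>\<^sub>0) u"
  have N: "0 \<le> ?N" using order_trans[OF L2norm_nonneg eM_low(1)[of u \<chi>\<^sub>0]] assms by auto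
  have "L2norm (Lam \<chi>\<^sub>0 u) \<le> norm \<chi>\<^sub>0 / sqrt \<nu> * ?N" using eM_low(2) assms by simp
  also have "\<dots> \<le> 12 / sqrt \<nu> * ?N" using N norm_Ydual[of \<chi>\<^sub>0] assms \<nu>_pos by (intro mult_right_mono divide_right_mono) auto
  finally have "L2norm (Lam \<chi>\<^sub>0 u) \<le> 12 / sqrt \<nu> * ?N" .
  moreover have "L2norm (grad u) \<le> 3 * L2norm (Lam \<chi>\<^sub>0 u)" using Korn(2) assms by simp
  moreover have "L2norm u \<le> ?N" using eM_low(1) assms by simp
  ultimately have "H1norm u \<le> ?N + 3 * (12 / sqrt \<nu> * ?N)" using H1norm_le[of u] by linarith
  then show ?thesis by (simp add: distrib_right)
qed

lemma eM_form_pair: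
  assumes x: "\<chi>\<^sub>0 \<in> Ydual - {0}"
  shows "form_pair {u. H1per u} {u. L2 u} CV.scf (eM \<chi>\<^sub>0) l2inner"
proof -
  interpret E: semi_inner "{u. H1per u}" CV.scf "eM \<chi>\<^sub>0" by (rule eM_semi_inner)
  interpret H: semi_inner "{u. L2 u}" CV.scf l2inner by (rule l2inner_semi_inner)
  show ?thesis
  proof
    show "{u. H1per u} \<subseteq> {u. L2 u}" using H1per_L2 by auto
    show "H.nrm u \<le> E.nrm u" if "u \<in> {u. H1per u}" for u
      using eM_low(1) that x by (simp add: nrm_l2inner)
    show "\<exists>u\<in>{u. H1per u}. 0 < H.nrm u"
      by (rule bexI[of _ "\<lambda>y. axis 1 1"]) (auto simp: nrm_l2inner L2norm_const axis_eq_0_iff H1per_const)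
    show E.complete_nrm
    proof (rule complete_H1[OF eM_semi_inner])
      show "H1norm u \<le> (1 + 36 / sqrt \<nu>) * E.nrm u" if "u \<in> {u. H1per u}" for u
        using eM_H1[OF _ x] that by simp
      show "0 < 1 + 36 / sqrt \<nu>" using \<nu>_pos by (simp add: add_pos_pos)
      show "E.nrm u \<le> sqrt (1 / (norm \<chi>\<^sub>0)\<^sup>2 * KA * (1 + norm \<chi>\<^sub>0)\<^sup>2 + 1) * H1norm u" if "u \<in> {u. H1per u}" for u
        by (rule ipE_nrm_up[OF eM_semi_inner that]) (use that in auto)
    qed auto
  qed
qed

lemma eM_res:
  assumes x: "\<chi>\<^sub>0 \<in> Ydual - {0}"
  shows "form_pair.res {u. H1per u} (eM \<chi>\<^sub>0) l2inner z g u \<longleftrightarrow> res_sol A \<chi>\<^sub>0 z g u"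
proof -
  interpret P: form_pair "{u. H1per u}" "{u. L2 u}" CV.scf "eM \<chi>\<^sub>0" l2inner by (rule eM_form_pair[OF x])
  let ?c = "complex_of_real ((norm \<chi>\<^sub>0)\<^sup>2)"
  have c: "?c \<noteq> 0" using x by simp
  have "eM \<chi>\<^sub>0 u v - (z + 1) * l2inner u v = l2inner g v \<longleftrightarrow>
      aform A \<chi>\<^sub>0 u v - z * ?c * l2inner u v = ?c * l2inner g v" for v
  proof -
    have "eM \<chi>\<^sub>0 u v - (z + 1) * l2inner u v - l2inner g v = (aform A \<chi>\<^sub>0 u v - z * ?c * l2inner u v - ?c * l2inner g v) / ?c"
      using c by (simp add: ipE_def aform_eq field_simps)
    then show ?thesis using c by (metis divide_eq_0_iff right_minus_eq)
  qed
  then show ?thesis by (simp add: P.res_def res_sol_def)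
qed

text \<open>The uniqueness clause of \<open>rho_op\<close> follows from its bound: the difference of
  two solutions solves the equation with data 0.\<close>

lemma eM_rho:
  assumes x: "\<chi>\<^sub>0 \<in> Ydual - {0}"
  shows "form_pair.rho {u. H1per u} {u. L2 u} (eM \<chi>\<^sub>0) l2inner = rho_op A \<chi>\<^sub>0"
proof -
  interpret P: form_pair "{u. H1per u}" "{u. L2 u}" CV.scf "eM \<chi>\<^sub>0" l2inner by (rule eM_form_pair[OF x])
  have uniq: "AE y in MY. u y = w y"
    if B: "\<And>f u. L2 f \<Longrightarrow> res_sol A \<chi>\<^sub>0 z f u \<Longrightarrow> L2norm u \<le> B * L2norm f"
      and f: "L2 f" and u: "res_sol A \<chi>\<^sub>0 z f u" and w: "res_sol A \<chi>\<^sub>0 z f w" for B z f u w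
  proof -
    have "P.res z (f - f) (u - w)" using P.res_diff[of z f u f w] f u w by (simp add: eM_res[OF x])
    then have "res_sol A \<chi>\<^sub>0 z (\<lambda>y. 0) (\<lambda>y. u y - w y)" by (simp add: eM_res[OF x] fun_diff_def zero_fun_def)
    from B[OF L2_const this] have "L2norm (\<lambda>y. u y - w y) \<le> 0" by (simp add: L2norm_const)
    then have "L2norm (\<lambda>y. u y - w y) = 0" by (simp add: antisym)
    moreover have "L2 (\<lambda>y. u y - w y)" using u w by (intro L2_diff H1per_L2) (auto simp: res_sol_def)
    ultimately show ?thesis using L2norm_eq_0_iff by fastforce
  qed
  show ?thesis
  proof (intro set_eqI iffI)
    fix z assume "z \<in> P.rho"
    then obtain B where ex: "\<And>f. L2 f \<Longrightarrow> \<exists>u. res_sol A \<chi>\<^sub>0 z f u"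
      and B: "\<And>f u. L2 f \<Longrightarrow> res_sol A \<chi>\<^sub>0 z f u \<Longrightarrow> L2norm u \<le> B * L2norm f"
      by (auto simp: P.rho_def eM_res[OF x] nrm_l2inner)
    have "\<exists>M. \<forall>f u. L2 f \<and> res_sol A \<chi>\<^sub>0 z f u \<longrightarrow> L2norm u \<le> M * L2norm f"
      by (intro exI[of _ B] allI impI) (use B in blast)
    moreover have "\<forall>f u w. L2 f \<and> res_sol A \<chi>\<^sub>0 z f u \<and> res_sol A \<chi>\<^sub>0 z f w \<longrightarrow> (AE y in lebesgue_on Ycell. u y = w y)"
      using uniq[OF B] by blast
    ultimately show "z \<in> rho_op A \<chi>\<^sub>0" using ex unfolding rho_op_def by blast
  next
    fix z assume z: "z \<in> rho_op A \<chi>\<^sub>0"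
    then obtain M where ex: "\<forall>f. L2 f \<longrightarrow> (\<exists>u. res_sol A \<chi>\<^sub>0 z f u)"
      and M: "\<forall>f u. L2 f \<and> res_sol A \<chi>\<^sub>0 z f u \<longrightarrow> L2norm u \<le> M * L2norm f"
      unfolding rho_op_def by blast
    have "\<exists>M. \<forall>g\<in>{u. L2 u}. \<forall>u. P.res z g u \<longrightarrow> P.H.nrm u \<le> M * P.H.nrm g"
      by (rule exI[of _ M]) (use M in \<open>simp add: eM_res[OF x] nrm_l2inner\<close>)
    moreover have "\<forall>g\<in>{u. L2 u}. \<exists>u. P.res z g u" using ex by (simp add: eM_res[OF x])
    ultimately show "z \<in> P.rho" unfolding P.rho_def by blast
  qed
qed

text \<open>The 2 comes from \<open>dual_resolvent_bound\<close>, the bracket from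
  \<open>eM_H1\<close>, and the last division from \<open>eM_low\<close>.\<close>

definition CE :: real where "CE = 2 * (1 + 36 / sqrt \<nu>) / sqrt \<nu>"

lemma CE_nonneg: "0 \<le> CE" using \<nu>_pos by (simp add: CE_def)

text \<open>Division by \<open>\<bar>\<chi>\<bar>\<^sup>2\<close> costs two powers, and
  \<open>eM_low\<close> gives one back; so a residual of size \<open>K\<close> yields an error of
  size \<open>K / norm \<chi>\<^sub>0\<close>.\<close>

lemma main_dual:
  assumes x: "\<chi>\<^sub>0 \<in> Ydual - {0}" and z: "z \<in> rho_op A \<chi>\<^sub>0" and w: "H1per w"
    and eq: "\<And>v. H1per v \<Longrightarrow> aA (Lam \<chi>\<^sub>0 w) (Lam \<chi>\<^sub>0 v) - z * complex_of_real ((norm \<chi>\<^sub>0)\<^sup>2) * l2inner w v = R v"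
    and bound: "\<And>v. H1per v \<Longrightarrow> cmod (R v) \<le> K * L2norm (Lam \<chi>\<^sub>0 v)" and K: "0 \<le> K"
  shows "H1norm w \<le> CE * max 1 (cmod (z + 1) / D_op A \<chi>\<^sub>0 z) * (K / norm \<chi>\<^sub>0)"
proof -
  interpret P: form_pair "{u. H1per u}" "{u. L2 u}" CV.scf "eM \<chi>\<^sub>0" l2inner by (rule eM_form_pair[OF x])
  let ?t = "norm \<chi>\<^sub>0" and ?c = "complex_of_real ((norm \<chi>\<^sub>0)\<^sup>2)"
  let ?m = "max 1 (cmod (z + 1) / D_op A \<chi>\<^sub>0 z)"
  have t: "0 < ?t" using x by simp
  have c: "?c \<noteq> 0" using x by simp
  have nc: "cmod ?c = ?t\<^sup>2" by (simp del: of_real_power)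
  have "P.E.nrm w \<le> 2 * max 1 (cmod (z + 1) / infdist z (- P.rho)) * (K / (?t * sqrt \<nu>))"
  proof (rule P.dual_resolvent_bound)
    show "z \<in> P.rho" using z by (simp add: eM_rho[OF x])
    show "w \<in> {u. H1per u}" using w by simp
    show "eM \<chi>\<^sub>0 w v - (z + 1) * l2inner w v = R v / ?c" if "v \<in> {u. H1per u}" for v
      using eq[of v, symmetric] that c by (simp add: ipE_def field_simps)
    show "cmod (R v / ?c) \<le> K / (?t * sqrt \<nu>) * P.E.nrm v" if v: "v \<in> {u. H1per u}" for v
    proof -
      have "cmod (R v / ?c) \<le> K * L2norm (Lam \<chi>\<^sub>0 v) / ?t\<^sup>2"
        unfolding norm_divide nc using bound v by (intro divide_right_mono) auto
      also have "\<dots> \<le> K * (?t / sqrt \<nu> * P.E.nrm v) / ?t\<^sup>2"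
        using eM_low(2)[of v \<chi>\<^sub>0] v x K by (intro divide_right_mono mult_left_mono) auto
      also have "\<dots> = K / (?t * sqrt \<nu>) * P.E.nrm v" using t by (simp add: power2_eq_square)
      finally show ?thesis .
    qed
    show "0 \<le> K / (?t * sqrt \<nu>)" using K t \<nu>_pos by simp
  qed
  then have N: "P.E.nrm w \<le> 2 * ?m * (K / (?t * sqrt \<nu>))" by (simp add: D_op_def eM_rho[OF x])
  have "H1norm w \<le> (1 + 36 / sqrt \<nu>) * P.E.nrm w" by (rule eM_H1[OF w x])
  also have "\<dots> \<le> (1 + 36 / sqrt \<nu>) * (2 * ?m * (K / (?t * sqrt \<nu>)))"
    using \<nu>_pos by (intro mult_left_mono N) simp
  also have "\<dots> = CE * ?m * (K / ?t)" by (simp only: CE_def times_divide_eq_left times_divide_eq_right divide_divide_eq_left mult_ac)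
  finally show ?thesis .
qed

section \<open>Bounds for the terms of a residual\<close>

lemma aA_Lam_bound: "L2 P \<Longrightarrow> H1per v \<Longrightarrow> cmod (aA P (Lam \<chi>\<^sub>0 v)) \<le> KA * L2norm P * L2norm (Lam \<chi>\<^sub>0 v)"
  using aA_bound[OF _ L2_Lam, of P v \<chi>\<^sub>0] by (simp add: mult.assoc)

text \<open>With its mean removed, \<open>v\<close> is bounded by its strain without an inverse
  power of \<bar>\<chi>\<bar>, so the factor from \<open>iX\<close> is a genuine gain. For
  \<open>v\<close> itself Korn's inequality would consume it.\<close>

lemma aA_iX_bound:
  assumes "L2 P" "H1per v" "\<chi>\<^sub>0 \<in> Ydual"
  shows "cmod (aA P (\<lambda>y. iX \<chi>\<^sub>0 (v y - meanY v))) \<le> 2 * KA * L2norm P * norm \<chi>\<^sub>0 * L2norm (Lam \<chi>\<^sub>0 v)"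
proof -
  have L: "L2 (\<lambda>y. v y - meanY v)" by (intro L2_diff H1per_L2 assms L2_const)
  have "cmod (aA P (\<lambda>y. iX \<chi>\<^sub>0 (v y - meanY v))) \<le> KA * (L2norm P * L2norm (\<lambda>y. iX \<chi>\<^sub>0 (v y - meanY v)))"
    by (rule aA_bound[OF assms(1) L2_iX[OF L]])
  also have "\<dots> \<le> KA * (L2norm P * (norm \<chi>\<^sub>0 * (2 * L2norm (Lam \<chi>\<^sub>0 v))))"
  proof (intro mult_left_mono)
    have "L2norm (\<lambda>y. iX \<chi>\<^sub>0 (v y - meanY v)) \<le> norm \<chi>\<^sub>0 * L2norm (\<lambda>y. v y - meanY v)" by (rule L2norm_iX[OF L])
    also have "\<dots> \<le> norm \<chi>\<^sub>0 * (2 * L2norm (Lam \<chi>\<^sub>0 v))" by (intro mult_left_mono Korn assms) simp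
    finally show "L2norm (\<lambda>y. iX \<chi>\<^sub>0 (v y - meanY v)) \<le> norm \<chi>\<^sub>0 * (2 * L2norm (Lam \<chi>\<^sub>0 v))" .
  qed (use KA in auto)
  finally show ?thesis by (simp add: mult_ac)
qed

lemma l2inner_osc_bound:
  assumes "L2 g" "H1per v" "\<chi>\<^sub>0 \<in> Ydual"
  shows "cmod (l2inner g (\<lambda>y. v y - meanY v)) \<le> 2 * L2norm g * L2norm (Lam \<chi>\<^sub>0 v)"
proof -
  have "cmod (l2inner g (\<lambda>y. v y - meanY v)) \<le> L2norm g * L2norm (\<lambda>y. v y - meanY v)"
    by (intro l2inner_bound L2_diff H1per_L2 assms L2_const)
  also have "\<dots> \<le> L2norm g * (2 * L2norm (Lam \<chi>\<^sub>0 v))" by (intro mult_left_mono Korn assms) simp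
  finally show ?thesis by (simp add: mult_ac)
qed

lemma aA_split_Lam:
  assumes "L2 P" "H1per v"
  shows "aA P (Lam \<chi>\<^sub>0 v) = aA P (Lam 0 v) + aA P (\<lambda>y. iX \<chi>\<^sub>0 (v y))"
  unfolding Lam_split[of \<chi>\<^sub>0, abs_def]
  by (rule aA_add_right[OF assms(1) L2_Lam[OF assms(2)] L2_iX[OF H1per_L2[OF assms(2)]]])

lemma aA_split_mean:
  assumes "L2 P" "H1per v"
  shows "aA P (\<lambda>y. iX \<chi>\<^sub>0 (v y)) = aA P (\<lambda>y. iX \<chi>\<^sub>0 (v y - meanY v)) + aA P (\<lambda>y. iX \<chi>\<^sub>0 (meanY v))"
proof -
  have L: "L2 (\<lambda>y. v y - meanY v)" by (intro L2_diff H1per_L2 assms L2_const)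
  show ?thesis using aA_add_right[OF assms(1) L2_iX[OF L] L2_const, of \<chi>\<^sub>0 "iX \<chi>\<^sub>0 (meanY v)"] by (simp add: iX_diff)
qed

lemma l2inner_split_mean:
  assumes "L2 g" "H1per v"
  shows "l2inner g v = l2inner g (\<lambda>y. v y - meanY v) + cinner (meanY g) (meanY v)"
  using l2inner_diff_right[OF H1per_L2[OF assms(2)] L2_const assms(1), of "meanY v"] l2inner_const_right[OF assms(1)]
  by simp

text \<open>\<open>u + c\<close> with \<open>c\<close> constant and \<open>u\<close> its corrector: up to the term \<open>iX u\<close> the fluxes are those of the
  cell problem, which only sees constants.\<close>

lemma corrected_constant:
  assumes u: "cellM (iX \<chi>\<^sub>0 c) u" and v: "H1per v"
  shows "aA (Lam \<chi>\<^sub>0 (\<lambda>y. c + u y)) (Lam \<chi>\<^sub>0 v)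
     = aA (\<lambda>y. Lam 0 u y + iX \<chi>\<^sub>0 c) (\<lambda>y. iX \<chi>\<^sub>0 (v y)) + aA (\<lambda>y. iX \<chi>\<^sub>0 (u y)) (Lam \<chi>\<^sub>0 v)"
    and "aA (\<lambda>y. Lam 0 u y + iX \<chi>\<^sub>0 c) (\<lambda>y. iX \<chi>\<^sub>0 d) = cinner (Ahom A \<chi>\<^sub>0 *v c) d"
proof -
  note H = cellM_H1per[OF u]
  let ?P = "\<lambda>y. Lam 0 u y + iX \<chi>\<^sub>0 c" and ?Q = "\<lambda>y. iX \<chi>\<^sub>0 (u y)"
  have LQ: "L2 ?Q" by (intro L2_iX H1per_L2 H)
  have "aA (Lam \<chi>\<^sub>0 (\<lambda>y. c + u y)) (Lam \<chi>\<^sub>0 v) = aA (\<lambda>y. ?P y + ?Q y) (Lam \<chi>\<^sub>0 v)"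
  proof (rule aA_cong_left)
    show "AE y in MY. Lam \<chi>\<^sub>0 (\<lambda>y. c + u y) y = ?P y + ?Q y"
      using Lam_add[OF H1per_const(1)[of c] H, of \<chi>\<^sub>0] Lam_const[of \<chi>\<^sub>0 c]
      by eventually_elim (simp add: Lam_split[of \<chi>\<^sub>0 u])
  qed (intro L2_Lam H1per_add(1) H1per_const H L2_add cellM_L2[OF u] LQ v)+
  also have "\<dots> = aA ?P (Lam \<chi>\<^sub>0 v) + aA ?Q (Lam \<chi>\<^sub>0 v)" by (rule aA_add_left[OF cellM_L2[OF u] LQ L2_Lam[OF v]])
  also have "aA ?P (Lam \<chi>\<^sub>0 v) = aA ?P (\<lambda>y. iX \<chi>\<^sub>0 (v y))"
    using aA_split_Lam[OF cellM_L2[OF u] v, of \<chi>\<^sub>0] cellM_orth[OF u v] by simp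
  finally show "aA (Lam \<chi>\<^sub>0 (\<lambda>y. c + u y)) (Lam \<chi>\<^sub>0 v) = aA ?P (\<lambda>y. iX \<chi>\<^sub>0 (v y)) + aA ?Q (Lam \<chi>\<^sub>0 v)" .
  show "aA ?P (\<lambda>y. iX \<chi>\<^sub>0 d) = cinner (Ahom A \<chi>\<^sub>0 *v c) d"
    unfolding Ahom_cinner by (rule Qh_eq[OF u, symmetric])
qed

definition c1 :: real where "c1 = 5 * KA / \<nu>"

lemma c1_nonneg: "0 \<le> c1" using KA \<nu>_pos by (simp add: c1_def)

text \<open>Every \<open>iX\<close> brings one factor \<open>norm \<chi>\<^sub>0\<close>: the first
  through the data of the corrector, the second when \<open>iX\<close> is applied to the
  corrector.\<close>

lemma corrector_bounds:
  assumes u: "cellM (iX \<chi>\<^sub>0 c) u"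
  shows "H1norm u \<le> c1 * (norm \<chi>\<^sub>0 * norm c)" "L2norm u \<le> c1 * (norm \<chi>\<^sub>0 * norm c)"
    and "L2norm (\<lambda>y. Lam 0 u y + iX \<chi>\<^sub>0 c) \<le> (c1 + 1) * (norm \<chi>\<^sub>0 * norm c)"
    and "L2norm (\<lambda>y. iX \<chi>\<^sub>0 (u y)) \<le> norm \<chi>\<^sub>0 * (c1 * (norm \<chi>\<^sub>0 * norm c))"
proof -
  note H = cellM_H1per[OF u]
  have "H1norm u \<le> c1 * norm (iX \<chi>\<^sub>0 c)" using cellM_bound(2)[OF u] by (simp add: c1_def)
  also have "\<dots> \<le> c1 * (norm \<chi>\<^sub>0 * norm c)" by (intro mult_left_mono iX_norm c1_nonneg)
  finally show 1: "H1norm u \<le> c1 * (norm \<chi>\<^sub>0 * norm c)" .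
  then show 2: "L2norm u \<le> c1 * (norm \<chi>\<^sub>0 * norm c)" using L2norm_le_H1norm(1)[of u] by simp
  have "KA / \<nu> \<le> c1" using KA \<nu>_pos by (simp add: c1_def divide_right_mono)
  then have "KA / \<nu> * norm (iX \<chi>\<^sub>0 c) \<le> c1 * (norm \<chi>\<^sub>0 * norm c)"
    using iX_norm c1_nonneg by (intro mult_mono) auto
  then have "L2norm (Lam 0 u) \<le> c1 * (norm \<chi>\<^sub>0 * norm c)" using cellM_bound(1)[OF u] by simp
  moreover have "L2norm (\<lambda>y. Lam 0 u y + iX \<chi>\<^sub>0 c) \<le> L2norm (Lam 0 u) + L2norm (\<lambda>y. iX \<chi>\<^sub>0 c)"
    by (intro L2norm_triangle_mat L2_Lam H L2_const)
  ultimately show "L2norm (\<lambda>y. Lam 0 u y + iX \<chi>\<^sub>0 c) \<le> (c1 + 1) * (norm \<chi>\<^sub>0 * norm c)"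
    using iX_norm[of \<chi>\<^sub>0 c] by (simp add: L2norm_const distrib_right)
  have "L2norm (\<lambda>y. iX \<chi>\<^sub>0 (u y)) \<le> norm \<chi>\<^sub>0 * L2norm u" by (intro L2norm_iX H1per_L2 H)
  also have "\<dots> \<le> norm \<chi>\<^sub>0 * (c1 * (norm \<chi>\<^sub>0 * norm c))" by (intro mult_left_mono 2) simp
  finally show "L2norm (\<lambda>y. iX \<chi>\<^sub>0 (u y)) \<le> norm \<chi>\<^sub>0 * (c1 * (norm \<chi>\<^sub>0 * norm c))" .
qed

lemma res_sol_eq:
  "res_sol A \<chi>\<^sub>0 z f u \<Longrightarrow> H1per v \<Longrightarrow> aA (Lam \<chi>\<^sub>0 u) (Lam \<chi>\<^sub>0 v) = z * complex_of_real ((norm \<chi>\<^sub>0)\<^sup>2) * l2inner u v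
      + complex_of_real ((norm \<chi>\<^sub>0)\<^sup>2) * l2inner f v"
  by (auto simp: res_sol_def aform_eq algebra_simps)

text \<open>The data are \<open>\<bar>\<chi>\<bar>\<^sup>2\<close> times the mean of
  \<open>f\<close>, so the powers of \<bar>\<chi>\<bar> cancel.\<close>

lemma u0vec_bound:
  assumes x: "\<chi>\<^sub>0 \<in> Ydual - {0}" and z: "z \<notin> mat_spectrum (Ahom_sc A \<chi>\<^sub>0)" and f: "L2 f"
  shows "norm (u0vec A \<chi>\<^sub>0 z f) \<le> CH / D_hom A \<chi>\<^sub>0 z * L2norm f"
proof -
  have x0: "\<chi>\<^sub>0 \<noteq> 0" using x by simp
  let ?c = "complex_of_real ((norm \<chi>\<^sub>0)\<^sup>2)"
  have "norm (u0vec A \<chi>\<^sub>0 z f) \<le> CH / D_hom A \<chi>\<^sub>0 z * (norm (?c *s meanY f) / (norm \<chi>\<^sub>0)\<^sup>2)"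
    by (rule hom_resolvent(2)[OF z x0]) (simp only: u0vec_eq[OF z x0] CV.ip0_sc)
  also have "norm (?c *s meanY f) = (norm \<chi>\<^sub>0)\<^sup>2 * norm (meanY f)"
  proof -
    interpret H: semi_inner "UNIV :: (complex^3) set" "(*s)" cinner by (rule cinner_semi_inner)
    show ?thesis using H.nrm_sc[of "meanY f" ?c] by (simp add: cinner_nrm del: of_real_power)
  qed
  also have "CH / D_hom A \<chi>\<^sub>0 z * ((norm \<chi>\<^sub>0)\<^sup>2 * norm (meanY f) / (norm \<chi>\<^sub>0)\<^sup>2) = CH / D_hom A \<chi>\<^sub>0 z * norm (meanY f)"
    using x0 by simp
  also have "\<dots> \<le> CH / D_hom A \<chi>\<^sub>0 z * L2norm f"
    using CH_pos hom_resolvent(1)[OF z x0] by (intro mult_left_mono meanY_bound f) auto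
  finally show ?thesis .
qed

text \<open>The comparison function is \<open>u0 + u1\<close>: the corrector makes the leading flux
  orthogonal to plain strains, and against constants only the homogenised equation remains, which
  holds exactly. All other terms are at least quadratic in \<bar>\<chi>\<bar>.\<close>

lemma first_order_residual:
  assumes x: "\<chi>\<^sub>0 \<in> Ydual - {0}" and zr: "z \<in> rho_op A \<chi>\<^sub>0" and z: "z \<notin> mat_spectrum (Ahom_sc A \<chi>\<^sub>0)"
    and f: "L2 f" and u: "res_sol A \<chi>\<^sub>0 z f u" and u1: "cellM (iX \<chi>\<^sub>0 (u0vec A \<chi>\<^sub>0 z f)) u1"
  shows "H1norm (\<lambda>y. u y - (u0vec A \<chi>\<^sub>0 z f + u1 y)) \<le> CE * max 1 (cmod (z + 1) / D_op A \<chi>\<^sub>0 z) *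
    ((2 * L2norm f + (24 * c1 * cmod z + 3 * KA * (c1 + 1)) * norm (u0vec A \<chi>\<^sub>0 z f)) * norm \<chi>\<^sub>0)"
proof -
  let ?c = "complex_of_real ((norm \<chi>\<^sub>0)\<^sup>2)" and ?t = "norm \<chi>\<^sub>0" and ?Z = "cmod z"
  define u0 where "u0 = u0vec A \<chi>\<^sub>0 z f"
  let ?a = "norm u0" and ?F = "L2norm f"
  note u1 = u1[folded u0_def]
  have xY: "\<chi>\<^sub>0 \<in> Ydual" and x0: "\<chi>\<^sub>0 \<noteq> 0" using x by auto
  have t: "0 < ?t" "?t \<le> 12" using x0 norm_Ydual[OF xY] by auto
  have nc: "cmod ?c = ?t\<^sup>2" by (simp del: of_real_power)
  note H1 = cellM_H1per[OF u1]
  have Hu: "H1per u" using u by (simp add: res_sol_def)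
  let ?U = "\<lambda>y. u0 + u1 y"
  have HU: "H1per ?U" by (intro H1per_add(1) H1per_const H1)
  define P Q where "P = (\<lambda>y. Lam 0 u1 y + iX \<chi>\<^sub>0 u0)" and "Q = (\<lambda>y. iX \<chi>\<^sub>0 (u1 y))"
  have LP: "L2 P" and LQ: "L2 Q" unfolding P_def Q_def by (intro cellM_L2[OF u1] L2_iX H1per_L2 H1)+
  \<comment> \<open>What is left once the part of the test function given by \<open>meanY v\<close>
    has cancelled through \<open>u0vec_eq\<close>.\<close>
  define R where "R v = ?c * l2inner f (\<lambda>y. v y - meanY v) + z * ?c * l2inner u1 (\<lambda>y. v y - meanY v)
     - aA P (\<lambda>y. iX \<chi>\<^sub>0 (v y - meanY v)) - aA Q (Lam \<chi>\<^sub>0 v)" for v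
  have eq: "aA (Lam \<chi>\<^sub>0 (\<lambda>y. u y - ?U y)) (Lam \<chi>\<^sub>0 v) - z * ?c * l2inner (\<lambda>y. u y - ?U y) v = R v" if v: "H1per v" for v
  proof -
    have 1: "aA (Lam \<chi>\<^sub>0 (\<lambda>y. u y - ?U y)) (Lam \<chi>\<^sub>0 v) = aA (Lam \<chi>\<^sub>0 u) (Lam \<chi>\<^sub>0 v) - aA (Lam \<chi>\<^sub>0 ?U) (Lam \<chi>\<^sub>0 v)"
      by (rule aA_Lam_diff_left[OF Hu HU L2_Lam[OF v]])
    have 2: "l2inner (\<lambda>y. u y - ?U y) v = l2inner u v - (cinner u0 (meanY v) + l2inner u1 v)"
      using l2inner_diff_left[OF H1per_L2[OF Hu] H1per_L2[OF HU] H1per_L2[OF v]]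
        l2inner_add_left[OF L2_const H1per_L2[OF H1] H1per_L2[OF v], of u0] l2inner_const_left[OF H1per_L2[OF v], of u0] by simp
    have 3: "aA (Lam \<chi>\<^sub>0 ?U) (Lam \<chi>\<^sub>0 v) = aA P (\<lambda>y. iX \<chi>\<^sub>0 (v y - meanY v)) + cinner (Ahom A \<chi>\<^sub>0 *v u0) (meanY v) + aA Q (Lam \<chi>\<^sub>0 v)"
      using corrected_constant[OF u1 v] aA_split_mean[OF LP v, of \<chi>\<^sub>0] by (simp add: P_def Q_def)
    have 4: "cinner (Ahom A \<chi>\<^sub>0 *v u0) (meanY v) = z * ?c * cinner u0 (meanY v) + ?c * cinner (meanY f) (meanY v)"
      using u0vec_eq[OF z x0, of f "meanY v"] by (simp add: u0_def algebra_simps)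
    have 5: "l2inner f v = l2inner f (\<lambda>y. v y - meanY v) + cinner (meanY f) (meanY v)" by (rule l2inner_split_mean[OF f v])
    have 6: "l2inner u1 v = l2inner u1 (\<lambda>y. v y - meanY v)"
      using l2inner_split_mean[OF H1per_L2[OF H1] v] W0_mean[OF cellM_W0[OF u1]] by (simp add: cinner_def)
    show ?thesis
      unfolding 1 2 3 4 6 R_def res_sol_eq[OF u v] 5 by (simp add: algebra_simps del: of_real_power)
  qed
  have "cmod (R v) \<le> ((2 * ?F + (24 * c1 * ?Z + 3 * KA * (c1 + 1)) * ?a) * ?t\<^sup>2) * L2norm (Lam \<chi>\<^sub>0 v)" if v: "H1per v" for v
  proof -
    let ?L = "L2norm (Lam \<chi>\<^sub>0 v)"
    have L: "0 \<le> ?L" by simp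
    have b1: "cmod (?c * l2inner f (\<lambda>y. v y - meanY v)) \<le> ?t\<^sup>2 * (2 * ?F * ?L)"
      unfolding norm_mult nc by (intro mult_left_mono l2inner_osc_bound f v xY) simp
    \<comment> \<open>\<open>u1\<close> contributes a third power of \<bar>\<chi>\<bar>, here
      replaced by 12; with the 2 of the oscillation bound this is the 24.\<close>
    have b2: "cmod (z * ?c * l2inner u1 (\<lambda>y. v y - meanY v)) \<le> ?Z * ?t\<^sup>2 * (24 * c1 * ?a * ?L)"
    proof -
      have "cmod (l2inner u1 (\<lambda>y. v y - meanY v)) \<le> 2 * L2norm u1 * ?L" by (intro l2inner_osc_bound H1per_L2 H1 v xY)
      also have "\<dots> \<le> 2 * (c1 * (?t * ?a)) * ?L" using corrector_bounds(2)[OF u1] by (intro mult_right_mono mult_left_mono) auto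
      also have "\<dots> \<le> 2 * (c1 * (12 * ?a)) * ?L" using t c1_nonneg by (intro mult_right_mono mult_left_mono) auto
      finally show ?thesis unfolding norm_mult nc by (intro mult_left_mono) (auto simp: mult_ac)
    qed
    have b3: "cmod (aA P (\<lambda>y. iX \<chi>\<^sub>0 (v y - meanY v))) \<le> ?t\<^sup>2 * (2 * KA * (c1 + 1) * ?a * ?L)"
    proof -
      have "cmod (aA P (\<lambda>y. iX \<chi>\<^sub>0 (v y - meanY v))) \<le> 2 * KA * L2norm P * ?t * ?L" by (rule aA_iX_bound[OF LP v xY])
      also have "\<dots> \<le> 2 * KA * ((c1 + 1) * (?t * ?a)) * ?t * ?L"
        using corrector_bounds(3)[OF u1] KA by (intro mult_right_mono mult_left_mono) (auto simp: P_def)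
      finally show ?thesis by (simp add: power2_eq_square mult_ac)
    qed
    have b4: "cmod (aA Q (Lam \<chi>\<^sub>0 v)) \<le> ?t\<^sup>2 * (KA * c1 * ?a * ?L)"
    proof -
      have "cmod (aA Q (Lam \<chi>\<^sub>0 v)) \<le> KA * L2norm Q * ?L" by (rule aA_Lam_bound[OF LQ v])
      also have "\<dots> \<le> KA * (?t * (c1 * (?t * ?a))) * ?L"
        using corrector_bounds(4)[OF u1] KA by (intro mult_right_mono mult_left_mono) (auto simp: Q_def)
      finally show ?thesis by (simp add: power2_eq_square mult_ac)
    qed
    \<comment> \<open>Enlarging \<open>c1\<close> to \<open>c1 + 1\<close> lets this term join the
      previous one and produces the coefficient 3.\<close>
    have "0 \<le> ?t\<^sup>2 * (KA * ?a * ?L)" using KA by simp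
    then have b5: "?t\<^sup>2 * (KA * c1 * ?a * ?L) \<le> ?t\<^sup>2 * (KA * (c1 + 1) * ?a * ?L)" by (simp add: algebra_simps)
    have "cmod (R v) \<le> cmod (?c * l2inner f (\<lambda>y. v y - meanY v)) + cmod (z * ?c * l2inner u1 (\<lambda>y. v y - meanY v))
        + cmod (aA P (\<lambda>y. iX \<chi>\<^sub>0 (v y - meanY v))) + cmod (aA Q (Lam \<chi>\<^sub>0 v))"
      unfolding R_def by (smt (verit) norm_triangle_ineq norm_triangle_ineq4)
    also have "\<dots> \<le> ?t\<^sup>2 * (2 * ?F * ?L) + ?Z * ?t\<^sup>2 * (24 * c1 * ?a * ?L) + ?t\<^sup>2 * (2 * KA * (c1 + 1) * ?a * ?L) + ?t\<^sup>2 * (KA * (c1 + 1) * ?a * ?L)"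
      using b1 b2 b3 b4 b5 by linarith
    also have "\<dots> = ((2 * ?F + (24 * c1 * ?Z + 3 * KA * (c1 + 1)) * ?a) * ?t\<^sup>2) * ?L" by (simp add: algebra_simps)
    finally show ?thesis .
  qed
  note bd = this
  have "0 \<le> (2 * ?F + (24 * c1 * ?Z + 3 * KA * (c1 + 1)) * ?a) * ?t\<^sup>2" using c1_nonneg KA by simp
  from main_dual[OF x zr H1per_diff(1)[OF Hu HU] eq bd this]
  show ?thesis using t unfolding u0_def by (simp add: power2_eq_square)
qed

end

section \<open>Second-order expansion\<close>

context elasticity
begin

lemma corr1_cellM:
  assumes "corr1 A \<chi>\<^sub>0 u0 u1"
  shows "cellM (iX \<chi>\<^sub>0 u0) u1"
proof -
  have H: "H1per u1" and m: "meanY u1 = 0"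
    and eq: "\<And>v. H1per v \<Longrightarrow> aA (Lam 0 u1) (Lam 0 v) = - aA (\<lambda>y. iX \<chi>\<^sub>0 u0) (Lam 0 v)"
    using assms by (auto simp: corr1_def aA_def Lam_0)
  have "aA (\<lambda>y. Lam 0 u1 y + iX \<chi>\<^sub>0 u0) (Lam 0 v) = 0" if v: "H1per v" for v
    using aA_add_left[OF L2_Lam[OF H] L2_const L2_Lam[OF v], of 0 "iX \<chi>\<^sub>0 u0" 0] eq[OF v] by simp
  then show ?thesis using H m by (simp add: cellM_def W0_def)
qed

text \<open>The 3 collects the two flux terms in the estimate of \<open>u2\<close>, with
  coefficients 1 and 2; the division is by the ellipticity constant.\<close>

definition c3 :: real where "c3 = 3 * KA * (c1 + 1) / \<nu>"

lemma c3_nonneg: "0 \<le> c3" using KA c1_nonneg \<nu>_pos by (simp add: c3_def)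

text \<open>The bound comes from testing with \<open>u2\<close> itself. Its mean is 0, so the term
  with \<open>z\<close> drops out and the estimate is uniform in \<open>z\<close>.\<close>

lemma corr2_bound:
  assumes f: "L2 f" and u1: "cellM (iX \<chi>\<^sub>0 u0) u1" and u2: "corr2 A \<chi>\<^sub>0 z f u0 u1 u2"
  shows "u2 \<in> W0"
    and "H1per v \<Longrightarrow> aA (Lam 0 u2) (Lam 0 v) = - aA (\<lambda>y. iX \<chi>\<^sub>0 (u1 y)) (Lam 0 v)
        - aA (\<lambda>y. Lam 0 u1 y + iX \<chi>\<^sub>0 u0) (\<lambda>y. iX \<chi>\<^sub>0 (v y))
        + z * complex_of_real ((norm \<chi>\<^sub>0)\<^sup>2) * cinner u0 (meanY v) + complex_of_real ((norm \<chi>\<^sub>0)\<^sup>2) * l2inner f v"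
    and "L2norm (Lam 0 u2) \<le> (norm \<chi>\<^sub>0)\<^sup>2 * (c3 * norm u0 + 2 / \<nu> * L2norm f)"
proof -
  let ?c = "complex_of_real ((norm \<chi>\<^sub>0)\<^sup>2)" and ?t = "norm \<chi>\<^sub>0" and ?a = "norm u0" and ?F = "L2norm f"
  have nc: "cmod ?c = ?t\<^sup>2" by (simp del: of_real_power)
  show u2W: "u2 \<in> W0" using u2 by (simp add: corr2_def W0_def)
  note H1 = cellM_H1per[OF u1] and H2 = W0_H1per[OF u2W]
  have eq: "aA (Lam 0 u2) (Lam 0 v) = - aA (\<lambda>y. iX \<chi>\<^sub>0 (u1 y)) (Lam 0 v)
        - aA (\<lambda>y. Lam 0 u1 y + iX \<chi>\<^sub>0 u0) (\<lambda>y. iX \<chi>\<^sub>0 (v y))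
        + z * ?c * cinner u0 (meanY v) + ?c * l2inner f v" if v: "H1per v" for v
  proof -
    have "aA (\<lambda>y. Lam 0 u1 y + iX \<chi>\<^sub>0 u0) (\<lambda>y. iX \<chi>\<^sub>0 (v y))
      = aA (Lam 0 u1) (\<lambda>y. iX \<chi>\<^sub>0 (v y)) + aA (\<lambda>y. iX \<chi>\<^sub>0 u0) (\<lambda>y. iX \<chi>\<^sub>0 (v y))"
      by (rule aA_add_left[OF L2_Lam[OF H1] L2_const L2_iX[OF H1per_L2[OF v]]])
    moreover have "aA (Lam 0 u2) (Lam 0 v) = - aA (\<lambda>y. iX \<chi>\<^sub>0 (u1 y)) (Lam 0 v)
        - aA (Lam 0 u1) (\<lambda>y. iX \<chi>\<^sub>0 (v y)) - aA (\<lambda>y. iX \<chi>\<^sub>0 u0) (\<lambda>y. iX \<chi>\<^sub>0 (v y))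
        + z * ?c * l2inner (\<lambda>y. u0) v + ?c * l2inner f v"
      using u2 v by (simp add: corr2_def aA_def Lam_0 l2inner_def)
    ultimately show ?thesis using l2inner_const_left[OF H1per_L2[OF v], of u0] by simp
  qed
  then show "H1per v \<Longrightarrow> aA (Lam 0 u2) (Lam 0 v) = - aA (\<lambda>y. iX \<chi>\<^sub>0 (u1 y)) (Lam 0 v)
        - aA (\<lambda>y. Lam 0 u1 y + iX \<chi>\<^sub>0 u0) (\<lambda>y. iX \<chi>\<^sub>0 (v y))
        + z * ?c * cinner u0 (meanY v) + ?c * l2inner f v" by blast
  let ?s = "L2norm (Lam 0 u2)"
  have u2n: "L2norm u2 \<le> 2 * ?s" using Korn(3)[OF H2 zero_Ydual] W0_mean[OF u2W] by simp
  have b1: "cmod (aA (\<lambda>y. iX \<chi>\<^sub>0 (u1 y)) (Lam 0 u2)) \<le> ?t\<^sup>2 * (KA * (c1 + 1) * ?a) * ?s"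
  proof -
    have "cmod (aA (\<lambda>y. iX \<chi>\<^sub>0 (u1 y)) (Lam 0 u2)) \<le> KA * L2norm (\<lambda>y. iX \<chi>\<^sub>0 (u1 y)) * ?s"
      by (rule aA_Lam_bound[OF L2_iX[OF H1per_L2[OF H1]] H2])
    also have "\<dots> \<le> KA * (?t * ((c1 + 1) * (?t * ?a))) * ?s"
    proof (intro mult_right_mono mult_left_mono)
      have "?t * (c1 * (?t * ?a)) \<le> ?t * ((c1 + 1) * (?t * ?a))" by (intro mult_left_mono mult_right_mono) auto
      then show "L2norm (\<lambda>y. iX \<chi>\<^sub>0 (u1 y)) \<le> ?t * ((c1 + 1) * (?t * ?a))" using corrector_bounds(4)[OF u1] by linarith
    qed (use KA in auto)
    finally show ?thesis by (simp add: power2_eq_square mult_ac)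
  qed
  have b2: "cmod (aA (\<lambda>y. Lam 0 u1 y + iX \<chi>\<^sub>0 u0) (\<lambda>y. iX \<chi>\<^sub>0 (u2 y))) \<le> ?t\<^sup>2 * (2 * KA * (c1 + 1) * ?a) * ?s"
  proof -
    have "cmod (aA (\<lambda>y. Lam 0 u1 y + iX \<chi>\<^sub>0 u0) (\<lambda>y. iX \<chi>\<^sub>0 (u2 y)))
        \<le> KA * (L2norm (\<lambda>y. Lam 0 u1 y + iX \<chi>\<^sub>0 u0) * L2norm (\<lambda>y. iX \<chi>\<^sub>0 (u2 y)))"
      by (rule aA_bound[OF cellM_L2[OF u1] L2_iX[OF H1per_L2[OF H2]]])
    also have "\<dots> \<le> KA * (((c1 + 1) * (?t * ?a)) * (?t * (2 * ?s)))"
    proof (intro mult_left_mono mult_mono corrector_bounds(3)[OF u1])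
      have "L2norm (\<lambda>y. iX \<chi>\<^sub>0 (u2 y)) \<le> ?t * L2norm u2" by (rule L2norm_iX[OF H1per_L2[OF H2]])
      also have "\<dots> \<le> ?t * (2 * ?s)" by (intro mult_left_mono u2n) simp
      finally show "L2norm (\<lambda>y. iX \<chi>\<^sub>0 (u2 y)) \<le> ?t * (2 * ?s)" .
    qed (use KA c1_nonneg in auto)
    finally show ?thesis by (simp only: power2_eq_square mult_ac)
  qed
  have b3: "cmod (?c * l2inner f u2) \<le> ?t\<^sup>2 * (2 * ?F) * ?s"
  proof -
    have "cmod (l2inner f u2) \<le> ?F * L2norm u2" by (rule l2inner_bound[OF f H1per_L2[OF H2]])
    also have "\<dots> \<le> ?F * (2 * ?s)" by (intro mult_left_mono u2n) simp
    finally have "?t\<^sup>2 * cmod (l2inner f u2) \<le> ?t\<^sup>2 * (?F * (2 * ?s))" by (intro mult_left_mono) auto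
    then show ?thesis unfolding norm_mult nc by (simp add: mult_ac)
  qed
  have "\<nu> * ?s\<^sup>2 \<le> Re (aA (Lam 0 u2) (Lam 0 u2))" by (rule aA_Lam_pos[OF H2])
  also have "\<dots> \<le> cmod (aA (Lam 0 u2) (Lam 0 u2))" by (rule complex_Re_le_cmod)
  also have "aA (Lam 0 u2) (Lam 0 u2) = - aA (\<lambda>y. iX \<chi>\<^sub>0 (u1 y)) (Lam 0 u2)
        - aA (\<lambda>y. Lam 0 u1 y + iX \<chi>\<^sub>0 u0) (\<lambda>y. iX \<chi>\<^sub>0 (u2 y)) + ?c * l2inner f u2"
    using eq[OF H2] W0_mean[OF u2W] by (simp add: cinner_def)
  also have "cmod \<dots> \<le> cmod (aA (\<lambda>y. iX \<chi>\<^sub>0 (u1 y)) (Lam 0 u2))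
        + cmod (aA (\<lambda>y. Lam 0 u1 y + iX \<chi>\<^sub>0 u0) (\<lambda>y. iX \<chi>\<^sub>0 (u2 y))) + cmod (?c * l2inner f u2)"
    by (smt (verit) norm_triangle_ineq norm_triangle_ineq4 norm_minus_cancel)
  also have "\<dots> \<le> (?t\<^sup>2 * (3 * KA * (c1 + 1) * ?a + 2 * ?F)) * ?s"
    using b1 b2 b3 by (simp add: algebra_simps)
  finally have le: "(\<nu> * ?s) * ?s \<le> (?t\<^sup>2 * (3 * KA * (c1 + 1) * ?a + 2 * ?F)) * ?s"
    by (simp add: power2_eq_square mult_ac)
  have nn: "0 \<le> ?t\<^sup>2 * (3 * KA * (c1 + 1) * ?a + 2 * ?F)" using KA c1_nonneg by simp
  have "\<nu> * ?s \<le> ?t\<^sup>2 * (3 * KA * (c1 + 1) * ?a + 2 * ?F)"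
  proof (cases "?s = 0")
    case True
    then show ?thesis using nn by simp
  next
    case False
    then have "0 < ?s" using L2norm_nonneg[of "Lam 0 u2"] by linarith
    then show ?thesis using le by (simp add: mult_le_cancel_right)
  qed
  then have "?s \<le> ?t\<^sup>2 * (3 * KA * (c1 + 1) * ?a + 2 * ?F) / \<nu>" using \<nu>_pos by (simp add: pos_le_divide_eq mult.commute)
  also have "?t\<^sup>2 * (X * ?a + 2 * ?F) / \<nu> = ?t\<^sup>2 * (X / \<nu> * ?a + 2 / \<nu> * ?F)" for X
    by (simp add: add_divide_distrib distrib_left)
  finally show "?s \<le> ?t\<^sup>2 * (c3 * ?a + 2 / \<nu> * ?F)" by (simp only: c3_def)
qed

text \<open>A constant vector \<open>g\<close> represents the right-hand side; testing with
  \<open>g\<close> bounds it by \<bar>\<chi>\<bar> times the flux. The scaled resolvent divides by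
  \<open>\<bar>\<chi>\<bar>\<^sup>2\<close>, which leaves one inverse power.\<close>

lemma corr3_bound:
  assumes x: "\<chi>\<^sub>0 \<in> Ydual - {0}" and z: "z \<notin> mat_spectrum (Ahom_sc A \<chi>\<^sub>0)"
    and u1: "cellM (iX \<chi>\<^sub>0 u0) u1" and u2: "u2 \<in> W0" and u01: "corr3 A \<chi>\<^sub>0 z u1 u2 u01"
  shows "cinner (Ahom A \<chi>\<^sub>0 *v u01) d - z * complex_of_real ((norm \<chi>\<^sub>0)\<^sup>2) * cinner u01 d
     = - aA (\<lambda>y. Lam 0 u2 y + iX \<chi>\<^sub>0 (u1 y)) (\<lambda>y. iX \<chi>\<^sub>0 d)"
    and "norm u01 \<le> CH / D_hom A \<chi>\<^sub>0 z * (KA * L2norm (\<lambda>y. Lam 0 u2 y + iX \<chi>\<^sub>0 (u1 y)) / norm \<chi>\<^sub>0)"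
proof -
  let ?c = "complex_of_real ((norm \<chi>\<^sub>0)\<^sup>2)" and ?t = "norm \<chi>\<^sub>0"
  let ?W = "\<lambda>y. Lam 0 u2 y + iX \<chi>\<^sub>0 (u1 y)"
  have x0: "\<chi>\<^sub>0 \<noteq> 0" using x by simp
  then have t: "0 < ?t" by simp
  have LW: "L2 ?W" by (intro L2_add L2_Lam W0_H1per u2 L2_iX H1per_L2 cellM_H1per[OF u1])
  have eq: "cinner (Ahom A \<chi>\<^sub>0 *v u01) d - z * ?c * cinner u01 d = - aA ?W (\<lambda>y. iX \<chi>\<^sub>0 d)" for d
    using u01 by (simp add: corr3_def aA_def Lam_0)
  then show "cinner (Ahom A \<chi>\<^sub>0 *v u01) d - z * ?c * cinner u01 d = - aA ?W (\<lambda>y. iX \<chi>\<^sub>0 d)" by blast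
  interpret H: semi_inner "UNIV :: (complex^3) set" "(*s)" cinner by (rule cinner_semi_inner)
  define g where "g = Ahom A \<chi>\<^sub>0 *v u01 - (z * ?c) *s u01"
  have g: "cinner g d = cinner (Ahom A \<chi>\<^sub>0 *v u01) d - z * ?c * cinner u01 d" for d
    unfolding g_def using H.ip_diff[of "Ahom A \<chi>\<^sub>0 *v u01" "(z * ?c) *s u01" d] by (simp add: CV.ip0_sc)
  have "norm g * norm g = cmod (cinner g g)" by (simp add: CV.ip0_self power2_eq_square norm_mult)
  also have "\<dots> = cmod (aA ?W (\<lambda>y. iX \<chi>\<^sub>0 g))" unfolding g eq by simp
  also have "\<dots> \<le> KA * (L2norm ?W * norm (iX \<chi>\<^sub>0 g))" using aA_bound[OF LW L2_const] by (simp add: L2norm_const)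
  also have "\<dots> \<le> KA * (L2norm ?W * (?t * norm g))" using KA by (intro mult_left_mono iX_norm) auto
  finally have "norm g * norm g \<le> (KA * L2norm ?W * ?t) * norm g" by (simp add: mult_ac)
  then have gn: "norm g \<le> KA * L2norm ?W * ?t"
    using KA by (cases "g = 0") (auto simp: mult_le_cancel_right)
  have "norm u01 \<le> CH / D_hom A \<chi>\<^sub>0 z * (norm g / ?t\<^sup>2)"
    by (rule hom_resolvent(2)[OF z x0]) (simp only: g)
  also have "\<dots> \<le> CH / D_hom A \<chi>\<^sub>0 z * ((KA * L2norm ?W * ?t) / ?t\<^sup>2)"
    using CH_pos hom_resolvent(1)[OF z x0] gn by (intro mult_left_mono divide_right_mono) auto
  also have "(KA * L2norm ?W * ?t) / ?t\<^sup>2 = KA * L2norm ?W / ?t" using t by (simp add: power2_eq_square)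
  finally show "norm u01 \<le> CH / D_hom A \<chi>\<^sub>0 z * (KA * L2norm ?W / ?t)" .
qed

text \<open>The sum of all coefficients in the residual estimate, hence a bound for each group of
  them.\<close>

definition c4 :: real where "c4 = 48 + 26 * c1 + 4 * KA + 2 * KA * c1 + 3 * KA * (c1 + 1)"

lemma c4_nonneg: "0 \<le> c4" using KA c1_nonneg by (simp add: c4_def)

text \<open>The comparison function also contains \<open>u2\<close> and the corrector
  \<open>u11\<close> of \<open>u01\<close>. The equation of \<open>u2\<close> reduces the fluxes of
  \<open>u0 + u1\<close> to the flux \<open>W\<close> against \<open>iX\<close>, and the equation of
  \<open>u01\<close> cancels what constants see of \<open>W\<close>. \<open>G\<close> and
  \<open>\<beta>\<close> are the sizes of \<open>u2\<close> and \<open>u01\<close> with their powers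
  of \<bar>\<chi>\<bar> taken out.\<close>

lemma second_order_residual:
  assumes x: "\<chi>\<^sub>0 \<in> Ydual - {0}" and zr: "z \<in> rho_op A \<chi>\<^sub>0" and z: "z \<notin> mat_spectrum (Ahom_sc A \<chi>\<^sub>0)"
    and f: "L2 f" and u: "res_sol A \<chi>\<^sub>0 z f u" and u1: "cellM (iX \<chi>\<^sub>0 u0) u1"
    and u2: "corr2 A \<chi>\<^sub>0 z f u0 u1 u2" and u01: "corr3 A \<chi>\<^sub>0 z u1 u2 u01" and u11: "cellM (iX \<chi>\<^sub>0 u01) u11"
    and G: "L2norm (Lam 0 u2) \<le> (norm \<chi>\<^sub>0)\<^sup>2 * G" "0 \<le> G" and \<beta>: "norm u01 \<le> norm \<chi>\<^sub>0 * \<beta>"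
  shows "H1norm (\<lambda>y. u y - (((u0 + u1 y) + (u01 + u11 y)) + u2 y)) \<le> CE * max 1 (cmod (z + 1) / D_op A \<chi>\<^sub>0 z) *
    ((1 + cmod z) * c4 * (norm u0 + G + \<beta>) * (norm \<chi>\<^sub>0)\<^sup>2)"
proof -
  let ?c = "complex_of_real ((norm \<chi>\<^sub>0)\<^sup>2)" and ?t = "norm \<chi>\<^sub>0" and ?Z = "cmod z"
  let ?a = "norm u0"
  have xY: "\<chi>\<^sub>0 \<in> Ydual" and x0: "\<chi>\<^sub>0 \<noteq> 0" using x by auto
  have t: "0 < ?t" "?t \<le> 12" using x0 norm_Ydual[OF xY] by auto
  have \<beta>0: "0 \<le> \<beta>" using \<beta> t by (smt (verit) norm_ge_zero zero_le_mult_iff)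
  have nc: "cmod ?c = ?t\<^sup>2" by (simp del: of_real_power)
  have u2W: "u2 \<in> W0" by (rule corr2_bound(1)[OF f u1 u2])
  note H1 = cellM_H1per[OF u1] and H2 = W0_H1per[OF u2W] and H11 = cellM_H1per[OF u11]
  have Hu: "H1per u" using u by (simp add: res_sol_def)
  define U U' where "U = (\<lambda>y. u0 + u1 y)" and "U' = (\<lambda>y. u01 + u11 y)"
  have HU: "H1per U" "H1per U'" unfolding U_def U'_def by (intro H1per_add(1) H1per_const H1 H11)+
  have HUU: "H1per (\<lambda>y. U y + U' y)" by (intro H1per_add(1) HU)
  have HV: "H1per (\<lambda>y. (U y + U' y) + u2 y)" by (intro H1per_add(1) HU H2)
  define P Q where "P = (\<lambda>y. Lam 0 u1 y + iX \<chi>\<^sub>0 u0)" and "Q = (\<lambda>y. iX \<chi>\<^sub>0 (u1 y))"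
  define P' Q' where "P' = (\<lambda>y. Lam 0 u11 y + iX \<chi>\<^sub>0 u01)" and "Q' = (\<lambda>y. iX \<chi>\<^sub>0 (u11 y))"
  define Q2 where "Q2 = (\<lambda>y. iX \<chi>\<^sub>0 (u2 y))"
  define W where "W = (\<lambda>y. Lam 0 u2 y + Q y)"
  have LP: "L2 P" "L2 P'" unfolding P_def P'_def by (intro cellM_L2[OF u1] cellM_L2[OF u11])+
  have LQ: "L2 Q" "L2 Q'" "L2 Q2" unfolding Q_def Q'_def Q2_def by (intro L2_iX H1per_L2 H1 H11 H2)+
  have LW: "L2 W" unfolding W_def by (intro L2_add L2_Lam H2 LQ)
  \<comment> \<open>Every term is cubic in \<bar>\<chi>\<bar>: it either tests the oscillation of
    \<open>v\<close> or contains \<open>iX\<close> of a second-order field.\<close>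
  define R where "R v = z * ?c * (l2inner u1 (\<lambda>y. v y - meanY v) + l2inner u2 (\<lambda>y. v y - meanY v) + l2inner u11 (\<lambda>y. v y - meanY v))
     - aA W (\<lambda>y. iX \<chi>\<^sub>0 (v y - meanY v)) - aA P' (\<lambda>y. iX \<chi>\<^sub>0 (v y - meanY v)) - aA Q' (Lam \<chi>\<^sub>0 v) - aA Q2 (Lam \<chi>\<^sub>0 v)" for v
  have eq: "aA (Lam \<chi>\<^sub>0 (\<lambda>y. u y - ((U y + U' y) + u2 y))) (Lam \<chi>\<^sub>0 v) - z * ?c * l2inner (\<lambda>y. u y - ((U y + U' y) + u2 y)) v = R v"
    if v: "H1per v" for v
  proof -
    note Lv = L2_Lam[OF v, of \<chi>\<^sub>0] and Lv2 = H1per_L2[OF v]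
    have Lix: "L2 (\<lambda>y. iX \<chi>\<^sub>0 (v y))" by (rule L2_iX[OF Lv2])
    have m: "l2inner w v = l2inner w (\<lambda>y. v y - meanY v)" if "w \<in> W0" for w
      using l2inner_split_mean[OF H1per_L2[OF W0_H1per[OF that]] v] W0_mean[OF that] by (simp add: cinner_def)
    have 1: "aA (Lam \<chi>\<^sub>0 (\<lambda>y. u y - ((U y + U' y) + u2 y))) (Lam \<chi>\<^sub>0 v)
        = aA (Lam \<chi>\<^sub>0 u) (Lam \<chi>\<^sub>0 v) - (aA (Lam \<chi>\<^sub>0 U) (Lam \<chi>\<^sub>0 v) + aA (Lam \<chi>\<^sub>0 U') (Lam \<chi>\<^sub>0 v) + aA (Lam \<chi>\<^sub>0 u2) (Lam \<chi>\<^sub>0 v))"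
      using aA_Lam_diff_left[OF Hu HV Lv, of \<chi>\<^sub>0] aA_Lam_add_left[OF HUU H2 Lv, of \<chi>\<^sub>0] aA_Lam_add_left[OF HU Lv, of \<chi>\<^sub>0] by simp
    have lU: "l2inner U v = cinner u0 (meanY v) + l2inner u1 v" "l2inner U' v = cinner u01 (meanY v) + l2inner u11 v"
      unfolding U_def U'_def
      using l2inner_add_left[OF L2_const H1per_L2[OF H1] Lv2, of u0] l2inner_add_left[OF L2_const H1per_L2[OF H11] Lv2, of u01]
        l2inner_const_left[OF Lv2] by simp_all
    have 2: "l2inner (\<lambda>y. u y - ((U y + U' y) + u2 y)) v
        = l2inner u v - (cinner u0 (meanY v) + l2inner u1 v + cinner u01 (meanY v) + l2inner u11 v + l2inner u2 v)"
      using l2inner_diff_left[OF H1per_L2[OF Hu] H1per_L2[OF HV] Lv2] l2inner_add_left[OF H1per_L2[OF HUU] H1per_L2[OF H2] Lv2]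
        l2inner_add_left[OF H1per_L2[OF HU(1)] H1per_L2[OF HU(2)] Lv2] lU by simp
    have 3: "aA (Lam \<chi>\<^sub>0 U) (Lam \<chi>\<^sub>0 v) = aA P (\<lambda>y. iX \<chi>\<^sub>0 (v y)) + aA Q (Lam 0 v) + aA Q (\<lambda>y. iX \<chi>\<^sub>0 (v y))"
      using corrected_constant(1)[OF u1 v] aA_split_Lam[OF LQ(1) v, of \<chi>\<^sub>0] by (simp add: P_def Q_def U_def)
    have 4: "aA (Lam \<chi>\<^sub>0 U') (Lam \<chi>\<^sub>0 v) = aA P' (\<lambda>y. iX \<chi>\<^sub>0 (v y - meanY v)) + cinner (Ahom A \<chi>\<^sub>0 *v u01) (meanY v) + aA Q' (Lam \<chi>\<^sub>0 v)"
      using corrected_constant[OF u11 v] aA_split_mean[OF LP(2) v, of \<chi>\<^sub>0] by (simp add: P'_def Q'_def U'_def)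
    have 5: "aA (Lam \<chi>\<^sub>0 u2) (Lam \<chi>\<^sub>0 v) = aA (Lam 0 u2) (Lam 0 v) + aA (Lam 0 u2) (\<lambda>y. iX \<chi>\<^sub>0 (v y)) + aA Q2 (Lam \<chi>\<^sub>0 v)"
    proof -
      have "aA (Lam \<chi>\<^sub>0 u2) (Lam \<chi>\<^sub>0 v) = aA (\<lambda>y. Lam 0 u2 y + Q2 y) (Lam \<chi>\<^sub>0 v)"
        by (simp add: Q2_def Lam_split[of \<chi>\<^sub>0 u2, abs_def])
      also have "\<dots> = aA (Lam 0 u2) (Lam \<chi>\<^sub>0 v) + aA Q2 (Lam \<chi>\<^sub>0 v)" by (rule aA_add_left[OF L2_Lam[OF H2] LQ(3) Lv])
      finally show ?thesis using aA_split_Lam[OF L2_Lam[OF H2] v, of 0 \<chi>\<^sub>0] by simp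
    qed
    have 6: "aA (Lam 0 u2) (Lam 0 v) = - aA Q (Lam 0 v) - aA P (\<lambda>y. iX \<chi>\<^sub>0 (v y)) + z * ?c * cinner u0 (meanY v) + ?c * l2inner f v"
      using corr2_bound(2)[OF f u1 u2 v] by (simp add: P_def Q_def)
    have 7: "aA W (\<lambda>y. iX \<chi>\<^sub>0 (v y)) = aA (Lam 0 u2) (\<lambda>y. iX \<chi>\<^sub>0 (v y)) + aA Q (\<lambda>y. iX \<chi>\<^sub>0 (v y))"
      unfolding W_def by (rule aA_add_left[OF L2_Lam[OF H2] LQ(1) Lix])
    have 8: "aA W (\<lambda>y. iX \<chi>\<^sub>0 (v y)) = aA W (\<lambda>y. iX \<chi>\<^sub>0 (v y - meanY v)) + aA W (\<lambda>y. iX \<chi>\<^sub>0 (meanY v))"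
      by (rule aA_split_mean[OF LW v])
    have 9: "cinner (Ahom A \<chi>\<^sub>0 *v u01) (meanY v) = z * ?c * cinner u01 (meanY v) - aA W (\<lambda>y. iX \<chi>\<^sub>0 (meanY v))"
      using corr3_bound(1)[OF x z u1 u2W u01, of "meanY v"] by (simp add: W_def Q_def algebra_simps del: of_real_power)
    \<comment> \<open>\<open>u2\<close> absorbs the flux \<open>P\<close> against \<open>iX\<close>
      as well as \<open>Q\<close> against the plain strain; what remains is \<open>W\<close>, still
      to be split into mean and oscillation.\<close>
    have s: "aA (Lam \<chi>\<^sub>0 U) (Lam \<chi>\<^sub>0 v) + aA (Lam \<chi>\<^sub>0 u2) (Lam \<chi>\<^sub>0 v)
        = aA W (\<lambda>y. iX \<chi>\<^sub>0 (v y)) + z * ?c * cinner u0 (meanY v) + ?c * l2inner f v + aA Q2 (Lam \<chi>\<^sub>0 v)"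
      unfolding 3 5 6 7 by (simp add: algebra_simps del: of_real_power)
    have "aA (Lam \<chi>\<^sub>0 (\<lambda>y. u y - ((U y + U' y) + u2 y))) (Lam \<chi>\<^sub>0 v) = z * ?c * l2inner u v + ?c * l2inner f v
       - ((aA (Lam \<chi>\<^sub>0 U) (Lam \<chi>\<^sub>0 v) + aA (Lam \<chi>\<^sub>0 u2) (Lam \<chi>\<^sub>0 v)) + aA (Lam \<chi>\<^sub>0 U') (Lam \<chi>\<^sub>0 v))"
      unfolding 1 res_sol_eq[OF u v] by (simp add: algebra_simps del: of_real_power)
    then show ?thesis
      unfolding s 8 4 9 2 m[OF u2W] m[OF cellM_W0[OF u1]] m[OF cellM_W0[OF u11]] R_def
      by (simp add: algebra_simps del: of_real_power)
  qed
  let ?b = "norm u01"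
  have u2n: "L2norm u2 \<le> 2 * (?t\<^sup>2 * G)" using Korn(3)[OF H2 zero_Ydual] W0_mean[OF u2W] G by simp
  have b: "?b \<le> ?t * \<beta>" by (rule \<beta>)
  have Wn: "L2norm W \<le> ?t\<^sup>2 * (G + c1 * ?a)"
  proof -
    have "L2norm W \<le> L2norm (Lam 0 u2) + L2norm Q" unfolding W_def by (intro L2norm_triangle_mat L2_Lam H2 LQ)
    moreover have "L2norm Q \<le> ?t * (c1 * (?t * ?a))" unfolding Q_def by (rule corrector_bounds(4)[OF u1])
    ultimately show ?thesis using G(1) by (simp add: power2_eq_square algebra_simps)
  qed
  have t3: "?t\<^sup>2 * ?t = ?t ^ 3" by (simp add: power3_eq_cube power2_eq_square)
  have "cmod (R v) \<le> ((1 + ?Z) * c4 * (?a + G + \<beta>) * ?t ^ 3) * L2norm (Lam \<chi>\<^sub>0 v)" if v: "H1per v" for v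
  proof -
    let ?L = "L2norm (Lam \<chi>\<^sub>0 v)"
    have L: "0 \<le> ?L" by simp
    let ?T = "?t ^ 3 * ?L"
    have T: "0 \<le> ?T" using t by simp
    \<comment> \<open>One bound for the three mean-zero fields, each written as one power of
      \<bar>\<chi>\<bar> times \<open>k\<close>. The surplus power in \<open>u2\<close> and
      \<open>u11\<close> is then estimated by 12.\<close>
    have m: "cmod (z * ?c * l2inner w (\<lambda>y. v y - meanY v)) \<le> (?Z * (2 * k)) * ?T"
      if "H1per w" "L2norm w \<le> ?t * k" for w k
    proof -
      have "cmod (l2inner w (\<lambda>y. v y - meanY v)) \<le> 2 * L2norm w * ?L" by (intro l2inner_osc_bound H1per_L2 that v xY)
      also have "\<dots> \<le> 2 * (?t * k) * ?L" using that by (intro mult_right_mono mult_left_mono) auto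
      finally have "(?Z * ?t\<^sup>2) * cmod (l2inner w (\<lambda>y. v y - meanY v)) \<le> (?Z * ?t\<^sup>2) * (2 * (?t * k) * ?L)" by (intro mult_left_mono) auto
      then show ?thesis unfolding norm_mult nc t3[symmetric] by (simp add: mult_ac)
    qed
    have tG: "2 * (?t\<^sup>2 * G) \<le> ?t * (24 * G)"
    proof -
      have "?t * (2 * G) * ?t \<le> ?t * (2 * G) * 12" using t G by (intro mult_left_mono) auto
      then show ?thesis by (simp add: power2_eq_square mult_ac)
    qed
    have tb: "c1 * (?t * ?b) \<le> ?t * (12 * c1 * \<beta>)"
    proof -
      have "?b \<le> 12 * \<beta>" using b mult_right_mono[OF t(2) \<beta>0] by linarith
      then have "(c1 * ?t) * ?b \<le> (c1 * ?t) * (12 * \<beta>)" using c1_nonneg t by (intro mult_left_mono) auto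
      then show ?thesis by (simp add: mult_ac)
    qed
    have b1: "cmod (z * ?c * l2inner u1 (\<lambda>y. v y - meanY v)) \<le> (?Z * (2 * (c1 * ?a))) * ?T"
      by (rule m[OF H1]) (use corrector_bounds(2)[OF u1] in \<open>simp add: mult_ac\<close>)
    have b2: "cmod (z * ?c * l2inner u2 (\<lambda>y. v y - meanY v)) \<le> (?Z * (2 * (24 * G))) * ?T"
      by (rule m[OF H2]) (use u2n tG in linarith)
    have b3: "cmod (z * ?c * l2inner u11 (\<lambda>y. v y - meanY v)) \<le> (?Z * (2 * (12 * c1 * \<beta>))) * ?T"
      by (rule m[OF H11]) (use corrector_bounds(2)[OF u11] tb in linarith)
    have b4: "cmod (aA W (\<lambda>y. iX \<chi>\<^sub>0 (v y - meanY v))) \<le> (2 * KA * (G + c1 * ?a)) * ?T"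
    proof -
      have "cmod (aA W (\<lambda>y. iX \<chi>\<^sub>0 (v y - meanY v))) \<le> 2 * KA * L2norm W * ?t * ?L" by (rule aA_iX_bound[OF LW v xY])
      also have "\<dots> \<le> 2 * KA * (?t\<^sup>2 * (G + c1 * ?a)) * ?t * ?L"
        using Wn KA by (intro mult_right_mono mult_left_mono) auto
      finally show ?thesis unfolding t3[symmetric] by (simp only: mult_ac)
    qed
    have b5: "cmod (aA P' (\<lambda>y. iX \<chi>\<^sub>0 (v y - meanY v))) \<le> (2 * KA * (c1 + 1) * \<beta>) * ?T"
    proof -
      have "cmod (aA P' (\<lambda>y. iX \<chi>\<^sub>0 (v y - meanY v))) \<le> 2 * KA * L2norm P' * ?t * ?L" by (rule aA_iX_bound[OF LP(2) v xY])
      also have "\<dots> \<le> 2 * KA * ((c1 + 1) * (?t * (?t * \<beta>))) * ?t * ?L"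
      proof (intro mult_right_mono mult_left_mono)
        have "(c1 + 1) * (?t * ?b) \<le> (c1 + 1) * (?t * (?t * \<beta>))" using b c1_nonneg by (intro mult_left_mono) auto
        then show "L2norm P' \<le> (c1 + 1) * (?t * (?t * \<beta>))" using corrector_bounds(3)[OF u11] unfolding P'_def by linarith
      qed (use KA in auto)
      finally show ?thesis unfolding t3[symmetric] power2_eq_square by (simp only: mult_ac)
    qed
    have Q'n: "L2norm Q' \<le> ?t * (c1 * (?t * (?t * \<beta>)))"
    proof -
      have "?t * (c1 * (?t * ?b)) \<le> ?t * (c1 * (?t * (?t * \<beta>)))" using b c1_nonneg by (intro mult_left_mono) auto
      then show ?thesis using corrector_bounds(4)[OF u11] unfolding Q'_def by linarith
    qed
    have b6: "cmod (aA Q' (Lam \<chi>\<^sub>0 v)) \<le> (KA * (c1 + 1) * \<beta>) * ?T"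
    proof -
      have "cmod (aA Q' (Lam \<chi>\<^sub>0 v)) \<le> KA * L2norm Q' * ?L" by (rule aA_Lam_bound[OF LQ(2) v])
      also have "\<dots> \<le> KA * (?t * (c1 * (?t * (?t * \<beta>)))) * ?L" using Q'n KA by (intro mult_right_mono mult_left_mono) auto
      also have "\<dots> = (KA * c1 * \<beta>) * ?T" unfolding t3[symmetric] power2_eq_square by (simp only: mult_ac)
      also have "\<dots> \<le> (KA * (c1 + 1) * \<beta>) * ?T" using KA \<beta>0 c1_nonneg T by (intro mult_right_mono mult_left_mono) auto
      finally show ?thesis .
    qed
    have b7: "cmod (aA Q2 (Lam \<chi>\<^sub>0 v)) \<le> (2 * KA * G) * ?T"
    proof -
      have "cmod (aA Q2 (Lam \<chi>\<^sub>0 v)) \<le> KA * L2norm Q2 * ?L" by (rule aA_Lam_bound[OF LQ(3) v])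
      also have "\<dots> \<le> KA * (?t * (2 * (?t\<^sup>2 * G))) * ?L"
      proof (intro mult_right_mono mult_left_mono)
        have "L2norm Q2 \<le> ?t * L2norm u2" unfolding Q2_def by (rule L2norm_iX[OF H1per_L2[OF H2]])
        also have "\<dots> \<le> ?t * (2 * (?t\<^sup>2 * G))" by (intro mult_left_mono u2n) simp
        finally show "L2norm Q2 \<le> ?t * (2 * (?t\<^sup>2 * G))" .
      qed (use KA in auto)
      finally show ?thesis unfolding t3[symmetric] by (simp only: mult_ac)
    qed
    have "cmod (R v) \<le> cmod (z * ?c * l2inner u1 (\<lambda>y. v y - meanY v)) + cmod (z * ?c * l2inner u2 (\<lambda>y. v y - meanY v))
        + cmod (z * ?c * l2inner u11 (\<lambda>y. v y - meanY v)) + cmod (aA W (\<lambda>y. iX \<chi>\<^sub>0 (v y - meanY v)))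
        + cmod (aA P' (\<lambda>y. iX \<chi>\<^sub>0 (v y - meanY v))) + cmod (aA Q' (Lam \<chi>\<^sub>0 v)) + cmod (aA Q2 (Lam \<chi>\<^sub>0 v))"
    proof -
      have "cmod (p + q + r - s - w - k - l) \<le> cmod p + cmod q + cmod r + cmod s + cmod w + cmod k + cmod l" for p q r s w k l :: complex
        by (intro order_trans[OF norm_triangle_ineq4 add_right_mono] order_trans[OF norm_triangle_ineq add_right_mono] norm_triangle_ineq)
      then show ?thesis unfolding R_def distrib_left by blast
    qed
    also have "\<dots> \<le> (?Z * (2 * (c1 * ?a))) * ?T + (?Z * (2 * (24 * G))) * ?T + (?Z * (2 * (12 * c1 * \<beta>))) * ?T
       + (2 * KA * (G + c1 * ?a)) * ?T + (2 * KA * (c1 + 1) * \<beta>) * ?T + (KA * (c1 + 1) * \<beta>) * ?T + (2 * KA * G) * ?T"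
      by (intro add_mono b1 b2 b3 b4 b5 b6 b7)
    also have "\<dots> = ((?Z * (2 * c1) + 2 * KA * c1) * ?a + (?Z * 48 + 4 * KA) * G + (?Z * (24 * c1) + 3 * KA * (c1 + 1)) * \<beta>) * ?T"
      by (simp add: algebra_simps)
    also have "\<dots> \<le> ((1 + ?Z) * c4 * ?a + (1 + ?Z) * c4 * G + (1 + ?Z) * c4 * \<beta>) * ?T"
    proof (intro mult_right_mono add_mono T)
      have Zc: "?Z * k + l \<le> (1 + ?Z) * c4" if "k + l \<le> c4" "0 \<le> k" "0 \<le> l" for k l
      proof -
        have "?Z * k \<le> ?Z * c4" using that by (intro mult_left_mono) auto
        moreover have "l \<le> c4" using that by simp
        ultimately show ?thesis by (simp add: distrib_right)
      qed
      have p: "0 \<le> KA * c1" "0 \<le> KA" "0 \<le> c1" using KA c1_nonneg by auto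
      show "?Z * (2 * c1) + 2 * KA * c1 \<le> (1 + ?Z) * c4" by (rule Zc) (use p in \<open>auto simp: c4_def algebra_simps\<close>)
      show "?Z * 48 + 4 * KA \<le> (1 + ?Z) * c4" by (rule Zc) (use p in \<open>auto simp: c4_def algebra_simps\<close>)
      show "?Z * (24 * c1) + 3 * KA * (c1 + 1) \<le> (1 + ?Z) * c4" by (rule Zc) (use p in \<open>auto simp: c4_def algebra_simps\<close>)
    qed (use G \<beta>0 in auto)
    also have "\<dots> = ((1 + ?Z) * c4 * (?a + G + \<beta>) * ?t ^ 3) * ?L" by (simp add: algebra_simps)
    finally show ?thesis .
  qed
  note bd = this
  have "0 \<le> (1 + ?Z) * c4 * (?a + G + \<beta>) * ?t ^ 3" using c4_nonneg G \<beta>0 t by simp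
  from main_dual[OF x zr H1per_diff(1)[OF Hu HV] eq bd this]
  have "H1norm (\<lambda>y. u y - ((U y + U' y) + u2 y)) \<le> CE * max 1 (cmod (z + 1) / D_op A \<chi>\<^sub>0 z) *
    ((1 + ?Z) * c4 * (?a + G + \<beta>) * ?t ^ 3 / ?t)" .
  also have "(1 + ?Z) * c4 * (?a + G + \<beta>) * ?t ^ 3 / ?t = (1 + ?Z) * c4 * (?a + G + \<beta>) * ?t\<^sup>2"
    using t by (simp add: power3_eq_cube power2_eq_square)
  finally show ?thesis by (simp add: U_def U'_def)
qed

end

text \<open>Absorbs the factor \<open>1 + \<bar>z\<bar>\<close> of a residual into whichever maximum
  accompanies a given power of \<open>1 / D_hom\<close>.\<close>

lemma one_plus_le_max_power:
  fixes Z :: real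
  assumes "0 \<le> Z" "0 < n"
  shows "1 + Z \<le> 2 * max 1 (Z ^ n)"
proof (cases "Z \<le> 1")
  case True
  then show ?thesis by simp
next
  case False
  then have "Z \<le> Z ^ n" using assms by (simp add: self_le_power)
  then show ?thesis using False by simp
qed

section \<open>Collecting the constants\<close>

context elasticity
begin

text \<open>The summands come from \<open>f\<close>, from \<open>u0\<close> in the residual with the
  2 of \<open>one_plus_le_max_power\<close>, and from the corrector \<open>u1\<close> that the claim
  omits.\<close>

definition Ca :: real where "Ca = 2 * CE + CE * (24 * c1 + 3 * KA * (c1 + 1)) * (2 * CH) + c1 * CH"

lemma first_estimate:
  assumes x: "\<chi>\<^sub>0 \<in> Ydual - {0}" and zr: "z \<in> rho_op A \<chi>\<^sub>0" and z: "z \<notin> mat_spectrum (Ahom_sc A \<chi>\<^sub>0)"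
    and f: "L2 f" and u: "res_sol A \<chi>\<^sub>0 z f u"
  shows "H1norm (\<lambda>y. u y - u0vec A \<chi>\<^sub>0 z f) \<le> Ca * max 1 (cmod (z + 1) / D_op A \<chi>\<^sub>0 z)
    * (max 1 ((cmod z)\<^sup>2) / D_hom A \<chi>\<^sub>0 z + max 1 (cmod z)) * norm \<chi>\<^sub>0 * L2norm f"
proof -
  define u0 where "u0 = u0vec A \<chi>\<^sub>0 z f"
  obtain u1 where u1: "cellM (iX \<chi>\<^sub>0 u0) u1" using cellM_ex by blast
  define t F a Z D m where "t = norm \<chi>\<^sub>0" and "F = L2norm f" and "a = norm u0" and "Z = cmod z"
    and "D = D_hom A \<chi>\<^sub>0 z" and "m = max 1 (cmod (z + 1) / D_op A \<chi>\<^sub>0 z)"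
  define k where "k = 24 * c1 + 3 * KA * (c1 + 1)"
  have nn: "0 \<le> t" "0 \<le> F" "0 \<le> a" "0 \<le> Z" "1 \<le> m" "0 \<le> k" "0 \<le> CE" "0 \<le> c1" "1 \<le> CH" "0 \<le> KA"
    using c1_nonneg KA CE_nonneg CH_pos by (auto simp: t_def F_def a_def Z_def m_def k_def)
  have D: "0 < D" using hom_resolvent(1)[OF z] x by (simp add: D_def)
  have a: "a \<le> CH / D * F" unfolding a_def u0_def D_def F_def by (rule u0vec_bound[OF x z f])
  define B1 B0 where "B1 = max 1 (Z\<^sup>2) / D" and "B0 = max 1 Z"
  have B: "0 \<le> B1" "1 \<le> B0" using D by (auto simp: B1_def B0_def)
  have Hu: "H1per u" using u by (simp add: res_sol_def)
  note H1 = cellM_H1per[OF u1]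
  \<comment> \<open>The claim omits \<open>u1\<close>, which is split off again; it is of order
    \<bar>\<chi>\<bar> and fits into the bound.\<close>
  have "H1norm (\<lambda>y. u y - u0) = H1norm (\<lambda>y. (u y - (u0 + u1 y)) + u1 y)" by (simp add: algebra_simps)
  also have "\<dots> \<le> H1norm (\<lambda>y. u y - (u0 + u1 y)) + H1norm u1"
    by (intro H1norm_triangle H1per_diff(1) H1per_add(1) H1per_const Hu H1)
  also have "\<dots> \<le> CE * m * ((2 * F + (24 * c1 * Z + 3 * KA * (c1 + 1)) * a) * t) + c1 * (t * a)"
    using first_order_residual[OF x zr z f u u1[unfolded u0_def]] corrector_bounds(1)[OF u1]
    unfolding m_def F_def Z_def a_def t_def u0_def by (rule add_mono)
  also have "\<dots> \<le> CE * m * ((2 * F * B0 + k * (2 * CH * F * B1)) * t) + c1 * (t * (CH * F * B1)) * m"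
  proof -
    have aB: "a \<le> CH * F * B1"
    proof -
      have "CH * F * (1 / D) \<le> CH * F * B1"
        unfolding B1_def using D nn by (intro mult_left_mono divide_right_mono) auto
      then show ?thesis using a by simp
    qed
    \<comment> \<open>Here \<open>1 + \<bar>z\<bar>\<close> from the residual meets
      \<open>1 / D\<close> from \<open>u0\<close>, which produces the quotient in the claim.\<close>
    have ZaB: "(1 + Z) * a \<le> 2 * CH * F * B1"
    proof -
      have "(1 + Z) * a \<le> (2 * max 1 (Z\<^sup>2)) * (CH / D * F)"
        using one_plus_le_max_power[of Z 2] a nn by (intro mult_mono) auto
      then show ?thesis by (simp add: B1_def mult_ac)
    qed
    have "24 * c1 * Z + 3 * KA * (c1 + 1) \<le> k * (1 + Z)"
      using nn by (simp add: k_def algebra_simps)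
    then have "(24 * c1 * Z + 3 * KA * (c1 + 1)) * a \<le> k * (1 + Z) * a" using nn by (intro mult_right_mono) auto
    also have "\<dots> = k * ((1 + Z) * a)" by simp
    also have "\<dots> \<le> k * (2 * CH * F * B1)" using ZaB nn by (intro mult_left_mono) auto
    finally have 1: "(24 * c1 * Z + 3 * KA * (c1 + 1)) * a \<le> k * (2 * CH * F * B1)" .
    have "F * 1 \<le> F * B0" using B nn by (intro mult_left_mono) auto
    then have "CE * m * ((2 * F + (24 * c1 * Z + 3 * KA * (c1 + 1)) * a) * t) \<le> CE * m * ((2 * F * B0 + k * (2 * CH * F * B1)) * t)"
      using 1 nn by (intro mult_left_mono mult_right_mono) auto
    moreover have "c1 * (t * a) * 1 \<le> c1 * (t * (CH * F * B1)) * m"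
      using aB nn B by (intro mult_mono mult_left_mono) auto
    ultimately show ?thesis by simp
  qed
  also have "\<dots> = (2 * CE * B0 + (CE * k * (2 * CH) + c1 * CH) * B1) * (m * t * F)" by (simp add: algebra_simps)
  also have "\<dots> \<le> (Ca * B0 + Ca * B1) * (m * t * F)"
    using nn B by (intro mult_right_mono add_mono) (auto simp: Ca_def k_def)
  also have "\<dots> = Ca * m * (B1 + B0) * t * F" by (simp add: algebra_simps)
  finally show ?thesis by (simp only: m_def B1_def B0_def t_def F_def Z_def D_def u0_def)
qed

text \<open>The sum of the coefficients of 1, \<open>1 / D\<close> and \<open>1 / D\<^sup>2\<close>
  in the bound for \<open>a + G + \<beta>\<close>.\<close>

definition c5 :: real where
  "c5 = 2 / \<nu> + (CH + c3 * CH + 2 * CH * KA / \<nu>) + CH * CH * KA * (c3 + c1)"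

definition Cb :: real where "Cb = (CE * c4 + 5 + c1) * (2 * c5)"

lemma second_estimate:
  assumes x: "\<chi>\<^sub>0 \<in> Ydual - {0}" and zr: "z \<in> rho_op A \<chi>\<^sub>0" and z: "z \<notin> mat_spectrum (Ahom_sc A \<chi>\<^sub>0)"
    and f: "L2 f" and u: "res_sol A \<chi>\<^sub>0 z f u"
    and u1': "corr1 A \<chi>\<^sub>0 (u0vec A \<chi>\<^sub>0 z f) u1" and u2': "corr2 A \<chi>\<^sub>0 z f (u0vec A \<chi>\<^sub>0 z f) u1 u2"
    and u01: "corr3 A \<chi>\<^sub>0 z u1 u2 u01"
  shows "H1norm (\<lambda>y. u y - u0vec A \<chi>\<^sub>0 z f - u1 y - u01) \<le> Cb * max 1 (cmod (z + 1) / D_op A \<chi>\<^sub>0 z)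
    * (max 1 ((cmod z)^3) / (D_hom A \<chi>\<^sub>0 z)\<^sup>2 + max 1 ((cmod z)\<^sup>2) / D_hom A \<chi>\<^sub>0 z + max 1 (cmod z)) * (norm \<chi>\<^sub>0)\<^sup>2 * L2norm f"
proof -
  define u0 where "u0 = u0vec A \<chi>\<^sub>0 z f"
  define t F a Z D m where "t = norm \<chi>\<^sub>0" and "F = L2norm f" and "a = norm u0" and "Z = cmod z"
    and "D = D_hom A \<chi>\<^sub>0 z" and "m = max 1 (cmod (z + 1) / D_op A \<chi>\<^sub>0 z)"
  \<comment> \<open>The sizes delivered by \<open>corr2_bound\<close> and
    \<open>corr3_bound\<close>, without their powers of \<bar>\<chi>\<bar>.\<close>
  define G \<beta> where "G = c3 * a + 2 / \<nu> * F" and "\<beta> = CH / D * (KA * (G + c1 * a))"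
  have u1: "cellM (iX \<chi>\<^sub>0 u0) u1" using corr1_cellM[OF u1'] by (simp add: u0_def)
  note u2 = u2'[folded u0_def]
  obtain u11 where u11: "cellM (iX \<chi>\<^sub>0 u01) u11" using cellM_ex by blast
  have t: "0 < t" using x by (simp add: t_def)
  have D: "0 < D" using hom_resolvent(1)[OF z] x by (simp add: D_def)
  have nn: "0 \<le> F" "0 \<le> a" "0 \<le> Z" "1 \<le> m" "0 \<le> CE" "0 \<le> c1" "1 \<le> CH" "0 \<le> KA" "0 \<le> c3" "0 \<le> c4" "0 < \<nu>"
    using c1_nonneg KA CE_nonneg CH_pos c3_nonneg c4_nonneg \<nu>_pos by (auto simp: F_def a_def Z_def m_def)
  have G0: "0 \<le> G" using nn by (simp add: G_def)
  have \<beta>0: "0 \<le> \<beta>" using nn G0 D by (simp add: \<beta>_def)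
  have a: "a \<le> CH / D * F" unfolding a_def u0_def D_def F_def by (rule u0vec_bound[OF x z f])
  have u2W: "u2 \<in> W0" by (rule corr2_bound(1)[OF f u1 u2])
  note H1 = cellM_H1per[OF u1] and H2 = W0_H1per[OF u2W] and H11 = cellM_H1per[OF u11]
  have Hu: "H1per u" using u by (simp add: res_sol_def)
  have s2: "L2norm (Lam 0 u2) \<le> t\<^sup>2 * G"
    using corr2_bound(3)[OF f u1 u2] by (simp add: t_def G_def a_def F_def)
  have b: "norm u01 \<le> t * \<beta>"
  proof -
    have "L2norm (\<lambda>y. Lam 0 u2 y + iX \<chi>\<^sub>0 (u1 y)) \<le> L2norm (Lam 0 u2) + L2norm (\<lambda>y. iX \<chi>\<^sub>0 (u1 y))"
      by (intro L2norm_triangle_mat L2_Lam H2 L2_iX H1per_L2 H1)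
    also have "\<dots> \<le> t\<^sup>2 * G + t * (c1 * (t * a))"
      using s2 corrector_bounds(4)[OF u1] unfolding t_def a_def by (rule add_mono)
    also have "\<dots> = t * (t * (G + c1 * a))" by (simp add: power2_eq_square algebra_simps)
    finally have W: "L2norm (\<lambda>y. Lam 0 u2 y + iX \<chi>\<^sub>0 (u1 y)) \<le> t * (t * (G + c1 * a))" .
    have "norm u01 \<le> CH / D * (KA * L2norm (\<lambda>y. Lam 0 u2 y + iX \<chi>\<^sub>0 (u1 y)) / t)"
      using corr3_bound(2)[OF x z u1 u2W u01] by (simp add: D_def t_def)
    also have "\<dots> \<le> CH / D * (KA * (t * (t * (G + c1 * a))) / t)"
      using W nn D t by (intro mult_left_mono divide_right_mono) auto
    also have "\<dots> = t * \<beta>" using t by (simp add: \<beta>_def)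
    finally show ?thesis .
  qed
  have U2: "H1norm u2 \<le> 5 * (t\<^sup>2 * G)" using W0_bound[OF u2W] s2 by simp
  have U11: "H1norm u11 \<le> c1 * (t\<^sup>2 * \<beta>)"
  proof -
    have "H1norm u11 \<le> c1 * (t * norm u01)" using corrector_bounds(1)[OF u11] by (simp add: t_def)
    also have "\<dots> \<le> c1 * (t * (t * \<beta>))" using b nn t by (intro mult_left_mono) auto
    finally show ?thesis by (simp add: power2_eq_square mult_ac)
  qed
  \<comment> \<open>\<open>u2\<close> and \<open>u11\<close> belong to the comparison function but
    not to the claim; both are quadratic in \<bar>\<chi>\<bar> and return through the triangle
    inequality.\<close>
  define V where "V = (\<lambda>y. ((u0 + u1 y) + (u01 + u11 y)) + u2 y)"
  have HV: "H1per V" unfolding V_def by (intro H1per_add(1) H1per_const H1 H11 H2)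
  have "H1norm (\<lambda>y. u y - u0 - u1 y - u01) = H1norm (\<lambda>y. (u y - V y) + (u2 y + u11 y))"
    by (simp add: V_def algebra_simps)
  also have "\<dots> \<le> H1norm (\<lambda>y. u y - V y) + H1norm (\<lambda>y. u2 y + u11 y)"
    by (intro H1norm_triangle H1per_diff(1) H1per_add(1) Hu HV H2 H11)
  also have "\<dots> \<le> CE * m * ((1 + Z) * c4 * (a + G + \<beta>) * t\<^sup>2) + (5 * (t\<^sup>2 * G) + c1 * (t\<^sup>2 * \<beta>))"
  proof (rule add_mono)
    show "H1norm (\<lambda>y. u y - V y) \<le> CE * m * ((1 + Z) * c4 * (a + G + \<beta>) * t\<^sup>2)"
      unfolding V_def m_def Z_def a_def t_def
      by (rule second_order_residual[OF x zr z f u u1 u2 u01 u11 s2[unfolded t_def] G0 b[unfolded t_def]])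
    show "H1norm (\<lambda>y. u2 y + u11 y) \<le> 5 * (t\<^sup>2 * G) + c1 * (t\<^sup>2 * \<beta>)"
      using H1norm_triangle[OF H2 H11] U2 U11 by linarith
  qed
  also have "\<dots> \<le> ((CE * c4 + 5 + c1) * m * t\<^sup>2) * ((1 + Z) * (a + G + \<beta>))"
  proof -
    let ?S = "a + G + \<beta>"
    have S0: "0 \<le> ?S" using nn G0 \<beta>0 by simp
    have "5 * G + c1 * \<beta> \<le> (5 + c1) * ?S"
    proof -
      have "0 \<le> c1 * G" "0 \<le> (5 + c1) * a" using nn G0 by auto
      then show ?thesis using \<beta>0 by (simp add: algebra_simps)
    qed
    also have "\<dots> = (5 + c1) * 1 * (1 * ?S)" by simp
    also have "\<dots> \<le> (5 + c1) * m * ((1 + Z) * ?S)" using nn S0 by (intro mult_mono) auto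
    finally have "t\<^sup>2 * (5 * G + c1 * \<beta>) \<le> t\<^sup>2 * ((5 + c1) * m * ((1 + Z) * ?S))" by (intro mult_left_mono) auto
    then show ?thesis by (simp add: algebra_simps)
  qed
  also have "\<dots> \<le> ((CE * c4 + 5 + c1) * m * t\<^sup>2) * (2 * c5 * F * (max 1 (Z^3) / D\<^sup>2 + max 1 (Z\<^sup>2) / D + max 1 Z))"
  proof (rule mult_left_mono)
    \<comment> \<open>Orders in \<open>q\<close>: \<open>a\<close> is linear, \<open>G\<close> is
      constant plus linear, and \<open>\<beta>\<close> has a further factor from the second use of
      the homogenised resolvent. This is where the squared \<open>D_hom\<close> comes from.\<close>
    define q where "q = 1 / D"
    have q: "0 < q" using D by (simp add: q_def)
    have a': "a \<le> CH * q * F" using a by (simp add: q_def)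
    have G': "G \<le> (c3 * (CH * q) + 2 / \<nu>) * F"
    proof -
      have "c3 * a \<le> c3 * (CH * q * F)" by (intro mult_left_mono a' nn)
      then show ?thesis by (simp add: G_def algebra_simps)
    qed
    have \<beta>': "\<beta> \<le> CH * q * KA * (c3 * (CH * q) + 2 / \<nu> + c1 * (CH * q)) * F"
    proof -
      have "G + c1 * a \<le> (c3 * (CH * q) + 2 / \<nu>) * F + c1 * (CH * q * F)" by (intro add_mono G' mult_left_mono a' nn)
      then have "CH * q * KA * (G + c1 * a) \<le> CH * q * KA * ((c3 * (CH * q) + 2 / \<nu>) * F + c1 * (CH * q * F))"
        using nn q by (intro mult_left_mono) auto
      moreover have "\<beta> = CH * q * KA * (G + c1 * a)" by (simp add: \<beta>_def q_def)
      ultimately show ?thesis by (simp add: algebra_simps)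
    qed
    have p: "0 \<le> 2 / \<nu>" "0 \<le> CH + c3 * CH + 2 * CH * KA / \<nu>" "0 \<le> CH * CH * KA * (c3 + c1)"
      using nn by auto
    have "a + G + \<beta> \<le> (2 / \<nu> + (CH + c3 * CH + 2 * CH * KA / \<nu>) * q + CH * CH * KA * (c3 + c1) * q\<^sup>2) * F"
      using add_mono[OF add_mono[OF a' G'] \<beta>'] by (simp add: algebra_simps power2_eq_square)
    also have "\<dots> \<le> (c5 * 1 + c5 * q + c5 * q\<^sup>2) * F"
      using p q nn by (intro mult_right_mono add_mono) (auto simp: c5_def)
    finally have S: "a + G + \<beta> \<le> (c5 * F) * (1 + q + q\<^sup>2)" by (simp add: algebra_simps)
    have c50: "0 \<le> c5" using p by (simp add: c5_def)
    have M: "1 + Z \<le> 2 * max 1 Z" "1 + Z \<le> 2 * max 1 (Z\<^sup>2)" "1 + Z \<le> 2 * max 1 (Z^3)"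
      using one_plus_le_max_power[of Z 1] one_plus_le_max_power[of Z 2] one_plus_le_max_power[of Z 3] nn by auto
    have "(1 + Z) * (a + G + \<beta>) \<le> (1 + Z) * ((c5 * F) * (1 + q + q\<^sup>2))" using S nn by (intro mult_left_mono) auto
    also have "\<dots> = (c5 * F) * ((1 + Z) * 1 + (1 + Z) * q + (1 + Z) * q\<^sup>2)" by (simp add: algebra_simps)
    also have "\<dots> \<le> (c5 * F) * (2 * max 1 Z * 1 + 2 * max 1 (Z\<^sup>2) * q + 2 * max 1 (Z^3) * q\<^sup>2)"
      using c50 nn q M by (intro mult_left_mono add_mono mult_right_mono) auto
    also have "\<dots> = 2 * c5 * F * (max 1 (Z^3) / D\<^sup>2 + max 1 (Z\<^sup>2) / D + max 1 Z)"
      by (simp add: q_def power_divide algebra_simps)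
    finally show "(1 + Z) * (a + G + \<beta>) \<le> 2 * c5 * F * (max 1 (Z^3) / D\<^sup>2 + max 1 (Z\<^sup>2) / D + max 1 Z)" .
    show "0 \<le> (CE * c4 + 5 + c1) * m * t\<^sup>2" using nn by simp
  qed
  also have "\<dots> = Cb * m * (max 1 (Z^3) / D\<^sup>2 + max 1 (Z\<^sup>2) / D + max 1 Z) * t\<^sup>2 * F"
    by (simp only: Cb_def mult_ac)
  finally show ?thesis by (simp only: m_def t_def F_def Z_def D_def u0_def)
qed

end

theorem theorem5p12:
  fixes A :: tensor_field and \<nu> :: real
  assumes "admissible_tensor A \<nu>"
  shows "(\<exists>C>0.
      (\<forall>\<chi>\<^sub>0 \<in> Ydual - {0}. \<forall>z \<in> rho_op A \<chi>\<^sub>0 \<inter> (- mat_spectrum (Ahom_sc A \<chi>\<^sub>0)).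
         \<forall>f u. L2 f \<and> res_sol A \<chi>\<^sub>0 z f u \<longrightarrow>
           H1norm (\<lambda>y. u y - u0vec A \<chi>\<^sub>0 z f)
             \<le> C * max 1 (cmod (z + 1) / D_op A \<chi>\<^sub>0 z)
                 * (max 1 ((cmod z)^2) / D_hom A \<chi>\<^sub>0 z + max 1 (cmod z)) * norm \<chi>\<^sub>0
                 * L2norm f)
    \<and> (\<forall>\<chi>\<^sub>0 \<in> Ydual - {0}. \<forall>z \<in> rho_op A \<chi>\<^sub>0 \<inter> (- mat_spectrum (Ahom_sc A \<chi>\<^sub>0)).
         \<forall>f u u1 u2 u01. L2 f \<and> res_sol A \<chi>\<^sub>0 z f u
           \<and> corr1 A \<chi>\<^sub>0 (u0vec A \<chi>\<^sub>0 z f) u1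
           \<and> corr2 A \<chi>\<^sub>0 z f (u0vec A \<chi>\<^sub>0 z f) u1 u2
           \<and> corr3 A \<chi>\<^sub>0 z u1 u2 u01 \<longrightarrow>
           H1norm (\<lambda>y. u y - u0vec A \<chi>\<^sub>0 z f - u1 y - u01)
             \<le> C * max 1 (cmod (z + 1) / D_op A \<chi>\<^sub>0 z)
                 * (max 1 ((cmod z)^3) / (D_hom A \<chi>\<^sub>0 z)^2
                    + max 1 ((cmod z)^2) / D_hom A \<chi>\<^sub>0 z + max 1 (cmod z))
                 * (norm \<chi>\<^sub>0)^2 * L2norm f))
   \<and> (\<exists>T::const_tensor. tensor_symmetric T \<and>
        (\<forall>\<chi>\<^sub>0 \<in> Ydual - {0}. \<forall>c d.
           cinner (Ahom A \<chi>\<^sub>0 *v c) d = frob (tappc T (iX \<chi>\<^sub>0 c)) (iX \<chi>\<^sub>0 d)))"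
proof (rule conjI)
  interpret elasticity A \<nu> by (rule elasticity.intro[OF assms])
  show "\<exists>T::const_tensor. tensor_symmetric T \<and>
        (\<forall>\<chi>\<^sub>0 \<in> Ydual - {0}. \<forall>c d.
           cinner (Ahom A \<chi>\<^sub>0 *v c) d = frob (tappc T (iX \<chi>\<^sub>0 c)) (iX \<chi>\<^sub>0 d))"
    using homogenised_tensor by blast
  \<comment> \<open>The 1 secures positivity; \<open>Ca\<close> and \<open>Cb\<close> are built from
    \<open>A\<close> and \<open>\<nu>\<close> alone.\<close>
  define C where "C = max 1 (max Ca Cb)"
  have C: "0 < C" "Ca \<le> C" "Cb \<le> C" by (auto simp: C_def)
  have mono: "Ca * m * B * s * F \<le> C * m * B * s * F" "Cb * m * B * s * F \<le> C * m * B * s * F"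
    if "0 \<le> m" "0 \<le> B" "0 \<le> s" "0 \<le> F" for m B s F
    using that C by (auto intro!: mult_right_mono)
  have D: "0 \<le> D_hom A \<chi>\<^sub>0 z" for \<chi>\<^sub>0 z by (simp add: D_hom_def infdist_nonneg)
  show "\<exists>C>0.
      (\<forall>\<chi>\<^sub>0 \<in> Ydual - {0}. \<forall>z \<in> rho_op A \<chi>\<^sub>0 \<inter> (- mat_spectrum (Ahom_sc A \<chi>\<^sub>0)).
         \<forall>f u. L2 f \<and> res_sol A \<chi>\<^sub>0 z f u \<longrightarrow>
           H1norm (\<lambda>y. u y - u0vec A \<chi>\<^sub>0 z f)
             \<le> C * max 1 (cmod (z + 1) / D_op A \<chi>\<^sub>0 z)
                 * (max 1 ((cmod z)^2) / D_hom A \<chi>\<^sub>0 z + max 1 (cmod z)) * norm \<chi>\<^sub>0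
                 * L2norm f)
    \<and> (\<forall>\<chi>\<^sub>0 \<in> Ydual - {0}. \<forall>z \<in> rho_op A \<chi>\<^sub>0 \<inter> (- mat_spectrum (Ahom_sc A \<chi>\<^sub>0)).
         \<forall>f u u1 u2 u01. L2 f \<and> res_sol A \<chi>\<^sub>0 z f u
           \<and> corr1 A \<chi>\<^sub>0 (u0vec A \<chi>\<^sub>0 z f) u1
           \<and> corr2 A \<chi>\<^sub>0 z f (u0vec A \<chi>\<^sub>0 z f) u1 u2
           \<and> corr3 A \<chi>\<^sub>0 z u1 u2 u01 \<longrightarrow>
           H1norm (\<lambda>y. u y - u0vec A \<chi>\<^sub>0 z f - u1 y - u01)
             \<le> C * max 1 (cmod (z + 1) / D_op A \<chi>\<^sub>0 z)
                 * (max 1 ((cmod z)^3) / (D_hom A \<chi>\<^sub>0 z)^2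
                    + max 1 ((cmod z)^2) / D_hom A \<chi>\<^sub>0 z + max 1 (cmod z))
                 * (norm \<chi>\<^sub>0)^2 * L2norm f)"
  proof (intro exI[of _ C] conjI ballI allI impI C(1))
    fix \<chi>\<^sub>0 z f u
    assume x: "\<chi>\<^sub>0 \<in> Ydual - {0}" and z: "z \<in> rho_op A \<chi>\<^sub>0 \<inter> - mat_spectrum (Ahom_sc A \<chi>\<^sub>0)"
      and fu: "L2 f \<and> res_sol A \<chi>\<^sub>0 z f u"
    have "H1norm (\<lambda>y. u y - u0vec A \<chi>\<^sub>0 z f) \<le> Ca * max 1 (cmod (z + 1) / D_op A \<chi>\<^sub>0 z)
        * (max 1 ((cmod z)\<^sup>2) / D_hom A \<chi>\<^sub>0 z + max 1 (cmod z)) * norm \<chi>\<^sub>0 * L2norm f"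
      by (rule first_estimate[OF x]) (use z fu in auto)
    also have "\<dots> \<le> C * max 1 (cmod (z + 1) / D_op A \<chi>\<^sub>0 z)
        * (max 1 ((cmod z)\<^sup>2) / D_hom A \<chi>\<^sub>0 z + max 1 (cmod z)) * norm \<chi>\<^sub>0 * L2norm f"
      by (rule mono(1)) (use D in \<open>auto intro!: add_nonneg_nonneg divide_nonneg_nonneg\<close>)
    finally show "H1norm (\<lambda>y. u y - u0vec A \<chi>\<^sub>0 z f) \<le> C * max 1 (cmod (z + 1) / D_op A \<chi>\<^sub>0 z)
        * (max 1 ((cmod z)\<^sup>2) / D_hom A \<chi>\<^sub>0 z + max 1 (cmod z)) * norm \<chi>\<^sub>0 * L2norm f" .
  next
    fix \<chi>\<^sub>0 z f u u1 u2 u01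
    assume x: "\<chi>\<^sub>0 \<in> Ydual - {0}" and z: "z \<in> rho_op A \<chi>\<^sub>0 \<inter> - mat_spectrum (Ahom_sc A \<chi>\<^sub>0)"
      and fu: "L2 f \<and> res_sol A \<chi>\<^sub>0 z f u \<and> corr1 A \<chi>\<^sub>0 (u0vec A \<chi>\<^sub>0 z f) u1
           \<and> corr2 A \<chi>\<^sub>0 z f (u0vec A \<chi>\<^sub>0 z f) u1 u2 \<and> corr3 A \<chi>\<^sub>0 z u1 u2 u01"
    have "H1norm (\<lambda>y. u y - u0vec A \<chi>\<^sub>0 z f - u1 y - u01) \<le> Cb * max 1 (cmod (z + 1) / D_op A \<chi>\<^sub>0 z)
        * (max 1 ((cmod z)^3) / (D_hom A \<chi>\<^sub>0 z)\<^sup>2 + max 1 ((cmod z)\<^sup>2) / D_hom A \<chi>\<^sub>0 z + max 1 (cmod z))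
        * (norm \<chi>\<^sub>0)\<^sup>2 * L2norm f"
      by (rule second_estimate[OF x]) (use z fu in auto)
    also have "\<dots> \<le> C * max 1 (cmod (z + 1) / D_op A \<chi>\<^sub>0 z)
        * (max 1 ((cmod z)^3) / (D_hom A \<chi>\<^sub>0 z)\<^sup>2 + max 1 ((cmod z)\<^sup>2) / D_hom A \<chi>\<^sub>0 z + max 1 (cmod z))
        * (norm \<chi>\<^sub>0)\<^sup>2 * L2norm f"
      by (rule mono(2)) (use D in \<open>auto intro!: add_nonneg_nonneg divide_nonneg_nonneg\<close>)
    finally show "H1norm (\<lambda>y. u y - u0vec A \<chi>\<^sub>0 z f - u1 y - u01) \<le> C * max 1 (cmod (z + 1) / D_op A \<chi>\<^sub>0 z)
        * (max 1 ((cmod z)^3) / (D_hom A \<chi>\<^sub>0 z)\<^sup>2 + max 1 ((cmod z)\<^sup>2) / D_hom A \<chi>\<^sub>0 z + max 1 (cmod z))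
        * (norm \<chi>\<^sub>0)\<^sup>2 * L2norm f" .
  qed
qed

end
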